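(* Let $\mathbb K$ be a field, $R=\mathbb K[x_1,\dots,x_n]$ and $I\subseteq R$ a monomial ideal. (1) If $I$ is stable, then $I$ admits a minimal pruned resolution which is isomorphic to the Eliahou–Kervaire resolution of $R/I$. (2) If $I$ has linear quotients, then $I$ admits a minimal pruned resolution which is isomorphic to the Herzog–Takayama resolution of $R/I$.
   Context: $G(I)$ denotes the set of minimal monomial generators; $\max(m)$ and $\min(m)$ are the largest and smallest index of a variable dividing $m$. $I$ is stable if $x_i(m/x_{\max(m)})\in I$ for all $m\in G(I)$ and $i<\max(m)$. $I$ has linear quotients if $G(I)=\{m_1,\dots,m_q\}$ can be ordered so that $((m_1,\dots,m_{i-1}):m_i)$ is a prime monomial ideal for every $2\le i\le q$. Eliahou–Kervaire resolution of $R/I$, $I$ stable: every monomial $w\in I$ is uniquely $w=g(w)y$ with $g(w)\in G(I)$, $y$ a monomial and $\max(g(w))\le\min(y)$. In homological degree $0$ the module is $R$; in homological degree $t+1$ ($t\ge0$) it is free on symbols $e(j_1,\dots,j_t;u)$ with $u\in G(I)$ and $1\le j_1<\cdots<j_t<\max(u)$, of multidegree that of $x_{j_1}\cdots x_{j_t}u$. The differential sends $e(\emptyset;u)\mapsto u$ and, for $t\ge 1$, $e(j_1,\dots,j_t;u)\mapsto \sum_r(-1)^r x_{j_r}e(j_1,\dots,\widehat{j_r},\dots,j_t;u)-\sum_r(-1)^r\frac{x_{j_r}u}{g(x_{j_r}u)}\,e(j_1,\dots,\widehat{j_r},\dots,j_t;g(x_{j_r}u))$, where symbols violating $j_t<\max$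 are zero. Herzog–Takayama resolution of $R/I$, $I$ with linear quotients with respect to an order $m_1,\dots,m_q$: the minimal free resolution obtained by iterated mapping cones from the exact sequences $0\to R/((m_1,\dots,m_{k-1}):m_k)\xrightarrow{\,m_k\,} R/(m_1,\dots,m_{k-1})\to R/(m_1,\dots,m_k)\to0$, resolving $R/((m_1,\dots,m_{k-1}):m_k)$ by the Koszul complex on the variables generating the colon ideal. Pruned resolutions. For a monomial ideal $I$ with minimal generators in a fixed order $m_1,\dots,m_q$ and $\sigma\subseteq\{1,\dots,q\}$ put $m_\sigma=\mathrm{lcm}(m_i: i\in\sigma)$, $m_\emptyset=1$. The Taylor resolution of $R/I$ is supported on the full simplex $X_{\mathrm{Taylor}}$ on $q$ vertices; the face $\sigma$ has homological degree $|\sigma|$ and multidegree the exponent of $m_\sigma$. Pruning algorithm: for $j=1,\dots,q$ successively (step $j$), for every $\sigma\not\ni j$ with $m_\sigma=m_{\sigma\cup\{j\}}$ and such that neither $\sigma$ nor $\sigma\cup\{j\}$ belongs to a previously selected edge, select (prune) the edge $\{\sigma,\sigma\cup\{j\}\}$. The selected edges form a homogeneous acyclic matching on $X_{\mathrm{Taylor}}$, and discrete Morse theory (Batzies–Welker) yields a $\mathbb Z^n$-graded CW-complex, with cells corresponding to the faces in no selected edge (critical faces), supporting a free resolution of $R/I$: the pruned resolution for the given order. Its module in homological degree $i$ is the direct sum of $R(-\deg m_\sigma)$ over critical $\sigma$ with $|\sigma|=i$; so it is minimal iff, for all $i,\alpha$, the number of critical $\sigma$ with $|\sigma|=i$ and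 multidegree $\alpha$ is $\beta_{i,\alpha}(R/I)$. Betti splitting version. $I=J+K$, with $G(I)$ the disjoint union of $G(J)$ and $G(K)$, is a Betti splitting if $\beta_{i,\alpha}(I)=\beta_{i,\alpha}(J)+\beta_{i,\alpha}(K)+\beta_{i-1,\alpha}(J\cap K)$ for all $i$ and $\alpha\in\mathbb Z^n$. Then one may prune separately the faces with vertices in $G(J)$, the faces with vertices in $G(K)$, and the remaining faces (which account for $J\cap K$), and iterate this using Betti splittings of $J$, $K$, $J\cap K$; this is always a partial pruning of $X_{\mathrm{Taylor}}$, and the numbers of generators (pruned Betti numbers) satisfy $\overline\beta_{i,\alpha}(I)=\overline\beta_{i,\alpha}(J)+\overline\beta_{i,\alpha}(K)+\overline\beta_{i-1,\alpha}(J\cap K)$. $I$ admits a minimal pruned resolution if, for some order of the generators, the cellular resolution given by the pruning algorithm or by its iterated Betti splitting version is minimal. Explicitly (recursively, in finitely many steps): either for some order of $G(I)$ the pruned resolution of $R/I$ is minimal, or there is a Betti splitting $I=J+K$ such that $J$, $K$ and $J\cap K$ all admit minimal pruned resolutions. *)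

theory Defs
  imports Complex_Main "HOL-Library.Poly_Mapping" "HOL-Library.Function_Algebras"
begin

section \<open>Monomial ideals in a polynomial ring\<close>

text \<open>
  A monomial is its exponent vector. With the pointwise structure on functions, \<open>+\<close> is the product
  of monomials, \<open>0\<close> is the monomial 1, \<open>\<le>\<close> is divisibility and (below a multiple) \<open>-\<close> is the
  quotient. The index type is finite and linearly ordered, i.e. a copy of 1, ..., n.
  The ring K[x_1, ..., x_n] is the monoid algebra over the exponent vectors, with convolution
  product.
\<close>

type_synonym 'n mon = "'n \<Rightarrow> nat"
type_synonym ('n, 'k) pol = "('n \<Rightarrow> nat) \<Rightarrow>\<^sub>0 'k"

abbreviation monom :: "'n mon \<Rightarrow> ('n, 'k::comm_ring_1) pol" where
  "monom m \<equiv> Poly_Mapping.single m 1"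

definition var :: "'n \<Rightarrow> 'n mon" where
  "var j = (\<lambda>i. if i = j then 1 else 0)"

definition sqfree :: "'n set \<Rightarrow> 'n mon" where
  "sqfree T = (\<lambda>i. if i \<in> T then 1 else 0)"

definition mlcm :: "'n mon set \<Rightarrow> 'n mon" where
  "mlcm \<sigma> = (\<lambda>i. Max (insert 0 ((\<lambda>m. m i) ` \<sigma>)))"

definition mmax :: "'n::linorder mon \<Rightarrow> 'n" where
  "mmax m = Max {i. m i \<noteq> 0}"

definition mmin :: "'n::linorder mon \<Rightarrow> 'n" where
  "mmin m = Min {i. m i \<noteq> 0}"

abbreviation is_ideal :: "'a::comm_ring_1 set \<Rightarrow> bool" where
  "is_ideal \<equiv> module.subspace ((*) :: 'a \<Rightarrow> 'a \<Rightarrow> 'a)"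

abbreviation ideal_gen :: "'a::comm_ring_1 set \<Rightarrow> 'a set" where
  "ideal_gen \<equiv> module.span ((*) :: 'a \<Rightarrow> 'a \<Rightarrow> 'a)"

definition prime_ideal :: "'a::comm_ring_1 set \<Rightarrow> bool" where
  "prime_ideal P \<longleftrightarrow> is_ideal P \<and> P \<noteq> UNIV \<and> (\<forall>a b. a * b \<in> P \<longrightarrow> a \<in> P \<or> b \<in> P)"

definition monomial_ideal :: "('n::finite, 'k::field) pol set \<Rightarrow> bool" where
  "monomial_ideal I \<longleftrightarrow> (\<exists>S. I = ideal_gen (monom ` S))"

definition ideal_sum :: "'a::comm_ring_1 set \<Rightarrow> 'a set \<Rightarrow> 'a set" where
  "ideal_sum J K = {a + b | a b. a \<in> J \<and> b \<in> K}"

definition colon :: "('n::finite, 'k::field) pol set \<Rightarrow> 'n mon \<Rightarrow> ('n, 'k) pol set" where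
  "colon A m = {f. f * monom m \<in> A}"

definition min_gens :: "('n::finite, 'k::field) pol set \<Rightarrow> 'n mon set" where
  "min_gens I = {m. monom m \<in> I \<and> (\<forall>m'. monom m' \<in> I \<longrightarrow> m' \<le> m \<longrightarrow> m' = m)}"

definition stable :: "('n::{finite,linorder}, 'k::field) pol set \<Rightarrow> bool" where
  "stable I \<longleftrightarrow> (\<forall>m \<in> min_gens I. \<forall>i < mmax m. monom (var i + (m - var (mmax m))) \<in> I)"

definition linear_quotients_wrt :: "('n::finite, 'k::field) pol set \<Rightarrow> 'n mon list \<Rightarrow> bool" where
  "linear_quotients_wrt I ms \<longleftrightarrow>
     distinct ms \<and> set ms = min_gens I \<and>
     (\<forall>i. 0 < i \<and> i < length ms \<longrightarrow>
        (let P = colon (ideal_gen (monom ` set (take i ms)) :: ('n, 'k) pol set) (ms ! i)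
         in prime_ideal P \<and> monomial_ideal P))"

section \<open>Multigraded free complexes\<close>

text \<open>
  A bounded complex of finitely generated multigraded free modules is given by a homogeneous basis:
  \<open>hdeg b\<close> and \<open>mdeg b\<close> are the homological degree and the multidegree of the basis element b, and
  \<open>bd b c\<close> is the coefficient of c in the differential of b. Only values on basis elements matter.
  Every module that occurs is generated in multidegrees with nonnegative entries, so multidegrees
  are taken to be exponent vectors; Betti numbers in all other multidegrees vanish.
\<close>

record (overloaded) ('b, 'n, 'k) free_complex =
  gens :: "'b set"
  hdeg :: "'b \<Rightarrow> nat"
  mdeg :: "'b \<Rightarrow> 'n \<Rightarrow> nat"
  bd :: "'b \<Rightarrow> 'b \<Rightarrow> ('n \<Rightarrow> nat) \<Rightarrow>\<^sub>0 ('k::zero)"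

definition graded_free_complex :: "('b, 'n::finite, 'k::field) free_complex \<Rightarrow> bool" where
  "graded_free_complex F \<longleftrightarrow>
     finite (gens F) \<and>
     (\<forall>b \<in> gens F. \<forall>c \<in> gens F.
        (bd F b c \<noteq> 0 \<longrightarrow> hdeg F b = Suc (hdeg F c)) \<and>
        (\<forall>t \<in> Poly_Mapping.keys (bd F b c). t + mdeg F c = mdeg F b)) \<and>
     (\<forall>b \<in> gens F. \<forall>e \<in> gens F. (\<Sum>c \<in> gens F. bd F b c * bd F c e) = 0)"

definition is_chain :: "('b, 'n::finite, 'k::field) free_complex \<Rightarrow> nat \<Rightarrow> ('b \<Rightarrow> ('n, 'k) pol) \<Rightarrow> bool" where
  "is_chain F i v \<longleftrightarrow> (\<forall>b. v b \<noteq> 0 \<longrightarrow> b \<in> gens F \<and> hdeg F b = i)"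

definition boundary ::
  "('b, 'n::finite, 'k::field) free_complex \<Rightarrow> ('b \<Rightarrow> ('n, 'k) pol) \<Rightarrow> 'b \<Rightarrow> ('n, 'k) pol" where
  "boundary F v = (\<lambda>c. if c \<in> gens F then \<Sum>b \<in> gens F. v b * bd F b c else 0)"

text \<open>
  \<open>free_resolution A B F\<close>: F is a multigraded free resolution of A/B, for ideals B contained in A.
  The homogeneous augmentation is represented by lifts \<open>\<epsilon> b\<close> to A of the images of the basis
  elements of homological degree 0. A resolution of R/I is the case (UNIV, I), one of the module I
  the case (I, 0).
\<close>

definition free_resolution ::
  "('n::finite, 'k::field) pol set \<Rightarrow> ('n, 'k) pol set \<Rightarrow> ('b, 'n, 'k) free_complex \<Rightarrow> bool" where
  "free_resolution A B F \<longleftrightarrow>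
     graded_free_complex F \<and>
     (\<forall>i > 0. \<forall>v. is_chain F i v \<and> boundary F v = 0 \<longrightarrow>
        (\<exists>w. is_chain F (Suc i) w \<and> boundary F w = v)) \<and>
     (\<exists>\<epsilon>. (\<forall>b \<in> gens F. hdeg F b = 0 \<longrightarrow>
              \<epsilon> b \<in> A \<and> (\<forall>t \<in> Poly_Mapping.keys (\<epsilon> b). t = mdeg F b)) \<and>
          (\<forall>a \<in> A. \<exists>v. is_chain F 0 v \<and> a - (\<Sum>b \<in> gens F. v b * \<epsilon> b) \<in> B) \<and>
          (\<forall>v. is_chain F 0 v \<longrightarrow>
              ((\<Sum>b \<in> gens F. v b * \<epsilon> b) \<in> B \<longleftrightarrow> (\<exists>w. is_chain F 1 w \<and> boundary F w = v))))"

definition minimal_free_resolution ::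
  "('n::finite, 'k::field) pol set \<Rightarrow> ('n, 'k) pol set \<Rightarrow> ('b, 'n, 'k) free_complex \<Rightarrow> bool" where
  "minimal_free_resolution A B F \<longleftrightarrow>
     free_resolution A B F \<and>
     (\<forall>b \<in> gens F. \<forall>c \<in> gens F. Poly_Mapping.lookup (bd F b c) 0 = 0)"

text \<open>
  The multigraded Betti number of A/B: the number of basis elements of the given degrees in a
  minimal free resolution. It is independent of the resolution, and any finite basis can be
  labelled by natural numbers.
\<close>

definition betti :: "('n::finite, 'k::field) pol set \<Rightarrow> ('n, 'k) pol set \<Rightarrow> nat \<Rightarrow> 'n mon \<Rightarrow> nat" where
  "betti A B i \<alpha> =
     (THE r. \<exists>F :: (nat, 'n, 'k) free_complex.
        minimal_free_resolution A B F \<and> r = card {b \<in> gens F. hdeg F b = i \<and> mdeg F b = \<alpha>})"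

text \<open>\<open>\<phi> b c\<close> is the coefficient of c in the image of b.\<close>

definition chain_map ::
  "('b, 'n::finite, 'k::field) free_complex \<Rightarrow> ('c, 'n, 'k) free_complex \<Rightarrow>
   ('b \<Rightarrow> 'c \<Rightarrow> ('n, 'k) pol) \<Rightarrow> bool" where
  "chain_map F G \<phi> \<longleftrightarrow>
     (\<forall>b \<in> gens F. \<forall>c \<in> gens G.
        (\<phi> b c \<noteq> 0 \<longrightarrow> hdeg F b = hdeg G c) \<and>
        (\<forall>t \<in> Poly_Mapping.keys (\<phi> b c). t + mdeg G c = mdeg F b)) \<and>
     (\<forall>b \<in> gens F. \<forall>e \<in> gens G.
        (\<Sum>c \<in> gens F. bd F b c * \<phi> c e) = (\<Sum>c \<in> gens G. \<phi> b c * bd G c e))"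

definition complex_iso ::
  "('b, 'n::finite, 'k::field) free_complex \<Rightarrow> ('c, 'n, 'k) free_complex \<Rightarrow> bool" where
  "complex_iso F G \<longleftrightarrow>
     (\<exists>\<phi> \<psi>. chain_map F G \<phi> \<and> chain_map G F \<psi> \<and>
        (\<forall>b \<in> gens F. \<forall>b' \<in> gens F. (\<Sum>c \<in> gens G. \<phi> b c * \<psi> c b') = (if b = b' then 1 else 0)) \<and>
        (\<forall>c \<in> gens G. \<forall>c' \<in> gens G. (\<Sum>b \<in> gens F. \<psi> c b * \<phi> b c') = (if c = c' then 1 else 0)))"

section \<open>The Eliahou--Kervaire resolution\<close>

text \<open>
  Basis symbols shared by the Eliahou--Kervaire and the Herzog--Takayama resolution: \<open>None\<close> is the
  basis of the module R in homological degree 0, and \<open>Some (T, u)\<close> is e(j_1, ..., j_t; u) for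
  T = {j_1 < ... < j_t}.
\<close>

type_synonym 'n symb = "('n set \<times> 'n mon) option"

definition symb_hdeg :: "'n symb \<Rightarrow> nat" where
  "symb_hdeg b = (case b of None \<Rightarrow> 0 | Some (T, u) \<Rightarrow> Suc (card T))"

definition symb_mdeg :: "'n symb \<Rightarrow> 'n mon" where
  "symb_mdeg b = (case b of None \<Rightarrow> 0 | Some (T, u) \<Rightarrow> sqfree T + u)"

text \<open>The condition max(u) \<open>\<le>\<close> min(w/u) is void for w = u.\<close>

definition ek_gen :: "('n::{finite,linorder}, 'k::field) pol set \<Rightarrow> 'n mon \<Rightarrow> 'n mon" where
  "ek_gen I w = (THE u. u \<in> min_gens I \<and> u \<le> w \<and> (w = u \<or> mmax u \<le> mmin (w - u)))"

text \<open>
  In e(j_1, ..., j_t; u) the position r of \<open>j = j_r\<close> is the number of elements of T up to j. Symbols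
  that violate j_t < max(u) are not in the basis, hence disappear from the differential.
\<close>

definition eliahou_kervaire ::
  "('n::{finite,linorder}, 'k::field) pol set \<Rightarrow> ('n symb, 'n, 'k) free_complex" where
  "eliahou_kervaire I =
     \<lparr> gens = insert None {Some (T, u) | T u. u \<in> min_gens I \<and> T \<subseteq> {j. j < mmax u}},
       hdeg = symb_hdeg,
       mdeg = symb_mdeg,
       bd = (\<lambda>b c. case b of None \<Rightarrow> 0 | Some (T, u) \<Rightarrow>
         (case c of
            None \<Rightarrow> if T = {} then monom u else 0
          | Some (T', v) \<Rightarrow>
              (\<Sum>j \<in> T. (-1) ^ card {k \<in> T. k \<le> j} *
                 ((if T' = T - {j} \<and> v = u then monom (var j) else 0) -
                  (let g = ek_gen I (var j + u)
                   in if T' = T - {j} \<and> v = g then monom ((var j + u) - g) else 0))))) \<rparr>"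

section \<open>The Herzog--Takayama resolution\<close>

definition trivial_complex :: "('n::finite symb, 'n, 'k::field) free_complex" where
  "trivial_complex = \<lparr> gens = {None}, hdeg = symb_hdeg, mdeg = symb_mdeg, bd = (\<lambda>_ _. 0) \<rparr>"

text \<open>The Koszul complex on the variables in V, shifted by the multidegree u.\<close>

definition koszul :: "'n::{finite,linorder} set \<Rightarrow> 'n mon \<Rightarrow> ('n set, 'n, 'k::field) free_complex" where
  "koszul V u =
     \<lparr> gens = Pow V,
       hdeg = card,
       mdeg = (\<lambda>T. sqfree T + u),
       bd = (\<lambda>T T'. \<Sum>j \<in> T. if T' = T - {j} then (-1) ^ card {k \<in> T. k < j} * monom (var j) else 0) \<rparr>"

text \<open>
  The mapping cone of \<open>\<psi>\<close> from \<open>koszul V u\<close> to F, the element T of the Koszul complex being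
  labelled \<open>Some (T, u)\<close>.
\<close>

definition koszul_cone ::
  "('n::{finite,linorder} symb, 'n, 'k::field) free_complex \<Rightarrow> 'n set \<Rightarrow> 'n mon \<Rightarrow>
   ('n set \<Rightarrow> 'n symb \<Rightarrow> ('n, 'k) pol) \<Rightarrow> ('n symb, 'n, 'k) free_complex" where
  "koszul_cone F V u \<psi> =
     (let N = (\<lambda>T. Some (T, u)) ` Pow V in
      \<lparr> gens = gens F \<union> N,
        hdeg = symb_hdeg,
        mdeg = symb_mdeg,
        bd = (\<lambda>b c.
          if b \<in> N
          then (if c \<in> N then - bd (koszul V u) (fst (the b)) (fst (the c)) else \<psi> (fst (the b)) c)
          else (if c \<in> N then 0 else bd F b c)) \<rparr>)"

text \<open>
  \<open>herzog_takayama ms F\<close>: F arises by iterated mapping cones along the list ms. The comparison maps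
  \<open>\<psi>\<close> lift multiplication by the new generator and are not unique, hence a relation.
\<close>

inductive herzog_takayama ::
  "'n::{finite,linorder} mon list \<Rightarrow> ('n symb, 'n, 'k::field) free_complex \<Rightarrow> bool" where
  base: "herzog_takayama [] trivial_complex"
| cone: "herzog_takayama (ms @ [u]) (koszul_cone F V u \<psi>)"
  if "herzog_takayama ms F"
    and "colon (ideal_gen (monom ` set ms)) u = ideal_gen ((monom ` var ` V) :: ('n, 'k) pol set)"
    and "chain_map (koszul V u) F \<psi>"
    and "\<psi> {} None = monom u"

section \<open>Pruning the Taylor resolution\<close>

text \<open>
  Faces of the Taylor simplex are sets of minimal generators. A matching is a set of pairs
  \<open>(\<sigma>, \<tau>)\<close>, where \<open>\<tau>\<close> is \<open>\<sigma>\<close> with one more vertex; \<open>Field M\<close> is the set of matched faces.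
\<close>

type_synonym 'n face = "'n mon set"
type_synonym 'n matching = "('n face \<times> 'n face) set"

definition prune_step :: "'n mon set \<Rightarrow> 'n mon \<Rightarrow> 'n matching \<Rightarrow> 'n matching" where
  "prune_step G u M =
     M \<union> {(\<sigma>, insert u \<sigma>) | \<sigma>. \<sigma> \<subseteq> G \<and> u \<notin> \<sigma> \<and> mlcm \<sigma> = mlcm (insert u \<sigma>) \<and>
             \<sigma> \<notin> Field M \<and> insert u \<sigma> \<notin> Field M}"

definition pruning :: "'n mon list \<Rightarrow> 'n matching" where
  "pruning ms = fold (prune_step (set ms)) ms {}"

definition critical :: "'n mon set \<Rightarrow> 'n matching \<Rightarrow> 'n face set" where
  "critical G M = {\<sigma>. \<sigma> \<subseteq> G \<and> \<sigma> \<notin> Field M}"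

definition facet :: "'n face \<Rightarrow> 'n face \<Rightarrow> bool" where
  "facet \<sigma> \<tau> \<longleftrightarrow> (\<exists>u \<in> \<tau>. \<sigma> = \<tau> - {u})"

definition homogeneous_acyclic_matching :: "'n mon set \<Rightarrow> 'n matching \<Rightarrow> bool" where
  "homogeneous_acyclic_matching G M \<longleftrightarrow>
     (\<forall>(\<sigma>, \<tau>) \<in> M. \<tau> \<subseteq> G \<and> facet \<sigma> \<tau> \<and> mlcm \<sigma> = mlcm \<tau>) \<and>
     (\<forall>(\<sigma>, \<tau>) \<in> M. \<forall>(\<sigma>', \<tau>') \<in> M. {\<sigma>, \<tau>} \<inter> {\<sigma>', \<tau>'} \<noteq> {} \<longrightarrow> \<sigma> = \<sigma>' \<and> \<tau> = \<tau>') \<and>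
     acyclic ({(\<tau>, \<sigma>). \<tau> \<subseteq> G \<and> facet \<sigma> \<tau> \<and> (\<sigma>, \<tau>) \<notin> M} \<union> M)"

text \<open>
  The Morse complex of a matching M on the Taylor simplex with vertices ms, in that orientation:
  the incidence number of critical faces \<open>\<tau>\<close> and \<open>\<sigma>\<close> is the sum of the weights of the gradient
  paths from \<open>\<tau>\<close> to \<open>\<sigma>\<close>. Such a path goes down to a facet and then repeatedly up a matched pair
  and down again; it is given by the list of the matched pairs. The weight of an upward step is
  minus the inverse of the incidence number, which is 1 or -1.
\<close>

definition incidence :: "'n mon list \<Rightarrow> 'n face \<Rightarrow> 'n face \<Rightarrow> int" where
  "incidence ms \<tau> \<sigma> =
     (\<Sum>u \<in> \<tau>. if \<sigma> = \<tau> - {u} then (-1) ^ card (\<tau> \<inter> set (takeWhile (\<lambda>v. v \<noteq> u) ms)) else 0)"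

fun gradient_path :: "'n matching \<Rightarrow> 'n face \<Rightarrow> ('n face \<times> 'n face) list \<Rightarrow> 'n face \<Rightarrow> bool" where
  "gradient_path M \<tau> [] \<sigma> \<longleftrightarrow> facet \<sigma> \<tau> \<and> (\<sigma>, \<tau>) \<notin> M"
| "gradient_path M \<tau> ((\<alpha>, \<beta>) # es) \<sigma> \<longleftrightarrow>
     facet \<alpha> \<tau> \<and> (\<alpha>, \<tau>) \<notin> M \<and> (\<alpha>, \<beta>) \<in> M \<and> gradient_path M \<beta> es \<sigma>"

fun path_weight :: "'n mon list \<Rightarrow> 'n face \<Rightarrow> ('n face \<times> 'n face) list \<Rightarrow> 'n face \<Rightarrow> int" where
  "path_weight ms \<tau> [] \<sigma> = incidence ms \<tau> \<sigma>"
| "path_weight ms \<tau> ((\<alpha>, \<beta>) # es) \<sigma> =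
     incidence ms \<tau> \<alpha> * (- incidence ms \<beta> \<alpha>) * path_weight ms \<beta> es \<sigma>"

definition morse_complex :: "'n::finite mon list \<Rightarrow> 'n matching \<Rightarrow> ('n face, 'n, 'k::field) free_complex" where
  "morse_complex ms M =
     \<lparr> gens = critical (set ms) M,
       hdeg = card,
       mdeg = mlcm,
       bd = (\<lambda>\<tau> \<sigma>. Poly_Mapping.single (mlcm \<tau> - mlcm \<sigma>)
               (of_int (\<Sum>es \<in> {es. gradient_path M \<tau> es \<sigma>}. path_weight ms \<tau> es \<sigma>))) \<rparr>"

definition betti_splitting ::
  "('n::finite, 'k::field) pol set \<Rightarrow> ('n, 'k) pol set \<Rightarrow> ('n, 'k) pol set \<Rightarrow> bool" where
  "betti_splitting I J K \<longleftrightarrow>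
     monomial_ideal J \<and> monomial_ideal K \<and> I = ideal_sum J K \<and>
     min_gens I = min_gens J \<union> min_gens K \<and> min_gens J \<inter> min_gens K = {} \<and>
     (\<forall>i \<alpha>. betti I {0} i \<alpha> =
        betti J {0} i \<alpha> + betti K {0} i \<alpha> + (if i = 0 then 0 else betti (J \<inter> K) {0} (i - 1) \<alpha>))"

definition mixed_faces :: "'n mon set \<Rightarrow> 'n mon set \<Rightarrow> 'n face set" where
  "mixed_faces A B = {\<sigma>. \<sigma> \<subseteq> A \<union> B \<and> \<sigma> \<inter> A \<noteq> {} \<and> \<sigma> \<inter> B \<noteq> {}}"

text \<open>
  \<open>minimal_pruning I ms M\<close>: M is a matching on the Taylor simplex of I (oriented by the list ms of
  its generators) that is obtained by the pruning algorithm, or by its iterated Betti splitting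
  version, and the resulting resolution is minimal.

  In the splitting version the faces of J, the faces of K and the mixed faces are pruned
  separately. The mixed faces account for \<open>J \<inter> K\<close>: those left over of cardinality p + 1 correspond,
  with multidegrees, to the faces of cardinality p (for p > 0) left over by the pruning of
  \<open>J \<inter> K\<close>. Homological degrees for the ideals are one less than those for the quotient rings, so
  this is the term of index i - 1 in the formula for the pruned Betti numbers of I. Together the
  pieces form a partial pruning of the Taylor simplex of I.
\<close>

inductive minimal_pruning ::
  "('n::finite, 'k::field) pol set \<Rightarrow> 'n mon list \<Rightarrow> 'n matching \<Rightarrow> bool" where
  order: "minimal_pruning I ms (pruning ms)"
  if "monomial_ideal I"
    and "distinct ms" and "set ms = min_gens I"
    and "minimal_free_resolution UNIV I (morse_complex ms (pruning ms))"
| split: "minimal_pruning I (msJ @ msK) (MJ \<union> MK \<union> N)"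
  if "betti_splitting I J K"
    and "minimal_pruning J msJ MJ"
    and "minimal_pruning K msK MK"
    and "minimal_pruning (J \<inter> K) msL ML"
    and "Field N \<subseteq> mixed_faces (set msJ) (set msK)"
    and "homogeneous_acyclic_matching (set msJ \<union> set msK) (MJ \<union> MK \<union> N)"
    and "\<And>p \<alpha>. p > 0 \<Longrightarrow>
           card {\<sigma> \<in> mixed_faces (set msJ) (set msK) - Field N. card \<sigma> = Suc p \<and> mlcm \<sigma> = \<alpha>} =
           card {\<sigma> \<in> critical (set msL) ML. card \<sigma> = p \<and> mlcm \<sigma> = \<alpha>}"

definition minimal_pruned_resolution ::
  "('n::finite, 'k::field) pol set \<Rightarrow> ('n face, 'n, 'k) free_complex \<Rightarrow> bool" where
  "minimal_pruned_resolution I P \<longleftrightarrow>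
     (\<exists>ms M. minimal_pruning I ms M \<and> P = morse_complex ms M) \<and> minimal_free_resolution UNIV I P"

end

theory Submission
  imports Defs
begin

text \<open>
  A graded complex of free modules splits into strands, one complex of vector spaces per multidegree,
  and resolves R/I iff the strands are exact. Comparison maps between two resolutions of R/I
  are unique up to homotopy, so a complex without units in its differential is isomorphic to every
  other resolution of R/I with as many generators.

  For an order with linear quotients the Eliahou-Kervaire and Herzog-Takayama complexes resolve R/I
  because each generator adds a shifted Koszul complex on the variables of a colon ideal. For the
  pruned resolution, each generator u is split off by the Betti splitting of the ideal into (its
  predecessors) + (u); the mixed faces are matched such that one face survives for each set of
  variables of the colon ideal. Sorting the generators by degree keeps the colon ideals and excludes
  units, as the gradient flow never moves to a later generator. All three complexes have one basis
  element for each generator and each subset of the variables of its colon ideal.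
\<close>

section \<open>Linear algebra and the boundary of a simplex\<close>

text \<open>The splitting rule demands an identity of Betti numbers, and \<open>betti\<close> is a
  definite description, so counting critical faces says nothing until a minimal resolution is at
  hand. In each step the enlarged Morse complex must therefore first be shown to resolve R/I without
  units; only then do the counts yield the Betti splitting. Excluding units is a matter of degrees:
  a critical face \<sigma> belonging to the generator v has an lcm of degree deg v + card \<sigma> -
  1, and a gradient path lowers the cardinality by one. A unit from a face of u to a face of v thus
  forces deg v = deg u + 1, which cannot happen if v = u or if v precedes u in a list sorted by
  degree. Sorting changes the list but not the sets \<open>V u\<close> of variables, and the number
  of basis elements, one for R plus the sum of the \<open>2 ^ card (V u)\<close>, depends on these
  alone. This is why the pruned resolution can be compared with a complex built along the original
  order: a comparison map out of a unit-free resolution is injective on strands, and equal counts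
  make it bijective.\<close>

lemma exists_dependence:
  fixes A :: "'a \<Rightarrow> 'b \<Rightarrow> 'k::field"
  assumes "finite Y" "finite X" "card Y < card X"
  shows "\<exists>v. (\<exists>x\<in>X. v x \<noteq> 0) \<and> (\<forall>x. v x \<noteq> 0 \<longrightarrow> x \<in> X) \<and> (\<forall>y\<in>Y. (\<Sum>x\<in>X. v x * A x y) = 0)"
  using assms
proof (induction Y arbitrary: X A rule: finite_induct)
  case empty
  then obtain x where "x \<in> X" by (cases "X = {}") auto
  then show ?case by (intro exI[of _ "\<lambda>z. if z = x then 1 else 0"]) auto
next
  case (insert y Y)
  show ?case
  proof (cases "\<forall>x\<in>X. A x y = 0")
    case True
    moreover have "card Y < card X" using insert.prems insert.hyps by simp
    ultimately show ?thesis using insert.IH[of X A] insert.prems by auto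
  next
    case False
    then obtain x0 where x0: "x0 \<in> X" "A x0 y \<noteq> 0" by blast
    define X' where "X' = X - {x0}"
    have fX': "finite X'" and cX': "card Y < card X'"
      using insert x0 by (auto simp: X'_def)
    \<comment> \<open>Gaussian elimination: equation y serves to eliminate the unknown
      \<open>x0\<close>, whose value \<open>a\<close> is recovered from y afterwards.\<close>
    define B where "B x z = A x z - A x y / A x0 y * A x0 z" for x z
    from insert.IH[OF fX' cX', of B] obtain v where v: "\<exists>x\<in>X'. v x \<noteq> 0" "\<forall>x. v x \<noteq> 0 \<longrightarrow> x \<in> X'"
      "\<forall>z\<in>Y. (\<Sum>x\<in>X'. v x * B x z) = 0" by blast
    define a where "a = - (\<Sum>x\<in>X'. v x * A x y) / A x0 y"
    define w where "w = v(x0 := a)"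
    have sums: "(\<Sum>x\<in>X. w x * A x z) = a * A x0 z + (\<Sum>x\<in>X'. v x * A x z)" for z
      using insert.prems x0 by (simp add: sum.remove[of X x0] X'_def w_def)
    have "(\<Sum>x\<in>X. w x * A x z) = 0" if "z \<in> insert y Y" for z
    proof (cases "z = y")
      case True then show ?thesis using x0 by (simp add: sums a_def)
    next
      case False
      have "0 = (\<Sum>x\<in>X'. v x * B x z)" using v that False by simp
      also have "\<dots> = (\<Sum>x\<in>X'. v x * A x z) - (\<Sum>x\<in>X'. v x * A x y) / A x0 y * A x0 z"
        by (simp add: B_def right_diff_distrib sum_subtractf sum_distrib_right sum_divide_distrib mult.assoc)
      finally show ?thesis by (simp add: sums a_def)
    qed
    moreover have "\<exists>x\<in>X. w x \<noteq> 0" using v by (auto simp: w_def X'_def)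
    moreover have "\<forall>x. w x \<noteq> 0 \<longrightarrow> x \<in> X" using v x0 by (auto simp: w_def X'_def)
    ultimately show ?thesis by blast
  qed
qed

lemma injective_imp_card_le:
  fixes A :: "'a \<Rightarrow> 'b \<Rightarrow> 'k::field"
  assumes "finite X" "finite Y"
    and inj: "\<And>v. (\<And>x. v x \<noteq> 0 \<Longrightarrow> x \<in> X) \<Longrightarrow> (\<And>y. y \<in> Y \<Longrightarrow> (\<Sum>x\<in>X. v x * A x y) = 0) \<Longrightarrow> \<forall>x. v x = 0"
  shows "card X \<le> card Y"
  using exists_dependence[of Y X A] assms(1,2) inj by (metis not_le)

text \<open>The target \<open>t\<close> is adjoined as one more row \<open>None\<close>. There are
  now more than \<open>card Y\<close> rows, so they are dependent, and injectivity forces the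
  coefficient of \<open>t\<close> in the dependence to be nonzero; it can be divided out.\<close>

lemma injective_imp_surjective:
  fixes A :: "'a \<Rightarrow> 'b \<Rightarrow> 'k::field"
  assumes fin: "finite X" "finite Y" and card: "card Y \<le> card X"
    and inj: "\<And>v. (\<And>x. v x \<noteq> 0 \<Longrightarrow> x \<in> X) \<Longrightarrow> (\<And>y. y \<in> Y \<Longrightarrow> (\<Sum>x\<in>X. v x * A x y) = 0) \<Longrightarrow> \<forall>x. v x = 0"
  obtains v where "\<And>x. v x \<noteq> 0 \<Longrightarrow> x \<in> X" "\<And>y. y \<in> Y \<Longrightarrow> (\<Sum>x\<in>X. v x * A x y) = t y"
proof -
  define X' where "X' = insert None (Some ` X)"
  define B where "B x y = (case x of None \<Rightarrow> t y | Some x \<Rightarrow> A x y)" for x y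
  have "card X' = Suc (card X)" using fin by (simp add: X'_def card_image)
  then obtain u where u: "\<exists>x\<in>X'. u x \<noteq> 0" "\<forall>x. u x \<noteq> 0 \<longrightarrow> x \<in> X'" "\<forall>y\<in>Y. (\<Sum>x\<in>X'. u x * B x y) = 0"
    using exists_dependence[of Y X' B] fin card by (auto simp: X'_def)
  have sums: "(\<Sum>x\<in>X'. u x * B x y) = u None * t y + (\<Sum>x\<in>X. u (Some x) * A x y)" for y
    using fin by (simp add: X'_def B_def sum.reindex)
  have sup: "x \<in> X" if "u (Some x) \<noteq> 0" for x using u(2) that by (auto simp: X'_def)
  have "u None \<noteq> 0"
  proof
    assume 0: "u None = 0"
    then have "\<forall>x. u (Some x) = 0" using u(3) sup by (intro inj) (auto simp: sums)
    then show False using u(1) 0 by (auto simp: X'_def)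
  qed
  show thesis
  proof (rule that[of "\<lambda>x. - u (Some x) / u None"])
    show "x \<in> X" if "- u (Some x) / u None \<noteq> 0" for x using that sup by auto
    fix y assume "y \<in> Y"
    then have "(\<Sum>x\<in>X. u (Some x) * A x y) = - (u None * t y)"
      using u(3) by (auto simp: sums add_eq_0_iff)
    then show "(\<Sum>x\<in>X. - u (Some x) / u None * A x y) = t y"
      using \<open>u None \<noteq> 0\<close> by (simp add: sum_divide_distrib[symmetric] sum_negf)
  qed
qed

text \<open>The vertices are ordered through \<open>key\<close>, so that one boundary serves both
  the Taylor simplex (positions in the list of generators) and the Koszul complex (\<open>id\<close>
  on the variables). The empty face is included: this is the augmented complex.\<close>

definition simplex_bd :: "('a \<Rightarrow> 'o::linorder) \<Rightarrow> 'a set \<Rightarrow> 'a set \<Rightarrow> 'k::comm_ring_1" where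
  "simplex_bd key \<tau> \<sigma> = (\<Sum>u\<in>\<tau>. if \<sigma> = \<tau> - {u} then (-1) ^ card {v \<in> \<tau>. key v < key u} else 0)"

definition simplex_sgn :: "('a \<Rightarrow> 'o::linorder) \<Rightarrow> 'a set \<Rightarrow> 'a \<Rightarrow> 'k::comm_ring_1" where
  "simplex_sgn key \<tau> u = (-1) ^ card {v \<in> \<tau>. key v < key u}"

lemma simplex_sgn_square [simp]: "simplex_sgn key \<tau> u * simplex_sgn key \<tau> u = 1"
  by (simp add: simplex_sgn_def flip: power_mult_distrib)

text \<open>Removing the earlier of two vertices moves the later one down by one place, while
  removing the later one leaves the earlier in place; hence exactly one change of sign.\<close>

lemma simplex_sgn_swap:
  assumes "finite \<tau>" "inj_on key \<tau>" "i \<in> \<tau>" "j \<in> \<tau>" "i \<noteq> j"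
  shows "simplex_sgn key \<tau> j * simplex_sgn key (\<tau> - {j}) i
       = - (simplex_sgn key \<tau> i * simplex_sgn key (\<tau> - {i}) j :: 'k::comm_ring_1)"
proof -
  have *: "simplex_sgn key \<tau> j * simplex_sgn key (\<tau> - {j}) i
       = - (simplex_sgn key \<tau> i * simplex_sgn key (\<tau> - {i}) j :: 'k::comm_ring_1)"
    if "key i < key j" "i \<in> \<tau>" "j \<in> \<tau>" for i j
  proof -
    have "{v \<in> \<tau>. key v < key j} = insert i {v \<in> \<tau> - {i}. key v < key j}" using that by auto
    then have "card {v \<in> \<tau>. key v < key j} = Suc (card {v \<in> \<tau> - {i}. key v < key j})"
      using assms(1) by simp
    moreover have "{v \<in> \<tau>. key v < key i} = {v \<in> \<tau> - {j}. key v < key i}" using that by auto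
    ultimately show ?thesis by (simp add: simplex_sgn_def mult.commute)
  qed
  have "key i \<noteq> key j" using assms by (meson inj_on_def)
  then consider "key i < key j" | "key j < key i" by fastforce
  then show ?thesis using *[of i j] *[of j i] assms by cases auto
qed

text \<open>Turns the swap relation around: the signs \<open>a\<close> and \<open>d\<close> are
  their own inverses and can be moved to the other side.\<close>

lemma sign_cancel:
  fixes a b c d :: "'k::comm_ring_1"
  assumes "a * a = 1" "d * d = 1" "a * c = - (b * d)"
  shows "d * c = - (b * a)"
proof -
  have "d * c = d * a * (a * c)" using assms(1) by (simp add: mult.assoc flip: mult.assoc[of a a c])
  also have "\<dots> = - (b * a * (d * d))" unfolding assms(3) by (simp add: mult_ac)
  finally show ?thesis by (simp add: assms(2))
qed

text \<open>The terms (i, j) and (j, i) are paired off through the order of the keys. Deducing only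
  that the sum equals its own negative would not suffice in characteristic 2.\<close>

lemma sum_antisymmetric:
  fixes f :: "'a \<Rightarrow> 'a \<Rightarrow> 'k::comm_ring_1" and key :: "'a \<Rightarrow> 'o::linorder"
  assumes "finite \<tau>" "inj_on key \<tau>" and anti: "\<And>i j. i \<in> \<tau> \<Longrightarrow> j \<in> \<tau> \<Longrightarrow> i \<noteq> j \<Longrightarrow> f i j = - f j i"
  shows "(\<Sum>i\<in>\<tau>. \<Sum>j\<in>\<tau> - {i}. f i j) = 0"
proof -
  define L where "L = (\<Sum>i\<in>\<tau>. \<Sum>j\<in>\<tau>. if key i < key j then f i j else 0)"
  have "(\<Sum>j\<in>\<tau> - {i}. f i j) = (\<Sum>j\<in>\<tau>. if key i < key j then f i j else 0) + (\<Sum>j\<in>\<tau>. if key j < key i then f i j else 0)"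
    if "i \<in> \<tau>" for i
  proof -
    have "(\<Sum>j\<in>\<tau> - {i}. f i j) = (\<Sum>j\<in>\<tau>. if j = i then 0 else f i j)"
      using assms(1) by (intro sum.mono_neutral_cong_left) auto
    also have "\<dots> = (\<Sum>j\<in>\<tau>. (if key i < key j then f i j else 0) + (if key j < key i then f i j else 0))"
      by (intro sum.cong) (use that assms(2) in \<open>auto simp: inj_on_def not_less_iff_gr_or_eq\<close>)
    finally show ?thesis by (simp add: sum.distrib)
  qed
  then have "(\<Sum>i\<in>\<tau>. \<Sum>j\<in>\<tau> - {i}. f i j) = L + (\<Sum>i\<in>\<tau>. \<Sum>j\<in>\<tau>. if key j < key i then f i j else 0)"
    by (simp add: sum.distrib L_def)
  also have "(\<Sum>i\<in>\<tau>. \<Sum>j\<in>\<tau>. if key j < key i then f i j else 0) = (\<Sum>j\<in>\<tau>. \<Sum>i\<in>\<tau>. if key j < key i then f i j else 0)"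
    by (rule sum.swap)
  also have "\<dots> = (\<Sum>j\<in>\<tau>. \<Sum>i\<in>\<tau>. - (if key j < key i then f j i else 0))"
    by (intro sum.cong refl) (use anti in fastforce)
  also have "\<dots> = - L" by (simp add: sum_negf L_def)
  finally show ?thesis by simp
qed

lemma simplex_bd_eq: "simplex_bd key \<tau> \<sigma> = (\<Sum>u\<in>\<tau>. if \<sigma> = \<tau> - {u} then simplex_sgn key \<tau> u else 0)"
  unfolding simplex_bd_def simplex_sgn_def ..

lemma simplex_bd_face:
  assumes "finite \<tau>" "u \<in> \<tau>"
  shows "simplex_bd key \<tau> (\<tau> - {u}) = simplex_sgn key \<tau> u"
proof -
  have "(\<tau> - {u} = \<tau> - {v}) = (v = u)" if "v \<in> \<tau>" for v using that assms by blast
  then have "simplex_bd key \<tau> (\<tau> - {u}) = (\<Sum>v\<in>\<tau>. if v = u then simplex_sgn key \<tau> u else 0)"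
    unfolding simplex_bd_eq by (intro sum.cong) auto
  then show ?thesis using assms by simp
qed

lemma simplex_bd_nonzeroD:
  assumes "simplex_bd key \<tau> \<sigma> \<noteq> 0" shows "facet \<sigma> \<tau>"
  using assms unfolding simplex_bd_eq facet_def
  by (auto elim!: sum.not_neutral_contains_not_neutral split: if_splits)

lemma sum_simplex_bd:
  assumes "finite X" "finite \<tau>" "\<And>u. u \<in> \<tau> \<Longrightarrow> \<tau> - {u} \<in> X"
  shows "(\<Sum>\<sigma>\<in>X. simplex_bd key \<tau> \<sigma> * f \<sigma>) = (\<Sum>u\<in>\<tau>. simplex_sgn key \<tau> u * f (\<tau> - {u}))"
proof -
  have "(\<Sum>\<sigma>\<in>X. simplex_bd key \<tau> \<sigma> * f \<sigma>) = (\<Sum>\<sigma>\<in>X. \<Sum>u\<in>\<tau>. if \<sigma> = \<tau> - {u} then simplex_sgn key \<tau> u * f (\<tau> - {u}) else 0)"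
    unfolding simplex_bd_eq sum_distrib_right by (intro sum.cong) auto
  also have "\<dots> = (\<Sum>u\<in>\<tau>. \<Sum>\<sigma>\<in>X. if \<sigma> = \<tau> - {u} then simplex_sgn key \<tau> u * f (\<tau> - {u}) else 0)"
    by (rule sum.swap)
  also have "\<dots> = (\<Sum>u\<in>\<tau>. simplex_sgn key \<tau> u * f (\<tau> - {u}))"
    using assms by (intro sum.cong) auto
  finally show ?thesis .
qed

lemma simplex_bd_bd:
  assumes "finite \<tau>" "inj_on key \<tau>" "finite X" "\<And>u. u \<in> \<tau> \<Longrightarrow> \<tau> - {u} \<in> X"
  shows "(\<Sum>\<sigma>\<in>X. simplex_bd key \<tau> \<sigma> * simplex_bd key \<sigma> \<rho>) = (0 :: 'k::comm_ring_1)"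
proof -
  have "(\<Sum>\<sigma>\<in>X. simplex_bd key \<tau> \<sigma> * simplex_bd key \<sigma> \<rho>)
      = (\<Sum>u\<in>\<tau>. simplex_sgn key \<tau> u * simplex_bd key (\<tau> - {u}) \<rho> :: 'k)"
    using assms by (intro sum_simplex_bd) auto
  also have "\<dots> = (\<Sum>u\<in>\<tau>. \<Sum>w\<in>\<tau> - {u}. if \<rho> = \<tau> - {u} - {w} then simplex_sgn key \<tau> u * simplex_sgn key (\<tau> - {u}) w else 0)"
    unfolding simplex_bd_eq sum_distrib_left by (intro sum.cong) auto
  also have "\<dots> = 0"
  proof (rule sum_antisymmetric[OF assms(1,2)], goal_cases)
    case (1 i j)
    have sets: "\<tau> - {i} - {j} = \<tau> - {j} - {i}" by blast
    have "simplex_sgn key \<tau> i * simplex_sgn key (\<tau> - {i}) j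
        = - (simplex_sgn key \<tau> j * simplex_sgn key (\<tau> - {j}) i :: 'k)"
      using 1 by (intro simplex_sgn_swap assms) auto
    then show ?case unfolding sets by (cases "\<rho> = \<tau> - {j} - {i}") simp_all
  qed
  finally show ?thesis .
qed

text \<open>The simplex is a cone with apex \<open>m\<close>, and inserting \<open>m\<close> is a
  contracting homotopy of the augmented complex.\<close>

lemma simplex_exact:
  fixes v :: "'a set \<Rightarrow> 'k::comm_ring_1"
  assumes B: "finite B" "inj_on key B" "m \<in> B"
    and v: "\<And>\<sigma>. v \<sigma> \<noteq> 0 \<Longrightarrow> \<sigma> \<subseteq> B \<and> card \<sigma> = i"
    and cycle: "\<And>\<sigma>. \<sigma> \<subseteq> B \<Longrightarrow> (\<Sum>\<tau>\<in>Pow B. v \<tau> * simplex_bd key \<tau> \<sigma>) = 0"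
  shows "\<exists>w. (\<forall>\<sigma>. w \<sigma> \<noteq> 0 \<longrightarrow> \<sigma> \<subseteq> B \<and> card \<sigma> = Suc i) \<and>
             (\<forall>\<sigma>\<subseteq>B. (\<Sum>\<tau>\<in>Pow B. w \<tau> * simplex_bd key \<tau> \<sigma>) = v \<sigma>)"
proof -
  define h :: "'a set \<Rightarrow> 'a set \<Rightarrow> 'k" where
    "h \<sigma> \<tau> = (if m \<notin> \<sigma> \<and> \<tau> = insert m \<sigma> then simplex_sgn key (insert m \<sigma>) m else 0)" for \<sigma> \<tau>
  have fin: "finite (Pow B)" using B by simp
  have homotopy: "(\<Sum>\<sigma>\<in>Pow B. simplex_bd key \<tau> \<sigma> * h \<sigma> \<rho>) + (\<Sum>\<sigma>\<in>Pow B. h \<tau> \<sigma> * simplex_bd key \<sigma> \<rho>) = (if \<tau> = \<rho> then 1 else 0)"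
    if \<tau>: "\<tau> \<subseteq> B" for \<tau> \<rho>
  proof -
    have ft: "finite \<tau>" using \<tau> B finite_subset by blast
    have 1: "(\<Sum>\<sigma>\<in>Pow B. simplex_bd key \<tau> \<sigma> * h \<sigma> \<rho>) = (\<Sum>u\<in>\<tau>. simplex_sgn key \<tau> u * h (\<tau> - {u}) \<rho>)"
      using \<tau> ft B by (intro sum_simplex_bd) auto
    show ?thesis
    proof (cases "m \<in> \<tau>")
      case True
      have "(\<Sum>u\<in>\<tau>. simplex_sgn key \<tau> u * h (\<tau> - {u}) \<rho>) = (\<Sum>u\<in>\<tau>. if u = m then (if \<tau> = \<rho> then 1 else 0) else 0)"
        by (intro sum.cong) (use True in \<open>auto simp: h_def insert_absorb\<close>)
      moreover have "(\<Sum>\<sigma>\<in>Pow B. h \<tau> \<sigma> * simplex_bd key \<sigma> \<rho>) = 0"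
        by (intro sum.neutral) (use True in \<open>auto simp: h_def\<close>)
      ultimately show ?thesis using True ft 1 by simp
    next
      case False
      define \<mu> where "\<mu> = insert m \<tau>"
      have \<mu>: "\<mu> \<subseteq> B" "finite \<mu>" "inj_on key \<mu>" using \<tau> B ft inj_on_subset[OF B(2), of \<mu>] by (auto simp: \<mu>_def)
      have "(\<Sum>\<sigma>\<in>Pow B. h \<tau> \<sigma> * simplex_bd key \<sigma> \<rho>) = (\<Sum>\<sigma>\<in>Pow B. if \<sigma> = \<mu> then simplex_sgn key \<mu> m * simplex_bd key \<mu> \<rho> else 0)"
        by (intro sum.cong) (use False in \<open>auto simp: h_def \<mu>_def\<close>)
      also have "\<dots> = simplex_sgn key \<mu> m * simplex_bd key \<mu> \<rho>" using \<mu> fin by simp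
      also have "simplex_bd key \<mu> \<rho> = (if \<rho> = \<tau> then simplex_sgn key \<mu> m else 0) + (\<Sum>u\<in>\<tau>. if \<rho> = \<mu> - {u} then simplex_sgn key \<mu> u else 0)"
        unfolding simplex_bd_eq \<mu>_def using False ft by simp
      finally have 2: "(\<Sum>\<sigma>\<in>Pow B. h \<tau> \<sigma> * simplex_bd key \<sigma> \<rho>)
          = (if \<tau> = \<rho> then 1 else 0) + (\<Sum>u\<in>\<tau>. if \<rho> = \<mu> - {u} then simplex_sgn key \<mu> m * simplex_sgn key \<mu> u else 0)"
        by (auto simp: distrib_left sum_distrib_left if_distrib[of "(*) _"] cong: if_cong)
      \<comment> \<open>The face with u removed and m inserted arises in both orders, with opposite
        signs.\<close>
      have "simplex_sgn key \<tau> u * h (\<tau> - {u}) \<rho> = - (if \<rho> = \<mu> - {u} then simplex_sgn key \<mu> m * simplex_sgn key \<mu> u else 0)"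
        if u: "u \<in> \<tau>" for u
      proof -
        have "u \<noteq> m" and ins: "insert m (\<tau> - {u}) = \<mu> - {u}" "\<mu> - {m} = \<tau>" using u False by (auto simp: \<mu>_def)
        have "simplex_sgn key \<mu> u * simplex_sgn key (\<mu> - {u}) m = - (simplex_sgn key \<mu> m * simplex_sgn key \<tau> u :: 'k)"
          using simplex_sgn_swap[OF \<mu>(2,3), of m u, where 'k='k] u \<open>u \<noteq> m\<close> ins by (simp add: \<mu>_def)
        from sign_cancel[OF _ _ this]
        have "simplex_sgn key \<tau> u * simplex_sgn key (\<mu> - {u}) m = - (simplex_sgn key \<mu> m * simplex_sgn key \<mu> u :: 'k)"
          by (simp only: simplex_sgn_square)
        then show ?thesis using False \<open>u \<noteq> m\<close> by (auto simp: h_def ins)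
      qed
      then have "(\<Sum>u\<in>\<tau>. simplex_sgn key \<tau> u * h (\<tau> - {u}) \<rho>)
          = - (\<Sum>u\<in>\<tau>. if \<rho> = \<mu> - {u} then simplex_sgn key \<mu> m * simplex_sgn key \<mu> u else 0)"
        by (simp add: sum_negf)
      then show ?thesis using 1 2 by simp
    qed
  qed
  define w where "w \<rho> = (\<Sum>\<tau>\<in>Pow B. v \<tau> * h \<tau> \<rho>)" for \<rho>
  have "\<rho> \<subseteq> B \<and> card \<rho> = Suc i" if nz: "w \<rho> \<noteq> 0" for \<rho>
  proof -
    obtain \<tau> where "v \<tau> \<noteq> 0" "h \<tau> \<rho> \<noteq> 0" 
      using nz unfolding w_def by (metis (no_types, lifting) mult_eq_0_iff mult_zero_left mult_zero_right sum.neutral)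
    then show ?thesis using v[of \<tau>] B finite_subset[of \<tau> B] by (auto simp: h_def split: if_splits)
  qed
  moreover have "(\<Sum>\<tau>\<in>Pow B. w \<tau> * simplex_bd key \<tau> \<rho>) = v \<rho>" if "\<rho> \<subseteq> B" for \<rho>
  proof -
    \<comment> \<open>For a cycle the first half of the homotopy formula contributes
      nothing.\<close>
    have "(\<Sum>\<sigma>\<in>Pow B. (\<Sum>\<tau>\<in>Pow B. v \<tau> * simplex_bd key \<tau> \<sigma>) * h \<sigma> \<rho>) = 0"
      using cycle by (intro sum.neutral) auto
    then have 0: "(\<Sum>\<tau>\<in>Pow B. v \<tau> * (\<Sum>\<sigma>\<in>Pow B. simplex_bd key \<tau> \<sigma> * h \<sigma> \<rho>)) = 0"
      unfolding sum_distrib_left sum_distrib_right by (subst sum.swap) (simp add: mult.assoc)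
    have "(\<Sum>\<tau>\<in>Pow B. w \<tau> * simplex_bd key \<tau> \<rho>) = (\<Sum>\<tau>\<in>Pow B. v \<tau> * (\<Sum>\<sigma>\<in>Pow B. h \<tau> \<sigma> * simplex_bd key \<sigma> \<rho>))"
      unfolding w_def sum_distrib_left sum_distrib_right by (subst sum.swap) (simp add: mult.assoc)
    also have "\<dots> = (\<Sum>\<tau>\<in>Pow B. v \<tau> * ((\<Sum>\<sigma>\<in>Pow B. simplex_bd key \<tau> \<sigma> * h \<sigma> \<rho>) + (\<Sum>\<sigma>\<in>Pow B. h \<tau> \<sigma> * simplex_bd key \<sigma> \<rho>)))"
      using 0 by (simp add: distrib_left sum.distrib)
    also have "\<dots> = (\<Sum>\<tau>\<in>Pow B. v \<tau> * (if \<tau> = \<rho> then 1 else 0))"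
      by (intro sum.cong) (use homotopy in auto)
    also have "\<dots> = v \<rho>" using fin that by (simp add: if_distrib[of "(*) _"] cong: if_cong)
    finally show ?thesis .
  qed
  ultimately show ?thesis by blast
qed

section \<open>Strands, comparison maps and uniqueness of resolutions\<close>

text \<open>In a graded complex an entry of the differential is a multiple of a single monomial,
  fixed by the two multidegrees; this is its scalar factor.\<close>

definition cf :: "('b, 'n::finite, 'k::field) free_complex \<Rightarrow> 'b \<Rightarrow> 'b \<Rightarrow> 'k" where
  "cf F b c = Poly_Mapping.lookup (bd F b c) (mdeg F b - mdeg F c)"

text \<open>A scalar at \<open>b\<close> stands for that multiple of x^(\<alpha> - mdeg b) b, which
  exists only if \<open>mdeg F b \<le> \<alpha>\<close>. In these coordinates the differential of
  every strand is given by the one matrix \<open>cf F\<close>.\<close>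

definition strand :: "('b, 'n::finite, 'k::field) free_complex \<Rightarrow> nat \<Rightarrow> 'n mon \<Rightarrow> ('b \<Rightarrow> 'k) \<Rightarrow> bool" where
  "strand F i \<alpha> v \<longleftrightarrow> (\<forall>b. v b \<noteq> 0 \<longrightarrow> b \<in> gens F \<and> hdeg F b = i \<and> mdeg F b \<le> \<alpha>)"

definition exact_at :: "('b, 'n::finite, 'k::field) free_complex \<Rightarrow> nat \<Rightarrow> 'n mon \<Rightarrow> bool" where
  "exact_at F i \<alpha> \<longleftrightarrow>
     (\<forall>v. strand F i \<alpha> v \<and> (\<forall>c\<in>gens F. (\<Sum>b\<in>gens F. v b * cf F b c) = 0) \<longrightarrow>
       (\<exists>w. strand F (Suc i) \<alpha> w \<and> (\<forall>c\<in>gens F. (\<Sum>b\<in>gens F. w b * cf F b c) = v c)))"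

text \<open>Being a resolution of R/I, for \<open>S\<close> the set of monomials of I, expressed by
  scalars alone. The basis element \<open>z\<close> spans R. In homological degree 0 exactness is
  asked only at \<alpha> in \<open>S\<close>, where R/I vanishes; the condition on
  \<open>cf F b z\<close> puts the image of the differential inside I.\<close>

definition resolves :: "'n mon set \<Rightarrow> 'b \<Rightarrow> ('b, 'n::finite, 'k::field) free_complex \<Rightarrow> bool" where
  "resolves S z F \<longleftrightarrow> graded_free_complex F \<and>
     z \<in> gens F \<and> hdeg F z = 0 \<and> mdeg F z = 0 \<and> (\<forall>b\<in>gens F. hdeg F b = 0 \<longrightarrow> b = z) \<and>
     (\<forall>b\<in>gens F. cf F b z \<noteq> 0 \<longrightarrow> mdeg F b \<in> S) \<and>
     (\<forall>i \<alpha>. 0 < i \<or> \<alpha> \<in> S \<longrightarrow> exact_at F i \<alpha>)"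

text \<open>Between equal multidegrees the only possible monomial is 1, so a nonzero entry there
  would be a unit.\<close>

definition unitfree :: "('b, 'n::finite, 'k::field) free_complex \<Rightarrow> bool" where
  "unitfree F \<longleftrightarrow> (\<forall>b\<in>gens F. \<forall>c\<in>gens F. cf F b c \<noteq> 0 \<longrightarrow> mdeg F b \<noteq> mdeg F c)"

text \<open>Chain maps in scalar form. Vanishing outside the bases is built in, so that degrees can
  be read off from any nonzero entry.\<close>

definition scalar_map ::
  "('b, 'n::finite, 'k::field) free_complex \<Rightarrow> ('c, 'n, 'k) free_complex \<Rightarrow> ('b \<Rightarrow> 'c \<Rightarrow> 'k) \<Rightarrow> bool" where
  "scalar_map F G \<phi> \<longleftrightarrow>
     (\<forall>b c. \<phi> b c \<noteq> 0 \<longrightarrow> b \<in> gens F \<and> c \<in> gens G \<and> hdeg F b = hdeg G c \<and> mdeg G c \<le> mdeg F b) \<and>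
     (\<forall>b\<in>gens F. \<forall>e\<in>gens G. (\<Sum>c\<in>gens F. cf F b c * \<phi> c e) = (\<Sum>c\<in>gens G. \<phi> b c * cf G c e))"

lemma sum_nonzeroE:
  assumes "(\<Sum>x\<in>A. f x) \<noteq> (0 :: 'a::comm_monoid_add)"
  obtains x where "x \<in> A" "f x \<noteq> 0"
  using assms by (meson sum.neutral)

lemma mon_diff_eq: "k + m = n \<Longrightarrow> k = n - (m :: 'n mon)"
  by (drule sym) simp

lemma mon_diff_add: "m \<le> n \<Longrightarrow> n - m + m = (n :: 'n mon)"
  by (auto simp: fun_eq_iff le_fun_def)

lemma homogeneous_eq_single:
  assumes "\<forall>t\<in>Poly_Mapping.keys p. t + m = (n :: 'n mon)"
  shows "p = Poly_Mapping.single (n - m) (Poly_Mapping.lookup p (n - m))"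
proof (rule poly_mapping_eqI)
  fix k
  show "Poly_Mapping.lookup p k = Poly_Mapping.lookup (Poly_Mapping.single (n - m) (Poly_Mapping.lookup p (n - m))) k"
  proof (cases "k \<in> Poly_Mapping.keys p")
    case True
    then have "k = n - m" using assms mon_diff_eq by blast
    then show ?thesis by simp
  next
    case False
    then show ?thesis by (auto simp: lookup_single when_def in_keys_iff)
  qed
qed

lemma single_sum: "Poly_Mapping.single t (\<Sum>x\<in>A. f x) = (\<Sum>x\<in>A. Poly_Mapping.single t (f x))"
  by (induction A rule: infinite_finite_induct) (auto simp: single_add)

text \<open>The exponents telescope, because truncated subtraction is exact wherever both scalars
  are nonzero. This is the passage from matrices of homogeneous polynomials to scalar
  matrices.\<close>

lemma sum_single_mult:
  fixes mc :: "'c \<Rightarrow> 'n mon" and a :: "'c \<Rightarrow> 'k::field"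
  assumes "\<And>c. c \<in> C \<Longrightarrow> a c \<noteq> 0 \<Longrightarrow> mc c \<le> mb" "\<And>c. c \<in> C \<Longrightarrow> b c \<noteq> 0 \<Longrightarrow> me \<le> mc c"
  shows "(\<Sum>c\<in>C. Poly_Mapping.single (mb - mc c) (a c) * Poly_Mapping.single (mc c - me) (b c))
       = Poly_Mapping.single (mb - me) (\<Sum>c\<in>C. a c * b c)"
  unfolding single_sum
proof (rule sum.cong, goal_cases)
  case (2 c)
  show ?case
  proof (cases "a c = 0 \<or> b c = 0")
    case False
    then have "mc c \<le> mb" "me \<le> mc c" using assms 2 by auto
    then have "mb - mc c + (mc c - me) = mb - me" by (auto simp: fun_eq_iff le_fun_def)
    then show ?thesis by (simp add: mult_single)
  qed auto
qed auto

lemma graded_cf: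
  assumes "graded_free_complex F" "b \<in> gens F" "c \<in> gens F"
  shows "bd F b c = Poly_Mapping.single (mdeg F b - mdeg F c) (cf F b c)"
  unfolding cf_def
  by (rule homogeneous_eq_single) (use assms in \<open>auto simp: graded_free_complex_def\<close>)

lemma graded_finite: "graded_free_complex F \<Longrightarrow> finite (gens F)"
  by (simp add: graded_free_complex_def)

lemma graded_cf_nonzero:
  assumes "graded_free_complex F" "b \<in> gens F" "c \<in> gens F" "cf F b c \<noteq> 0"
  shows "hdeg F b = Suc (hdeg F c)" "mdeg F c \<le> mdeg F b"
proof -
  have k: "mdeg F b - mdeg F c \<in> Poly_Mapping.keys (bd F b c)"
    using assms(4) by (simp add: cf_def in_keys_iff)
  then have "bd F b c \<noteq> 0" by auto
  then show "hdeg F b = Suc (hdeg F c)" using assms by (auto simp: graded_free_complex_def)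
  have "mdeg F b - mdeg F c + mdeg F c = mdeg F b" using k assms by (auto simp: graded_free_complex_def)
  then show "mdeg F c \<le> mdeg F b" by (metis (mono_tags, lifting) le_add2 le_funI plus_fun_apply)
qed

lemma graded_cf_cf:
  assumes "graded_free_complex F" "b \<in> gens F" "e \<in> gens F"
  shows "(\<Sum>c\<in>gens F. cf F b c * cf F c e) = 0"
proof -
  have "0 = (\<Sum>c\<in>gens F. bd F b c * bd F c e)" using assms by (auto simp: graded_free_complex_def)
  also have "\<dots> = (\<Sum>c\<in>gens F. Poly_Mapping.single (mdeg F b - mdeg F c) (cf F b c) *
       Poly_Mapping.single (mdeg F c - mdeg F e) (cf F c e))"
    by (intro sum.cong) (use graded_cf[OF assms(1)] assms in auto)
  also have "\<dots> = Poly_Mapping.single (mdeg F b - mdeg F e) (\<Sum>c\<in>gens F. cf F b c * cf F c e)"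
    by (rule sum_single_mult) (use graded_cf_nonzero[OF assms(1)] assms in auto)
  finally show ?thesis by (metis lookup_single_eq lookup_zero)
qed

text \<open>The vanishing of the squared differential is asked only for homological degrees two
  apart: elsewhere every product vanishes for reasons of degree.\<close>

lemma gradedI:
  assumes fin: "finite (gens F)"
    and bd: "\<And>b c. b \<in> gens F \<Longrightarrow> c \<in> gens F \<Longrightarrow> bd F b c = Poly_Mapping.single (mdeg F b - mdeg F c) (k b c)"
    and deg: "\<And>b c. b \<in> gens F \<Longrightarrow> c \<in> gens F \<Longrightarrow> k b c \<noteq> 0 \<Longrightarrow> hdeg F b = Suc (hdeg F c) \<and> mdeg F c \<le> mdeg F b"
    and kk: "\<And>b e. b \<in> gens F \<Longrightarrow> e \<in> gens F \<Longrightarrow> hdeg F b = Suc (Suc (hdeg F e)) \<Longrightarrow> (\<Sum>c\<in>gens F. k b c * k c e) = 0"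
  shows "graded_free_complex F"
  unfolding graded_free_complex_def
proof (intro conjI ballI impI)
  fix b c assume b: "b \<in> gens F" and c: "c \<in> gens F"
  show "bd F b c \<noteq> 0 \<Longrightarrow> hdeg F b = Suc (hdeg F c)"
    using bd[OF b c] deg[OF b c] by (metis single_zero)
  show "t + mdeg F c = mdeg F b" if "t \<in> Poly_Mapping.keys (bd F b c)" for t
    using bd[OF b c] deg[OF b c] that mon_diff_add by (auto split: if_splits)
  have "(\<Sum>e\<in>gens F. bd F b e * bd F e c) = (\<Sum>e\<in>gens F. Poly_Mapping.single (mdeg F b - mdeg F e) (k b e) *
       Poly_Mapping.single (mdeg F e - mdeg F c) (k e c))"
    by (intro sum.cong) (use bd b c in auto)
  also have "\<dots> = Poly_Mapping.single (mdeg F b - mdeg F c) (\<Sum>e\<in>gens F. k b e * k e c)"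
    by (rule sum_single_mult) (use deg b c in auto)
  also have "(\<Sum>e\<in>gens F. k b e * k e c) = 0"
  proof (cases "hdeg F b = Suc (Suc (hdeg F c))")
    case True then show ?thesis using kk b c by auto
  next
    case False
    then show ?thesis using deg b c by (intro sum.neutral) (metis mult_eq_0_iff)
  qed
  finally show "(\<Sum>e\<in>gens F. bd F b e * bd F e c) = 0" by simp
qed (fact fin)

lemma cf_eqI: "bd F b c = Poly_Mapping.single (mdeg F b - mdeg F c) k \<Longrightarrow> cf F b c = k"
  by (simp add: cf_def)

lemma scalar_map_chain_map:
  assumes F: "graded_free_complex F" and G: "graded_free_complex G" and \<phi>: "scalar_map F G \<phi>"
  shows "chain_map F G (\<lambda>b c. Poly_Mapping.single (mdeg F b - mdeg G c) (\<phi> b c))"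
  unfolding chain_map_def
proof (intro conjI ballI impI)
  fix b c assume b: "b \<in> gens F" and c: "c \<in> gens G"
  show "hdeg F b = hdeg G c" if "Poly_Mapping.single (mdeg F b - mdeg G c) (\<phi> b c) \<noteq> 0"
    using that \<phi> unfolding scalar_map_def by (metis single_zero)
  show "t + mdeg G c = mdeg F b"
    if "t \<in> Poly_Mapping.keys (Poly_Mapping.single (mdeg F b - mdeg G c) (\<phi> b c))" for t
    using that \<phi> mon_diff_add unfolding scalar_map_def by (auto split: if_splits)
  have "(\<Sum>e\<in>gens F. bd F b e * Poly_Mapping.single (mdeg F e - mdeg G c) (\<phi> e c)) =
     (\<Sum>e\<in>gens F. Poly_Mapping.single (mdeg F b - mdeg F e) (cf F b e) * Poly_Mapping.single (mdeg F e - mdeg G c) (\<phi> e c))"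
    by (intro sum.cong) (use graded_cf[OF F] b in auto)
  also have "\<dots> = Poly_Mapping.single (mdeg F b - mdeg G c) (\<Sum>e\<in>gens F. cf F b e * \<phi> e c)"
    by (rule sum_single_mult) (use graded_cf_nonzero[OF F] b \<phi> in \<open>auto simp: scalar_map_def\<close>)
  also have "(\<Sum>e\<in>gens F. cf F b e * \<phi> e c) = (\<Sum>e\<in>gens G. \<phi> b e * cf G e c)"
    using \<phi> b c by (auto simp: scalar_map_def)
  also have "Poly_Mapping.single (mdeg F b - mdeg G c) \<dots> =
    (\<Sum>e\<in>gens G. Poly_Mapping.single (mdeg F b - mdeg G e) (\<phi> b e) * Poly_Mapping.single (mdeg G e - mdeg G c) (cf G e c))"
    by (rule sum_single_mult[symmetric]) (use graded_cf_nonzero[OF G] c \<phi> in \<open>auto simp: scalar_map_def\<close>)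
  also have "\<dots> = (\<Sum>e\<in>gens G. Poly_Mapping.single (mdeg F b - mdeg G e) (\<phi> b e) * bd G e c)"
    by (intro sum.cong) (use graded_cf[OF G] c in auto)
  finally show "(\<Sum>e\<in>gens F. bd F b e * Poly_Mapping.single (mdeg F e - mdeg G c) (\<phi> e c)) =
    (\<Sum>e\<in>gens G. Poly_Mapping.single (mdeg F b - mdeg G e) (\<phi> b e) * bd G e c)" .
qed

lemma scalar_map_inverse:
  assumes "scalar_map F G \<phi>" "scalar_map G F \<psi>" "(\<Sum>c\<in>gens G. \<phi> b c * \<psi> c b') = (if b = b' then 1 else 0)"
  shows "(\<Sum>c\<in>gens G. Poly_Mapping.single (mdeg F b - mdeg G c) (\<phi> b c) * Poly_Mapping.single (mdeg G c - mdeg F b') (\<psi> c b'))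
     = (if b = b' then 1 else 0)"
proof -
  have "(\<Sum>c\<in>gens G. Poly_Mapping.single (mdeg F b - mdeg G c) (\<phi> b c) * Poly_Mapping.single (mdeg G c - mdeg F b') (\<psi> c b'))
      = Poly_Mapping.single (mdeg F b - mdeg F b') (if b = b' then 1 else 0)"
    unfolding assms(3)[symmetric] by (rule sum_single_mult) (use assms in \<open>auto simp: scalar_map_def\<close>)
  then show ?thesis by simp
qed

text \<open>The map is built degree by degree from exactness of the strands of G, starting with the
  prescribed scalars \<open>f\<close> in degree 0. The assumption on \<open>f\<close> takes care of
  the multidegrees outside \<open>S\<close>, where G need not be exact in degree 0.\<close>

lemma comparison_map:
  fixes F :: "('b, 'n::finite, 'k::field) free_complex" and G :: "('c, 'n, 'k) free_complex"
  assumes F: "graded_free_complex F" and G: "resolves S z G"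
    and f: "\<And>b. b \<in> gens F \<Longrightarrow> hdeg F b = 1 \<Longrightarrow> (\<Sum>c\<in>gens F. cf F b c * f c) \<noteq> 0 \<Longrightarrow> mdeg F b \<in> S"
  obtains \<phi> where "scalar_map F G \<phi>" "\<And>b. b \<in> gens F \<Longrightarrow> hdeg F b = 0 \<Longrightarrow> \<phi> b z = f b"
proof -
  have gG: "graded_free_complex G" and z: "z \<in> gens G" "hdeg G z = 0" "mdeg G z = 0"
    and z1: "\<And>b. b \<in> gens G \<Longrightarrow> hdeg G b = 0 \<Longrightarrow> b = z"
    and ex: "\<And>i \<alpha>. 0 < i \<or> \<alpha> \<in> S \<Longrightarrow> exact_at G i \<alpha>"
    using G by (auto simp: resolves_def)
  define good where "good \<phi> n \<longleftrightarrow>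
      (\<forall>b c. \<phi> b c \<noteq> 0 \<longrightarrow> b \<in> gens F \<and> c \<in> gens G \<and> hdeg F b = hdeg G c \<and> mdeg G c \<le> mdeg F b) \<and>
      (\<forall>b\<in>gens F. hdeg F b = 0 \<longrightarrow> \<phi> b z = f b) \<and>
      (\<forall>b\<in>gens F. hdeg F b \<le> n \<longrightarrow> (\<forall>e\<in>gens G. (\<Sum>c\<in>gens F. cf F b c * \<phi> c e) = (\<Sum>c\<in>gens G. \<phi> b c * cf G c e)))"
    for \<phi> :: "'b \<Rightarrow> 'c \<Rightarrow> 'k" and n
  have "\<exists>\<phi>. good \<phi> n" for n
  proof (induction n)
    case 0
    define \<phi> where "\<phi> b c = (if b \<in> gens F \<and> hdeg F b = 0 \<and> c = z then f b else 0)" for b c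
    have "(\<Sum>c\<in>gens F. cf F b c * \<phi> c e) = (\<Sum>c\<in>gens G. \<phi> b c * cf G c e)"
      if "b \<in> gens F" "hdeg F b = 0" "e \<in> gens G" for b e
    proof -
      have "cf F b c = 0" if "c \<in> gens F" for c
        using graded_cf_nonzero(1)[OF F \<open>b \<in> gens F\<close> that] \<open>hdeg F b = 0\<close> by (cases "cf F b c = 0") auto
      then have "(\<Sum>c\<in>gens F. cf F b c * \<phi> c e) = 0" by (intro sum.neutral) auto
      moreover have "cf G z e = 0"
        using graded_cf_nonzero(1)[OF gG z(1) \<open>e \<in> gens G\<close>] z(2) by (cases "cf G z e = 0") auto
      then have "(\<Sum>c\<in>gens G. \<phi> b c * cf G c e) = 0" by (intro sum.neutral) (auto simp: \<phi>_def)
      ultimately show ?thesis by simp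
    qed
    then have "good \<phi> 0" unfolding good_def using z by (auto simp: \<phi>_def le_fun_def)
    then show ?case by blast
  next
    case (Suc n)
    then obtain \<phi> where "good \<phi> n" by blast
    then have sup: "\<And>b c. \<phi> b c \<noteq> 0 \<Longrightarrow> b \<in> gens F \<and> c \<in> gens G \<and> hdeg F b = hdeg G c \<and> mdeg G c \<le> mdeg F b"
      and \<phi>0: "\<And>b. b \<in> gens F \<Longrightarrow> hdeg F b = 0 \<Longrightarrow> \<phi> b z = f b"
      and com: "\<And>b e. b \<in> gens F \<Longrightarrow> hdeg F b \<le> n \<Longrightarrow> e \<in> gens G \<Longrightarrow>
          (\<Sum>c\<in>gens F. cf F b c * \<phi> c e) = (\<Sum>c\<in>gens G. \<phi> b c * cf G c e)"
      by (auto simp: good_def)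
    define W where "W b w \<longleftrightarrow> strand G (Suc n) (mdeg F b) w \<and>
        (\<forall>e\<in>gens G. (\<Sum>c\<in>gens G. w c * cf G c e) = (\<Sum>c\<in>gens F. cf F b c * \<phi> c e))" for b w
    have step: "\<exists>w. W b w"
      if b: "b \<in> gens F" "hdeg F b = Suc n" for b
    proof -
      define v where "v e = (\<Sum>c\<in>gens F. cf F b c * \<phi> c e)" for e
      have v: "strand G n (mdeg F b) v"
        unfolding strand_def
      proof (intro allI impI)
        fix e assume "v e \<noteq> 0"
        then obtain c where c: "c \<in> gens F" "cf F b c * \<phi> c e \<noteq> 0" unfolding v_def by (rule sum_nonzeroE)
        then show "e \<in> gens G \<and> hdeg G e = n \<and> mdeg G e \<le> mdeg F b"
          using sup[of c e] graded_cf_nonzero[OF F b(1), of c] b(2) by auto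
      qed
      have cyc: "(\<Sum>e\<in>gens G. v e * cf G e g) = 0" if g: "g \<in> gens G" for g
      proof -
        have "(\<Sum>e\<in>gens G. v e * cf G e g) = (\<Sum>c\<in>gens F. cf F b c * (\<Sum>e\<in>gens G. \<phi> c e * cf G e g))"
          unfolding v_def sum_distrib_left sum_distrib_right by (subst sum.swap) (simp add: mult.assoc)
        also have "\<dots> = (\<Sum>c\<in>gens F. cf F b c * (\<Sum>e\<in>gens F. cf F c e * \<phi> e g))"
        proof (rule sum.cong, goal_cases)
          case (2 c)
          show ?case using com[of c g] graded_cf_nonzero(1)[OF F b(1), of c] b(2) g 2 by (cases "cf F b c = 0") auto
        qed simp
        also have "\<dots> = (\<Sum>e\<in>gens F. (\<Sum>c\<in>gens F. cf F b c * cf F c e) * \<phi> e g)"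
          unfolding sum_distrib_left sum_distrib_right by (subst sum.swap) (simp add: mult.assoc)
        also have "\<dots> = 0" using graded_cf_cf[OF F b(1)] by simp
        finally show ?thesis .
      qed
      show ?thesis
      proof (cases "0 < n \<or> mdeg F b \<in> S")
        case True
        then show ?thesis using ex[of n "mdeg F b"] v cyc unfolding W_def exact_at_def v_def by blast
      next
        case False
        \<comment> \<open>Here n = 0 and the multidegree lies outside \<open>S\<close>; the
          assumption on \<open>f\<close> makes the element to be lifted vanish.\<close>
        have "v e = 0" for e
        proof (rule ccontr)
          assume ne: "v e \<noteq> 0"
          then have "e = z" using v False z1 unfolding strand_def by auto
          then have "v e = (\<Sum>c\<in>gens F. cf F b c * f c)"
            unfolding v_def using \<phi>0 graded_cf_nonzero(1)[OF F b(1)] b(2) False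
            by (intro sum.cong) fastforce+
          then show False using f[of b] b False ne by auto
        qed
        then show ?thesis unfolding W_def by (intro exI[of _ "\<lambda>_. 0"]) (auto simp: strand_def simp flip: v_def)
      qed
    qed
    define w where "w b = (SOME w. W b w)" for b
    have w: "strand G (Suc n) (mdeg F b) (w b)"
      "\<And>e. e \<in> gens G \<Longrightarrow> (\<Sum>c\<in>gens G. w b c * cf G c e) = (\<Sum>c\<in>gens F. cf F b c * \<phi> c e)"
      if "b \<in> gens F" "hdeg F b = Suc n" for b
    proof -
      have "W b (w b)" unfolding w_def by (rule someI_ex[OF step[OF that]])
      then show "strand G (Suc n) (mdeg F b) (w b)"
        "\<And>e. e \<in> gens G \<Longrightarrow> (\<Sum>c\<in>gens G. w b c * cf G c e) = (\<Sum>c\<in>gens F. cf F b c * \<phi> c e)"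
        unfolding W_def by blast+
    qed
    define \<phi>' where "\<phi>' b = (if b \<in> gens F \<and> hdeg F b = Suc n then w b else \<phi> b)" for b
    have \<phi>'eq: "\<phi>' c = \<phi> c" if "hdeg F c \<noteq> Suc n" for c using that by (simp add: \<phi>'_def)
    have "(\<Sum>c\<in>gens F. cf F b c * \<phi>' c e) = (\<Sum>c\<in>gens G. \<phi>' b c * cf G c e)"
      if b: "b \<in> gens F" "hdeg F b \<le> Suc n" and e: "e \<in> gens G" for b e
    proof -
      have 1: "(\<Sum>c\<in>gens F. cf F b c * \<phi>' c e) = (\<Sum>c\<in>gens F. cf F b c * \<phi> c e)"
      proof (rule sum.cong, goal_cases)
        case (2 c)
        then show ?case using graded_cf_nonzero(1)[OF F b(1), of c] b(2) \<phi>'eq by (cases "cf F b c = 0") auto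
      qed simp
      show ?thesis
      proof (cases "hdeg F b = Suc n")
        case True
        then show ?thesis using 1 w(2)[OF b(1) True e] b by (simp add: \<phi>'_def)
      next
        case False
        then show ?thesis using 1 com[OF b(1) _ e] b \<phi>'eq[OF False] by simp
      qed
    qed
    moreover have "b \<in> gens F \<and> c \<in> gens G \<and> hdeg F b = hdeg G c \<and> mdeg G c \<le> mdeg F b" if "\<phi>' b c \<noteq> 0" for b c
      using that sup[of b c] w(1)[of b] unfolding \<phi>'_def strand_def by (auto split: if_splits)
    moreover have "\<phi>' b z = f b" if "b \<in> gens F" "hdeg F b = 0" for b
      using \<phi>0 that by (simp add: \<phi>'_def)
    ultimately have "good \<phi>' (Suc n)" unfolding good_def by blast
    then show ?case by blast
  qed
  \<comment> \<open>No basis element lies beyond the largest homological degree, so this stage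
    commutes everywhere.\<close>
  then obtain \<phi> where "good \<phi> (Max (hdeg F ` gens F))" by blast
  moreover have "hdeg F b \<le> Max (hdeg F ` gens F)" if "b \<in> gens F" for b
    using graded_finite[OF F] that by simp
  ultimately show thesis using that[of \<phi>] unfolding good_def scalar_map_def by blast
qed

text \<open>Once the homotopy is known up to degree n, the defect of the map in degree n + 1 is a
  cycle of positive homological degree, hence a boundary; a bounding chain is the next value of
  \<open>h\<close>. The start is \<open>h = 0\<close>, as \<phi> vanishes in degree 0.\<close>

lemma null_homotopy:
  fixes F :: "('b, 'n::finite, 'k::field) free_complex" and G :: "('c, 'n, 'k) free_complex"
  assumes F: "graded_free_complex F" and G: "resolves S z G" and \<phi>: "scalar_map F G \<phi>"
    and \<phi>0: "\<And>b c. hdeg F b = 0 \<Longrightarrow> \<phi> b c = 0"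
  obtains h where "\<And>b c. h b c \<noteq> 0 \<Longrightarrow> b \<in> gens F \<and> c \<in> gens G \<and> hdeg G c = Suc (hdeg F b) \<and> mdeg G c \<le> mdeg F b"
    "\<And>b e. b \<in> gens F \<Longrightarrow> e \<in> gens G \<Longrightarrow> \<phi> b e = (\<Sum>c\<in>gens G. h b c * cf G c e) + (\<Sum>c\<in>gens F. cf F b c * h c e)"
proof -
  have gG: "graded_free_complex G" and ex: "\<And>i \<alpha>. 0 < i \<Longrightarrow> exact_at G i \<alpha>"
    using G by (auto simp: resolves_def)
  have sup: "\<And>b c. \<phi> b c \<noteq> 0 \<Longrightarrow> b \<in> gens F \<and> c \<in> gens G \<and> hdeg F b = hdeg G c \<and> mdeg G c \<le> mdeg F b"
    and com: "\<And>b e. b \<in> gens F \<Longrightarrow> e \<in> gens G \<Longrightarrow>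
        (\<Sum>c\<in>gens F. cf F b c * \<phi> c e) = (\<Sum>c\<in>gens G. \<phi> b c * cf G c e)"
    using \<phi> by (auto simp: scalar_map_def)
  define good where "good h n \<longleftrightarrow>
      (\<forall>b c. h b c \<noteq> 0 \<longrightarrow> b \<in> gens F \<and> c \<in> gens G \<and> hdeg G c = Suc (hdeg F b) \<and> mdeg G c \<le> mdeg F b) \<and>
      (\<forall>b\<in>gens F. hdeg F b \<le> n \<longrightarrow> (\<forall>e\<in>gens G. \<phi> b e = (\<Sum>c\<in>gens G. h b c * cf G c e) + (\<Sum>c\<in>gens F. cf F b c * h c e)))"
    for h :: "'b \<Rightarrow> 'c \<Rightarrow> 'k" and n
  have "\<exists>h. good h n" for n
  proof (induction n)
    case 0
    have "good (\<lambda>_ _. 0) 0" using \<phi>0 by (auto simp: good_def)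
    then show ?case by blast
  next
    case (Suc n)
    then obtain h where "good h n" by blast
    then have hsup: "\<And>b c. h b c \<noteq> 0 \<Longrightarrow> b \<in> gens F \<and> c \<in> gens G \<and> hdeg G c = Suc (hdeg F b) \<and> mdeg G c \<le> mdeg F b"
      and heq: "\<And>b e. b \<in> gens F \<Longrightarrow> hdeg F b \<le> n \<Longrightarrow> e \<in> gens G \<Longrightarrow>
          \<phi> b e = (\<Sum>c\<in>gens G. h b c * cf G c e) + (\<Sum>c\<in>gens F. cf F b c * h c e)"
      by (auto simp: good_def)
    define W where "W b w \<longleftrightarrow> strand G (Suc (Suc n)) (mdeg F b) w \<and>
        (\<forall>e\<in>gens G. (\<Sum>c\<in>gens G. w c * cf G c e) = \<phi> b e - (\<Sum>c\<in>gens F. cf F b c * h c e))" for b w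
    have step: "\<exists>w. W b w"
      if b: "b \<in> gens F" "hdeg F b = Suc n" for b
    proof -
      define v where "v e = \<phi> b e - (\<Sum>c\<in>gens F. cf F b c * h c e)" for e
      have v: "strand G (Suc n) (mdeg F b) v"
        unfolding strand_def
      proof (intro allI impI)
        fix e assume ne: "v e \<noteq> 0"
        show "e \<in> gens G \<and> hdeg G e = Suc n \<and> mdeg G e \<le> mdeg F b"
        proof (cases "\<phi> b e = 0")
          case True
          then have "(\<Sum>c\<in>gens F. cf F b c * h c e) \<noteq> 0" using ne by (simp add: v_def)
          then obtain c where c: "c \<in> gens F" "cf F b c * h c e \<noteq> 0" by (rule sum_nonzeroE)
          then show ?thesis using hsup[of c e] graded_cf_nonzero[OF F b(1), of c] b(2) by auto
        next
          case False then show ?thesis using sup[of b e] b by auto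
        qed
      qed
      have cyc: "(\<Sum>e\<in>gens G. v e * cf G e g) = 0" if g: "g \<in> gens G" for g
      proof -
        have "(\<Sum>e\<in>gens G. (\<Sum>c\<in>gens F. cf F b c * h c e) * cf G e g)
            = (\<Sum>c\<in>gens F. cf F b c * (\<Sum>e\<in>gens G. h c e * cf G e g))"
          unfolding sum_distrib_left sum_distrib_right by (subst sum.swap) (simp add: mult.assoc)
        also have "\<dots> = (\<Sum>c\<in>gens F. cf F b c * (\<phi> c g - (\<Sum>e\<in>gens F. cf F c e * h e g)))"
        proof (rule sum.cong, goal_cases)
          case (2 c)
          show ?case using heq[of c g] graded_cf_nonzero(1)[OF F b(1), of c] b(2) g 2 by (cases "cf F b c = 0") auto
        qed simp
        also have "\<dots> = (\<Sum>c\<in>gens F. cf F b c * \<phi> c g) - (\<Sum>c\<in>gens F. cf F b c * (\<Sum>e\<in>gens F. cf F c e * h e g))"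
          by (simp add: right_diff_distrib sum_subtractf)
        also have "(\<Sum>c\<in>gens F. cf F b c * (\<Sum>e\<in>gens F. cf F c e * h e g)) = (\<Sum>e\<in>gens F. (\<Sum>c\<in>gens F. cf F b c * cf F c e) * h e g)"
          unfolding sum_distrib_left sum_distrib_right by (subst sum.swap) (simp add: mult.assoc)
        also have "\<dots> = 0" using graded_cf_cf[OF F b(1)] by simp
        finally show ?thesis using com[OF b(1) g] by (simp add: v_def left_diff_distrib sum_subtractf)
      qed
      show ?thesis using ex[of "Suc n" "mdeg F b"] v cyc unfolding W_def exact_at_def v_def by blast
    qed
    define w where "w b = (SOME w. W b w)" for b
    have w: "strand G (Suc (Suc n)) (mdeg F b) (w b)"
      "\<And>e. e \<in> gens G \<Longrightarrow> (\<Sum>c\<in>gens G. w b c * cf G c e) = \<phi> b e - (\<Sum>c\<in>gens F. cf F b c * h c e)"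
      if "b \<in> gens F" "hdeg F b = Suc n" for b
    proof -
      have "W b (w b)" unfolding w_def by (rule someI_ex[OF step[OF that]])
      then show "strand G (Suc (Suc n)) (mdeg F b) (w b)"
        "\<And>e. e \<in> gens G \<Longrightarrow> (\<Sum>c\<in>gens G. w b c * cf G c e) = \<phi> b e - (\<Sum>c\<in>gens F. cf F b c * h c e)"
        unfolding W_def by blast+
    qed
    define h' where "h' b = (if b \<in> gens F \<and> hdeg F b = Suc n then w b else h b)" for b
    have h'eq: "h' c = h c" if "hdeg F c \<noteq> Suc n" for c using that by (simp add: h'_def)
    have "\<phi> b e = (\<Sum>c\<in>gens G. h' b c * cf G c e) + (\<Sum>c\<in>gens F. cf F b c * h' c e)"
      if b: "b \<in> gens F" "hdeg F b \<le> Suc n" and e: "e \<in> gens G" for b e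
    proof -
      have 1: "(\<Sum>c\<in>gens F. cf F b c * h' c e) = (\<Sum>c\<in>gens F. cf F b c * h c e)"
      proof (rule sum.cong, goal_cases)
        case (2 c)
        then show ?case using graded_cf_nonzero(1)[OF F b(1), of c] b(2) h'eq by (cases "cf F b c = 0") auto
      qed simp
      show ?thesis
      proof (cases "hdeg F b = Suc n")
        case True
        then show ?thesis using 1 w(2)[OF b(1) True e] b by (simp add: h'_def)
      next
        case False
        then show ?thesis using 1 heq[OF b(1) _ e] b h'eq[OF False] by simp
      qed
    qed
    moreover have "b \<in> gens F \<and> c \<in> gens G \<and> hdeg G c = Suc (hdeg F b) \<and> mdeg G c \<le> mdeg F b" if "h' b c \<noteq> 0" for b c
      using that hsup[of b c] w(1)[of b] unfolding h'_def strand_def by (auto split: if_splits)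
    ultimately have "good h' (Suc n)" unfolding good_def by blast
    then show ?case by blast
  qed
  then obtain h where "good h (Max (hdeg F ` gens F))" by blast
  moreover have "hdeg F b \<le> Max (hdeg F ` gens F)" if "b \<in> gens F" for b
    using graded_finite[OF F] that by simp
  ultimately show thesis using that[of h] unfolding good_def by blast
qed

section \<open>Uniqueness of unit-free resolutions\<close>

definition mat_comp :: "('b, 'n::finite, 'k::field) free_complex \<Rightarrow> ('a \<Rightarrow> 'b \<Rightarrow> 'k) \<Rightarrow> ('b \<Rightarrow> 'c \<Rightarrow> 'k) \<Rightarrow> 'a \<Rightarrow> 'c \<Rightarrow> 'k" where
  "mat_comp G \<phi> \<chi> b e = (\<Sum>c\<in>gens G. \<phi> b c * \<chi> c e)"

lemma scalar_map_comp:
  assumes \<phi>: "scalar_map F G \<phi>" and \<chi>: "scalar_map G H \<chi>"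
  shows "scalar_map F H (mat_comp G \<phi> \<chi>)"
proof -
  have "b \<in> gens F \<and> e \<in> gens H \<and> hdeg F b = hdeg H e \<and> mdeg H e \<le> mdeg F b" if "mat_comp G \<phi> \<chi> b e \<noteq> 0" for b e
  proof -
    obtain c where "\<phi> b c * \<chi> c e \<noteq> 0" using \<open>mat_comp G \<phi> \<chi> b e \<noteq> 0\<close> unfolding mat_comp_def by (rule sum_nonzeroE)
    then have "\<phi> b c \<noteq> 0" "\<chi> c e \<noteq> 0" by auto
    then have "b \<in> gens F \<and> c \<in> gens G \<and> hdeg F b = hdeg G c \<and> mdeg G c \<le> mdeg F b"
      "c \<in> gens G \<and> e \<in> gens H \<and> hdeg G c = hdeg H e \<and> mdeg H e \<le> mdeg G c"
      using \<phi> \<chi> unfolding scalar_map_def by blast+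
    then show ?thesis by (auto intro: order_trans)
  qed
  moreover have "(\<Sum>c\<in>gens F. cf F b c * mat_comp G \<phi> \<chi> c e) = (\<Sum>c\<in>gens H. mat_comp G \<phi> \<chi> b c * cf H c e)"
    if "b \<in> gens F" "e \<in> gens H" for b e
  proof -
    have "(\<Sum>c\<in>gens F. cf F b c * mat_comp G \<phi> \<chi> c e) = (\<Sum>g\<in>gens G. (\<Sum>c\<in>gens F. cf F b c * \<phi> c g) * \<chi> g e)"
      unfolding mat_comp_def sum_distrib_left sum_distrib_right by (subst sum.swap) (simp add: mult.assoc)
    also have "\<dots> = (\<Sum>g\<in>gens G. (\<Sum>c\<in>gens G. \<phi> b c * cf G c g) * \<chi> g e)"
      using \<phi> that by (intro sum.cong) (auto simp: scalar_map_def)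
    also have "\<dots> = (\<Sum>c\<in>gens G. \<phi> b c * (\<Sum>g\<in>gens G. cf G c g * \<chi> g e))"
      unfolding sum_distrib_left sum_distrib_right by (subst sum.swap) (simp add: mult.assoc)
    also have "\<dots> = (\<Sum>c\<in>gens G. \<phi> b c * (\<Sum>g\<in>gens H. \<chi> c g * cf H g e))"
      using \<chi> that by (intro sum.cong) (auto simp: scalar_map_def)
    also have "\<dots> = (\<Sum>c\<in>gens H. mat_comp G \<phi> \<chi> b c * cf H c e)"
      unfolding mat_comp_def sum_distrib_left sum_distrib_right by (subst sum.swap) (simp add: mult.assoc)
    finally show ?thesis .
  qed
  ultimately show ?thesis unfolding scalar_map_def by blast
qed

text \<open>The difference of \<theta> and the identity is null-homotopic, so each of its entries is
  a sum of products of the homotopy with the differential. Between equal multidegrees a nonzero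
  product would have as a factor an entry of the differential between equal multidegrees, that is, a
  unit.\<close>

lemma unitfree_endo_diagonal:
  assumes F: "resolves S z F" "unitfree F" and \<theta>: "scalar_map F F \<theta>" "\<theta> z z = 1"
    and bc: "b \<in> gens F" "c \<in> gens F" "mdeg F b = mdeg F c"
  shows "\<theta> b c = (if b = c then 1 else 0)"
proof -
  have gF: "graded_free_complex F" and z: "z \<in> gens F" "hdeg F z = 0"
    and z1: "\<And>b. b \<in> gens F \<Longrightarrow> hdeg F b = 0 \<Longrightarrow> b = z"
    using F by (auto simp: resolves_def)
  have fin: "finite (gens F)" using gF by (rule graded_finite)
  have sup: "\<And>b c. \<theta> b c \<noteq> 0 \<Longrightarrow> b \<in> gens F \<and> c \<in> gens F \<and> hdeg F b = hdeg F c \<and> mdeg F c \<le> mdeg F b"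
    using \<theta> by (auto simp: scalar_map_def)
  define \<phi> where "\<phi> b c = \<theta> b c - (if b = c \<and> b \<in> gens F then 1 else 0)" for b c
  have \<phi>sup: "b \<in> gens F \<and> e \<in> gens F \<and> hdeg F b = hdeg F e \<and> mdeg F e \<le> mdeg F b" if "\<phi> b e \<noteq> 0" for b e
    using that sup[of b e] unfolding \<phi>_def by (cases "\<theta> b e = 0") (auto split: if_splits)
  have \<phi>com: "(\<Sum>c\<in>gens F. cf F b c * \<phi> c e) = (\<Sum>c\<in>gens F. \<phi> b c * cf F c e)"
    if be: "b \<in> gens F" "e \<in> gens F" for b e
  proof -
    have "(\<Sum>c\<in>gens F. cf F b c * \<phi> c e) = (\<Sum>c\<in>gens F. cf F b c * \<theta> c e) - (\<Sum>c\<in>gens F. if c = e then cf F b c else 0)"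
      unfolding sum_subtractf[symmetric] by (rule sum.cong) (auto simp: \<phi>_def algebra_simps)
    also have "\<dots> = (\<Sum>c\<in>gens F. \<theta> b c * cf F c e) - (\<Sum>c\<in>gens F. if c = b then cf F c e else 0)"
      using \<theta>(1) be fin by (simp add: scalar_map_def)
    also have "\<dots> = (\<Sum>c\<in>gens F. \<phi> b c * cf F c e)"
      unfolding sum_subtractf[symmetric] by (rule sum.cong) (use be in \<open>auto simp: \<phi>_def algebra_simps\<close>)
    finally show ?thesis .
  qed
  have \<phi>: "scalar_map F F \<phi>" unfolding scalar_map_def using \<phi>sup \<phi>com by blast
  have \<phi>0: "\<phi> b c = 0" if "hdeg F b = 0" for b c
  proof (rule ccontr)
    assume ne: "\<phi> b c \<noteq> 0"
    then have "b = z" "c = z" using \<phi> that z1 by (auto simp: scalar_map_def)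
    then show False using ne \<theta>(2) z by (simp add: \<phi>_def)
  qed
  obtain h where h: "\<And>b c. h b c \<noteq> 0 \<Longrightarrow> b \<in> gens F \<and> c \<in> gens F \<and> hdeg F c = Suc (hdeg F b) \<and> mdeg F c \<le> mdeg F b"
    "\<And>b e. b \<in> gens F \<Longrightarrow> e \<in> gens F \<Longrightarrow> \<phi> b e = (\<Sum>c\<in>gens F. h b c * cf F c e) + (\<Sum>c\<in>gens F. cf F b c * h c e)"
    using null_homotopy[OF gF F(1) \<phi> \<phi>0] by blast
  have "h b d * cf F d c = 0" "cf F b d * h d c = 0" if d: "d \<in> gens F" for d
  proof -
    show "h b d * cf F d c = 0"
    proof (rule ccontr)
      assume "h b d * cf F d c \<noteq> 0"
      then have "h b d \<noteq> 0" "cf F d c \<noteq> 0" by auto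
      then show False
        using h(1)[of b d] graded_cf_nonzero(2)[OF gF d bc(2)] bc d F(2) unfolding unitfree_def by (metis order_antisym)
    qed
    show "cf F b d * h d c = 0"
    proof (rule ccontr)
      assume "cf F b d * h d c \<noteq> 0"
      then have "h d c \<noteq> 0" "cf F b d \<noteq> 0" by auto
      then show False
        using h(1)[of d c] graded_cf_nonzero(2)[OF gF bc(1) d] bc d F(2) unfolding unitfree_def by (metis order_antisym)
    qed
  qed
  then have "\<phi> b c = 0" unfolding h(2)[OF bc(1,2)] by (simp only: sum.neutral_const add_0 cong: sum.cong)
  then show ?thesis using bc by (auto simp: \<phi>_def split: if_splits)
qed

lemma resolves_comparison:
  assumes "resolves S z F" "resolves S y G"
  obtains \<phi> where "scalar_map F G \<phi>" "\<phi> z y = 1"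
proof -
  have F: "graded_free_complex F" "z \<in> gens F" "hdeg F z = 0"
    "\<And>b. b \<in> gens F \<Longrightarrow> hdeg F b = 0 \<Longrightarrow> b = z"
    and S: "\<And>b. b \<in> gens F \<Longrightarrow> cf F b z \<noteq> 0 \<Longrightarrow> mdeg F b \<in> S"
    using assms(1) by (auto simp: resolves_def)
  have "mdeg F b \<in> S" if b: "b \<in> gens F" "hdeg F b = 1" and ne: "(\<Sum>c\<in>gens F. cf F b c * 1) \<noteq> 0" for b
  proof -
    obtain c where "c \<in> gens F" "cf F b c * 1 \<noteq> 0" using ne by (rule sum_nonzeroE)
    then show ?thesis using F(4)[of c] graded_cf_nonzero(1)[OF F(1) b(1)] b(2) S[OF b(1)] by fastforce
  qed
  from comparison_map[OF F(1) assms(2), of "\<lambda>_. 1", OF this]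
  show thesis using that F by metis
qed

lemma comparison_comp_unit:
  assumes "resolves S z F" "resolves S y G" "scalar_map F G \<phi>" "\<phi> z y = 1" "scalar_map G F \<chi>" "\<chi> y z = 1"
  shows "mat_comp G \<phi> \<chi> z z = 1"
proof -
  have y: "y \<in> gens G" "\<And>b. b \<in> gens G \<Longrightarrow> hdeg G b = 0 \<Longrightarrow> b = y" "finite (gens G)" and z: "hdeg F z = 0"
    using assms(1,2) graded_finite by (auto simp: resolves_def)
  have "\<phi> z c * \<chi> c z = (if c = y then 1 else 0)" if "c \<in> gens G" for c
  proof (cases "c = y")
    case False
    then have "hdeg G c \<noteq> 0" using y that by blast
    then have "\<phi> z c = 0" using assms(3) z unfolding scalar_map_def by metis
    then show ?thesis using False by simp
  qed (use assms in auto)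
  then have "mat_comp G \<phi> \<chi> z z = (\<Sum>c\<in>gens G. if c = y then 1 else 0)" unfolding mat_comp_def by (intro sum.cong) auto
  then show ?thesis using y by simp
qed

text \<open>Map F to G and back. On the block of fixed homological degree and multidegree the
  composite is the identity, and all intermediate basis elements lie in the same block of G; so this
  block of \<phi> is injective.\<close>

lemma unitfree_card_le:
  fixes F :: "('b, 'n::finite, 'k::field) free_complex" and G :: "('c, 'n, 'k) free_complex"
  assumes F: "resolves S z F" "unitfree F" and G: "resolves S y G"
  shows "card {b \<in> gens F. hdeg F b = i \<and> mdeg F b = \<alpha>} \<le> card {b \<in> gens G. hdeg G b = i \<and> mdeg G b = \<alpha>}"
    (is "card ?X \<le> card ?Y")
proof -
  obtain \<phi> where \<phi>: "scalar_map F G \<phi>" "\<phi> z y = 1" using resolves_comparison[OF F(1) G] .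
  obtain \<chi> where \<chi>: "scalar_map G F \<chi>" "\<chi> y z = 1" using resolves_comparison[OF G F(1)] .
  have \<theta>: "scalar_map F F (mat_comp G \<phi> \<chi>)" "mat_comp G \<phi> \<chi> z z = 1"
    using scalar_map_comp \<phi> \<chi> comparison_comp_unit[OF F(1) G \<phi> \<chi>] by auto
  have fin: "finite (gens F)" "finite (gens G)" using F G graded_finite by (auto simp: resolves_def)
  have block: "(\<Sum>c\<in>?Y. \<phi> b c * \<chi> c e) = (if b = e then 1 else 0)" if b: "b \<in> ?X" and e: "e \<in> ?X" for b e
  proof -
    have "(\<Sum>c\<in>?Y. \<phi> b c * \<chi> c e) = mat_comp G \<phi> \<chi> b e"
      unfolding mat_comp_def
    proof (rule sum.mono_neutral_left)
      show "\<forall>c\<in>gens G - ?Y. \<phi> b c * \<chi> c e = 0"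
      proof (intro ballI, rule ccontr)
        fix c assume c: "c \<in> gens G - ?Y" "\<phi> b c * \<chi> c e \<noteq> 0"
        then have "\<phi> b c \<noteq> 0" "\<chi> c e \<noteq> 0" by auto
        then have "hdeg F b = hdeg G c" "mdeg G c \<le> mdeg F b" "mdeg F e \<le> mdeg G c"
          using \<phi>(1) \<chi>(1) by (auto simp: scalar_map_def)
        then show False using b e c(1) by auto
      qed
    qed (use fin in auto)
    also have "\<dots> = (if b = e then 1 else 0)"
      using unitfree_endo_diagonal[OF F \<theta>] b e by simp
    finally show ?thesis .
  qed
  show ?thesis
  proof (rule injective_imp_card_le[of _ _ \<phi>])
    fix v assume v: "\<And>x. v x \<noteq> 0 \<Longrightarrow> x \<in> ?X" "\<And>c. c \<in> ?Y \<Longrightarrow> (\<Sum>b\<in>?X. v b * \<phi> b c) = 0"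
    have "v e = 0" if e: "e \<in> ?X" for e
    proof -
      have "0 = (\<Sum>c\<in>?Y. (\<Sum>b\<in>?X. v b * \<phi> b c) * \<chi> c e)" using v(2) by simp
      also have "\<dots> = (\<Sum>b\<in>?X. v b * (\<Sum>c\<in>?Y. \<phi> b c * \<chi> c e))"
        unfolding sum_distrib_left sum_distrib_right by (subst sum.swap) (simp add: mult.assoc)
      also have "\<dots> = (\<Sum>b\<in>?X. if b = e then v b else 0)"
        by (intro sum.cong refl) (use block e in auto)
      also have "\<dots> = v e" using e fin by simp
      finally show ?thesis by simp
    qed
    then show "\<forall>x. v x = 0" using v(1) by blast
  qed (use fin in auto)
qed

lemma unitfree_card_eq:
  fixes F :: "('b, 'n::finite, 'k::field) free_complex" and G :: "('c, 'n, 'k) free_complex"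
  assumes "resolves S z F" "unitfree F" "resolves S y G" "unitfree G"
  shows "card {b \<in> gens F. hdeg F b = i \<and> mdeg F b = \<alpha>} = card {b \<in> gens G. hdeg G b = i \<and> mdeg G b = \<alpha>}"
  using unitfree_card_le[of S z F y G i \<alpha>] unitfree_card_le[of S y G z F i \<alpha>] assms by simp

lemma card_filter_fibers_le:
  assumes "finite A" "finite B" "\<And>k. card {a \<in> A. f a = k} \<le> card {b \<in> B. g b = k}"
  shows "card {a \<in> A. Q (f a)} \<le> card {b \<in> B. Q (g b)}"
proof -
  define K where "K = {k \<in> f ` A \<union> g ` B. Q k}"
  have "finite K" using assms by (auto simp: K_def)
  have "card {a \<in> A. Q (f a)} = card (\<Union>k\<in>K. {a \<in> A. f a = k})"
    by (rule arg_cong[where f = card]) (auto simp: K_def)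
  also have "\<dots> = (\<Sum>k\<in>K. card {a \<in> A. f a = k})" using assms \<open>finite K\<close> by (intro card_UN_disjoint) auto
  also have "\<dots> \<le> (\<Sum>k\<in>K. card {b \<in> B. g b = k})" by (intro sum_mono assms)
  also have "\<dots> = card (\<Union>k\<in>K. {b \<in> B. g b = k})" using assms \<open>finite K\<close> by (intro card_UN_disjoint[symmetric]) auto
  also have "\<dots> = card {b \<in> B. Q (g b)}"
    by (rule arg_cong[where f = card]) (auto simp: K_def)
  finally show ?thesis .
qed

text \<open>The inequality holds for \<open>Q\<close> and for its complement, and since
  \<open>B\<close> is no larger than \<open>A\<close> in total, neither can be strict.\<close>

lemma card_filter_fibers_eq:
  assumes fin: "finite A" "finite B" and le: "\<And>k. card {a \<in> A. f a = k} \<le> card {b \<in> B. g b = k}" and "card B \<le> card A"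
  shows "card {a \<in> A. Q (f a)} = card {b \<in> B. Q (g b)}"
proof -
  have split: "card A = card {a \<in> A. Q (f a)} + card {a \<in> A. \<not> Q (f a)}" "card B = card {b \<in> B. Q (g b)} + card {b \<in> B. \<not> Q (g b)}"
    by (subst card_Un_disjoint[symmetric]; use fin in \<open>auto intro!: arg_cong[where f = card]\<close>)+
  show ?thesis
    using split card_filter_fibers_le[OF fin le, of Q] card_filter_fibers_le[OF fin le, of "\<lambda>k. \<not> Q k"] assms(4)
    by linarith
qed

text \<open>Composing with a map back shows that \<phi> is injective on strands: the composite is
  unitriangular with respect to multidegrees. The bound on the number of generators of G makes the
  strands of F and G equidimensional, so \<phi> can be inverted strand by strand.\<close>

theorem resolves_complex_iso:
  fixes F :: "('b, 'n::finite, 'k::field) free_complex" and G :: "('c, 'n, 'k) free_complex"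
  assumes F: "resolves S z F" "unitfree F" and G: "resolves S y G" and card: "card (gens G) \<le> card (gens F)"
  shows "complex_iso F G"
proof -
  obtain \<phi> where \<phi>: "scalar_map F G \<phi>" "\<phi> z y = 1" using resolves_comparison[OF F(1) G] .
  obtain \<chi> where \<chi>: "scalar_map G F \<chi>" "\<chi> y z = 1" using resolves_comparison[OF G F(1)] .
  define \<theta> where "\<theta> = mat_comp G \<phi> \<chi>"
  have \<theta>: "scalar_map F F \<theta>" "\<theta> z z = 1"
    using scalar_map_comp \<phi> \<chi> comparison_comp_unit[OF F(1) G \<phi> \<chi>] by (auto simp: \<theta>_def)
  have gr: "graded_free_complex F" "graded_free_complex G" using F G by (auto simp: resolves_def)
  have fin: "finite (gens F)" "finite (gens G)" using gr graded_finite by auto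
  have sup: "b \<in> gens F \<and> c \<in> gens G \<and> hdeg F b = hdeg G c \<and> mdeg G c \<le> mdeg F b" if "\<phi> b c \<noteq> 0" for b c
    using \<phi>(1) that by (auto simp: scalar_map_def)
  have inj: "v b = 0"
    if v: "\<And>b. v b \<noteq> 0 \<Longrightarrow> b \<in> gens F" "\<And>c. c \<in> gens G \<Longrightarrow> (\<Sum>b\<in>gens F. v b * \<phi> b c) = 0" for v b
  proof (rule ccontr)
    assume "v b \<noteq> 0"
    define U where "U = {b. v b \<noteq> 0}"
    have U: "U \<subseteq> gens F" "finite U" "b \<in> U" using v(1) fin \<open>v b \<noteq> 0\<close> finite_subset[of U "gens F"] by (auto simp: U_def)
    \<comment> \<open>At a maximal multidegree of the support of v the unitriangular composite
      returns the coefficient of v itself.\<close>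
    obtain \<mu> where \<mu>: "\<mu> \<in> mdeg F ` U" "\<And>\<nu>. \<nu> \<in> mdeg F ` U \<Longrightarrow> \<mu> \<le> \<nu> \<Longrightarrow> \<mu> = \<nu>"
      using finite_has_maximal[of "mdeg F ` U"] U by auto
    then obtain e where e: "e \<in> U" "mdeg F e = \<mu>" by auto
    have "0 = (\<Sum>c\<in>gens G. (\<Sum>b\<in>gens F. v b * \<phi> b c) * \<chi> c e)" using v(2) by simp
    also have "\<dots> = (\<Sum>b\<in>gens F. v b * \<theta> b e)"
      unfolding \<theta>_def mat_comp_def sum_distrib_left sum_distrib_right by (subst sum.swap) (simp add: mult.assoc)
    also have "\<dots> = (\<Sum>b\<in>gens F. if b = e then v e else 0)"
    proof (rule sum.cong, goal_cases)
      case (2 b)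
      show ?case
      proof (cases "v b = 0 \<or> \<theta> b e = 0")
        case True
        then show ?thesis using unitfree_endo_diagonal[OF F \<theta>, of e e] e U(1) by (cases "b = e") auto
      next
        case False
        then have "mdeg F e \<le> mdeg F b" using \<theta>(1) by (auto simp: scalar_map_def)
        then have "mdeg F e = mdeg F b" using \<mu>(2)[of "mdeg F b"] e False by (auto simp: U_def)
        then show ?thesis using unitfree_endo_diagonal[OF F \<theta>, of b e] 2 e U(1) by auto
      qed
    qed simp
    also have "\<dots> = v e" using e U fin by auto
    finally show False using e by (simp add: U_def)
  qed
  \<comment> \<open>In each degree F has at most as many generators as G; the reverse bound on the
    totals makes all these counts equal.\<close>
  have cards: "card {b \<in> gens F. Q (hdeg F b, mdeg F b)} = card {b \<in> gens G. Q (hdeg G b, mdeg G b)}" for Q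
  proof (rule card_filter_fibers_eq[OF fin _ card, where f = "\<lambda>b. (hdeg F b, mdeg F b)" and g = "\<lambda>b. (hdeg G b, mdeg G b)"])
    fix k :: "nat \<times> 'n mon"
    show "card {b \<in> gens F. (hdeg F b, mdeg F b) = k} \<le> card {b \<in> gens G. (hdeg G b, mdeg G b) = k}"
      using unitfree_card_le[OF F G, of "fst k" "snd k"] by (cases k) simp
  qed
  define P where "P c u \<longleftrightarrow> (\<forall>b. u b \<noteq> 0 \<longrightarrow> b \<in> gens F \<and> hdeg F b = hdeg G c \<and> mdeg F b \<le> mdeg G c) \<and>
      (\<forall>e\<in>gens G. (\<Sum>b\<in>gens F. u b * \<phi> b e) = (if e = c then 1 else 0))" for c u
  \<comment> \<open>A preimage of the basis element c, found in the strand at its own multidegree,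
    where injectivity implies surjectivity.\<close>
  have ex: "\<exists>u. P c u" if c: "c \<in> gens G" for c
  proof -
    define X where "X = {b \<in> gens F. hdeg F b = hdeg G c \<and> mdeg F b \<le> mdeg G c}"
    define Y where "Y = {b \<in> gens G. hdeg G b = hdeg G c \<and> mdeg G b \<le> mdeg G c}"
    have fXY: "finite X" "finite Y" using fin by (auto simp: X_def Y_def)
    have cXY: "card Y \<le> card X" using cards[of "\<lambda>(i, m). i = hdeg G c \<and> m \<le> mdeg G c"] by (simp add: X_def Y_def)
    have restr: "(\<Sum>b\<in>gens F. v b * \<phi> b e) = (\<Sum>b\<in>X. v b * \<phi> b e)" if "\<And>b. v b \<noteq> 0 \<Longrightarrow> b \<in> X" for v e
      by (rule sum.mono_neutral_right) (use that fin in \<open>auto simp: X_def\<close>)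
    have outside: "\<phi> b e = 0" if "b \<in> X" "e \<in> gens G" "e \<notin> Y" for b e
      using sup[of b e] that order_trans unfolding X_def Y_def by fastforce
    obtain u where u: "\<And>b. u b \<noteq> 0 \<Longrightarrow> b \<in> X" "\<And>e. e \<in> Y \<Longrightarrow> (\<Sum>b\<in>X. u b * \<phi> b e) = (if e = c then 1 else 0)"
    proof (rule injective_imp_surjective[OF fXY cXY, of \<phi> "\<lambda>e. if e = c then 1 else 0"])
      fix v assume v: "\<And>x. v x \<noteq> 0 \<Longrightarrow> x \<in> X" "\<And>e. e \<in> Y \<Longrightarrow> (\<Sum>x\<in>X. v x * \<phi> x e) = 0"
      have "(\<Sum>b\<in>gens F. v b * \<phi> b e) = 0" if "e \<in> gens G" for e
        using restr[of v e] v(1) v(2)[of e] outside that by (cases "e \<in> Y") auto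
      then show "\<forall>x. v x = 0" using inj[of v] v(1) by (auto simp: X_def)
    qed (use that in blast)
    have "(\<Sum>b\<in>gens F. u b * \<phi> b e) = (if e = c then 1 else 0)" if "e \<in> gens G" for e
      using restr[of u e] u(1) u(2)[of e] outside[of _ e] that c by (cases "e \<in> Y") (auto simp: Y_def)
    moreover have "b \<in> gens F \<and> hdeg F b = hdeg G c \<and> mdeg F b \<le> mdeg G c" if "u b \<noteq> 0" for b
      using u(1)[OF that] by (simp add: X_def)
    ultimately have "P c u" unfolding P_def by blast
    then show ?thesis by blast
  qed
  define \<psi> where "\<psi> c = (if c \<in> gens G then SOME u. P c u else (\<lambda>_. 0))" for c
  have "P c (\<psi> c)" if "c \<in> gens G" for c using someI_ex[OF ex[OF that]] that by (simp add: \<psi>_def)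
  then have \<psi>sup: "c \<in> gens G \<and> b \<in> gens F \<and> hdeg G c = hdeg F b \<and> mdeg F b \<le> mdeg G c" if "\<psi> c b \<noteq> 0" for c b
    using that unfolding P_def by (cases "c \<in> gens G") (fastforce simp: \<psi>_def)+
  have \<psi>\<phi>: "(\<Sum>b\<in>gens F. \<psi> c b * \<phi> b e) = (if c = e then 1 else 0)" if "c \<in> gens G" "e \<in> gens G" for c e
    using \<open>\<And>c. c \<in> gens G \<Longrightarrow> P c (\<psi> c)\<close>[OF that(1)] that unfolding P_def by auto
  have \<phi>\<psi>: "(\<Sum>c\<in>gens G. \<phi> b c * \<psi> c e) = (if b = e then 1 else 0)" if b: "b \<in> gens F" and e: "e \<in> gens F" for b e
  proof -
    define v where "v e = (\<Sum>c\<in>gens G. \<phi> b c * \<psi> c e) - (if b = e then 1 else 0)" for e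
    have "v e = 0"
    proof (rule inj)
      show "x \<in> gens F" if "v x \<noteq> 0" for x
      proof (cases "b = x")
        case False
        then have "(\<Sum>c\<in>gens G. \<phi> b c * \<psi> c x) \<noteq> 0" using that by (simp add: v_def)
        then obtain c where "\<phi> b c * \<psi> c x \<noteq> 0" by (rule sum_nonzeroE)
        then show ?thesis using \<psi>sup[of c x] by auto
      qed (use b in auto)
      fix g assume g: "g \<in> gens G"
      have "(\<Sum>x\<in>gens F. v x * \<phi> x g) = (\<Sum>x\<in>gens F. (\<Sum>c\<in>gens G. \<phi> b c * \<psi> c x) * \<phi> x g) - (\<Sum>x\<in>gens F. if x = b then \<phi> x g else 0)"
        unfolding sum_subtractf[symmetric] by (rule sum.cong) (auto simp: v_def algebra_simps)
      also have "(\<Sum>x\<in>gens F. (\<Sum>c\<in>gens G. \<phi> b c * \<psi> c x) * \<phi> x g) = (\<Sum>c\<in>gens G. \<phi> b c * (\<Sum>x\<in>gens F. \<psi> c x * \<phi> x g))"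
        unfolding sum_distrib_left sum_distrib_right by (subst sum.swap) (simp add: mult.assoc)
      also have "\<dots> = (\<Sum>c\<in>gens G. if c = g then \<phi> b c else 0)"
        by (intro sum.cong refl) (use \<psi>\<phi> g in auto)
      finally show "(\<Sum>x\<in>gens F. v x * \<phi> x g) = 0" using fin b g by simp
    qed
    then show ?thesis by (simp add: v_def)
  qed
  \<comment> \<open>Both sides agree after applying \<phi>, because \<phi> is a chain map, and
    \<phi> is injective.\<close>
  have com: "(\<Sum>g\<in>gens G. cf G c g * \<psi> g e) = (\<Sum>b\<in>gens F. \<psi> c b * cf F b e)" if c: "c \<in> gens G" and e: "e \<in> gens F" for c e
  proof -
    define v where "v e = (if e \<in> gens F then (\<Sum>g\<in>gens G. cf G c g * \<psi> g e) - (\<Sum>b\<in>gens F. \<psi> c b * cf F b e) else 0)" for e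
    have "v e = 0"
    proof (rule inj)
      show "x \<in> gens F" if "v x \<noteq> 0" for x using that by (auto simp: v_def split: if_splits)
      fix a assume a: "a \<in> gens G"
      have "(\<Sum>x\<in>gens F. v x * \<phi> x a) = (\<Sum>x\<in>gens F. (\<Sum>g\<in>gens G. cf G c g * \<psi> g x) * \<phi> x a) - (\<Sum>x\<in>gens F. (\<Sum>b\<in>gens F. \<psi> c b * cf F b x) * \<phi> x a)"
        unfolding sum_subtractf[symmetric] by (rule sum.cong) (auto simp: v_def algebra_simps)
      also have "(\<Sum>x\<in>gens F. (\<Sum>g\<in>gens G. cf G c g * \<psi> g x) * \<phi> x a) = (\<Sum>g\<in>gens G. cf G c g * (\<Sum>x\<in>gens F. \<psi> g x * \<phi> x a))"
        unfolding sum_distrib_left sum_distrib_right by (subst sum.swap) (simp add: mult.assoc)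
      also have "\<dots> = (\<Sum>g\<in>gens G. if g = a then cf G c g else 0)"
        by (intro sum.cong refl) (use \<psi>\<phi> a in auto)
      also have "\<dots> = cf G c a" using fin a by simp
      also have "(\<Sum>x\<in>gens F. (\<Sum>b\<in>gens F. \<psi> c b * cf F b x) * \<phi> x a) = (\<Sum>b\<in>gens F. \<psi> c b * (\<Sum>x\<in>gens F. cf F b x * \<phi> x a))"
        unfolding sum_distrib_left sum_distrib_right by (subst sum.swap) (simp add: mult.assoc)
      also have "\<dots> = (\<Sum>b\<in>gens F. \<psi> c b * (\<Sum>g\<in>gens G. \<phi> b g * cf G g a))"
        using \<phi>(1) a by (intro sum.cong) (auto simp: scalar_map_def)
      also have "\<dots> = (\<Sum>g\<in>gens G. (\<Sum>b\<in>gens F. \<psi> c b * \<phi> b g) * cf G g a)"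
        unfolding sum_distrib_left sum_distrib_right by (subst sum.swap) (simp add: mult.assoc)
      also have "\<dots> = (\<Sum>g\<in>gens G. if g = c then cf G g a else 0)"
        by (intro sum.cong refl) (use \<psi>\<phi> c in auto)
      also have "\<dots> = cf G c a" using fin c by simp
      finally show "(\<Sum>x\<in>gens F. v x * \<phi> x a) = 0" by simp
    qed
    then show ?thesis using e by (simp add: v_def)
  qed
  have \<psi>: "scalar_map G F \<psi>" unfolding scalar_map_def using \<psi>sup com by blast
  show ?thesis
    unfolding complex_iso_def
    by (rule exI[of _ "\<lambda>b c. Poly_Mapping.single (mdeg F b - mdeg G c) (\<phi> b c)"],
        rule exI[of _ "\<lambda>c b. Poly_Mapping.single (mdeg G c - mdeg F b) (\<psi> c b)"],
        intro conjI ballI scalar_map_chain_map scalar_map_inverse gr \<phi> \<psi> \<phi>\<psi> \<psi>\<phi>)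
qed

section \<open>Monomial ideals\<close>

lemma module_mult: "module ((*) :: 'a::comm_ring_1 \<Rightarrow> 'a \<Rightarrow> 'a)"
  by unfold_locales (auto simp: algebra_simps)

lemma poly_mapping_eq_sum: "p = (\<Sum>t\<in>Poly_Mapping.keys p. Poly_Mapping.single t (Poly_Mapping.lookup p t))"
proof (rule poly_mapping_eqI)
  fix k
  show "Poly_Mapping.lookup p k = Poly_Mapping.lookup (\<Sum>t\<in>Poly_Mapping.keys p. Poly_Mapping.single t (Poly_Mapping.lookup p t)) k"
    by (simp add: lookup_sum lookup_single when_def in_keys_iff)
qed

text \<open>The right-hand side describes an ideal containing the generators; conversely each single
  term of such an f is a multiple of a generator.\<close>

lemma mem_ideal_gen_monom:
  fixes f :: "('n::finite, 'k::field) pol"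
  shows "f \<in> ideal_gen (monom ` A) \<longleftrightarrow> (\<forall>t\<in>Poly_Mapping.keys f. \<exists>s\<in>A. s \<le> t)"
proof
  let ?P = "{f :: ('n, 'k) pol. \<forall>t\<in>Poly_Mapping.keys f. \<exists>s\<in>A. s \<le> t}"
  have "is_ideal ?P"
  proof (rule module.subspaceI[OF module_mult])
    show "0 \<in> ?P" by simp
    show "f + g \<in> ?P" if "f \<in> ?P" "g \<in> ?P" for f g using that keys_add[of f g] by fastforce
    show "c * f \<in> ?P" if f: "f \<in> ?P" for c f
    proof (intro CollectI ballI)
      fix t assume "t \<in> Poly_Mapping.keys (c * f)"
      then obtain a b where ab: "t = a + b" "b \<in> Poly_Mapping.keys f" using keys_mult[of c f] by blast
      then obtain s where "s \<in> A" "s \<le> b" using f by auto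
      then have "s \<le> t" by (auto simp: ab le_fun_def intro: trans_le_add2)
      then show "\<exists>s\<in>A. s \<le> t" using \<open>s \<in> A\<close> by blast
    qed
  qed
  moreover have "monom ` A \<subseteq> ?P" by auto
  ultimately have "ideal_gen (monom ` A) \<subseteq> ?P" by (intro module.span_minimal[OF module_mult])
  then show "f \<in> ideal_gen (monom ` A) \<Longrightarrow> \<forall>t\<in>Poly_Mapping.keys f. \<exists>s\<in>A. s \<le> t" by blast
  assume f: "\<forall>t\<in>Poly_Mapping.keys f. \<exists>s\<in>A. s \<le> t"
  have "Poly_Mapping.single t c \<in> ideal_gen (monom ` A)" if t: "t \<in> Poly_Mapping.keys f" for t and c :: 'k
  proof -
    obtain s where s: "s \<in> A" "s \<le> t" using f t by blast
    have "Poly_Mapping.single t c = Poly_Mapping.single (t - s) c * monom s" using s by (simp add: mult_single mon_diff_add)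
    then show ?thesis using s
      by (metis imageI module.span_base[OF module_mult] module.span_scale[OF module_mult])
  qed
  then show "f \<in> ideal_gen (monom ` A)"
    by (subst poly_mapping_eq_sum) (intro module.span_sum[OF module_mult])
qed

definition mons :: "('n::finite, 'k::field) pol set \<Rightarrow> 'n mon set" where
  "mons I = {m. monom m \<in> I}"

lemma mons_ideal_gen: "mons (ideal_gen ((monom ` A) :: ('n::finite, 'k::field) pol set)) = {m. \<exists>s\<in>A. s \<le> m}"
  by (simp add: mons_def mem_ideal_gen_monom)

lemma mem_monomial_ideal:
  assumes "monomial_ideal I" shows "f \<in> I \<longleftrightarrow> Poly_Mapping.keys f \<subseteq> mons I"
proof -
  obtain A where A: "I = ideal_gen (monom ` A)" using assms by (auto simp: monomial_ideal_def)
  show ?thesis unfolding A mons_ideal_gen by (auto simp: mem_ideal_gen_monom)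
qed

lemma monomial_ideal_eqI: "monomial_ideal I \<Longrightarrow> monomial_ideal J \<Longrightarrow> mons I = mons J \<Longrightarrow> I = J"
  using mem_monomial_ideal by blast

lemma mons_upward: "monomial_ideal I \<Longrightarrow> m \<in> mons I \<Longrightarrow> m \<le> m' \<Longrightarrow> m' \<in> mons I"
  unfolding monomial_ideal_def by (auto simp: mons_ideal_gen) (meson order_trans)

section \<open>Strands of a graded complex\<close>

text \<open>The homogeneous component of degree \<alpha> of a chain, in the coordinates of
  \<open>strand\<close>.\<close>

definition part :: "('b, 'n::finite, 'k::field) free_complex \<Rightarrow> ('b \<Rightarrow> ('n, 'k) pol) \<Rightarrow> 'n mon \<Rightarrow> 'b \<Rightarrow> 'k" where
  "part F v \<alpha> b = (if b \<in> gens F \<and> mdeg F b \<le> \<alpha> then Poly_Mapping.lookup (v b) (\<alpha> - mdeg F b) else 0)"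

lemma lookup_mult_single:
  fixes p :: "('n, 'k::field) pol"
  shows "Poly_Mapping.lookup (p * Poly_Mapping.single t s) x = (if t \<le> x then Poly_Mapping.lookup p (x - t) * s else 0)"
proof -
  have *: "(a + t = x) = (t \<le> x \<and> a = x - t)" for a
    using mon_diff_add[of t x] mon_diff_eq[of a t x] by (auto simp: le_fun_def)
  have "p * Poly_Mapping.single t s = (\<Sum>a\<in>Poly_Mapping.keys p. Poly_Mapping.single (a + t) (Poly_Mapping.lookup p a * s))"
    by (subst poly_mapping_eq_sum) (simp add: sum_distrib_right mult_single)
  then have "Poly_Mapping.lookup (p * Poly_Mapping.single t s) x = (\<Sum>a\<in>Poly_Mapping.keys p. if a + t = x then Poly_Mapping.lookup p a * s else 0)"
    by (simp add: lookup_sum lookup_single when_def)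
  also have "\<dots> = (\<Sum>a\<in>Poly_Mapping.keys p. if a = x - t then (if t \<le> x then Poly_Mapping.lookup p (x - t) * s else 0) else 0)"
    by (intro sum.cong refl) (auto simp: *)
  also have "\<dots> = (if t \<le> x then Poly_Mapping.lookup p (x - t) * s else 0)"
    by (auto simp: in_keys_iff)
  finally show ?thesis .
qed

lemma lookup_combination:
  assumes "m \<le> \<alpha>" and k: "\<And>b. b \<in> gens F \<Longrightarrow> k b \<noteq> 0 \<Longrightarrow> m \<le> mdeg F b"
  shows "Poly_Mapping.lookup (\<Sum>b\<in>gens F. v b * Poly_Mapping.single (mdeg F b - m) (k b)) (\<alpha> - m) = (\<Sum>b\<in>gens F. part F v \<alpha> b * k b)"
  unfolding lookup_sum
proof (rule sum.cong, goal_cases)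
  case (2 b)
  show ?case
  proof (cases "k b = 0")
    case False
    then have "m \<le> mdeg F b" using k 2 by blast
    then have "(mdeg F b - m \<le> \<alpha> - m) = (mdeg F b \<le> \<alpha>)" and "\<alpha> - m - (mdeg F b - m) = \<alpha> - mdeg F b"
      using assms(1) by (auto simp: le_fun_def fun_eq_iff le_diff_iff)
    then show ?thesis using 2 by (simp add: lookup_mult_single part_def)
  qed auto
qed simp

lemma lookup_boundary:
  assumes F: "graded_free_complex F" and c: "c \<in> gens F" "mdeg F c \<le> \<alpha>"
  shows "Poly_Mapping.lookup (boundary F v c) (\<alpha> - mdeg F c) = (\<Sum>b\<in>gens F. part F v \<alpha> b * cf F b c)"
proof -
  have "boundary F v c = (\<Sum>b\<in>gens F. v b * Poly_Mapping.single (mdeg F b - mdeg F c) (cf F b c))"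
    unfolding boundary_def using c by (auto intro!: sum.cong simp: graded_cf[OF F])
  then show ?thesis using lookup_combination[OF c(2), of F "\<lambda>b. cf F b c" v] graded_cf_nonzero(2)[OF F _ c(1)] by simp
qed

lemma strand_boundary_zero:
  assumes F: "graded_free_complex F" and c: "c \<in> gens F" "\<not> mdeg F c \<le> \<alpha>" and w: "strand F i \<alpha> w"
  shows "(\<Sum>b\<in>gens F. w b * cf F b c) = 0"
proof (rule sum.neutral, intro ballI, rule ccontr)
  fix b assume b: "b \<in> gens F" "w b * cf F b c \<noteq> 0"
  then have "mdeg F b \<le> \<alpha>" "mdeg F c \<le> mdeg F b" using w graded_cf_nonzero(2)[OF F b(1) c(1)] by (auto simp: strand_def)
  then show False using c(2) order_trans by blast
qed

lemma part_strand: "is_chain F i v \<Longrightarrow> strand F i \<alpha> (part F v \<alpha>)"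
  unfolding strand_def part_def is_chain_def by (metis lookup_zero)

lemma part_cycle:
  assumes "graded_free_complex F" "is_chain F i v" "boundary F v = 0" "c \<in> gens F"
  shows "(\<Sum>b\<in>gens F. part F v \<alpha> b * cf F b c) = 0"
  using lookup_boundary[OF assms(1,4), of \<alpha> v] strand_boundary_zero[OF assms(1,4) _ part_strand[OF assms(2)]] assms(3)
  by (cases "mdeg F c \<le> \<alpha>") auto

text \<open>Each strand is solved separately. Only the finitely many degrees in \<open>L\<close>,
  those occurring in \<open>v\<close>, are assembled, so the result has polynomial
  coefficients.\<close>

lemma boundary_from_strands:
  fixes F :: "('b, 'n::finite, 'k::field) free_complex"
  assumes F: "graded_free_complex F" and v: "\<And>c. v c \<noteq> 0 \<Longrightarrow> c \<in> gens F"
    and ex: "\<And>\<alpha>. \<exists>w. strand F j \<alpha> w \<and> (\<forall>c\<in>gens F. (\<Sum>b\<in>gens F. w b * cf F b c) = part F v \<alpha> c)"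
  shows "\<exists>w. is_chain F j w \<and> boundary F w = v"
proof -
  obtain w where w: "\<And>\<alpha>. strand F j \<alpha> (w \<alpha>)"
    "\<And>\<alpha> c. c \<in> gens F \<Longrightarrow> (\<Sum>b\<in>gens F. w \<alpha> b * cf F b c) = part F v \<alpha> c"
    using ex by metis
  have fin: "finite (gens F)" using F by (rule graded_finite)
  define L where "L = (\<Union>c\<in>gens F. (\<lambda>t. t + mdeg F c) ` Poly_Mapping.keys (v c))"
  have fL: "finite L" using fin by (simp add: L_def)
  define W where "W b = (\<Sum>\<alpha>\<in>L. Poly_Mapping.single (\<alpha> - mdeg F b) (w \<alpha> b))" for b
  have W: "is_chain F j W" unfolding is_chain_def
  proof (intro allI impI)
    fix b assume "W b \<noteq> 0"
    then obtain \<alpha> where "Poly_Mapping.single (\<alpha> - mdeg F b) (w \<alpha> b) \<noteq> 0" unfolding W_def by (rule sum_nonzeroE)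
    then have "w \<alpha> b \<noteq> 0" by auto
    then show "b \<in> gens F \<and> hdeg F b = j" using w(1)[of \<alpha>] by (auto simp: strand_def)
  qed
  have part: "part F W \<beta> b = (if \<beta> \<in> L then w \<beta> b else 0)" if b: "b \<in> gens F" for \<beta> b
  proof (cases "mdeg F b \<le> \<beta>")
    case True
    have "Poly_Mapping.lookup (Poly_Mapping.single (\<alpha> - mdeg F b) (w \<alpha> b)) (\<beta> - mdeg F b) = (if \<alpha> = \<beta> then w \<beta> b else 0)" for \<alpha>
    proof (cases "w \<alpha> b = 0 \<or> \<alpha> = \<beta>")
      case False
      then have "mdeg F b \<le> \<alpha>" using w(1)[of \<alpha>] by (auto simp: strand_def)
      then have "\<alpha> - mdeg F b \<noteq> \<beta> - mdeg F b" using True False mon_diff_add by metis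
      then show ?thesis using False by (simp add: lookup_single_not_eq)
    qed auto
    then show ?thesis using True b fL by (simp add: part_def W_def lookup_sum)
  next
    case False
    then have "w \<beta> b = 0" using w(1)[of \<beta>] by (auto simp: strand_def)
    then show ?thesis using False by (simp add: part_def)
  qed
  have "boundary F W c = v c" for c
  proof (cases "c \<in> gens F")
    case True
    show ?thesis
    proof (rule poly_mapping_eqI)
      fix t
      define \<beta> where "\<beta> = t + mdeg F c"
      have \<beta>: "mdeg F c \<le> \<beta>" "\<beta> - mdeg F c = t" by (auto simp: \<beta>_def le_fun_def fun_eq_iff)
      have "Poly_Mapping.lookup (boundary F W c) t = (\<Sum>b\<in>gens F. part F W \<beta> b * cf F b c)"
        using lookup_boundary[OF F True \<beta>(1)] \<beta>(2) by simp
      also have "\<dots> = (\<Sum>b\<in>gens F. (if \<beta> \<in> L then w \<beta> b else 0) * cf F b c)"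
        by (intro sum.cong) (use part in auto)
      also have "\<dots> = (if \<beta> \<in> L then part F v \<beta> c else 0)" using w(2)[OF True] by simp
      also have "\<dots> = Poly_Mapping.lookup (v c) t"
      proof (cases "\<beta> \<in> L")
        case True
        then show ?thesis using \<open>c \<in> gens F\<close> \<beta> by (simp add: part_def)
      next
        case False
        then have "t \<notin> Poly_Mapping.keys (v c)" using \<open>c \<in> gens F\<close> by (auto simp: L_def \<beta>_def)
        then show ?thesis using False by (simp add: in_keys_iff)
      qed
      finally show "Poly_Mapping.lookup (boundary F W c) t = Poly_Mapping.lookup (v c) t" .
    qed
  next
    case False then show ?thesis using v by (auto simp: boundary_def)
  qed
  then show ?thesis using W by blast
qed

lemma resolves_exact:
  assumes R: "resolves S z F" and i: "0 < i" and v: "is_chain F i v" "boundary F v = 0"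
  shows "\<exists>w. is_chain F (Suc i) w \<and> boundary F w = v"
proof (rule boundary_from_strands)
  show F: "graded_free_complex F" using R by (simp add: resolves_def)
  show "c \<in> gens F" if "v c \<noteq> 0" for c using that v by (auto simp: is_chain_def)
  fix \<alpha>
  have "exact_at F i \<alpha>" using R i by (simp add: resolves_def)
  then show "\<exists>w. strand F (Suc i) \<alpha> w \<and> (\<forall>c\<in>gens F. (\<Sum>b\<in>gens F. w b * cf F b c) = part F v \<alpha> c)"
    using part_strand[OF v(1)] part_cycle[OF F v] unfolding exact_at_def by blast
qed

text \<open>Exactness in degree 0 at the monomials of I gives one direction, the condition on
  \<open>cf F b z\<close> the other.\<close>

lemma resolves_augmentation:
  assumes R: "resolves (mons I) z F" and I: "monomial_ideal I"
  shows "a \<in> I \<longleftrightarrow> (\<exists>w. is_chain F 1 w \<and> boundary F w = (\<lambda>b. if b = z then a else 0))"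
proof
  have F: "graded_free_complex F" and z: "z \<in> gens F" "hdeg F z = 0" "mdeg F z = 0"
    and zI: "\<And>b. b \<in> gens F \<Longrightarrow> cf F b z \<noteq> 0 \<Longrightarrow> mdeg F b \<in> mons I"
    using R by (auto simp: resolves_def)
  {
    assume a: "a \<in> I"
    have "\<exists>w. is_chain F (Suc 0) w \<and> boundary F w = (\<lambda>b. if b = z then a else 0)" (is "\<exists>w. _ \<and> _ = ?v")
    proof (rule boundary_from_strands[OF F])
      show "c \<in> gens F" if "?v c \<noteq> 0" for c using that z by (auto split: if_splits)
      fix \<alpha>
      have ch: "is_chain F 0 ?v" using z by (auto simp: is_chain_def)
      have cyc: "(\<Sum>b\<in>gens F. part F ?v \<alpha> b * cf F b c) = 0" if c: "c \<in> gens F" for c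
      proof (rule sum.neutral, intro ballI, rule ccontr)
        fix b assume b: "b \<in> gens F" "part F ?v \<alpha> b * cf F b c \<noteq> 0"
        then have "b = z" by (auto simp: part_def split: if_splits)
        then show False using graded_cf_nonzero(1)[OF F b(1) c] b z by auto
      qed
      show "\<exists>w. strand F (Suc 0) \<alpha> w \<and> (\<forall>c\<in>gens F. (\<Sum>b\<in>gens F. w b * cf F b c) = part F ?v \<alpha> c)"
      proof (cases "\<alpha> \<in> mons I")
        case True
        then have "exact_at F 0 \<alpha>" using R by (simp add: resolves_def)
        then show ?thesis using part_strand[OF ch] cyc unfolding exact_at_def by blast
      next
        case False
        then have "\<alpha> \<notin> Poly_Mapping.keys a" using a mem_monomial_ideal[OF I] by blast
        then have "part F ?v \<alpha> c = 0" for c using z by (auto simp: part_def in_keys_iff)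
        then show ?thesis by (intro exI[of _ "\<lambda>_. 0"]) (auto simp: strand_def)
      qed
    qed
    then show "\<exists>w. is_chain F 1 w \<and> boundary F w = ?v" by simp
  }
  assume "\<exists>w. is_chain F 1 w \<and> boundary F w = (\<lambda>b. if b = z then a else 0)"
  then obtain w where w: "boundary F w = (\<lambda>b. if b = z then a else 0)" by blast
  then have "boundary F w z = a" by simp
  then have "a = (\<Sum>b\<in>gens F. w b * bd F b z)" using z by (simp add: boundary_def)
  also have "\<dots> \<in> I"
  proof -
    obtain A where A: "I = ideal_gen (monom ` A)" using I by (auto simp: monomial_ideal_def)
    have "bd F b z \<in> I" if "b \<in> gens F" for b
      unfolding mem_monomial_ideal[OF I] graded_cf[OF F that z(1)] using zI[OF that] z(3) by (cases "cf F b z = 0") auto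
    then show ?thesis unfolding A by (intro module.span_sum[OF module_mult] module.span_scale[OF module_mult])
  qed
  finally show "a \<in> I" .
qed

lemma unitfree_lookup:
  assumes F: "graded_free_complex F"
  shows "unitfree F \<longleftrightarrow> (\<forall>b\<in>gens F. \<forall>c\<in>gens F. Poly_Mapping.lookup (bd F b c) 0 = 0)"
proof -
  have "(cf F b c \<noteq> 0 \<longrightarrow> mdeg F b \<noteq> mdeg F c) = (Poly_Mapping.lookup (bd F b c) 0 = 0)"
    if bc: "b \<in> gens F" "c \<in> gens F" for b c
  proof (cases "cf F b c = 0")
    case False
    then have le: "mdeg F c \<le> mdeg F b" using graded_cf_nonzero(2)[OF F bc] by blast
    have "(mdeg F b - mdeg F c = 0) = (mdeg F b = mdeg F c)"
      using mon_diff_add[OF le] by (auto simp: fun_eq_iff)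
    then show ?thesis using False by (simp add: graded_cf[OF F bc] lookup_single when_def)
  qed (simp add: graded_cf[OF F bc])
  then show ?thesis unfolding unitfree_def by blast
qed

theorem resolves_minimal_free_resolution:
  fixes F :: "('b, 'n::finite, 'k::field) free_complex"
  assumes R: "resolves (mons I) z F" and I: "monomial_ideal I" and F: "unitfree F"
  shows "minimal_free_resolution UNIV I F"
proof -
  have gF: "graded_free_complex F" and z: "z \<in> gens F" "hdeg F z = 0" "mdeg F z = 0"
    and z1: "\<And>b. b \<in> gens F \<Longrightarrow> hdeg F b = 0 \<Longrightarrow> b = z"
    using R by (auto simp: resolves_def)
  have fin: "finite (gens F)" using gF by (rule graded_finite)
  define \<epsilon> :: "'b \<Rightarrow> ('n, 'k) pol" where "\<epsilon> b = (if b = z then 1 else 0)" for b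
  have sum\<epsilon>: "(\<Sum>b\<in>gens F. v b * \<epsilon> b) = v z" for v
    using fin z(1) by (simp add: \<epsilon>_def if_distrib[of "(*) _"] cong: if_cong)
  have chain0: "v = (\<lambda>b. if b = z then v z else 0)" if "is_chain F 0 v" for v
    using that z1 by (auto simp: is_chain_def fun_eq_iff)
  have 0: "0 \<in> I" using mem_monomial_ideal[OF I, of 0] by simp
  have "\<exists>v. is_chain F 0 v \<and> a - (\<Sum>b\<in>gens F. v b * \<epsilon> b) \<in> I" for a
    unfolding sum\<epsilon> by (rule exI[of _ "\<lambda>b. if b = z then a else 0"]) (use z 0 in \<open>auto simp: is_chain_def\<close>)
  moreover have "((\<Sum>b\<in>gens F. v b * \<epsilon> b) \<in> I) = (\<exists>w. is_chain F 1 w \<and> boundary F w = v)" if "is_chain F 0 v" for v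
    unfolding sum\<epsilon> using resolves_augmentation[OF R I, of "v z"] chain0[OF that] by simp
  moreover have "\<epsilon> b \<in> UNIV \<and> (\<forall>t\<in>Poly_Mapping.keys (\<epsilon> b). t = mdeg F b)" if "b \<in> gens F" "hdeg F b = 0" for b
    using z1[OF that] z(3) by (simp add: \<epsilon>_def)
  ultimately have "free_resolution UNIV I F"
    unfolding free_resolution_def using gF resolves_exact[OF R] by blast
  then show ?thesis using F unitfree_lookup[OF gF] by (simp add: minimal_free_resolution_def)
qed

section \<open>Betti numbers\<close>

lemma graded_bd_bd:
  "graded_free_complex F \<Longrightarrow> b \<in> gens F \<Longrightarrow> e \<in> gens F \<Longrightarrow> (\<Sum>c\<in>gens F. bd F b c * bd F c e) = 0"
  by (simp add: graded_free_complex_def)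

lemma graded_bd_nonzero:
  "graded_free_complex F \<Longrightarrow> b \<in> gens F \<Longrightarrow> c \<in> gens F \<Longrightarrow> bd F b c \<noteq> 0 \<Longrightarrow> hdeg F b = Suc (hdeg F c)"
  by (simp add: graded_free_complex_def)

text \<open>Omitting the generator \<open>z\<close> of R and lowering homological degrees by one
  turns a resolution of R/I into one of the module I; the entries towards \<open>z\<close> become
  the augmentation. The basis is renamed by natural numbers because \<open>betti\<close> quantifies
  over such complexes.\<close>

lemma resolves_truncate:
  fixes F :: "('b, 'n::finite, 'k::field) free_complex"
  assumes R: "resolves (mons I) z F" and I: "monomial_ideal I" and F: "unitfree F"
  shows "\<exists>T :: (nat, 'n, 'k) free_complex. minimal_free_resolution I {0} T \<and>
     (\<forall>i \<alpha>. card {x \<in> gens T. hdeg T x = i \<and> mdeg T x = \<alpha>} = card {b \<in> gens F. hdeg F b = Suc i \<and> mdeg F b = \<alpha>})"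
proof -
  have gF: "graded_free_complex F" and z: "z \<in> gens F" "hdeg F z = 0" "mdeg F z = 0"
    and z1: "\<And>b. b \<in> gens F \<Longrightarrow> hdeg F b = 0 \<Longrightarrow> b = z"
    and zI: "\<And>b. b \<in> gens F \<Longrightarrow> cf F b z \<noteq> 0 \<Longrightarrow> mdeg F b \<in> mons I"
    using R by (auto simp: resolves_def)
  have fin: "finite (gens F)" using gF by (rule graded_finite)
  define Z where "Z = gens F - {z}"
  define n where "n = card Z"
  obtain g where g: "bij_betw g {0..<n} Z"
    using ex_bij_betw_nat_finite[of Z] fin by (auto simp: Z_def n_def)
  define f where "f = inv_into {0..<n} g"
  have gZ: "g x \<in> gens F" "g x \<noteq> z" if "x \<in> {0..<n}" for x using g that by (auto simp: bij_betw_def Z_def)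
  have inj: "inj_on g {0..<n}" and img: "g ` {0..<n} = Z" using g by (auto simp: bij_betw_def)
  have fg: "f (g x) = x" if "x \<in> {0..<n}" for x using that inj by (simp add: f_def)
  have gf: "g (f b) = b" "f b \<in> {0..<n}" if "b \<in> Z" for b
    using that fg unfolding img[symmetric] by auto
  have hpos: "hdeg F b > 0" if "b \<in> Z" for b using that z1 by (auto simp: Z_def)
  define T :: "(nat, 'n, 'k) free_complex" where
    "T = \<lparr> gens = {0..<n}, hdeg = (\<lambda>x. hdeg F (g x) - 1), mdeg = (\<lambda>x. mdeg F (g x)), bd = (\<lambda>x y. bd F (g x) (g y)) \<rparr>"
  have T: "gens T = {0..<n}" "hdeg T x = hdeg F (g x) - 1" "mdeg T x = mdeg F (g x)" "bd T x y = bd F (g x) (g y)" for x y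
    by (simp_all add: T_def)
  have hT: "hdeg F (g x) = Suc (hdeg T x)" if "x \<in> {0..<n}" for x
    using hpos[of "g x"] gZ[OF that] by (simp add: T Z_def)
  have sumT: "(\<Sum>x\<in>gens T. k (g x)) = (\<Sum>b\<in>Z. k b)" for k :: "'b \<Rightarrow> ('n, 'k) pol"
    using sum.reindex_bij_betw[OF g] by (simp add: T)
  have sumZ: "(\<Sum>b\<in>Z. k b) = (\<Sum>b\<in>gens F. k b)" if "k z = 0" for k :: "'b \<Rightarrow> ('n, 'k) pol"
    using fin z that by (simp add: Z_def sum_diff1)
  have bdz: "bd F z c = 0" if "c \<in> gens F" for c
    using graded_bd_nonzero[OF gF z(1) that] z(2) by (cases "bd F z c = 0") auto
  have bdz': "bd F b z = 0" if "b \<in> gens F" "hdeg F b \<noteq> 1" for b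
    using graded_bd_nonzero[OF gF that(1) z(1)] z(2) that(2) by (cases "bd F b z = 0") auto
  have gT: "graded_free_complex T"
    unfolding graded_free_complex_def
  proof (intro conjI ballI impI)
    show "finite (gens T)" by (simp add: T)
    fix x y assume xy: "x \<in> gens T" "y \<in> gens T"
    then have xy': "g x \<in> gens F" "g y \<in> gens F" "g x \<in> Z" "g y \<in> Z" using gZ by (auto simp: T Z_def)
    show "bd T x y \<noteq> 0 \<Longrightarrow> hdeg T x = Suc (hdeg T y)"
      using graded_bd_nonzero[OF gF xy'(1,2)] hT xy by (simp add: T)
    show "t + mdeg T y = mdeg T x" if "t \<in> Poly_Mapping.keys (bd T x y)" for t
      using gF that xy' by (simp add: T graded_free_complex_def)
    have "(\<Sum>c\<in>gens T. bd T x c * bd T c y) = (\<Sum>c\<in>gens F. bd F (g x) c * bd F c (g y))"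
      unfolding T(4) using sumT[of "\<lambda>c. bd F (g x) c * bd F c (g y)"] sumZ[of "\<lambda>c. bd F (g x) c * bd F c (g y)"] bdz[OF xy'(2)]
      by simp
    then show "(\<Sum>c\<in>gens T. bd T x c * bd T c y) = 0" using graded_bd_bd[OF gF xy'(1,2)] by simp
  qed
  \<comment> \<open>Carries chains of \<open>T\<close> back to chains of F, one homological degree
    higher, so that exactness of F can be used.\<close>
  define up where "up v b = (if b \<in> Z then v (f b) else 0)" for v :: "nat \<Rightarrow> ('n, 'k) pol" and b
  have up_chain: "is_chain F (Suc i) (up v)" if "is_chain T i v" for i v
    using that hT gf unfolding is_chain_def up_def by (auto simp: T Z_def split: if_splits) (metis One_nat_def Suc_pred atLeastLessThan_iff le0)
  have up_sum: "(\<Sum>b\<in>gens F. up v b * bd F b c) = (\<Sum>x\<in>gens T. v x * bd F (g x) c)" for v c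
  proof -
    have "(\<Sum>b\<in>gens F. up v b * bd F b c) = (\<Sum>b\<in>Z. up v b * bd F b c)" by (rule sumZ[symmetric]) (simp add: up_def Z_def)
    also have "\<dots> = (\<Sum>x\<in>gens T. up v (g x) * bd F (g x) c)" by (rule sumT[symmetric])
    also have "\<dots> = (\<Sum>x\<in>gens T. v x * bd F (g x) c)"
      by (intro sum.cong refl) (use gZ fg in \<open>auto simp: up_def T Z_def\<close>)
    finally show ?thesis .
  qed
  have up_bd: "boundary F (up v) (g y) = boundary T v y" if "y \<in> {0..<n}" for v y
    using that gZ up_sum by (simp add: boundary_def T)
  have down: "\<exists>w'. is_chain T i w' \<and> boundary T w' = v"
    if w: "is_chain F (Suc i) w" "boundary F w = up v" and v: "\<And>x. v x \<noteq> 0 \<Longrightarrow> x \<in> {0..<n}" for w i v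
  proof -
    define w' where "w' x = (if x \<in> {0..<n} then w (g x) else 0)" for x
    have "w z = 0" using w(1) z(2) unfolding is_chain_def by (metis nat.distinct(1))
    then have "up w' = w" using w(1) gf unfolding up_def is_chain_def w'_def by (auto simp: fun_eq_iff Z_def)
    moreover have "is_chain T i w'" using w(1) gZ unfolding is_chain_def w'_def by (auto simp: T)
    moreover have "boundary T w' y = v y" for y
    proof (cases "y \<in> {0..<n}")
      case True
      then show ?thesis using up_bd[OF True, of w'] \<open>up w' = w\<close> w(2) gZ[OF True] fg[OF True] by (simp add: up_def Z_def)
    next
      case False then show ?thesis using v by (auto simp: boundary_def T)
    qed
    ultimately show ?thesis by blast
  qed
  define \<epsilon> where "\<epsilon> x = bd F (g x) z" for x
  have up_z: "boundary F (up v) z = (\<Sum>x\<in>gens T. v x * \<epsilon> x)" for v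
    using z up_sum by (simp add: boundary_def \<epsilon>_def)
  have up_bd_zero: "boundary F (up v) c = 0" if "c \<noteq> z" "boundary T v = 0" for v c
  proof (cases "c \<in> Z")
    case True
    then show ?thesis using up_bd[of "f c" v] gf that(2) by simp
  next
    case False then show ?thesis using that by (auto simp: boundary_def Z_def)
  qed
  \<comment> \<open>In degree 0 the cycle condition is replaced by vanishing under the augmentation,
    which is the coefficient of the boundary at \<open>z\<close>.\<close>
  have exact: "\<exists>w. is_chain T (Suc i) w \<and> boundary T w = v"
    if v: "is_chain T i v" "boundary T v = 0 \<or> i = 0" "boundary F (up v) z = 0" for i v
  proof -
    have "boundary F (up v) c = 0" if "c \<noteq> z" for c
    proof (cases "i = 0")
      case True
      then have "is_chain F 1 (up v)" using up_chain[OF v(1)] by simp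
      have "up v b * bd F b c = 0" if "b \<in> gens F" "c \<in> gens F" for b
      proof (rule ccontr)
        assume "up v b * bd F b c \<noteq> 0"
        then have "up v b \<noteq> 0" "bd F b c \<noteq> 0" by auto
        then show False using \<open>is_chain F 1 (up v)\<close> graded_bd_nonzero[OF gF that] z1[of c] that \<open>c \<noteq> z\<close>
          by (auto simp: is_chain_def)
      qed
      then show ?thesis unfolding boundary_def by (auto intro!: sum.neutral)
    qed (use up_bd_zero[OF that] v(2) in auto)
    then have "boundary F (up v) = 0" using v(3) by (intro ext) (metis zero_fun_apply)
    then obtain w where "is_chain F (Suc (Suc i)) w" "boundary F w = up v"
      using resolves_exact[OF R _ up_chain[OF v(1)]] by blast
    then show ?thesis using down v(1) by (auto simp: is_chain_def T)
  qed
  have "free_resolution I {0} T"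
    unfolding free_resolution_def
  proof (intro conjI allI impI, fact gT)
    fix i :: nat and v assume i: "0 < i" and v: "is_chain T i v \<and> boundary T v = 0"
    have "v x * \<epsilon> x = 0" if "x \<in> gens T" for x
    proof (rule ccontr)
      assume "v x * \<epsilon> x \<noteq> 0"
      then have "v x \<noteq> 0" and "bd F (g x) z \<noteq> 0" by (auto simp: \<epsilon>_def)
      moreover have "hdeg F (g x) = Suc i" using v \<open>v x \<noteq> 0\<close> hT[of x] that by (simp add: is_chain_def T(1))
      ultimately show False using bdz'[of "g x"] gZ(1)[of x] i that by (simp add: T(1))
    qed
    then have "boundary F (up v) z = 0" unfolding up_z by (intro sum.neutral) auto
    then show "\<exists>w. is_chain T (Suc i) w \<and> boundary T w = v" using exact v by blast
  next
    show "\<exists>\<epsilon>. (\<forall>b\<in>gens T. hdeg T b = 0 \<longrightarrow> \<epsilon> b \<in> I \<and> (\<forall>t\<in>Poly_Mapping.keys (\<epsilon> b). t = mdeg T b)) \<and>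
         (\<forall>a\<in>I. \<exists>v. is_chain T 0 v \<and> a - (\<Sum>b\<in>gens T. v b * \<epsilon> b) \<in> {0}) \<and>
         (\<forall>v. is_chain T 0 v \<longrightarrow> ((\<Sum>b\<in>gens T. v b * \<epsilon> b) \<in> {0}) = (\<exists>w. is_chain T 1 w \<and> boundary T w = v))"
    proof (rule exI[of _ \<epsilon>], intro conjI ballI allI impI)
      fix x assume x: "x \<in> gens T"
      then have gx: "g x \<in> gens F" using gZ by (simp add: T)
      have \<epsilon>: "\<epsilon> x = Poly_Mapping.single (mdeg T x) (cf F (g x) z)"
        using graded_cf[OF gF gx z(1)] z(3) by (simp add: \<epsilon>_def T)
      then show "\<epsilon> x \<in> I" unfolding mem_monomial_ideal[OF I] using zI[OF gx] by (simp add: T)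
      show "t = mdeg T x" if "t \<in> Poly_Mapping.keys (\<epsilon> x)" for t using that \<epsilon> by (auto split: if_splits)
    next
      fix a assume "a \<in> I"
      then obtain w where w: "is_chain F 1 w" "boundary F w = (\<lambda>b. if b = z then a else 0)"
        using resolves_augmentation[OF R I, of a] by blast
      define w' where "w' x = (if x \<in> {0..<n} then w (g x) else 0)" for x
      have "w z = 0" using w(1) z(2) unfolding is_chain_def by (metis zero_neq_one)
      then have "up w' = w" using w(1) gf unfolding up_def is_chain_def w'_def by (auto simp: fun_eq_iff Z_def)
      moreover have "is_chain T 0 w'" using w(1) gZ unfolding is_chain_def w'_def by (auto simp: T)
      ultimately show "\<exists>v. is_chain T 0 v \<and> a - (\<Sum>b\<in>gens T. v b * \<epsilon> b) \<in> {0}"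
        using up_z[of w'] w(2) by (intro exI[of _ w']) simp
    next
      fix v assume v: "is_chain T 0 v"
      show "((\<Sum>b\<in>gens T. v b * \<epsilon> b) \<in> {0}) = (\<exists>w. is_chain T 1 w \<and> boundary T w = v)"
      proof
        assume "(\<Sum>b\<in>gens T. v b * \<epsilon> b) \<in> {0}"
        then show "\<exists>w. is_chain T 1 w \<and> boundary T w = v" using exact[OF v] up_z[of v] by simp
      next
        assume "\<exists>w. is_chain T 1 w \<and> boundary T w = v"
        then obtain w where w: "is_chain T 1 w" "boundary T w = v" by blast
        have "(\<Sum>y\<in>gens T. v y * \<epsilon> y) = (\<Sum>y\<in>gens T. \<Sum>x\<in>gens T. w x * (bd F (g x) (g y) * bd F (g y) z))"
          unfolding w(2)[symmetric] boundary_def \<epsilon>_def T(4) by (simp add: sum_distrib_right mult.assoc)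
        also have "\<dots> = (\<Sum>x\<in>gens T. w x * (\<Sum>y\<in>gens T. bd F (g x) (g y) * bd F (g y) z))"
          unfolding sum_distrib_left by (rule sum.swap)
        also have "\<dots> = (\<Sum>x\<in>gens T. w x * (\<Sum>c\<in>gens F. bd F (g x) c * bd F c z))"
          using sumT[of "\<lambda>c. bd F (g _) c * bd F c z"] sumZ[of "\<lambda>c. bd F (g _) c * bd F c z"] bdz[OF z(1)] by simp
        also have "\<dots> = 0"
          using graded_bd_bd[OF gF _ z(1)] gZ by (intro sum.neutral) (auto simp: T)
        finally show "(\<Sum>b\<in>gens T. v b * \<epsilon> b) \<in> {0}" by simp
      qed
    qed
  qed
  moreover have "Poly_Mapping.lookup (bd T x y) 0 = 0" if "x \<in> gens T" "y \<in> gens T" for x y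
    using F gZ that unfolding unitfree_lookup[OF gF] by (simp add: T)
  moreover have "card {x \<in> gens T. hdeg T x = i \<and> mdeg T x = \<alpha>} = card {b \<in> gens F. hdeg F b = Suc i \<and> mdeg F b = \<alpha>}" for i \<alpha>
  proof (rule bij_betw_same_card[of g], rule bij_betw_imageI)
    show "inj_on g {x \<in> gens T. hdeg T x = i \<and> mdeg T x = \<alpha>}" using inj by (rule inj_on_subset) (auto simp: T)
    show "g ` {x \<in> gens T. hdeg T x = i \<and> mdeg T x = \<alpha>} = {b \<in> gens F. hdeg F b = Suc i \<and> mdeg F b = \<alpha>}"
    proof (intro equalityI subsetI)
      fix b assume "b \<in> g ` {x \<in> gens T. hdeg T x = i \<and> mdeg T x = \<alpha>}"
      then show "b \<in> {b \<in> gens F. hdeg F b = Suc i \<and> mdeg F b = \<alpha>}" using gZ hT by (auto simp: T(1,3))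
    next
      fix b assume b: "b \<in> {b \<in> gens F. hdeg F b = Suc i \<and> mdeg F b = \<alpha>}"
      then have "b \<in> Z" using z by (auto simp: Z_def)
      then show "b \<in> g ` {x \<in> gens T. hdeg T x = i \<and> mdeg T x = \<alpha>}"
        using gf[of b] b by (intro image_eqI[of _ _ "f b"]) (auto simp: T)
    qed
  qed
  ultimately show ?thesis unfolding minimal_free_resolution_def by blast
qed

text \<open>The inverse of the truncation: a generator \<open>None\<close> of R is put below a
  resolution of the module I, with the augmentation as last differential. Comparison of resolutions
  is available for R/I, while the Betti numbers in a splitting are those of I.\<close>

definition augment ::
  "('b, 'n::finite, 'k::field) free_complex \<Rightarrow> ('b \<Rightarrow> ('n, 'k) pol) \<Rightarrow> ('b option, 'n, 'k) free_complex" where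
  "augment F \<epsilon> = \<lparr> gens = insert None (Some ` gens F),
     hdeg = case_option 0 (\<lambda>b. Suc (hdeg F b)), mdeg = case_option 0 (mdeg F),
     bd = (\<lambda>x y. case x of None \<Rightarrow> 0 | Some b \<Rightarrow>
       (case y of None \<Rightarrow> if hdeg F b = 0 then \<epsilon> b else 0 | Some c \<Rightarrow> bd F b c)) \<rparr>"

lemma augment_sel:
  "gens (augment F \<epsilon>) = insert None (Some ` gens F)"
  "hdeg (augment F \<epsilon>) None = 0" "hdeg (augment F \<epsilon>) (Some b) = Suc (hdeg F b)"
  "mdeg (augment F \<epsilon>) None = 0" "mdeg (augment F \<epsilon>) (Some b) = mdeg F b"
  "bd (augment F \<epsilon>) None y = 0" "bd (augment F \<epsilon>) (Some b) (Some c) = bd F b c"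
  "bd (augment F \<epsilon>) (Some b) None = (if hdeg F b = 0 then \<epsilon> b else 0)"
  by (simp_all add: augment_def)

lemma strand_to_chain:
  fixes F :: "('b, 'n::finite, 'k::field) free_complex"
  assumes F: "graded_free_complex F" and v: "strand F i \<alpha> v"
  defines "p \<equiv> \<lambda>b. Poly_Mapping.single (\<alpha> - mdeg F b) (v b)"
  shows "is_chain F i p"
    and "c \<in> gens F \<Longrightarrow> boundary F p c = Poly_Mapping.single (\<alpha> - mdeg F c) (\<Sum>b\<in>gens F. v b * cf F b c)"
    and "part F p \<alpha> = v"
proof -
  show "is_chain F i p" using v unfolding is_chain_def p_def strand_def by (metis single_zero)
  show "part F p \<alpha> = v" using v by (auto simp: part_def p_def strand_def fun_eq_iff)
  assume c: "c \<in> gens F"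
  have "boundary F p c = (\<Sum>b\<in>gens F. Poly_Mapping.single (\<alpha> - mdeg F b) (v b) * Poly_Mapping.single (mdeg F b - mdeg F c) (cf F b c))"
    unfolding boundary_def p_def using c graded_cf[OF F] by auto
  also have "\<dots> = Poly_Mapping.single (\<alpha> - mdeg F c) (\<Sum>b\<in>gens F. v b * cf F b c)"
    by (rule sum_single_mult) (use v graded_cf_nonzero(2)[OF F _ c] in \<open>auto simp: strand_def\<close>)
  finally show "boundary F p c = \<dots>" .
qed

lemma part_boundary:
  assumes F: "graded_free_complex F" and w: "is_chain F j w" and c: "c \<in> gens F"
  shows "(\<Sum>b\<in>gens F. part F w \<alpha> b * cf F b c) = part F (boundary F w) \<alpha> c"
  using lookup_boundary[OF F c, of \<alpha> w] strand_boundary_zero[OF F c _ part_strand[OF w]] c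
  by (cases "mdeg F c \<le> \<alpha>") (auto simp: part_def)

text \<open>Exactness falls into three ranges: in degree 0 it is surjectivity of the augmentation,
  in degree 1 the description of its kernel, above that exactness of F. A new unit entry would need
  a basis element of multidegree 0, but the augmentation takes values in a proper ideal.\<close>

lemma resolves_augment:
  fixes F :: "('b, 'n::finite, 'k::field) free_complex"
  assumes R: "minimal_free_resolution I {0} F" and I: "monomial_ideal I" and I1: "0 \<notin> mons I"
  obtains \<epsilon> where "resolves (mons I) None (augment F \<epsilon>)" "unitfree (augment F \<epsilon>)"
proof -
  have gF: "graded_free_complex F" 
    and ex: "\<And>i v. 0 < i \<Longrightarrow> is_chain F i v \<Longrightarrow> boundary F v = 0 \<Longrightarrow> \<exists>w. is_chain F (Suc i) w \<and> boundary F w = v"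
    using R by (auto simp: minimal_free_resolution_def free_resolution_def)
  define aug where "aug \<epsilon> \<longleftrightarrow>
      (\<forall>b\<in>gens F. hdeg F b = 0 \<longrightarrow> \<epsilon> b \<in> I \<and> (\<forall>t\<in>Poly_Mapping.keys (\<epsilon> b). t = mdeg F b)) \<and>
      (\<forall>a\<in>I. \<exists>v. is_chain F 0 v \<and> a - (\<Sum>b\<in>gens F. v b * \<epsilon> b) \<in> {0}) \<and>
      (\<forall>v. is_chain F 0 v \<longrightarrow> ((\<Sum>b\<in>gens F. v b * \<epsilon> b) \<in> {0} \<longleftrightarrow> (\<exists>w. is_chain F 1 w \<and> boundary F w = v)))" for \<epsilon>
  have "\<exists>\<epsilon>. aug \<epsilon>"
    using R unfolding minimal_free_resolution_def free_resolution_def aug_def by (elim conjE)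
  then obtain \<epsilon> where "aug \<epsilon>" by blast
  then have \<epsilon>: "\<epsilon> b \<in> I" "t \<in> Poly_Mapping.keys (\<epsilon> b) \<Longrightarrow> t = mdeg F b" if "b \<in> gens F" "hdeg F b = 0" for b t
    using that by (auto simp: aug_def)
  have onto: "\<exists>v. is_chain F 0 v \<and> a - (\<Sum>b\<in>gens F. v b * \<epsilon> b) = 0" if "a \<in> I" for a
    using \<open>aug \<epsilon>\<close> that by (simp add: aug_def)
  have ker: "((\<Sum>b\<in>gens F. v b * \<epsilon> b) = 0) = (\<exists>w. is_chain F 1 w \<and> boundary F w = v)" if "is_chain F 0 v" for v
    using \<open>aug \<epsilon>\<close> that by (simp add: aug_def)
  have fin: "finite (gens F)" using gF by (rule graded_finite)
  define e where "e b = (if hdeg F b = 0 then Poly_Mapping.lookup (\<epsilon> b) (mdeg F b) else 0)" for b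
  have \<epsilon>e: "\<epsilon> b = Poly_Mapping.single (mdeg F b) (e b)" if "b \<in> gens F" "hdeg F b = 0" for b
    using homogeneous_eq_single[of "\<epsilon> b" 0 "mdeg F b"] \<epsilon>(2) that by (simp add: e_def)
  have sum\<epsilon>: "(\<Sum>b\<in>gens F. v b * \<epsilon> b) = (\<Sum>b\<in>gens F. v b * Poly_Mapping.single (mdeg F b - 0) (e b))"
    if "is_chain F 0 v" for v
  proof (rule sum.cong, goal_cases)
    case (2 b) then show ?case using \<epsilon>e[of b] that by (cases "v b = 0") (auto simp: is_chain_def)
  qed simp
  define A where "A = augment F \<epsilon>"
  note A = augment_sel[of F \<epsilon>, folded A_def]
  define k where "k x y = (case x of None \<Rightarrow> 0 | Some b \<Rightarrow> (case y of None \<Rightarrow> e b | Some c \<Rightarrow> cf F b c))" for x y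
  have bdA: "bd A x y = Poly_Mapping.single (mdeg A x - mdeg A y) (k x y)" if "x \<in> gens A" "y \<in> gens A" for x y
    using that \<epsilon>e graded_cf[OF gF] by (auto simp: A k_def e_def)
  have sumA: "(\<Sum>x\<in>gens A. h x) = h None + (\<Sum>b\<in>gens F. h (Some b))" for h :: "'b option \<Rightarrow> 'k"
    using fin by (simp add: A sum.reindex)
  have gA: "graded_free_complex A"
  proof (rule gradedI[OF _ bdA])
    show "finite (gens A)" using fin by (simp add: A)
    show "hdeg A x = Suc (hdeg A y) \<and> mdeg A y \<le> mdeg A x" if "x \<in> gens A" "y \<in> gens A" "k x y \<noteq> 0" for x y
      using that graded_cf_nonzero[OF gF] by (auto simp: A k_def e_def le_fun_def split: if_splits)
    fix x y assume xy: "x \<in> gens A" "y \<in> gens A" "hdeg A x = Suc (Suc (hdeg A y))"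
    then obtain b where b: "x = Some b" "b \<in> gens F" by (auto simp: A)
    show "(\<Sum>c\<in>gens A. k x c * k c y) = 0"
    proof (cases y)
      case (Some d)
      then have "d \<in> gens F" using xy(2) by (auto simp: A)
      then show ?thesis using graded_cf_cf[OF gF b(2)] b Some by (simp add: sumA k_def)
    next
      case None
      then have hb: "hdeg F b = 1" using xy(3) b by (simp add: A)
      \<comment> \<open>The image of the degree-1 element b is a boundary, so the augmentation kills
        it; this makes the differential square to zero at the new end.\<close>
      define v where "v c = (if c \<in> gens F then bd F b c else 0)" for c
      have v: "is_chain F 0 v" using graded_bd_nonzero[OF gF b(2)] hb by (auto simp: is_chain_def v_def)
      have "is_chain F 1 (\<lambda>c. if c = b then 1 else 0)" "boundary F (\<lambda>c. if c = b then 1 else 0) = v"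
        using b hb fin by (auto simp: is_chain_def boundary_def v_def fun_eq_iff if_distrib[of "\<lambda>x. x * _"] cong: if_cong)
      then have "0 = (\<Sum>c\<in>gens F. v c * \<epsilon> c)" using ker[OF v] by fastforce
      also have "\<dots> = (\<Sum>c\<in>gens F. Poly_Mapping.single (mdeg F b - mdeg F c) (cf F b c) * Poly_Mapping.single (mdeg F c - 0) (e c))"
        unfolding sum\<epsilon>[OF v] by (intro sum.cong refl) (use graded_cf[OF gF b(2)] in \<open>simp add: v_def\<close>)
      also have "\<dots> = Poly_Mapping.single (mdeg F b - 0) (\<Sum>c\<in>gens F. cf F b c * e c)"
        by (rule sum_single_mult) (use graded_cf_nonzero(2)[OF gF b(2)] in \<open>auto simp: le_fun_def\<close>)
      finally have "(\<Sum>c\<in>gens F. cf F b c * e c) = 0" by (metis lookup_single_eq lookup_zero)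
      then show ?thesis using None b by (simp add: sumA k_def)
    qed
  qed
  have cfA: "cf A x y = k x y" if "x \<in> gens A" "y \<in> gens A" for x y using cf_eqI[OF bdA[OF that]] .
  have eI: "mdeg F b \<in> mons I" if "b \<in> gens F" "e b \<noteq> 0" for b
  proof -
    have h: "hdeg F b = 0" using that by (auto simp: e_def split: if_splits)
    then have "Poly_Mapping.keys (\<epsilon> b) \<subseteq> mons I" using \<epsilon>(1)[OF that(1)] mem_monomial_ideal[OF I] by blast
    then show ?thesis using \<epsilon>e[OF that(1) h] that(2) by simp
  qed
  have exact: "exact_at A i \<alpha>" if i\<alpha>: "0 < i \<or> \<alpha> \<in> mons I" for i \<alpha>
    unfolding exact_at_def
  proof (intro allI impI)
    fix v assume v: "strand A i \<alpha> v \<and> (\<forall>y\<in>gens A. (\<Sum>x\<in>gens A. v x * cf A x y) = 0)"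
    define v' where "v' b = v (Some b)" for b
    have cyc: "v None * k None y + (\<Sum>b\<in>gens F. v' b * k (Some b) y) = 0" if "y \<in> gens A" for y
    proof -
      have "(\<Sum>x\<in>gens A. v x * cf A x y) = (\<Sum>x\<in>gens A. v x * k x y)" using cfA that by simp
      then show ?thesis using v that by (simp add: sumA v'_def)
    qed
    have cyc0: "(\<Sum>b\<in>gens F. v' b * e b) = 0" using cyc[of None] by (simp add: k_def A)
    have cyc1: "(\<Sum>b\<in>gens F. v' b * cf F b c) = 0" if "c \<in> gens F" for c using cyc[of "Some c"] that by (simp add: k_def A)
    have lift: "\<exists>w. strand A (Suc i) \<alpha> w \<and> (\<forall>y\<in>gens A. (\<Sum>x\<in>gens A. w x * cf A x y) = v y)"
      if u: "strand F i \<alpha> u" and 1: "\<And>c. c \<in> gens F \<Longrightarrow> (\<Sum>b\<in>gens F. u b * cf F b c) = v' c"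
        and 0: "(\<Sum>b\<in>gens F. u b * e b) = v None" for u
    proof (intro exI[of _ "case_option 0 u"] conjI ballI)
      show "strand A (Suc i) \<alpha> (case_option 0 u)" using u by (auto simp: strand_def A split: option.splits)
      fix y assume y: "y \<in> gens A"
      have "(\<Sum>x\<in>gens A. (case x of None \<Rightarrow> 0 | Some x \<Rightarrow> u x) * cf A x y) = (\<Sum>x\<in>gens A. (case x of None \<Rightarrow> 0 | Some x \<Rightarrow> u x) * k x y)"
        using cfA y by simp
      also have "\<dots> = (\<Sum>b\<in>gens F. u b * k (Some b) y)" by (simp add: sumA)
      also have "\<dots> = v y" using y 0 1 by (auto simp: A k_def v'_def)
      finally show "(\<Sum>x\<in>gens A. (case x of None \<Rightarrow> 0 | Some x \<Rightarrow> u x) * cf A x y) = v y" .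
    qed
    show "\<exists>w. strand A (Suc i) \<alpha> w \<and> (\<forall>y\<in>gens A. (\<Sum>x\<in>gens A. w x * cf A x y) = v y)"
    proof (cases i)
      case 0
      have vs: "v (Some b) = 0" for b using v 0 by (auto simp: strand_def A)
      have "Poly_Mapping.single \<alpha> (v None) \<in> I" using i\<alpha> 0 unfolding mem_monomial_ideal[OF I] by simp
      then obtain u where u: "is_chain F 0 u" "Poly_Mapping.single \<alpha> (v None) = (\<Sum>b\<in>gens F. u b * \<epsilon> b)"
        using onto by fastforce
      have "(\<Sum>b\<in>gens F. part F u \<alpha> b * e b) = v None"
        using lookup_combination[of 0 \<alpha> F e u] u(2) sum\<epsilon>[OF u(1)] by (simp add: le_fun_def) (metis lookup_single_eq)
      moreover have "(\<Sum>b\<in>gens F. part F u \<alpha> b * cf F b c) = v' c" if c: "c \<in> gens F" for c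
      proof -
        have "part F u \<alpha> b * cf F b c = 0" if "b \<in> gens F" for b
          using part_strand[OF u(1), of \<alpha>] graded_cf_nonzero(1)[OF gF that c] by (cases "cf F b c = 0") (auto simp: strand_def)
        then have "(\<Sum>b\<in>gens F. part F u \<alpha> b * cf F b c) = 0" by (rule sum.neutral[OF ballI])
        then show ?thesis using vs by (simp add: v'_def)
      qed
      ultimately show ?thesis using lift[of "part F u \<alpha>"] part_strand[OF u(1)] 0 by blast
    next
      case (Suc j)
      have vN: "v None = 0" using v Suc by (auto simp: strand_def A)
      have v': "strand F j \<alpha> v'" using v Suc by (auto simp: strand_def v'_def A)
      define p where "p = (\<lambda>b. Poly_Mapping.single (\<alpha> - mdeg F b) (v' b))"
      note chain = strand_to_chain[OF gF v', folded p_def]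
      have "boundary F p c = 0" for c
        using chain(2)[of c] cyc1[of c] by (cases "c \<in> gens F") (simp_all add: boundary_def)
      then have p: "is_chain F j p" "boundary F p = 0" "part F p \<alpha> = v'"
        using chain(1,3) by (auto simp: fun_eq_iff)
      have "\<exists>w. is_chain F (Suc j) w \<and> boundary F w = p"
      proof (cases j)
        case 0
        have "(\<Sum>b\<in>gens F. p b * \<epsilon> b) = (\<Sum>b\<in>gens F. Poly_Mapping.single (\<alpha> - mdeg F b) (v' b) * Poly_Mapping.single (mdeg F b - 0) (e b))"
          using sum\<epsilon>[of p] p(1) 0 by (simp add: p_def)
        also have "\<dots> = Poly_Mapping.single (\<alpha> - 0) (\<Sum>b\<in>gens F. v' b * e b)"
          by (rule sum_single_mult) (use v' in \<open>auto simp: strand_def le_fun_def\<close>)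
        finally show ?thesis using ker[of p] p(1) 0 cyc0 by simp
      next
        case Suc then show ?thesis using ex[of j p] p by simp
      qed
      then obtain w where w: "is_chain F (Suc j) w" "boundary F w = p" by blast
      have "e b = 0" if "part F w \<alpha> b \<noteq> 0" for b
        using part_strand[OF w(1), of \<alpha>] that by (auto simp: strand_def e_def)
      then have "(\<Sum>b\<in>gens F. part F w \<alpha> b * e b) = v None"
        unfolding vN by (intro sum.neutral ballI) (metis mult_eq_0_iff)
      then show ?thesis
        using lift[of "part F w \<alpha>"] part_strand[OF w(1), of \<alpha>] part_boundary[OF gF w(1), of _ \<alpha>] w(2) p(3) Suc by simp
    qed
  qed
  have "resolves (mons I) None A"
    unfolding resolves_def using gA exact cfA eI by (auto simp: A k_def)
  moreover have "unitfree A"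
  proof -
    have "unitfree F" using R unitfree_lookup[OF gF] by (simp add: minimal_free_resolution_def)
    moreover have "e b = 0" if "b \<in> gens F" "mdeg F b = 0" for b
      using eI[OF that(1)] I1 that(2) by (cases "e b = 0") auto
    ultimately show ?thesis unfolding unitfree_def using cfA by (auto simp: A k_def)
  qed
  ultimately show thesis using that by (simp add: A_def)
qed

text \<open>Truncating F shows that the count is attained. Any other candidate is augmented to a
  unit-free resolution of R/I, whose counts agree with those of F.\<close>

theorem betti_eq_card:
  fixes I :: "('n::finite, 'k::field) pol set" and F :: "('b, 'n, 'k) free_complex"
  assumes R: "resolves (mons I) z F" and I: "monomial_ideal I" "0 \<notin> mons I" and F: "unitfree F"
  shows "betti I {0} i \<alpha> = card {b \<in> gens F. hdeg F b = Suc i \<and> mdeg F b = \<alpha>}"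
  unfolding betti_def
proof (rule the_equality)
  show "\<exists>T :: (nat, 'n, 'k) free_complex. minimal_free_resolution I {0} T \<and>
      card {b \<in> gens F. hdeg F b = Suc i \<and> mdeg F b = \<alpha>} = card {b \<in> gens T. hdeg T b = i \<and> mdeg T b = \<alpha>}"
    using resolves_truncate[OF R I(1) F] by metis
  fix r assume "\<exists>T :: (nat, 'n, 'k) free_complex. minimal_free_resolution I {0} T \<and>
      r = card {b \<in> gens T. hdeg T b = i \<and> mdeg T b = \<alpha>}"
  then obtain T :: "(nat, 'n, 'k) free_complex" where T: "minimal_free_resolution I {0} T"
    "r = card {b \<in> gens T. hdeg T b = i \<and> mdeg T b = \<alpha>}" by blast
  obtain \<epsilon> where A: "resolves (mons I) None (augment T \<epsilon>)" "unitfree (augment T \<epsilon>)"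
    using resolves_augment[OF T(1) I] .
  have "{b \<in> gens (augment T \<epsilon>). hdeg (augment T \<epsilon>) b = Suc i \<and> mdeg (augment T \<epsilon>) b = \<alpha>} = Some ` {b \<in> gens T. hdeg T b = i \<and> mdeg T b = \<alpha>}"
    by (auto simp: augment_sel)
  then have "card {b \<in> gens (augment T \<epsilon>). hdeg (augment T \<epsilon>) b = Suc i \<and> mdeg (augment T \<epsilon>) b = \<alpha>} = r"
    by (simp add: T(2) card_image)
  then show "r = card {b \<in> gens F. hdeg F b = Suc i \<and> mdeg F b = \<alpha>}"
    using unitfree_card_eq[OF A R F, of "Suc i" \<alpha>] by simp
qed

section \<open>The Morse complex of a homogeneous acyclic matching\<close>

definition pos :: "'a list \<Rightarrow> 'a \<Rightarrow> nat" where
  "pos xs u = length (takeWhile (\<lambda>v. v \<noteq> u) xs)"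

lemma mem_takeWhile_iff_pos:
  "v \<in> set xs \<Longrightarrow> v \<in> set (takeWhile (\<lambda>w. w \<noteq> u) xs) \<longleftrightarrow> pos xs v < pos xs u"
  by (induction xs) (auto simp: pos_def)

lemma nth_pos: "u \<in> set xs \<Longrightarrow> xs ! pos xs u = u"
  by (induction xs) (auto simp: pos_def)

lemma inj_on_pos: "inj_on (pos xs) (set xs)"
  by (metis inj_onI nth_pos)

lemma incidence_eq_simplex_bd:
  assumes "\<tau> \<subseteq> set ms"
  shows "incidence ms \<tau> \<sigma> = simplex_bd (pos ms) \<tau> \<sigma>"
proof -
  have "\<tau> \<inter> set (takeWhile (\<lambda>v. v \<noteq> u) ms) = {v \<in> \<tau>. pos ms v < pos ms u}" for u
    using assms mem_takeWhile_iff_pos[of _ ms u] by auto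
  then show ?thesis unfolding incidence_def simplex_bd_def by (simp cong: if_cong)
qed

lemma of_int_simplex_bd: "of_int (simplex_bd key \<tau> \<sigma>) = (simplex_bd key \<tau> \<sigma> :: 'k::comm_ring_1)"
  unfolding simplex_bd_def of_int_sum by (intro sum.cong) auto

lemma simplex_bd_square:
  assumes "finite \<tau>" "facet \<sigma> \<tau>"
  shows "simplex_bd key \<tau> \<sigma> * simplex_bd key \<tau> \<sigma> = (1 :: 'k::comm_ring_1)"
  using assms by (auto simp: facet_def simplex_bd_face)

lemma mlcm_empty [simp]: "mlcm {} = 0"
  by (simp add: mlcm_def fun_eq_iff)

lemma mlcm_le_iff: "finite \<sigma> \<Longrightarrow> mlcm \<sigma> \<le> \<alpha> \<longleftrightarrow> (\<forall>m\<in>\<sigma>. m \<le> \<alpha>)"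
  by (auto simp: mlcm_def le_fun_def)

lemma mlcm_upper: "finite \<sigma> \<Longrightarrow> m \<in> \<sigma> \<Longrightarrow> m \<le> mlcm \<sigma>"
  using mlcm_le_iff by blast

lemma mlcm_mono: "finite \<tau> \<Longrightarrow> \<sigma> \<subseteq> \<tau> \<Longrightarrow> mlcm \<sigma> \<le> mlcm \<tau>"
  by (meson finite_subset mlcm_le_iff mlcm_upper subsetD)

text \<open>The monomial 1 is excluded so that the empty face, which generates R, stays
  critical.\<close>

locale morse_matching =
  fixes ms :: "'n::finite mon list" and M :: "'n matching"
  assumes no_unit: "0 \<notin> set ms"
    and matching: "homogeneous_acyclic_matching (set ms) M"
begin

abbreviation "G \<equiv> set ms"
abbreviation "crit \<equiv> critical G M"
abbreviation inc :: "'n face \<Rightarrow> 'n face \<Rightarrow> int" where "inc \<equiv> simplex_bd (pos ms)"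

definition "flow = {(\<tau>, \<sigma>). \<tau> \<subseteq> G \<and> facet \<sigma> \<tau> \<and> (\<sigma>, \<tau>) \<notin> M} \<union> M"

definition lower :: "'n face set" where "lower = fst ` M"
definition upper :: "'n face set" where "upper = snd ` M"

lemma M_facet: "(\<sigma>, \<tau>) \<in> M \<Longrightarrow> \<tau> \<subseteq> G" "(\<sigma>, \<tau>) \<in> M \<Longrightarrow> facet \<sigma> \<tau>" "(\<sigma>, \<tau>) \<in> M \<Longrightarrow> mlcm \<sigma> = mlcm \<tau>"
  using matching unfolding homogeneous_acyclic_matching_def by blast+

lemma M_unique:
  assumes "(\<sigma>, \<tau>) \<in> M" "(\<sigma>', \<tau>') \<in> M" "{\<sigma>, \<tau>} \<inter> {\<sigma>', \<tau>'} \<noteq> {}"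
  shows "\<sigma> = \<sigma>' \<and> \<tau> = \<tau>'"
proof -
  have "\<forall>e\<in>M. \<forall>e'\<in>M. {fst e, snd e} \<inter> {fst e', snd e'} \<noteq> {} \<longrightarrow> fst e = fst e' \<and> snd e = snd e'"
    using matching unfolding homogeneous_acyclic_matching_def split_beta by (elim conjE)
  from this[rule_format, OF assms(1,2)] assms(3) show ?thesis by simp
qed

lemma facet_subset: "facet \<sigma> \<tau> \<Longrightarrow> \<sigma> \<subseteq> \<tau>"
  by (auto simp: facet_def)

lemma facet_card: "facet \<sigma> \<tau> \<Longrightarrow> finite \<tau> \<Longrightarrow> card \<tau> = Suc (card \<sigma>)"
  unfolding facet_def using card.remove by fastforce

lemma fin_face: "\<tau> \<subseteq> G \<Longrightarrow> finite \<tau>"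
  using finite_subset by blast

lemma M_lower_subset: "(\<sigma>, \<tau>) \<in> M \<Longrightarrow> \<sigma> \<subseteq> G"
  using M_facet facet_subset by blast

lemma M_card: "(\<sigma>, \<tau>) \<in> M \<Longrightarrow> card \<tau> = Suc (card \<sigma>)"
  by (rule facet_card[OF M_facet(2) fin_face[OF M_facet(1)]])

lemma finite_M: "finite M"
proof (rule finite_subset)
  show "M \<subseteq> Pow G \<times> Pow G" by (clarify; use M_lower_subset M_facet(1) in blast)
qed simp

lemma finite_crit: "finite crit"
  by (rule finite_subset[of _ "Pow G"]) (auto simp: critical_def)

lemma crit_subset: "x \<in> crit \<Longrightarrow> x \<subseteq> G"
  by (simp add: critical_def)

lemma lower_upper: "lower \<inter> upper = {}" "lower \<inter> crit = {}" "upper \<inter> crit = {}"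
proof -
  show "lower \<inter> crit = {}" "upper \<inter> crit = {}" by (force simp: lower_def upper_def critical_def Field_def)+
  show "lower \<inter> upper = {}"
  proof (rule ccontr)
    assume "lower \<inter> upper \<noteq> {}"
    then obtain x \<beta> \<sigma> where "(x, \<beta>) \<in> M" "(\<sigma>, x) \<in> M" by (auto simp: lower_def upper_def)
    then show False using M_unique[of x \<beta> \<sigma> x] M_card by fastforce
  qed
qed

lemma face_cases: "x \<subseteq> G \<Longrightarrow> x \<in> crit \<or> x \<in> lower \<or> x \<in> upper"
  by (force simp: critical_def lower_def upper_def Field_def)

text \<open>The flow is a finite acyclic graph, so induction is possible in both directions: over
  the faces reachable from a given one, and over the faces from which it is reached.\<close>

lemma wf_flow: "wf ((flow\<inverse>)\<^sup>+)" and wf_flow': "wf (flow\<^sup>+)"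
proof -
  have "finite flow"
  proof (rule finite_subset)
    show "flow \<subseteq> Pow G \<times> Pow G" using M_lower_subset M_facet(1) facet_subset by (fastforce simp: flow_def)
  qed simp
  moreover have "acyclic flow" using matching unfolding homogeneous_acyclic_matching_def flow_def by blast
  ultimately show "wf ((flow\<inverse>)\<^sup>+)" "wf (flow\<^sup>+)"
    using finite_acyclic_wf_converse finite_acyclic_wf wf_trancl by blast+
qed

lemma flow_step:
  assumes "\<tau> \<subseteq> G" "facet \<alpha> \<tau>" "(\<alpha>, \<tau>) \<notin> M" "(\<alpha>, \<beta>) \<in> M"
  shows "(\<tau>, \<beta>) \<in> flow\<^sup>+"
proof -
  have "(\<tau>, \<alpha>) \<in> flow" "(\<alpha>, \<beta>) \<in> flow" using assms by (auto simp: flow_def)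
  then show ?thesis by auto
qed

definition paths :: "'n face \<Rightarrow> 'n face \<Rightarrow> ('n face \<times> 'n face) list set" where
  "paths \<tau> \<sigma> = {es. gradient_path M \<tau> es \<sigma>}"

definition exits :: "'n face \<Rightarrow> 'n matching" where
  "exits \<tau> = {(\<alpha>, \<beta>) \<in> M. facet \<alpha> \<tau> \<and> (\<alpha>, \<tau>) \<notin> M}"

lemma finite_exits: "finite (exits \<tau>)"
  by (rule finite_subset[OF _ finite_M]) (auto simp: exits_def)

lemma paths_rec:
  "paths \<tau> \<sigma> = (if facet \<sigma> \<tau> \<and> (\<sigma>, \<tau>) \<notin> M then {[]} else {}) \<union> (\<Union>e\<in>exits \<tau>. (#) e ` paths (snd e) \<sigma>)"
proof (rule set_eqI)
  fix es
  show "es \<in> paths \<tau> \<sigma> \<longleftrightarrow> es \<in> (if facet \<sigma> \<tau> \<and> (\<sigma>, \<tau>) \<notin> M then {[]} else {}) \<union> (\<Union>e\<in>exits \<tau>. (#) e ` paths (snd e) \<sigma>)"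
  proof (cases es)
    case Nil then show ?thesis by (auto simp: paths_def)
  next
    case (Cons e es')
    then show ?thesis by (cases e) (auto simp: paths_def exits_def)
  qed
qed

lemma finite_paths: "\<tau> \<subseteq> G \<Longrightarrow> finite (paths \<tau> \<sigma>)"
proof (induction \<tau> rule: wf_induct_rule[OF wf_flow])
  case (1 \<tau>)
  have "finite (paths (snd e) \<sigma>)" if e: "e \<in> exits \<tau>" for e
  proof (rule 1)
    obtain \<alpha> \<beta> where [simp]: "e = (\<alpha>, \<beta>)" by fastforce
    have "(\<tau>, \<beta>) \<in> flow\<^sup>+" using flow_step[OF 1(2)] e by (auto simp: exits_def)
    then show "(snd e, \<tau>) \<in> (flow\<inverse>)\<^sup>+" by (simp add: trancl_converse)
    show "snd e \<subseteq> G" using e M_facet(1) by (auto simp: exits_def)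
  qed
  then show ?case using finite_exits by (subst paths_rec) auto
qed

text \<open>The incidence numbers of the Morse complex, taken for every starting face because the
  recursion along a path passes through faces that are not critical.\<close>

definition W :: "'n face \<Rightarrow> 'n face \<Rightarrow> int" where
  "W \<tau> \<sigma> = (\<Sum>es\<in>paths \<tau> \<sigma>. path_weight ms \<tau> es \<sigma>)"

definition mate :: "'n face \<Rightarrow> 'n face" where
  "mate x = (THE \<beta>. (x, \<beta>) \<in> M)"

lemma mate_eq:
  assumes "(x, \<beta>) \<in> M" shows "mate x = \<beta>"
  unfolding mate_def
proof (rule the_equality)
  show "(x, \<beta>) \<in> M" by (fact assms)
  show "\<gamma> = \<beta>" if "(x, \<gamma>) \<in> M" for \<gamma> using M_unique[OF that assms] by simp
qed

lemma mate_M: "x \<in> lower \<Longrightarrow> (x, mate x) \<in> M"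
  using mate_eq by (auto simp: lower_def)

text \<open>The retraction of the Taylor complex onto the critical faces along the gradient flow.\<close>

definition retr :: "'n face \<Rightarrow> 'n face \<Rightarrow> int" where
  "retr x \<sigma> = (if x \<in> crit then (if x = \<sigma> then 1 else 0)
     else if x \<in> lower then - inc (mate x) x * W (mate x) \<sigma> else 0)"

lemma retr_crit: "x \<in> crit \<Longrightarrow> retr x \<sigma> = (if x = \<sigma> then 1 else 0)"
  and retr_lower: "x \<in> lower \<Longrightarrow> retr x \<sigma> = - inc (mate x) x * W (mate x) \<sigma>"
  and retr_upper: "x \<in> upper \<Longrightarrow> retr x \<sigma> = 0"
  using lower_upper by (auto simp: retr_def)

text \<open>Split off the first step of a path: it ends in \<sigma> at once or enters a matched pair
  at a facet x, and the remaining paths from the mate of x are what \<open>retr x\<close> collects.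
  A lower face matched with \<tau> may not be entered.\<close>

lemma W_rec:
  assumes \<tau>: "\<tau> \<subseteq> G" and \<sigma>: "\<sigma> \<in> crit"
  shows "W \<tau> \<sigma> = (\<Sum>x\<in>Pow G. if (x, \<tau>) \<in> M then 0 else inc \<tau> x * retr x \<sigma>)"
proof -
  define f where "f x = (if (x, \<tau>) \<in> M then 0 else inc \<tau> x * retr x \<sigma>)" for x
  have \<sigma>G: "\<sigma> \<subseteq> G" using \<sigma> crit_subset by blast
  have \<sigma>M: "(\<sigma>, \<beta>) \<notin> M" for \<beta> using \<sigma> by (auto simp: critical_def Field_def)
  have snd_sub: "snd e \<subseteq> G" if "e \<in> exits \<tau>" for e
    using that M_facet(1)[of "fst e" "snd e"] by (auto simp: exits_def)
  have inc_facet: "facet \<sigma> \<tau>" if "inc \<tau> \<sigma> \<noteq> 0" using that by (rule simplex_bd_nonzeroD)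
  have "W \<tau> \<sigma> = (\<Sum>es\<in>(if facet \<sigma> \<tau> \<and> (\<sigma>, \<tau>) \<notin> M then {[]} else {}). path_weight ms \<tau> es \<sigma>)
      + (\<Sum>es\<in>(\<Union>e\<in>exits \<tau>. (#) e ` paths (snd e) \<sigma>). path_weight ms \<tau> es \<sigma>)"
    unfolding W_def by (subst paths_rec, rule sum.union_disjoint) (use finite_exits finite_paths snd_sub in auto)
  also have "(\<Sum>es\<in>(if facet \<sigma> \<tau> \<and> (\<sigma>, \<tau>) \<notin> M then {[]} else {}). path_weight ms \<tau> es \<sigma>) = f \<sigma>"
    using incidence_eq_simplex_bd[OF \<tau>, of \<sigma>] inc_facet \<sigma> \<sigma>M by (auto simp: f_def retr_crit)
  also have "(\<Sum>es\<in>(\<Union>e\<in>exits \<tau>. (#) e ` paths (snd e) \<sigma>). path_weight ms \<tau> es \<sigma>)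
      = (\<Sum>e\<in>exits \<tau>. \<Sum>es\<in>(#) e ` paths (snd e) \<sigma>. path_weight ms \<tau> es \<sigma>)"
    by (rule sum.UNION_disjoint) (use finite_exits finite_paths snd_sub in auto)
  also have "\<dots> = (\<Sum>e\<in>exits \<tau>. f (fst e))"
  proof (rule sum.cong, goal_cases)
    case (2 e)
    obtain \<alpha> \<beta> where e: "e = (\<alpha>, \<beta>)" by fastforce
    have M: "(\<alpha>, \<beta>) \<in> M" "(\<alpha>, \<tau>) \<notin> M" using 2 by (auto simp: exits_def e)
    then have \<alpha>: "\<alpha> \<in> lower" "mate \<alpha> = \<beta>" "\<beta> \<subseteq> G" using mate_eq M_facet(1) by (force simp: lower_def)+
    have "(\<Sum>es\<in>(#) e ` paths (snd e) \<sigma>. path_weight ms \<tau> es \<sigma>) = (\<Sum>es\<in>paths \<beta> \<sigma>. inc \<tau> \<alpha> * - inc \<beta> \<alpha> * path_weight ms \<beta> es \<sigma>)"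
      by (subst sum.reindex) (simp_all add: e incidence_eq_simplex_bd[OF \<tau>] incidence_eq_simplex_bd[OF \<alpha>(3)])
    also have "\<dots> = f \<alpha>" using M \<alpha> by (simp add: f_def retr_lower W_def sum_distrib_left mult.assoc)
    finally show ?case by (simp add: e)
  qed simp
  also have "\<dots> = (\<Sum>x\<in>fst ` exits \<tau>. f x)"
  proof (subst sum.reindex)
    show "inj_on fst (exits \<tau>)"
    proof (rule inj_onI)
      fix e e' assume "e \<in> exits \<tau>" "e' \<in> exits \<tau>" "fst e = fst e'"
      then show "e = e'" using M_unique[of "fst e" "snd e" "fst e'" "snd e'"] by (auto simp: exits_def)
    qed
  qed simp
  also have "f \<sigma> + \<dots> = (\<Sum>x\<in>insert \<sigma> (fst ` exits \<tau>). f x)"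
    by (subst sum.insert) (use finite_exits \<sigma>M in \<open>auto simp: exits_def\<close>)
  also have "\<dots> = (\<Sum>x\<in>Pow G. f x)"
  proof (rule sum.mono_neutral_left)
    show "insert \<sigma> (fst ` exits \<tau>) \<subseteq> Pow G" using \<sigma>G by (auto simp: exits_def dest!: M_lower_subset)
    show "\<forall>x\<in>Pow G - insert \<sigma> (fst ` exits \<tau>). f x = 0"
    proof (intro ballI, rule ccontr)
      fix x assume x: "x \<in> Pow G - insert \<sigma> (fst ` exits \<tau>)" "f x \<noteq> 0"
      then have xM: "(x, \<tau>) \<notin> M" and 0: "inc \<tau> x \<noteq> 0" "retr x \<sigma> \<noteq> 0" by (auto simp: f_def split: if_splits)
      have "facet x \<tau>" using simplex_bd_nonzeroD[OF 0(1)] .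
      moreover have "x \<in> lower" using 0(2) x(1) face_cases[of x] retr_crit[of x \<sigma>] retr_upper[of x \<sigma>] by (metis DiffE PowD insertCI)
      ultimately have "(x, mate x) \<in> exits \<tau>" using mate_M xM by (auto simp: exits_def)
      then show False using x(1) by force
    qed
  qed simp
  finally show ?thesis by (simp add: f_def)
qed

lemma W_crit: "\<tau> \<in> crit \<Longrightarrow> \<sigma> \<in> crit \<Longrightarrow> W \<tau> \<sigma> = (\<Sum>x\<in>Pow G. inc \<tau> x * retr x \<sigma>)"
  by (subst W_rec) (auto simp: critical_def Field_def intro!: sum.cong)

lemma W_lower:
  assumes "x \<in> lower" "\<sigma> \<in> crit"
  shows "W (mate x) \<sigma> = (\<Sum>y\<in>Pow G - {x}. inc (mate x) y * retr y \<sigma>)"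
proof -
  note M = mate_M[OF assms(1)]
  have "((y, mate x) \<in> M) = (y = x)" for y using M M_unique[OF M, of y "mate x"] by auto
  then have "W (mate x) \<sigma> = (\<Sum>y\<in>Pow G. if y = x then 0 else inc (mate x) y * retr y \<sigma>)"
    using W_rec[OF M_facet(1)[OF M] assms(2)] by simp
  also have "\<dots> = (\<Sum>y\<in>Pow G - {x}. inc (mate x) y * retr y \<sigma>)"
    by (rule sum.mono_neutral_cong_right) auto
  finally show ?thesis .
qed

lemma inc_square: "x \<in> lower \<Longrightarrow> inc (mate x) x * inc (mate x) x = 1"
  by (rule simplex_bd_square[OF fin_face[OF M_facet(1)[OF mate_M]] M_facet(2)[OF mate_M]])

text \<open>The sign in \<open>retr\<close> is chosen for this: the term of the matched lower face
  cancels the terms of all other facets.\<close>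

lemma retr_boundary_upper:
  assumes "\<tau> \<in> upper" "\<sigma> \<in> crit"
  shows "(\<Sum>y\<in>Pow G. inc \<tau> y * retr y \<sigma>) = 0"
proof -
  obtain x where x: "(x, \<tau>) \<in> M" using assms by (auto simp: upper_def)
  then have l: "x \<in> lower" "mate x = \<tau>" "x \<in> Pow G" using mate_eq[OF x] M_lower_subset[OF x]
    by (auto simp: lower_def intro: rev_image_eqI)
  have "(\<Sum>y\<in>Pow G. inc \<tau> y * retr y \<sigma>) = inc \<tau> x * retr x \<sigma> + W \<tau> \<sigma>"
    using W_lower[OF l(1) assms(2)] l by (simp add: sum.remove[of _ x])
  also have "inc \<tau> x * retr x \<sigma> = - (inc \<tau> x * inc \<tau> x * W \<tau> \<sigma>)" using l by (simp add: retr_lower)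
  finally show ?thesis using inc_square[OF l(1)] l by simp
qed

lemma inc_inc:
  assumes "\<tau> \<subseteq> G" shows "(\<Sum>y\<in>Pow G. inc \<tau> y * inc y z) = 0"
  using assms fin_face inj_on_subset[OF inj_on_pos] by (intro simplex_bd_bd) auto

text \<open>Induction along the flow. For a lower face x with mate \<beta>, the double boundary of
  \<beta> is zero, which expresses the boundary of x by the boundaries of the other facets of
  \<beta>; these are reached from x by the flow.\<close>

lemma retr_chain_map:
  assumes "x \<subseteq> G" "\<sigma> \<in> crit"
  shows "(\<Sum>y\<in>Pow G. inc x y * retr y \<sigma>) = (\<Sum>w\<in>crit. retr x w * W w \<sigma>)"
  using assms(1)
proof (induction x rule: wf_induct_rule[OF wf_flow])
  case (1 x)
  consider "x \<in> crit" | "x \<in> upper" | "x \<in> lower" using face_cases 1(2) by blast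
  then show ?case
  proof cases
    assume x: "x \<in> crit"
    have "(\<Sum>w\<in>crit. retr x w * W w \<sigma>) = (\<Sum>w\<in>crit. if x = w then W x \<sigma> else 0)"
      by (intro sum.cong) (use x in \<open>auto simp: retr_crit\<close>)
    then show ?thesis using x finite_crit W_crit[OF x assms(2)] by simp
  next
    assume x: "x \<in> upper"
    then show ?thesis using retr_boundary_upper[OF x assms(2)] by (simp add: retr_upper)
  next
    assume x: "x \<in> lower"
    define \<beta> where "\<beta> = mate x"
    have M: "(x, \<beta>) \<in> M" using mate_M x by (simp add: \<beta>_def)
    have \<beta>: "\<beta> \<subseteq> G" using M_facet(1) M .
    have ii: "inc \<beta> x * inc \<beta> x = 1" using inc_square x by (simp add: \<beta>_def)
    have IH: "inc \<beta> y * (\<Sum>z\<in>Pow G. inc y z * retr z \<sigma>) = inc \<beta> y * (\<Sum>w\<in>crit. retr y w * W w \<sigma>)" if y: "y \<in> Pow G - {x}" for y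
    proof (cases "inc \<beta> y = 0")
      case False
      then have "facet y \<beta>" by (rule simplex_bd_nonzeroD)
      moreover have "(y, \<beta>) \<notin> M" using M_unique[OF M, of y \<beta>] y by auto
      ultimately have "(x, \<beta>) \<in> flow" "(\<beta>, y) \<in> flow" using M \<beta> by (auto simp: flow_def)
      then have "(x, y) \<in> flow\<^sup>+" by auto
      then show ?thesis using 1(1)[of y] y by (simp add: trancl_converse)
    qed simp
    have bd: "inc \<beta> x * inc x z = - (\<Sum>y\<in>Pow G - {x}. inc \<beta> y * inc y z)" for z
      using inc_inc[OF \<beta>, of z] 1(2) by (simp add: sum.remove[of "Pow G" x])
    have "(\<Sum>z\<in>Pow G. inc x z * retr z \<sigma>) = inc \<beta> x * (\<Sum>z\<in>Pow G. (inc \<beta> x * inc x z) * retr z \<sigma>)"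
      using ii by (simp add: sum_distrib_left flip: mult.assoc)
    also have "(\<Sum>z\<in>Pow G. (inc \<beta> x * inc x z) * retr z \<sigma>) = - (\<Sum>y\<in>Pow G - {x}. inc \<beta> y * (\<Sum>z\<in>Pow G. inc y z * retr z \<sigma>))"
      unfolding bd minus_mult_left[symmetric] sum_negf sum_distrib_left sum_distrib_right
      by (subst sum.swap) (simp add: mult.assoc)
    also have "\<dots> = - (\<Sum>y\<in>Pow G - {x}. inc \<beta> y * (\<Sum>w\<in>crit. retr y w * W w \<sigma>))"
      by (simp only: sum.cong[OF refl IH])
    also have "\<dots> = - (\<Sum>w\<in>crit. (\<Sum>y\<in>Pow G - {x}. inc \<beta> y * retr y w) * W w \<sigma>)"
      unfolding sum_distrib_left sum_distrib_right by (subst sum.swap) (simp add: mult.assoc)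
    also have "\<dots> = - (\<Sum>w\<in>crit. W \<beta> w * W w \<sigma>)"
      using W_lower[OF x] by (simp add: \<beta>_def cong: sum.cong)
    also have "inc \<beta> x * \<dots> = (\<Sum>w\<in>crit. retr x w * W w \<sigma>)"
      using x by (simp add: retr_lower \<beta>_def sum_distrib_left sum_negf mult.assoc)
    finally show ?thesis .
  qed
qed

text \<open>The retraction commutes with the differentials, so the double Morse boundary is the
  retraction of a double simplicial boundary.\<close>

lemma W_W:
  assumes "\<tau> \<in> crit" "\<sigma> \<in> crit"
  shows "(\<Sum>w\<in>crit. W \<tau> w * W w \<sigma>) = 0"
proof -
  have "(\<Sum>w\<in>crit. W \<tau> w * W w \<sigma>) = (\<Sum>w\<in>crit. (\<Sum>x\<in>Pow G. inc \<tau> x * retr x w) * W w \<sigma>)"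
    using W_crit[OF assms(1)] by (simp cong: sum.cong)
  also have "\<dots> = (\<Sum>x\<in>Pow G. inc \<tau> x * (\<Sum>w\<in>crit. retr x w * W w \<sigma>))"
    unfolding sum_distrib_left sum_distrib_right by (subst sum.swap) (simp add: mult.assoc)
  also have "\<dots> = (\<Sum>x\<in>Pow G. inc \<tau> x * (\<Sum>y\<in>Pow G. inc x y * retr y \<sigma>))"
    by (intro sum.cong refl) (simp add: retr_chain_map[OF _ assms(2)])
  also have "\<dots> = (\<Sum>y\<in>Pow G. (\<Sum>x\<in>Pow G. inc \<tau> x * inc x y) * retr y \<sigma>)"
    unfolding sum_distrib_left sum_distrib_right by (subst sum.swap) (simp add: mult.assoc)
  also have "\<dots> = 0" using inc_inc crit_subset[OF assms(1)] by simp
  finally show ?thesis .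
qed

lemma gradient_path_degrees:
  "gradient_path M \<tau> es \<sigma> \<Longrightarrow> \<tau> \<subseteq> G \<Longrightarrow> card \<tau> = Suc (card \<sigma>) \<and> mlcm \<sigma> \<le> mlcm \<tau>"
proof (induction es arbitrary: \<tau>)
  case Nil
  then have "facet \<sigma> \<tau>" "finite \<tau>" using fin_face by auto
  then show ?case using facet_card[of \<sigma> \<tau>] mlcm_mono[of \<tau> \<sigma>] facet_subset[of \<sigma> \<tau>] by blast
next
  case (Cons e es)
  obtain \<alpha> \<beta> where e: "e = (\<alpha>, \<beta>)" by fastforce
  then have *: "facet \<alpha> \<tau>" "(\<alpha>, \<beta>) \<in> M" "gradient_path M \<beta> es \<sigma>" using Cons.prems by auto
  then have "card \<beta> = Suc (card \<sigma>)" "mlcm \<sigma> \<le> mlcm \<beta>" using Cons.IH M_facet(1) by blast+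
  moreover have "card \<tau> = Suc (card \<alpha>)" "card \<beta> = Suc (card \<alpha>)" "mlcm \<alpha> = mlcm \<beta>"
    using facet_card[OF *(1)] M_card M_facet(3) * Cons.prems fin_face by auto
  moreover have "mlcm \<alpha> \<le> mlcm \<tau>" by (rule mlcm_mono[OF fin_face[OF Cons.prems(2)] facet_subset[OF *(1)]])
  ultimately show ?case by (metis order_trans)
qed

lemma W_nonzeroD:
  assumes "\<tau> \<subseteq> G" "W \<tau> \<sigma> \<noteq> 0"
  shows "card \<tau> = Suc (card \<sigma>) \<and> mlcm \<sigma> \<le> mlcm \<tau>" "\<exists>es. gradient_path M \<tau> es \<sigma>"
proof -
  obtain es where "gradient_path M \<tau> es \<sigma>" using assms(2) unfolding W_def paths_def by (auto elim: sum_nonzeroE)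
  then show "card \<tau> = Suc (card \<sigma>) \<and> mlcm \<sigma> \<le> mlcm \<tau>" "\<exists>es. gradient_path M \<tau> es \<sigma>"
    using gradient_path_degrees assms(1) by blast+
qed

lemma retr_nonzeroD:
  assumes "x \<subseteq> G" "retr x \<sigma> \<noteq> 0"
  shows "card \<sigma> = card x \<and> mlcm \<sigma> \<le> mlcm x"
proof -
  consider "x \<in> crit" | "x \<in> lower" using face_cases[OF assms(1)] assms(2) by (auto simp: retr_upper)
  then show ?thesis
  proof cases
    assume "x \<in> crit" then show ?thesis using assms(2) by (auto simp: retr_crit split: if_splits)
  next
    assume x: "x \<in> lower"
    then have "W (mate x) \<sigma> \<noteq> 0" using assms(2) by (auto simp: retr_lower)
    then show ?thesis using W_nonzeroD(1)[of "mate x" \<sigma>] M_facet[OF mate_M[OF x]] M_card[OF mate_M[OF x]] by auto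
  qed
qed

end

section \<open>Exactness of the Morse complex\<close>

context morse_matching
begin

lemma morse_sel:
  "gens (morse_complex ms M :: (_, 'n, 'k::field) free_complex) = crit"
  "hdeg (morse_complex ms M :: (_, 'n, 'k) free_complex) = card"
  "mdeg (morse_complex ms M :: (_, 'n, 'k) free_complex) = mlcm"
  "bd (morse_complex ms M :: (_, 'n, 'k) free_complex) \<tau> \<sigma> = Poly_Mapping.single (mlcm \<tau> - mlcm \<sigma>) (of_int (W \<tau> \<sigma>))"
  by (simp_all add: morse_complex_def W_def paths_def)

lemma morse_cf: "cf (morse_complex ms M :: (_, 'n, 'k::field) free_complex) \<tau> \<sigma> = of_int (W \<tau> \<sigma>)"
  by (simp add: cf_def morse_sel)

lemma empty_crit: "{} \<in> crit"
proof -
  have "({}, \<tau>) \<notin> M" for \<tau>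
  proof
    assume M: "({}, \<tau>) \<in> M"
    then obtain u where "u \<in> \<tau>" using M_facet(2)[OF M] by (auto simp: facet_def)
    then have "u \<le> 0" using M_facet(1,3)[OF M] mlcm_upper[OF fin_face, of \<tau> u] by simp
    then have "u = 0" by (auto simp: le_fun_def fun_eq_iff)
    then show False using no_unit M_facet(1)[OF M] \<open>u \<in> \<tau>\<close> by auto
  qed
  moreover have "(\<sigma>, {}) \<notin> M" for \<sigma> using M_facet(2) by (auto simp: facet_def)
  ultimately show ?thesis by (auto simp: critical_def Field_def)
qed

lemma morse_graded: "graded_free_complex (morse_complex ms M :: (_, 'n, 'k::field) free_complex)"
proof (rule gradedI[where k = "\<lambda>\<tau> \<sigma>. of_int (W \<tau> \<sigma>)"], unfold morse_sel)
  show "card b = Suc (card c) \<and> mlcm c \<le> mlcm b" if "b \<in> crit" "of_int (W b c) \<noteq> (0 :: 'k)" for b c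
    using W_nonzeroD(1)[OF crit_subset[OF that(1)], of c] that(2) by (metis of_int_0)
  show "(\<Sum>c\<in>crit. of_int (W b c) * of_int (W c e)) = (0 :: 'k)" if "b \<in> crit" "e \<in> crit" for b e
    using arg_cong[OF W_W[OF that], of of_int] by (simp only: of_int_sum of_int_mult of_int_0)
qed (simp_all add: finite_crit)

text \<open>The boundary matrix from upper to lower faces is triangular along the flow, with 1 or -1
  at the matched pairs. At a member \<beta> of the support that the flow reaches from no other
  member, only \<beta> contributes to the coefficient of its matched facet.\<close>

lemma upper_injective:
  fixes u :: "'n face \<Rightarrow> 'k::field"
  assumes u: "\<And>\<tau>. u \<tau> \<noteq> 0 \<Longrightarrow> \<tau> \<in> upper"
    and bd: "\<And>y. y \<in> lower \<Longrightarrow> (\<Sum>\<tau>\<in>Pow G. u \<tau> * simplex_bd (pos ms) \<tau> y) = 0"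
  shows "u \<tau> = 0"
proof (rule ccontr)
  assume "u \<tau> \<noteq> 0"
  then obtain \<beta> where \<beta>: "u \<beta> \<noteq> 0" "\<And>\<gamma>. (\<gamma>, \<beta>) \<in> flow\<^sup>+ \<Longrightarrow> u \<gamma> = 0"
    using wfE_min[OF wf_flow', of \<tau> "{\<tau>. u \<tau> \<noteq> 0}"] by auto
  obtain x where M: "(x, \<beta>) \<in> M" using u[OF \<beta>(1)] by (auto simp: upper_def)
  then have x: "x \<in> lower" by (force simp: lower_def)
  have f: "facet x \<beta>" "\<beta> \<subseteq> G" using M_facet M by blast+
  have zero: "u \<gamma> * simplex_bd (pos ms) \<gamma> x = 0" if \<gamma>: "\<gamma> \<in> Pow G" "\<gamma> \<noteq> \<beta>" for \<gamma>
  proof (rule ccontr)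
    assume "u \<gamma> * simplex_bd (pos ms) \<gamma> x \<noteq> 0"
    then have ne: "u \<gamma> \<noteq> 0" and "simplex_bd (pos ms) \<gamma> x \<noteq> (0 :: 'k)" by auto
    then have "facet x \<gamma>" using simplex_bd_nonzeroD by blast
    moreover have "(x, \<gamma>) \<notin> M" using M_unique[OF M, of x \<gamma>] \<gamma>(2) by auto
    ultimately have "(\<gamma>, \<beta>) \<in> flow\<^sup>+" using flow_step[of \<gamma> x \<beta>] \<gamma>(1) M by auto
    then show False using \<beta>(2) ne by blast
  qed
  have "(\<Sum>\<gamma>\<in>Pow G - {\<beta>}. u \<gamma> * simplex_bd (pos ms) \<gamma> x) = 0"
    by (intro sum.neutral ballI zero) auto
  then have "(\<Sum>\<gamma>\<in>Pow G. u \<gamma> * simplex_bd (pos ms) \<gamma> x) = u \<beta> * simplex_bd (pos ms) \<beta> x"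
    using f by (simp add: sum.remove[of "Pow G" \<beta>])
  then have "u \<beta> * simplex_bd (pos ms) \<beta> x = 0" using bd[OF x] by simp
  then show False using \<beta>(1) simplex_bd_square[OF fin_face[OF f(2)] f(1), of "pos ms", where 'k = 'k] by auto
qed

text \<open>The same triangularity yields solvability: the mate of x hits x, and the other lower
  facets of the mate, which the flow reaches from x, are corrected by induction.\<close>

lemma lower_solvable:
  assumes "x \<in> lower"
  shows "\<exists>u :: 'n face \<Rightarrow> 'k::field. (\<forall>\<tau>. u \<tau> \<noteq> 0 \<longrightarrow> \<tau> \<in> upper \<and> card \<tau> = Suc (card x) \<and> mlcm \<tau> \<le> mlcm x) \<and>
     (\<forall>y\<in>lower. (\<Sum>\<tau>\<in>Pow G. u \<tau> * simplex_bd (pos ms) \<tau> y) = (if x = y then 1 else 0))"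
  using assms
proof (induction x rule: wf_induct_rule[OF wf_flow])
  case (1 x)
  define I :: "'n face \<Rightarrow> 'n face \<Rightarrow> 'k" where "I = simplex_bd (pos ms)"
  define P where "P x u \<longleftrightarrow> (\<forall>\<tau>. u \<tau> \<noteq> 0 \<longrightarrow> \<tau> \<in> upper \<and> card \<tau> = Suc (card x) \<and> mlcm \<tau> \<le> mlcm x) \<and>
     (\<forall>y\<in>lower. (\<Sum>\<tau>\<in>Pow G. u \<tau> * I \<tau> y) = (if x = y then 1 else 0))" for x u
  define \<beta> where "\<beta> = mate x"
  have M: "(x, \<beta>) \<in> M" using mate_M 1(2) by (simp add: \<beta>_def)
  have \<beta>: "\<beta> \<subseteq> G" "\<beta> \<in> upper" "facet x \<beta>" "mlcm x = mlcm \<beta>" "card \<beta> = Suc (card x)"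
    using M_facet[OF M] M M_card[OF M] by (force simp: upper_def)+
  have ii: "I \<beta> x * I \<beta> x = 1" unfolding I_def by (rule simplex_bd_square[OF fin_face[OF \<beta>(1)] \<beta>(3)])
  define Y where "Y = {y \<in> lower. y \<noteq> x \<and> facet y \<beta>}"
  have Y: "y \<subseteq> G" "card y = card x" "mlcm y \<le> mlcm x" if "y \<in> Y" for y
    using that facet_subset[of y \<beta>] facet_card[of y \<beta>] mlcm_mono[of \<beta> y] \<beta> fin_face[OF \<beta>(1)] by (auto simp: Y_def)
  have fY: "finite Y" by (rule finite_subset[of _ "Pow G"]) (use Y(1) in auto)
  have "\<exists>u. P y u" if y: "y \<in> Y" for y
  proof -
    have "(y, \<beta>) \<notin> M" using M_unique[OF M, of y \<beta>] y by (auto simp: Y_def)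
    then have "(x, \<beta>) \<in> flow" "(\<beta>, y) \<in> flow" using M \<beta>(1) y by (auto simp: flow_def Y_def)
    then have "(x, y) \<in> flow\<^sup>+" by auto
    then have "(y, x) \<in> (flow\<inverse>)\<^sup>+" by (simp add: trancl_converse)
    moreover have "y \<in> lower" using y by (simp add: Y_def)
    ultimately show ?thesis using 1(1)[of y] unfolding P_def I_def by blast
  qed
  then obtain w where w: "\<And>y. y \<in> Y \<Longrightarrow> P y (w y)" by metis
  \<comment> \<open>The sign \<open>I \<beta> x\<close> is its own inverse and normalizes the
    coefficient of x to 1.\<close>
  define u where "u \<tau> = I \<beta> x * ((if \<tau> = \<beta> then 1 else 0) - (\<Sum>y\<in>Y. I \<beta> y * w y \<tau>))" for \<tau>
  have "\<tau> \<in> upper \<and> card \<tau> = Suc (card x) \<and> mlcm \<tau> \<le> mlcm x" if ne: "u \<tau> \<noteq> 0" for \<tau>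
  proof (cases "\<tau> = \<beta>")
    case True then show ?thesis using \<beta> by simp
  next
    case False
    then have "(\<Sum>y\<in>Y. I \<beta> y * w y \<tau>) \<noteq> 0" using ne by (auto simp: u_def)
    then obtain y where "y \<in> Y" "I \<beta> y * w y \<tau> \<noteq> 0" by (rule sum_nonzeroE)
    then have "\<tau> \<in> upper \<and> card \<tau> = Suc (card y) \<and> mlcm \<tau> \<le> mlcm y" using w[of y] unfolding P_def by auto
    then show ?thesis using Y[OF \<open>y \<in> Y\<close>] order_trans by auto
  qed
  moreover have "(\<Sum>\<tau>\<in>Pow G. u \<tau> * I \<tau> z) = (if x = z then 1 else 0)" if z: "z \<in> lower" for z
  proof -
    have "(\<Sum>\<tau>\<in>Pow G. u \<tau> * I \<tau> z) = I \<beta> x * ((\<Sum>\<tau>\<in>Pow G. if \<tau> = \<beta> then I \<tau> z else 0) - (\<Sum>\<tau>\<in>Pow G. (\<Sum>y\<in>Y. I \<beta> y * w y \<tau>) * I \<tau> z))"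
      unfolding sum_subtractf[symmetric] sum_distrib_left by (intro sum.cong refl) (simp add: u_def algebra_simps)
    also have "(\<Sum>\<tau>\<in>Pow G. if \<tau> = \<beta> then I \<tau> z else 0) = I \<beta> z" using \<beta>(1) by simp
    also have "(\<Sum>\<tau>\<in>Pow G. (\<Sum>y\<in>Y. I \<beta> y * w y \<tau>) * I \<tau> z) = (\<Sum>y\<in>Y. I \<beta> y * (\<Sum>\<tau>\<in>Pow G. w y \<tau> * I \<tau> z))"
      unfolding sum_distrib_left sum_distrib_right by (subst sum.swap) (simp add: mult.assoc)
    also have "\<dots> = (\<Sum>y\<in>Y. if y = z then I \<beta> z else 0)"
      by (intro sum.cong refl) (use w z in \<open>auto simp: P_def\<close>)
    also have "\<dots> = (if z \<in> Y then I \<beta> z else 0)" using fY by simp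
    finally have "(\<Sum>\<tau>\<in>Pow G. u \<tau> * I \<tau> z) = I \<beta> x * (I \<beta> z - (if z \<in> Y then I \<beta> z else 0))" .
    moreover have "I \<beta> z = 0" if "z \<notin> Y" "z \<noteq> x"
    proof (rule ccontr)
      assume "I \<beta> z \<noteq> 0"
      then have "facet z \<beta>" unfolding I_def by (rule simplex_bd_nonzeroD)
      then show False using that z by (simp add: Y_def)
    qed
    moreover have "x \<notin> Y" by (simp add: Y_def)
    ultimately show ?thesis using ii by auto
  qed
  ultimately show ?case unfolding I_def by blast
qed

text \<open>A Morse cycle is lifted to a cycle of the full simplex by adding upper faces, the lift
  is filled in the simplex on the generators dividing \<alpha>, and the filling is retracted to the
  critical faces.\<close>

theorem morse_resolves:
  "resolves {\<alpha>. \<exists>m\<in>G. m \<le> \<alpha>} {} (morse_complex ms M :: (_, 'n, 'k::field) free_complex)"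
proof -
  let ?X = "morse_complex ms M :: (_, 'n, 'k) free_complex"
  define I :: "'n face \<Rightarrow> 'n face \<Rightarrow> 'k" where "I = simplex_bd (pos ms)"
  define r :: "'n face \<Rightarrow> 'n face \<Rightarrow> 'k" where "r x \<sigma> = of_int (retr x \<sigma>)" for x \<sigma>
  define w :: "'n face \<Rightarrow> 'n face \<Rightarrow> 'k" where "w x \<sigma> = of_int (W x \<sigma>)" for x \<sigma>
  have I: "I x y = of_int (inc x y)" for x y by (simp add: I_def of_int_simplex_bd)
  have chain: "(\<Sum>y\<in>Pow G. I x y * r y \<sigma>) = (\<Sum>c\<in>crit. r x c * w c \<sigma>)" if "x \<subseteq> G" "\<sigma> \<in> crit" for x \<sigma>
    using arg_cong[OF retr_chain_map[OF that], of of_int] by (simp only: I r_def w_def of_int_sum of_int_mult)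
  have II: "(\<Sum>y\<in>Pow G. I x y * I y z) = 0" if "x \<subseteq> G" for x z
    using arg_cong[OF inc_inc[OF that], of of_int] by (simp only: I of_int_sum of_int_mult of_int_0)
  have "exact_at ?X i \<alpha>" if i\<alpha>: "0 < i \<or> (\<exists>m\<in>G. m \<le> \<alpha>)" for i \<alpha>
    unfolding exact_at_def
  proof (intro allI impI)
    fix v assume "strand ?X i \<alpha> v \<and> (\<forall>c\<in>gens ?X. (\<Sum>b\<in>gens ?X. v b * cf ?X b c) = 0)"
    then have v: "\<And>b. v b \<noteq> 0 \<Longrightarrow> b \<in> crit \<and> card b = i \<and> mlcm b \<le> \<alpha>"
      and cyc: "\<And>c. c \<in> crit \<Longrightarrow> (\<Sum>b\<in>crit. v b * w b c) = 0"
      by (auto simp: strand_def morse_sel morse_cf w_def)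
    show "\<exists>u. strand ?X (Suc i) \<alpha> u \<and> (\<forall>c\<in>gens ?X. (\<Sum>b\<in>gens ?X. u b * cf ?X b c) = v c)"
    proof (cases "\<exists>m\<in>G. m \<le> \<alpha>")
      case False
      \<comment> \<open>No generator divides \<alpha>, so only the empty face could occur; it has
        homological degree 0, while i is positive here.\<close>
      have "v b = 0" for b
      proof (rule ccontr)
        assume "v b \<noteq> 0"
        then have b: "b \<in> crit" "card b = i" "mlcm b \<le> \<alpha>" using v by blast+
        then have "b \<noteq> {}" "b \<subseteq> G" using i\<alpha> False crit_subset by auto
        then obtain m where "m \<in> b" "m \<in> G" by blast
        then have "m \<le> \<alpha>" using mlcm_upper[OF fin_face[OF \<open>b \<subseteq> G\<close>]] b(3) order_trans by blast
        then show False using False \<open>m \<in> G\<close> by blast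
      qed
      then show ?thesis by (intro exI[of _ "\<lambda>_. 0"]) (auto simp: strand_def)
    next
      case True
      then obtain m where m: "m \<in> G" "m \<le> \<alpha>" by blast
      define PU where "PU x u \<longleftrightarrow> (\<forall>\<tau>. u \<tau> \<noteq> 0 \<longrightarrow> \<tau> \<in> upper \<and> card \<tau> = Suc (card x) \<and> mlcm \<tau> \<le> mlcm x) \<and>
        (\<forall>y\<in>lower. (\<Sum>\<tau>\<in>Pow G. u \<tau> * I \<tau> y) = (if x = y then 1 else 0))" for x u
      have "\<exists>u. PU x u" if "x \<in> lower" for x using lower_solvable[OF that, where 'k = 'k] unfolding PU_def I_def .
      then obtain U where PU: "\<And>x. x \<in> lower \<Longrightarrow> PU x (U x)" by metis
      have U: "U x \<tau> \<noteq> 0 \<Longrightarrow> \<tau> \<in> upper \<and> card \<tau> = Suc (card x) \<and> mlcm \<tau> \<le> mlcm x"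
        "y \<in> lower \<Longrightarrow> (\<Sum>\<tau>\<in>Pow G. U x \<tau> * I \<tau> y) = (if x = y then 1 else 0)" if "x \<in> lower" for x y \<tau>
        using PU[OF that] unfolding PU_def by blast+
      have flow: "finite lower" "lower \<subseteq> Pow G" using finite_M by (auto simp: lower_def dest!: M_lower_subset)
      have upG: "upper \<subseteq> Pow G" by (auto simp: upper_def dest!: M_facet(1))
      define g where "g y = (\<Sum>b\<in>Pow G. v b * I b y)" for y
      \<comment> \<open>The correction by upper faces is chosen so as to cancel the lower part of
        the boundary of v.\<close>
      define v1 where "v1 \<tau> = v \<tau> - (\<Sum>y\<in>lower. g y * U y \<tau>)" for \<tau>
      define h where "h c = (\<Sum>b\<in>Pow G. v1 b * I b c)" for c
      have gdeg: "i = Suc (card y) \<and> mlcm y \<le> \<alpha>" if ne: "g y \<noteq> 0" for y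
      proof -
        obtain b where b: "b \<in> Pow G" "v b * I b y \<noteq> 0" using ne unfolding g_def by (rule sum_nonzeroE)
        then have "v b \<noteq> 0" "I b y \<noteq> 0" by auto
        then have f: "facet y b" unfolding I_def using simplex_bd_nonzeroD by blast
        have fb: "finite b" using b fin_face by auto
        show ?thesis
          using facet_card[OF f fb] mlcm_mono[OF fb facet_subset[OF f]] v[OF \<open>v b \<noteq> 0\<close>] order_trans by auto
      qed
      have v1_cases: "v \<tau> \<noteq> 0 \<or> \<tau> \<in> upper \<and> card \<tau> = i \<and> mlcm \<tau> \<le> \<alpha>" if ne: "v1 \<tau> \<noteq> 0" for \<tau>
      proof (cases "v \<tau> = 0")
        case True
        then have "(\<Sum>y\<in>lower. g y * U y \<tau>) \<noteq> 0" using ne by (simp add: v1_def)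
        then obtain y where y: "y \<in> lower" "g y * U y \<tau> \<noteq> 0" by (rule sum_nonzeroE)
        then have "g y \<noteq> 0" "U y \<tau> \<noteq> 0" by auto
        then show ?thesis using gdeg[of y] U(1)[OF y(1), of \<tau>] order_trans by auto
      qed simp
      have v1: "\<tau> \<subseteq> G \<and> card \<tau> = i \<and> mlcm \<tau> \<le> \<alpha>" if "v1 \<tau> \<noteq> 0" for \<tau>
        using v1_cases[OF that] v[of \<tau>] upG crit_subset by auto
      have h_lower: "h c = 0" if c: "c \<in> lower" for c
      proof -
        have "(\<Sum>b\<in>Pow G. (\<Sum>y\<in>lower. g y * U y b) * I b c) = (\<Sum>y\<in>lower. g y * (\<Sum>b\<in>Pow G. U y b * I b c))"
          unfolding sum_distrib_left sum_distrib_right by (subst sum.swap) (simp add: mult.assoc)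
        also have "\<dots> = (\<Sum>y\<in>lower. if y = c then g c else 0)"
          by (intro sum.cong refl) (use U(2) c in auto)
        also have "\<dots> = g c" using flow c by simp
        finally show ?thesis unfolding h_def v1_def left_diff_distrib sum_subtractf by (simp add: g_def)
      qed
      \<comment> \<open>Upper faces retract to 0, so the correction is invisible after
        retraction.\<close>
      have v1_r: "(\<Sum>b\<in>Pow G. v1 b * r b c) = v c" if c: "c \<in> crit" for c
      proof -
        have "v1 b * r b c = (if b = c then v c else 0)" if b: "b \<in> Pow G" for b
        proof (cases "b \<in> crit")
          case True
          then have "U y b = 0" if "y \<in> lower" for y using U(1)[OF that, of b] lower_upper by auto
          then have "v1 b = v b" by (simp add: v1_def)
          then show ?thesis using True by (simp add: r_def retr_crit)
        next
          case False
          then have "b \<noteq> c" "v b = 0" using c v[of b] by auto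
          then show ?thesis using v1_cases[of b] by (auto simp: r_def retr_upper)
        qed
        then have "(\<Sum>b\<in>Pow G. v1 b * r b c) = (\<Sum>b\<in>Pow G. if b = c then v c else 0)" by (intro sum.cong) auto
        then show ?thesis using crit_subset[OF c] by simp
      qed
      have h_r: "(\<Sum>x\<in>Pow G. h x * r x c) = 0" if c: "c \<in> crit" for c
      proof -
        have "(\<Sum>x\<in>Pow G. h x * r x c) = (\<Sum>b\<in>Pow G. v1 b * (\<Sum>x\<in>Pow G. I b x * r x c))"
          unfolding h_def sum_distrib_left sum_distrib_right by (subst sum.swap) (simp add: mult.assoc)
        also have "\<dots> = (\<Sum>b\<in>Pow G. v1 b * (\<Sum>y\<in>crit. r b y * w y c))"
          by (intro sum.cong refl) (simp add: chain[OF _ c])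
        also have "\<dots> = (\<Sum>y\<in>crit. (\<Sum>b\<in>Pow G. v1 b * r b y) * w y c)"
          unfolding sum_distrib_left sum_distrib_right by (subst sum.swap) (simp add: mult.assoc)
        also have "\<dots> = (\<Sum>y\<in>crit. v y * w y c)" by (intro sum.cong refl) (simp add: v1_r)
        finally show ?thesis using cyc[OF c] by simp
      qed
      have h_crit: "h c = 0" if c: "c \<in> crit" for c
      proof -
        have "h x * r x c = (if x = c then h c else 0)" if "x \<in> Pow G" for x
        proof (cases "x \<in> crit")
          case True then show ?thesis by (simp add: r_def retr_crit)
        next
          case False
          then have "x \<noteq> c" "x \<in> lower \<or> x \<in> upper" using c face_cases[of x] that by auto
          then show ?thesis using h_lower[of x] by (auto simp: r_def retr_upper)
        qed
        then have "(\<Sum>x\<in>Pow G. h x * r x c) = (\<Sum>x\<in>Pow G. if x = c then h c else 0)" by (intro sum.cong) auto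
        then show ?thesis using h_r[OF c] crit_subset[OF c] by simp
      qed
      have h_sub: "c \<subseteq> G" if ne: "h c \<noteq> 0" for c
      proof -
        obtain b where b: "b \<in> Pow G" "v1 b * I b c \<noteq> 0" using ne unfolding h_def by (rule sum_nonzeroE)
        then have "I b c \<noteq> 0" by auto
        then show ?thesis using facet_subset simplex_bd_nonzeroD b(1) unfolding I_def by blast
      qed
      \<comment> \<open>The boundary of \<open>v1\<close> has no lower part by construction and no
        critical part because v is a Morse cycle. What is left is upper and has zero boundary, hence
        vanishes by triangularity.\<close>
      have h0: "h c = 0" for c
      proof (rule upper_injective)
        show "\<tau> \<in> upper" if "h \<tau> \<noteq> 0" for \<tau>
          using h_sub[OF that] face_cases[of \<tau>] h_lower h_crit that by blast
        fix y assume "y \<in> lower"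
        have "(\<Sum>\<tau>\<in>Pow G. h \<tau> * I \<tau> y) = (\<Sum>b\<in>Pow G. v1 b * (\<Sum>\<tau>\<in>Pow G. I b \<tau> * I \<tau> y))"
          unfolding h_def sum_distrib_left sum_distrib_right by (subst sum.swap) (simp add: mult.assoc)
        also have "\<dots> = 0" by (intro sum.neutral ballI) (simp add: II)
        finally show "(\<Sum>\<tau>\<in>Pow G. h \<tau> * simplex_bd (pos ms) \<tau> y) = 0" by (simp add: I_def)
      qed
      \<comment> \<open>All faces of the strand at \<alpha> have their vertices here, and
        \<open>B\<close> is nonempty, so the simplex on it is acyclic.\<close>
      define B where "B = {m \<in> G. m \<le> \<alpha>}"
      have BG: "Pow B \<subseteq> Pow G" by (auto simp: B_def)
      have v1B: "\<tau> \<subseteq> B \<and> card \<tau> = i" if "v1 \<tau> \<noteq> 0" for \<tau>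
        using v1[OF that] mlcm_le_iff[OF fin_face, of \<tau> \<alpha>] by (auto simp: B_def)
      have restr: "(\<Sum>\<tau>\<in>Pow B. x \<tau> * I \<tau> y) = (\<Sum>\<tau>\<in>Pow G. x \<tau> * I \<tau> y)" if "\<And>\<tau>. x \<tau> \<noteq> 0 \<Longrightarrow> \<tau> \<subseteq> B" for x y
        by (rule sum.mono_neutral_left) (use that BG in auto)
      have "\<exists>x. (\<forall>\<sigma>. x \<sigma> \<noteq> 0 \<longrightarrow> \<sigma> \<subseteq> B \<and> card \<sigma> = Suc i) \<and> (\<forall>\<sigma>\<subseteq>B. (\<Sum>\<tau>\<in>Pow B. x \<tau> * simplex_bd (pos ms) \<tau> \<sigma>) = v1 \<sigma>)"
      proof (rule simplex_exact)
        show "finite B" "m \<in> B" using m by (auto simp: B_def)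
        show "inj_on (pos ms) B" by (rule inj_on_subset[OF inj_on_pos]) (auto simp: B_def)
        show "\<sigma> \<subseteq> B \<and> card \<sigma> = i" if "v1 \<sigma> \<noteq> 0" for \<sigma> using v1B that by blast
        show "(\<Sum>\<tau>\<in>Pow B. v1 \<tau> * simplex_bd (pos ms) \<tau> \<sigma>) = 0" for \<sigma>
          using restr[of v1 \<sigma>] v1B h0[of \<sigma>] by (simp add: I_def h_def)
      qed
      then obtain x where x: "\<And>\<sigma>. x \<sigma> \<noteq> 0 \<Longrightarrow> \<sigma> \<subseteq> B \<and> card \<sigma> = Suc i" and
        xB: "\<And>\<sigma>. \<sigma> \<subseteq> B \<Longrightarrow> (\<Sum>\<tau>\<in>Pow B. x \<tau> * I \<tau> \<sigma>) = v1 \<sigma>" unfolding I_def by blast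
      have x_bd: "(\<Sum>\<tau>\<in>Pow G. x \<tau> * I \<tau> \<sigma>) = v1 \<sigma>" for \<sigma>
      proof (cases "\<sigma> \<subseteq> B")
        case True
        then show ?thesis using xB restr[of x \<sigma>] x by simp
      next
        case False
        have zero: "x \<tau> * I \<tau> \<sigma> = 0" for \<tau>
        proof (rule ccontr)
          assume "x \<tau> * I \<tau> \<sigma> \<noteq> 0"
          then have "x \<tau> \<noteq> 0" "I \<tau> \<sigma> \<noteq> 0" by auto
          then show False using x[of \<tau>] facet_subset simplex_bd_nonzeroD False unfolding I_def by blast
        qed
        have "v1 \<sigma> = 0" using v1B False by blast
        then show ?thesis by (simp only: zero sum.neutral_const)
      qed
      \<comment> \<open>The Morse boundary of the retracted filling is the retraction of
        \<open>v1\<close>, that is, v.\<close>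
      define u where "u c = (if c \<in> crit then \<Sum>\<tau>\<in>Pow G. x \<tau> * r \<tau> c else 0)" for c
      have "strand ?X (Suc i) \<alpha> u"
        unfolding strand_def morse_sel
      proof (intro allI impI)
        fix c assume ne: "u c \<noteq> 0"
        then have c: "c \<in> crit" "(\<Sum>\<tau>\<in>Pow G. x \<tau> * r \<tau> c) \<noteq> 0" by (auto simp: u_def split: if_splits)
        from c(2) obtain \<tau> where \<tau>: "\<tau> \<in> Pow G" "x \<tau> * r \<tau> c \<noteq> 0" by (rule sum_nonzeroE)
        then have "x \<tau> \<noteq> 0" "retr \<tau> c \<noteq> 0" by (auto simp: r_def)
        then have "card c = Suc i" "mlcm c \<le> mlcm \<tau>" "\<tau> \<subseteq> B" using retr_nonzeroD[of \<tau> c] x[of \<tau>] \<tau>(1) by auto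
        moreover have "mlcm \<tau> \<le> \<alpha>" using mlcm_le_iff[OF fin_face, of \<tau> \<alpha>] \<tau>(1) \<open>\<tau> \<subseteq> B\<close> by (auto simp: B_def)
        ultimately show "c \<in> crit \<and> card c = Suc i \<and> mlcm c \<le> \<alpha>" using c(1) order_trans by blast
      qed
      moreover have "(\<Sum>b\<in>crit. u b * w b c) = v c" if c: "c \<in> crit" for c
      proof -
        have "(\<Sum>b\<in>crit. u b * w b c) = (\<Sum>b\<in>crit. (\<Sum>\<tau>\<in>Pow G. x \<tau> * r \<tau> b) * w b c)"
          by (intro sum.cong refl) (simp add: u_def)
        also have "\<dots> = (\<Sum>\<tau>\<in>Pow G. x \<tau> * (\<Sum>b\<in>crit. r \<tau> b * w b c))"
          unfolding sum_distrib_left sum_distrib_right by (subst sum.swap) (simp add: mult.assoc)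
        also have "\<dots> = (\<Sum>\<tau>\<in>Pow G. x \<tau> * (\<Sum>y\<in>Pow G. I \<tau> y * r y c))"
          by (intro sum.cong refl) (simp add: chain[OF _ c])
        also have "\<dots> = (\<Sum>y\<in>Pow G. (\<Sum>\<tau>\<in>Pow G. x \<tau> * I \<tau> y) * r y c)"
          unfolding sum_distrib_left sum_distrib_right by (subst sum.swap) (simp add: mult.assoc)
        also have "\<dots> = v c" using v1_r[OF c] by (simp add: x_bd)
        finally show ?thesis .
      qed
      ultimately show ?thesis unfolding morse_sel morse_cf w_def by blast
    qed
  qed
  moreover have "\<exists>m\<in>G. m \<le> mlcm b" if b: "b \<in> crit" "cf ?X b {} \<noteq> 0" for b
  proof -
    have "W b {} \<noteq> 0" using b(2) by (auto simp: morse_cf)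
    then have "card b = 1" using W_nonzeroD(1)[OF crit_subset[OF b(1)]] by simp
    then obtain m where "b = {m}" by (auto simp: card_Suc_eq)
    then show ?thesis using crit_subset[OF b(1)] mlcm_upper[of b m] by auto
  qed
  moreover have "b = {}" if "b \<in> crit" "card b = 0" for b
    using that fin_face[OF crit_subset[OF that(1)]] by simp
  ultimately show ?thesis unfolding resolves_def using morse_graded empty_crit by (simp add: morse_sel)
qed

end

section \<open>Linear quotients and mapping cones\<close>

definition multiples :: "'n mon set \<Rightarrow> 'n mon set" where
  "multiples A = {\<alpha>. \<exists>m\<in>A. m \<le> \<alpha>}"

lemma mons_ideal_gen_multiples: "mons (ideal_gen ((monom ` A) :: ('n::finite, 'k::field) pol set)) = multiples A"
  by (simp add: mons_ideal_gen multiples_def)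

text \<open>The colon ideal of the ideal generated by A and the monomial u is generated by the variables in V.\<close>

definition linear_step :: "'n mon set \<Rightarrow> 'n mon \<Rightarrow> 'n set \<Rightarrow> bool" where
  "linear_step A u V \<longleftrightarrow> (\<forall>p\<in>A. \<exists>j\<in>V. u j < p j) \<and> (\<forall>j\<in>V. \<exists>p\<in>A. p \<le> u + var j)"

lemma add_var_le_iff: "u + var j \<le> \<alpha> \<longleftrightarrow> u \<le> \<alpha> \<and> u j < \<alpha> j"
proof
  assume le: "u + var j \<le> \<alpha>"
  have "u i \<le> \<alpha> i" for i using le_funD[OF le, of i] by simp
  moreover have "u j < \<alpha> j" using le_funD[OF le, of j] by (simp add: var_def)
  ultimately show "u \<le> \<alpha> \<and> u j < \<alpha> j" by (simp add: le_fun_def)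
qed (auto simp: le_fun_def var_def Suc_le_eq)

text \<open>The form in which the colon ideal enters the exactness arguments: for a multiple of u
  only the exponents at \<open>V\<close> have to be looked at.\<close>

lemma linear_step_multiples:
  assumes "linear_step A u V" "u \<le> \<alpha>"
  shows "\<alpha> \<in> multiples A \<longleftrightarrow> (\<exists>j\<in>V. u j < \<alpha> j)"
proof
  assume "\<alpha> \<in> multiples A"
  then obtain p where "p \<in> A" "p \<le> \<alpha>" by (auto simp: multiples_def)
  then obtain j where "j \<in> V" "u j < p j" using assms(1) by (auto simp: linear_step_def)
  moreover have "p j \<le> \<alpha> j" using \<open>p \<le> \<alpha>\<close> by (simp add: le_fun_def)
  ultimately show "\<exists>j\<in>V. u j < \<alpha> j" using order_less_le_trans by blast
next
  assume "\<exists>j\<in>V. u j < \<alpha> j"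
  then obtain j where j: "j \<in> V" "u j < \<alpha> j" by blast
  then obtain p where "p \<in> A" "p \<le> u + var j" using assms(1) by (auto simp: linear_step_def)
  moreover have "u + var j \<le> \<alpha>" using j assms(2) by (simp add: add_var_le_iff)
  ultimately show "\<alpha> \<in> multiples A" using order_trans by (auto simp: multiples_def)
qed

text \<open>A variable x_j in \<open>V\<close> is detected by the monomial x_j u, which exceeds u in
  no other variable.\<close>

lemma linear_step_unique:
  assumes "linear_step A u V" "linear_step A u V'" shows "V \<subseteq> V'"
proof
  fix j assume "j \<in> V"
  then have "u + var j \<in> multiples A" using assms(1) by (auto simp: linear_step_def multiples_def)
  moreover have "u \<le> u + var j" by (simp add: le_fun_def)
  ultimately obtain i where "i \<in> V'" "u i < (u + var j) i" using linear_step_multiples[OF assms(2)] by blast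
  then show "j \<in> V'" by (auto simp: var_def split: if_splits)
qed

lemma var_le_iff: "var j \<le> t \<longleftrightarrow> 0 < t j"
  using add_var_le_iff[of 0 j t] by (simp add: le_fun_def)

lemma mem_colon:
  fixes f :: "('n::finite, 'k::field) pol"
  shows "f \<in> colon (ideal_gen (monom ` A)) u \<longleftrightarrow> (\<forall>t\<in>Poly_Mapping.keys f. t + u \<in> multiples A)"
proof -
  have keys: "Poly_Mapping.keys (f * monom u) = (\<lambda>t. t + u) ` Poly_Mapping.keys f"
  proof (intro equalityI subsetI)
    fix x assume "x \<in> Poly_Mapping.keys (f * monom u)"
    then have "u \<le> x" "x - u \<in> Poly_Mapping.keys f"
      by (auto simp: in_keys_iff lookup_mult_single split: if_splits)
    then show "x \<in> (\<lambda>t. t + u) ` Poly_Mapping.keys f" using mon_diff_add[of u x] by (intro image_eqI[of _ _ "x - u"]) auto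
  next
    fix x assume "x \<in> (\<lambda>t. t + u) ` Poly_Mapping.keys f"
    then obtain t where "t \<in> Poly_Mapping.keys f" "x = t + u" by blast
    then show "x \<in> Poly_Mapping.keys (f * monom u)"
      by (auto simp: in_keys_iff lookup_mult_single le_fun_def)
  qed
  show ?thesis unfolding colon_def mem_Collect_eq mem_ideal_gen_monom keys by (auto simp: multiples_def)
qed

lemma colon_eq_iff_linear_step:
  "colon (ideal_gen (monom ` A)) u = ideal_gen ((monom ` var ` V) :: ('n::finite, 'k::field) pol set) \<longleftrightarrow> linear_step A u V"
proof
  assume eq: "colon (ideal_gen (monom ` A)) u = ideal_gen ((monom ` var ` V) :: ('n, 'k) pol set)"
  have mem: "t + u \<in> multiples A \<longleftrightarrow> (\<exists>j\<in>V. 0 < t j)" for t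
  proof -
    have "(monom t :: ('n, 'k) pol) \<in> colon (ideal_gen (monom ` A)) u \<longleftrightarrow> t + u \<in> multiples A" by (simp add: mem_colon)
    moreover have "(monom t :: ('n, 'k) pol) \<in> ideal_gen (monom ` var ` V) \<longleftrightarrow> (\<exists>j\<in>V. 0 < t j)"
      by (simp add: mem_ideal_gen_monom var_le_iff)
    ultimately show ?thesis using eq by simp
  qed
  show "linear_step A u V"
    unfolding linear_step_def
  proof (intro conjI ballI)
    fix p assume "p \<in> A"
    \<comment> \<open>The truncated difference \<open>p - u\<close> is p divided by its gcd with u,
      the element that p contributes to the colon ideal.\<close>
    moreover have "p \<le> p - u + u" by (auto simp: le_fun_def)
    ultimately have "\<exists>j\<in>V. 0 < (p - u) j" using mem[of "p - u"] by (auto simp: multiples_def)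
    then show "\<exists>j\<in>V. u j < p j" by auto
  next
    fix j assume "j \<in> V"
    then show "\<exists>p\<in>A. p \<le> u + var j" using mem[of "var j"] by (auto simp: multiples_def var_def add.commute)
  qed
next
  assume st: "linear_step A u V"
  have "t + u \<in> multiples A \<longleftrightarrow> (\<exists>j\<in>V. var j \<le> t)" for t
  proof -
    have "u \<le> t + u" by (simp add: le_fun_def)
    then show ?thesis using linear_step_multiples[OF st, of "t + u"] by (simp add: var_le_iff)
  qed
  then show "colon (ideal_gen (monom ` A)) u = ideal_gen ((monom ` var ` V) :: ('n, 'k) pol set)"
    by (intro set_eqI) (simp add: mem_colon mem_ideal_gen_monom)
qed

section \<open>Exactness of a cone over a shifted Koszul complex\<close>

lemma simplex_bd_nonzero_subset: "simplex_bd key \<tau> \<sigma> \<noteq> 0 \<Longrightarrow> \<sigma> \<subseteq> \<tau>"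
  unfolding simplex_bd_eq by (auto elim!: sum.not_neutral_contains_not_neutral split: if_splits)

lemma sqfree_add_le_iff: "sqfree T + u \<le> \<alpha> \<longleftrightarrow> u \<le> \<alpha> \<and> (\<forall>j\<in>T. u j < \<alpha> j)"
proof
  assume le: "sqfree T + u \<le> \<alpha>"
  have "u j \<le> \<alpha> j" "j \<in> T \<longrightarrow> u j < \<alpha> j" for j
    using le_funD[OF le, of j] by (auto simp: sqfree_def split: if_splits)
  then show "u \<le> \<alpha> \<and> (\<forall>j\<in>T. u j < \<alpha> j)" by (auto simp: le_fun_def)
next
  assume "u \<le> \<alpha> \<and> (\<forall>j\<in>T. u j < \<alpha> j)"
  then show "sqfree T + u \<le> \<alpha>" by (auto simp: le_fun_def sqfree_def Suc_le_eq)
qed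

text \<open>The common core of both classical resolutions. At \<alpha> the strand of the Koszul part
  is the simplex on the variables of \<open>V\<close> in which \<alpha> exceeds u. If there are any,
  this simplex is acyclic and the Koszul part of a cycle can be subtracted as a boundary. If there
  are none, at most the symbol with the empty set survives, and its entry 1 towards
  \<open>None\<close> makes the quotient vanish at \<alpha>. The other entries from the Koszul part
  to Y enter only through the differential squaring to zero.\<close>

lemma resolves_cone:
  fixes X Y :: "('n::{finite,linorder} symb, 'n, 'k::field) free_complex"
  assumes gX: "graded_free_complex X" and Y: "resolves (multiples A) None Y"
    and gens: "gens X = gens Y \<union> (\<lambda>T. Some (T, u)) ` Pow V" "gens Y \<inter> (\<lambda>T. Some (T, u)) ` Pow V = {}"
    and deg: "hdeg X = symb_hdeg" "mdeg X = symb_mdeg" "hdeg Y = symb_hdeg" "mdeg Y = symb_mdeg"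
    and cfY: "\<And>b c. b \<in> gens Y \<Longrightarrow> c \<in> gens Y \<Longrightarrow> cf X b c = cf Y b c"
    and cf0: "\<And>b T. b \<in> gens Y \<Longrightarrow> T \<subseteq> V \<Longrightarrow> cf X b (Some (T, u)) = 0"
    and cfN: "\<And>T T'. T \<subseteq> V \<Longrightarrow> T' \<subseteq> V \<Longrightarrow> cf X (Some (T, u)) (Some (T', u)) = - simplex_bd id T T'"
    and cf1: "cf X (Some ({}, u)) None = 1"
    and st: "linear_step A u V"
  shows "resolves (multiples (insert u A)) None X"
proof -
  define s :: "'n set \<Rightarrow> 'n symb" where "s T = Some (T, u)" for T
  note gens = gens[folded s_def] and cf0 = cf0[folded s_def] and cfN = cfN[folded s_def] and cf1 = cf1[folded s_def]
  have inj: "inj_on s B" for B by (auto simp: inj_on_def s_def)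
  have fin: "finite (gens Y)" "finite (Pow V)" using Y graded_finite by (auto simp: resolves_def)
  have N: "None \<in> gens Y" and z1: "\<And>b. b \<in> gens Y \<Longrightarrow> symb_hdeg b = 0 \<Longrightarrow> b = None"
    and zA: "\<And>b. b \<in> gens Y \<Longrightarrow> cf Y b None \<noteq> 0 \<Longrightarrow> symb_mdeg b \<in> multiples A"
    and exY: "\<And>i \<alpha>. 0 < i \<or> \<alpha> \<in> multiples A \<Longrightarrow> exact_at Y i \<alpha>"
    using Y deg by (auto simp: resolves_def)
  have sdeg: "symb_hdeg (s T) = Suc (card T)" "symb_mdeg (s T) = sqfree T + u" for T
    by (simp_all add: s_def symb_hdeg_def symb_mdeg_def)
  have disj: "s T \<notin> gens Y" if "T \<subseteq> V" for T using gens(2) that by auto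
  have sumX: "(\<Sum>b\<in>gens X. f b) = (\<Sum>b\<in>gens Y. f b) + (\<Sum>T\<in>Pow V. f (s T))" for f :: "'n symb \<Rightarrow> 'k"
    unfolding gens(1) using fin gens(2) by (simp add: sum.union_disjoint sum.reindex[OF inj])
  have cone_Y: "\<exists>w. strand X (Suc i) \<alpha> w \<and> (\<forall>c\<in>gens X. (\<Sum>b\<in>gens X. w b * cf X b c) = v c)"
    if v: "strand X i \<alpha> v" and cyc: "\<And>c. c \<in> gens X \<Longrightarrow> (\<Sum>b\<in>gens X. v b * cf X b c) = 0"
      and vN: "\<And>T. T \<subseteq> V \<Longrightarrow> v (s T) = 0" and i\<alpha>: "0 < i \<or> \<alpha> \<in> multiples A" for i \<alpha> v
  proof -
    have "strand Y i \<alpha> v" using v vN unfolding strand_def deg gens(1) by blast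
    moreover have "(\<Sum>b\<in>gens Y. v b * cf Y b c) = 0" if "c \<in> gens Y" for c
    proof -
      have "c \<in> gens X" using that gens(1) by blast
      from cyc[OF this] show ?thesis using that cfY vN by (simp add: sumX)
    qed
    ultimately obtain w where w: "strand Y (Suc i) \<alpha> w" "\<And>c. c \<in> gens Y \<Longrightarrow> (\<Sum>b\<in>gens Y. w b * cf Y b c) = v c"
      using exY[OF i\<alpha>] unfolding exact_at_def by blast
    have wN: "w (s T) = 0" if "T \<subseteq> V" for T using w(1) disj[OF that] by (auto simp: strand_def)
    have "strand X (Suc i) \<alpha> w" using w(1) unfolding strand_def deg gens(1) by blast
    moreover have "(\<Sum>b\<in>gens X. w b * cf X b c) = v c" if c: "c \<in> gens X" for c
    proof (cases "c \<in> gens Y")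
      case True
      then show ?thesis using w(2)[OF True] cfY wN by (simp add: sumX)
    next
      case False
      then obtain T where "c = s T" "T \<subseteq> V" using c gens(1) by auto
      then show ?thesis using cf0 wN vN by (simp add: sumX)
    qed
    ultimately show ?thesis by blast
  qed
  have "exact_at X i \<alpha>" if i\<alpha>: "0 < i \<or> \<alpha> \<in> multiples (insert u A)" for i \<alpha>
    unfolding exact_at_def
  proof (intro allI impI)
    fix v assume "strand X i \<alpha> v \<and> (\<forall>c\<in>gens X. (\<Sum>b\<in>gens X. v b * cf X b c) = 0)"
    then have v: "strand X i \<alpha> v" and cyc: "\<And>c. c \<in> gens X \<Longrightarrow> (\<Sum>b\<in>gens X. v b * cf X b c) = 0" by auto
    define W where "W = {j \<in> V. u j < \<alpha> j}"
    have vW: "T \<subseteq> W \<and> u \<le> \<alpha> \<and> i = Suc (card T)" if "v (s T) \<noteq> 0" "T \<subseteq> V" for T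
    proof -
      have "symb_hdeg (s T) = i" "symb_mdeg (s T) \<le> \<alpha>" using v that by (auto simp: strand_def deg)
      then show ?thesis using that(2) by (auto simp: sdeg sqfree_add_le_iff W_def)
    qed
    show "\<exists>w. strand X (Suc i) \<alpha> w \<and> (\<forall>c\<in>gens X. (\<Sum>b\<in>gens X. w b * cf X b c) = v c)"
    proof (cases "u \<le> \<alpha> \<and> W \<noteq> {}")
      case True
      then obtain m where m: "m \<in> W" and u\<alpha>: "u \<le> \<alpha>" by blast
      have \<alpha>A: "\<alpha> \<in> multiples A" using linear_step_multiples[OF st u\<alpha>] m by (auto simp: W_def)
      have WV: "Pow W \<subseteq> Pow V" by (auto simp: W_def)
      have restr: "(\<Sum>T\<in>Pow V. x T * f T) = (\<Sum>T\<in>Pow W. x T * f T)" if "\<And>T. T \<subseteq> V \<Longrightarrow> x T \<noteq> 0 \<Longrightarrow> T \<subseteq> W" for x f :: "'n set \<Rightarrow> 'k"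
        by (rule sum.mono_neutral_right) (use that WV fin in auto)
      have "\<exists>w. (\<forall>T. w T \<noteq> 0 \<longrightarrow> T \<subseteq> W \<and> card T = i) \<and> (\<forall>T\<subseteq>W. (\<Sum>T'\<in>Pow W. w T' * simplex_bd id T' T) = - v (s T))"
      proof (cases i)
        case 0
        then have "v (s T) = 0" if "T \<subseteq> W" for T using vW[of T] that WV by auto
        then show ?thesis by (intro exI[of _ "\<lambda>_. 0"]) auto
      next
        case (Suc k)
        define v' where "v' T = (if T \<subseteq> W then - v (s T) else 0)" for T
        have "\<exists>w. (\<forall>T. w T \<noteq> 0 \<longrightarrow> T \<subseteq> W \<and> card T = Suc k) \<and> (\<forall>T\<subseteq>W. (\<Sum>T'\<in>Pow W. w T' * simplex_bd id T' T) = v' T)"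
        proof (rule simplex_exact[of W id m])
          show "T \<subseteq> W \<and> card T = k" if "v' T \<noteq> 0" for T
            using that vW[of T] WV Suc by (auto simp: v'_def split: if_splits)
          fix T assume T: "T \<subseteq> W"
          then have "T \<subseteq> V" using WV by auto
          then have "s T \<in> gens X" using gens(1) by auto
          then have "0 = (\<Sum>b\<in>gens X. v b * cf X b (s T))" using cyc by simp
          also have "\<dots> = (\<Sum>T'\<in>Pow V. v (s T') * - simplex_bd id T' T)"
            using cf0 cfN \<open>T \<subseteq> V\<close> by (simp add: sumX)
          also have "\<dots> = (\<Sum>T'\<in>Pow W. v (s T') * - simplex_bd id T' T)" by (rule restr) (use vW in blast)
          also have "\<dots> = (\<Sum>T'\<in>Pow W. v' T' * simplex_bd id T' T)" by (intro sum.cong) (auto simp: v'_def)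
          finally show "(\<Sum>T'\<in>Pow W. v' T' * simplex_bd id T' T) = 0" by simp
        qed (use m in auto)
        then show ?thesis using Suc by (auto simp: v'_def)
      qed
      then obtain w where w: "\<And>T. w T \<noteq> 0 \<Longrightarrow> T \<subseteq> W \<and> card T = i"
        "\<And>T. T \<subseteq> W \<Longrightarrow> (\<Sum>T'\<in>Pow W. w T' * simplex_bd id T' T) = - v (s T)" by blast
      have w_bd: "(\<Sum>T'\<in>Pow V. w T' * - simplex_bd id T' T) = v (s T)" if T: "T \<subseteq> V" for T
      proof (cases "T \<subseteq> W")
        case True
        have "(\<Sum>T'\<in>Pow V. w T' * - simplex_bd id T' T) = (\<Sum>T'\<in>Pow W. w T' * - simplex_bd id T' T)"
          by (rule restr) (use w(1) in blast)
        then show ?thesis using w(2)[OF True] by (simp add: sum_negf)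
      next
        case False
        have "w T' * - simplex_bd id T' T = 0" for T'
        proof (rule ccontr)
          assume "w T' * - simplex_bd id T' T \<noteq> 0"
          then have "w T' \<noteq> 0" "simplex_bd id T' T \<noteq> (0 :: 'k)" by auto
          then have "T' \<subseteq> W" "T \<subseteq> T'" using w(1) simplex_bd_nonzero_subset by blast+
          then show False using False by auto
        qed
        moreover have "v (s T) = 0" using vW[OF _ T] False by blast
        ultimately show ?thesis by (simp only: sum.neutral_const)
      qed
      \<comment> \<open>The Koszul filling, regarded as a chain of X. Its boundary agrees with v on
        the Koszul part; the difference, formed below as \<open>v'\<close>, is a cycle supported in
        Y, and Y is exact here since \<alpha> lies in the ideal of \<open>A\<close>.\<close>
      define y where "y b = (if b \<in> s ` Pow V then w (fst (the b)) else 0)" for b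
      have ys: "y (s T) = w T" if "T \<subseteq> V" for T using that by (auto simp: y_def s_def)
      have yY: "y b = 0" if "b \<in> gens Y" for b using that gens(2) by (auto simp: y_def)
      have y: "strand X (Suc i) \<alpha> y"
        unfolding strand_def
      proof (intro allI impI)
        fix b assume ne: "y b \<noteq> 0"
        then have "b \<in> s ` Pow V" by (cases "b \<in> s ` Pow V") (simp_all add: y_def)
        then obtain T where "b = s T" "T \<subseteq> V" by blast
        then have T: "b = s T" "T \<subseteq> V" "w T \<noteq> 0" using ne ys by auto
        then show "b \<in> gens X \<and> hdeg X b = Suc i \<and> mdeg X b \<le> \<alpha>"
          using w(1)[of T] u\<alpha> by (auto simp: gens(1) deg sdeg sqfree_add_le_iff W_def)
      qed
      define d where "d c = (\<Sum>b\<in>gens X. y b * cf X b c)" for c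
      have d_s: "d (s T) = v (s T)" if "T \<subseteq> V" for T
        using w_bd[OF that] cfN that ys yY by (simp add: d_def sumX)
      define v' where "v' c = (if c \<in> gens X then v c - d c else 0)" for c
      have "strand X i \<alpha> v'"
        unfolding strand_def
      proof (intro allI impI)
        fix c assume ne: "v' c \<noteq> 0"
        then have c: "c \<in> gens X" by (auto simp: v'_def split: if_splits)
        show "c \<in> gens X \<and> hdeg X c = i \<and> mdeg X c \<le> \<alpha>"
        proof (cases "v c = 0")
          case False then show ?thesis using v by (auto simp: strand_def)
        next
          case True
          then have "d c \<noteq> 0" using ne c by (simp add: v'_def)
          then obtain b where b: "b \<in> gens X" "y b * cf X b c \<noteq> 0" unfolding d_def by (rule sum_nonzeroE)
          then have "y b \<noteq> 0" "cf X b c \<noteq> 0" by auto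
          then show ?thesis using y graded_cf_nonzero[OF gX b(1) c] c order_trans unfolding strand_def by fastforce
        qed
      qed
      moreover have "(\<Sum>c\<in>gens X. v' c * cf X c e) = 0" if e: "e \<in> gens X" for e
      proof -
        have "(\<Sum>c\<in>gens X. v' c * cf X c e) = (\<Sum>c\<in>gens X. v c * cf X c e) - (\<Sum>c\<in>gens X. d c * cf X c e)"
          unfolding sum_subtractf[symmetric] by (rule sum.cong) (auto simp: v'_def algebra_simps)
        also have "(\<Sum>c\<in>gens X. d c * cf X c e) = (\<Sum>b\<in>gens X. y b * (\<Sum>c\<in>gens X. cf X b c * cf X c e))"
          unfolding d_def sum_distrib_left sum_distrib_right by (subst sum.swap) (simp add: mult.assoc)
        also have "\<dots> = 0" using graded_cf_cf[OF gX _ e] by (intro sum.neutral) auto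
        finally show ?thesis using cyc[OF e] by simp
      qed
      moreover have "v' (s T) = 0" if "T \<subseteq> V" for T using d_s[OF that] by (simp add: v'_def)
      ultimately obtain w' where w': "strand X (Suc i) \<alpha> w'" "\<And>c. c \<in> gens X \<Longrightarrow> (\<Sum>b\<in>gens X. w' b * cf X b c) = v' c"
        using cone_Y[of i \<alpha> v'] \<alpha>A by blast
      have "strand X (Suc i) \<alpha> (\<lambda>b. w' b + y b)"
        using w'(1) y unfolding strand_def by (metis add.right_neutral)
      moreover have "(\<Sum>b\<in>gens X. (w' b + y b) * cf X b c) = v c" if "c \<in> gens X" for c
        using w'(2)[OF that] that by (simp add: distrib_right sum.distrib v'_def d_def)
      ultimately show ?thesis by blast
    next
      case False
      have vs: "v (s T) = 0" if T: "T \<subseteq> V" "T \<noteq> {} \<or> i \<noteq> 1" for T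
        using vW[OF _ T(1)] T(2) False by (cases "v (s T) = 0") auto
      have \<alpha>A: "\<alpha> \<in> multiples A \<Longrightarrow> \<not> u \<le> \<alpha>" using False linear_step_multiples[OF st, of \<alpha>] by (auto simp: W_def)
      \<comment> \<open>Evaluate the cycle condition at \<open>None\<close>: contributions from Y
        could only come from multidegrees below \<alpha> in the ideal of \<open>A\<close>, but
        \<alpha> is not in that ideal.\<close>
      have v0: "v (s {}) = 0"
      proof (rule ccontr)
        assume ne: "v (s {}) \<noteq> 0"
        then have u\<alpha>: "u \<le> \<alpha>" using vW[of "{}"] by simp
        have "(\<Sum>b\<in>gens Y. v b * cf Y b None) = 0"
        proof (rule sum.neutral, intro ballI, rule ccontr)
          fix b assume b: "b \<in> gens Y" "v b * cf Y b None \<noteq> 0"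
          then have "symb_mdeg b \<in> multiples A" "symb_mdeg b \<le> \<alpha>" using zA v by (auto simp: strand_def deg)
          then have "\<alpha> \<in> multiples A" unfolding multiples_def using order_trans by blast
          then show False using \<alpha>A u\<alpha> by blast
        qed
        moreover have "None \<in> gens X" using N gens(1) by blast
        from cyc[OF this] have "(\<Sum>b\<in>gens Y. v b * cf Y b None) + (\<Sum>T\<in>Pow V. v (s T) * cf X (s T) None) = 0"
          using N cfY by (simp add: sumX)
        moreover have "(\<Sum>T\<in>Pow V. v (s T) * cf X (s T) None) = v (s {}) * cf X (s {}) None"
          by (subst sum.remove[of _ "{}"]) (use fin vs in auto)
        ultimately show False using ne cf1 by simp
      qed
      then have vN: "v (s T) = 0" if "T \<subseteq> V" for T using vs[OF that] by (cases "T = {}") auto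
      show ?thesis
      proof (cases "0 < i \<or> \<alpha> \<in> multiples A")
        case True
        then show ?thesis using cone_Y[OF v cyc vN] by blast
      next
        case False
        then have i: "i = 0" and u\<alpha>: "u \<le> \<alpha>" using i\<alpha> by (auto simp: multiples_def)
        \<comment> \<open>The only new exactness in homological degree 0: \<alpha> is a multiple of
          u outside the ideal of \<open>A\<close>.\<close>
        define w where "w b = (if b = s {} then v None else 0)" for b
        have "strand X (Suc i) \<alpha> w" using u\<alpha> gens(1) by (auto simp: strand_def w_def i deg sdeg sqfree_add_le_iff)
        moreover have "(\<Sum>b\<in>gens X. w b * cf X b c) = v c" if c: "c \<in> gens X" for c
        proof -
          have s0: "s {} \<in> gens X" using gens(1) by auto
          have "(\<Sum>b\<in>gens X. w b * cf X b c) = (\<Sum>b\<in>gens X. if b = s {} then v None * cf X (s {}) c else 0)"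
            by (intro sum.cong) (auto simp: w_def)
          also have "\<dots> = v None * cf X (s {}) c" using s0 graded_finite[OF gX] by simp
          also have "\<dots> = v c"
          proof (cases "c = None")
            case True then show ?thesis using cf1 by simp
          next
            case False
            then have "symb_hdeg c \<noteq> 0" using c z1 gens(1) sdeg by auto
            then have "cf X (s {}) c = 0" "v c = 0"
              using graded_cf_nonzero(1)[OF gX s0 c] v i by (auto simp: deg sdeg strand_def)
            then show ?thesis by simp
          qed
          finally show ?thesis .
        qed
        ultimately show ?thesis by blast
      qed
    qed
  qed
  moreover have "b = None" if "b \<in> gens X" "symb_hdeg b = 0" for b
    using that z1 sdeg gens(1) by auto
  moreover have "symb_mdeg b \<in> multiples (insert u A)" if b: "b \<in> gens X" "cf X b None \<noteq> 0" for b
  proof (cases "b \<in> gens Y")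
    case True
    then show ?thesis using zA[OF True] cfY[OF True N] b(2) by (auto simp: multiples_def)
  next
    case False
    then obtain T where "b = s T" using b(1) gens(1) by auto
    then show ?thesis by (auto simp: sdeg multiples_def le_fun_def)
  qed
  ultimately show ?thesis
    unfolding resolves_def using gX N gens(1) by (simp add: deg symb_hdeg_def[of None] symb_mdeg_def[of None])
qed

section \<open>Koszul complexes and the Herzog-Takayama resolution\<close>

lemma simplex_bd_nonzeroE:
  assumes "simplex_bd key \<tau> \<sigma> \<noteq> 0" obtains u where "u \<in> \<tau>" "\<sigma> = \<tau> - {u}"
  using assms unfolding simplex_bd_eq by (auto elim!: sum.not_neutral_contains_not_neutral split: if_splits)

lemma minus_one_power_single: "(-1) ^ n * Poly_Mapping.single m 1 = Poly_Mapping.single m ((-1) ^ n :: 'k::comm_ring_1)"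
  by (cases "even n") (simp_all add: single_uminus)

lemma sqfree_empty [simp]: "sqfree {} = 0"
  by (simp add: sqfree_def fun_eq_iff)

lemma sqfree_remove: "j \<in> T \<Longrightarrow> sqfree T - sqfree (T - {j}) = var j"
  by (auto simp: fun_eq_iff sqfree_def var_def)

lemma koszul_sel:
  "gens (koszul V u) = Pow V" "hdeg (koszul V u) = card" "mdeg (koszul V u) T = sqfree T + u"
  by (simp_all add: koszul_def)

lemma koszul_bd:
  "bd (koszul V u :: ('n::{finite,linorder} set, 'n, 'k::field) free_complex) T T'
     = Poly_Mapping.single (sqfree T + u - (sqfree T' + u)) (simplex_bd id T T')"
proof -
  have "bd (koszul V u :: ('n set, 'n, 'k) free_complex) T T'
     = (\<Sum>j\<in>T. if T' = T - {j} then (-1) ^ card {k \<in> T. k < j} * monom (var j) else 0)"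
    by (simp add: koszul_def)
  also have "\<dots> = (\<Sum>j\<in>T. Poly_Mapping.single (sqfree T + u - (sqfree T' + u)) (if T' = T - {j} then (-1) ^ card {k \<in> T. k < j} else 0))"
    by (intro sum.cong refl) (auto simp: minus_one_power_single sqfree_remove)
  also have "\<dots> = Poly_Mapping.single (sqfree T + u - (sqfree T' + u)) (simplex_bd id T T')"
    by (simp add: simplex_bd_def single_sum cong: if_cong)
  finally show ?thesis .
qed

lemma koszul_graded: "graded_free_complex (koszul V u :: ('n::{finite,linorder} set, 'n, 'k::field) free_complex)"
proof (rule gradedI[where k = "simplex_bd id"], unfold koszul_sel)
  show "card T = Suc (card T') \<and> sqfree T' + u \<le> sqfree T + u" if ne: "simplex_bd id T T' \<noteq> (0 :: 'k)" for T T'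
  proof -
    obtain j where j: "j \<in> T" "T' = T - {j}" using ne by (rule simplex_bd_nonzeroE)
    then have "card T = Suc (card T')" using card.remove[of T j] by simp
    then show ?thesis using j by (auto simp: sqfree_def le_fun_def)
  qed
  show "(\<Sum>c\<in>Pow V. simplex_bd id b c * simplex_bd id c e) = (0 :: 'k)" if "b \<in> Pow V" for b e
    using that by (intro simplex_bd_bd) auto
qed (simp_all add: koszul_bd)

text \<open>With \<open>V u\<close> the variables of the colon ideal at u, this is the basis common
  to the Eliahou-Kervaire and the Herzog-Takayama complex.\<close>

definition symbols :: "'n mon set \<Rightarrow> ('n mon \<Rightarrow> 'n set) \<Rightarrow> 'n symb set" where
  "symbols A V = insert None {Some (T, u) | T u. u \<in> A \<and> T \<subseteq> V u}"

lemma symbols_insert: "symbols (insert u A) V = symbols A V \<union> (\<lambda>T. Some (T, u)) ` Pow (V u)"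
  by (auto simp: symbols_def)

lemma symbols_disjoint: "u \<notin> A \<Longrightarrow> symbols A V \<inter> (\<lambda>T. Some (T, u)) ` B = {}"
  by (auto simp: symbols_def)

lemma finite_symbols: "finite A \<Longrightarrow> finite (symbols A (V :: 'n::finite mon \<Rightarrow> 'n set))"
  by (induction A rule: finite_induct) (auto simp: symbols_insert, simp add: symbols_def)

text \<open>This number is what the final comparison of complexes rests on; it depends on the sizes
  of the sets \<open>V u\<close> and not on an order of the generators.\<close>

lemma card_symbols: "finite A \<Longrightarrow> card (symbols A (V :: 'n::finite mon \<Rightarrow> 'n set)) = Suc (\<Sum>u\<in>A. 2 ^ card (V u))"
proof (induction A rule: finite_induct)
  case empty
  then show ?case by (simp add: symbols_def)
next
  case (insert u A)
  have "card ((\<lambda>T. Some (T, u)) ` Pow (V u)) = 2 ^ card (V u)"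
    by (subst card_image) (auto simp: inj_on_def card_Pow)
  then show ?case
    using insert symbols_disjoint[OF insert(2), of V "Pow (V u)"] finite_symbols[OF insert(1), of V]
    by (simp add: symbols_insert card_Un_disjoint)
qed

text \<open>Linear quotients without reference to the field. The sets of variables are a function of
  the generator, so that it makes sense to keep them when the list is reordered.\<close>

definition lin_quot :: "'n mon list \<Rightarrow> ('n mon \<Rightarrow> 'n set) \<Rightarrow> bool" where
  "lin_quot ms V \<longleftrightarrow> distinct ms \<and> (\<forall>p\<in>set ms. \<forall>u\<in>set ms. p \<le> u \<longrightarrow> p = u) \<and>
     (\<forall>pre u post. ms = pre @ u # post \<longrightarrow> linear_step (set pre) u (V u))"

lemma lin_quot_snocD:
  assumes "lin_quot (ms @ [u]) V"
  shows "lin_quot ms V" "linear_step (set ms) u (V u)" "u \<notin> set ms"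
  using assms by (auto simp: lin_quot_def)

lemma resolves_trivial: "resolves (multiples {}) None (trivial_complex :: ('n::finite symb, 'n, 'k::field) free_complex)"
proof -
  have "graded_free_complex (trivial_complex :: ('n symb, 'n, 'k) free_complex)"
    by (rule gradedI[where k = "\<lambda>_ _. 0"]) (auto simp: trivial_complex_def)
  moreover have "exact_at (trivial_complex :: ('n symb, 'n, 'k) free_complex) i \<alpha>" if "0 < i" for i \<alpha>
    unfolding exact_at_def
  proof (intro allI impI)
    fix v assume v: "strand (trivial_complex :: ('n symb, 'n, 'k) free_complex) i \<alpha> v \<and>
      (\<forall>c\<in>gens (trivial_complex :: ('n symb, 'n, 'k) free_complex). (\<Sum>b\<in>gens (trivial_complex :: ('n symb, 'n, 'k) free_complex). v b * cf trivial_complex b c) = 0)"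
    then have "v b = 0" for b using that by (auto simp: strand_def trivial_complex_def symb_hdeg_def)
    then show "\<exists>w. strand (trivial_complex :: ('n symb, 'n, 'k) free_complex) (Suc i) \<alpha> w \<and>
      (\<forall>c\<in>gens (trivial_complex :: ('n symb, 'n, 'k) free_complex). (\<Sum>b\<in>gens (trivial_complex :: ('n symb, 'n, 'k) free_complex). w b * cf trivial_complex b c) = v c)"
      by (intro exI[of _ "\<lambda>_. 0"]) (auto simp: strand_def)
  qed
  ultimately show ?thesis
    by (auto simp: resolves_def multiples_def trivial_complex_def symb_hdeg_def symb_mdeg_def cf_def)
qed

text \<open>The minus sign on the Koszul block turns the chain map property of \<psi> into the
  cancellation of the two ways from the Koszul part to F.\<close>

lemma koszul_cone_graded:
  fixes F :: "('n::{finite,linorder} symb, 'n, 'k::field) free_complex"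
  assumes F: "graded_free_complex F" and deg: "hdeg F = symb_hdeg" "mdeg F = symb_mdeg"
    and disj: "gens F \<inter> (\<lambda>T. Some (T, u)) ` Pow V = {}" and \<psi>: "chain_map (koszul V u) F \<psi>"
  shows "graded_free_complex (koszul_cone F V u \<psi>)"
proof -
  let ?K = "koszul V u :: ('n set, 'n, 'k) free_complex"
  define s :: "'n set \<Rightarrow> 'n symb" where "s T = Some (T, u)" for T
  define X where "X = koszul_cone F V u \<psi>"
  have X: "gens X = gens F \<union> s ` Pow V" "hdeg X = symb_hdeg" "mdeg X = symb_mdeg"
    by (simp_all add: X_def koszul_cone_def Let_def s_def)
  have inj: "inj_on s B" for B by (auto simp: inj_on_def s_def)
  have fF: "finite (gens F)" using F by (rule graded_finite)
  have disj': "gens F \<inter> s ` Pow V = {}" using disj by (simp add: s_def)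
  have bd: "bd X (s T) (s T') = - bd ?K T T'" "b \<in> gens F \<Longrightarrow> bd X b (s T) = 0"
    "c \<in> gens F \<Longrightarrow> bd X (s T) c = \<psi> T c" "b \<in> gens F \<Longrightarrow> c \<in> gens F \<Longrightarrow> bd X b c = bd F b c"
    if "T \<subseteq> V" "T' \<subseteq> V" for T T' b c
    using that disj by (auto simp: X_def koszul_cone_def Let_def s_def)
  have sdeg: "symb_hdeg (s T) = Suc (card T)" "symb_mdeg (s T) = sqfree T + u" for T
    by (simp_all add: s_def symb_hdeg_def symb_mdeg_def)
  have sumX: "(\<Sum>b\<in>gens X. f b) = (\<Sum>b\<in>gens F. f b) + (\<Sum>T\<in>Pow V. f (s T))" for f :: "'n symb \<Rightarrow> ('n, 'k) pol"
    unfolding X using fF disj' by (simp add: sum.union_disjoint sum.reindex[OF inj])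
  have \<psi>0: "\<psi> T c \<noteq> 0 \<Longrightarrow> card T = symb_hdeg c" "t \<in> Poly_Mapping.keys (\<psi> T c) \<Longrightarrow> t + symb_mdeg c = sqfree T + u"
    if "T \<subseteq> V" "c \<in> gens F" for T c t
    using \<psi> that by (auto simp: chain_map_def koszul_sel deg)
  have \<psi>c: "(\<Sum>T'\<in>Pow V. bd ?K T T' * \<psi> T' e) = (\<Sum>c\<in>gens F. \<psi> T c * bd F c e)" if "T \<subseteq> V" "e \<in> gens F" for T e
    using \<psi> that by (auto simp: chain_map_def koszul_sel)
  have K: "bd ?K T T' \<noteq> 0 \<Longrightarrow> card T = Suc (card T')" "t \<in> Poly_Mapping.keys (bd ?K T T') \<Longrightarrow> t + (sqfree T' + u) = sqfree T + u"
    "(\<Sum>S\<in>Pow V. bd ?K T S * bd ?K S T') = 0" if "T \<subseteq> V" "T' \<subseteq> V" for T T' t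
    using koszul_graded[of V u, where 'k = 'k] that by (auto simp: graded_free_complex_def koszul_sel)
  have Fd: "bd F b c \<noteq> 0 \<Longrightarrow> symb_hdeg b = Suc (symb_hdeg c)" "t \<in> Poly_Mapping.keys (bd F b c) \<Longrightarrow> t + symb_mdeg c = symb_mdeg b"
    "(\<Sum>e\<in>gens F. bd F b e * bd F e c) = 0" if "b \<in> gens F" "c \<in> gens F" for b c t
    using F that by (auto simp: graded_free_complex_def deg)
  have "(bd X b c \<noteq> 0 \<longrightarrow> symb_hdeg b = Suc (symb_hdeg c)) \<and> (\<forall>t\<in>Poly_Mapping.keys (bd X b c). t + symb_mdeg c = symb_mdeg b)"
    if b: "b \<in> gens X" and c: "c \<in> gens X" for b c
  proof (cases "b \<in> gens F")
    case bF: True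
    show ?thesis
    proof (cases "c \<in> gens F")
      case True then show ?thesis using bF Fd bd(4)[of "{}" "{}" b c] by auto
    next
      case False
      then obtain T where "c = s T" "T \<subseteq> V" using c X(1) by auto
      then show ?thesis using bF bd(2) by auto
    qed
  next
    case False
    then obtain T where T: "b = s T" "T \<subseteq> V" using b X(1) by auto
    show ?thesis
    proof (cases "c \<in> gens F")
      case True then show ?thesis using T \<psi>0[OF T(2) True] bd(3) by (auto simp: sdeg)
    next
      case False
      then obtain T' where T': "c = s T'" "T' \<subseteq> V" using c X(1) by auto
      then show ?thesis using T K[OF T(2) T'(2)] bd(1) by (auto simp: sdeg)
    qed
  qed
  moreover have "(\<Sum>c\<in>gens X. bd X b c * bd X c e) = 0" if b: "b \<in> gens X" and e: "e \<in> gens X" for b e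
  proof (cases "b \<in> gens F")
    case bF: True
    have "(\<Sum>c\<in>gens X. bd X b c * bd X c e) = (\<Sum>c\<in>gens F. bd F b c * bd X c e)"
      unfolding sumX using bF bd(2,4)[of "{}" "{}"] bd(2) by (simp add: sum.neutral)
    also have "\<dots> = 0"
    proof (cases "e \<in> gens F")
      case True
      then have "(\<Sum>c\<in>gens F. bd F b c * bd X c e) = (\<Sum>c\<in>gens F. bd F b c * bd F c e)"
        using bd(4)[of "{}" "{}"] by (intro sum.cong) auto
      then show ?thesis using Fd(3)[OF bF True] by simp
    next
      case False
      then obtain T where "e = s T" "T \<subseteq> V" using e X(1) by auto
      then show ?thesis using bd(2) by (intro sum.neutral) auto
    qed
    finally show ?thesis .
  next
    case False
    then obtain T where T: "b = s T" "T \<subseteq> V" using b X(1) by auto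
    show ?thesis
    proof (cases "e \<in> gens F")
      case True
      have "(\<Sum>c\<in>gens X. bd X b c * bd X c e) = (\<Sum>c\<in>gens F. \<psi> T c * bd F c e) + (\<Sum>T'\<in>Pow V. - (bd ?K T T' * \<psi> T' e))"
        unfolding sumX T(1) using bd(1)[OF T(2)] bd(3)[OF _ _ True] bd(3)[OF T(2) T(2)] bd(4)[of "{}" "{}", OF _ _ _ True]
        by (intro arg_cong2[where f = "(+)"] sum.cong) auto
      then show ?thesis using \<psi>c[OF T(2) True] by (simp add: sum_negf)
    next
      case False
      then obtain S where S: "e = s S" "S \<subseteq> V" using e X(1) by auto
      have "(\<Sum>c\<in>gens X. bd X b c * bd X c e) = (\<Sum>c\<in>gens F. 0) + (\<Sum>T'\<in>Pow V. bd ?K T T' * bd ?K T' S)"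
        unfolding sumX T(1) S(1) using bd(1)[OF T(2)] bd(1)[OF _ S(2)] bd(2)[OF S(2) S(2)]
        by (intro arg_cong2[where f = "(+)"] sum.cong) auto
      then show ?thesis using K(3)[OF T(2) S(2)] by simp
    qed
  qed
  moreover have "finite (gens X)" unfolding X using fF by simp
  ultimately show ?thesis unfolding graded_free_complex_def X(2,3) X_def[symmetric] by blast
qed

text \<open>Whatever comparison maps were chosen, \<open>resolves_cone\<close> applies: the chain
  map property gives the graded complex, and the prescribed value at the empty set gives the entry
  1. The set of variables in the rule is determined by the colon ideal, so the basis depends on
  \<open>V\<close> alone.\<close>

lemma herzog_takayama_resolves:
  fixes F :: "('n::{finite,linorder} symb, 'n, 'k::field) free_complex"
  assumes "herzog_takayama ms F" "lin_quot ms V"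
  shows "resolves (multiples (set ms)) None F \<and> hdeg F = symb_hdeg \<and> mdeg F = symb_mdeg \<and> gens F = symbols (set ms) V"
  using assms
proof (induction rule: herzog_takayama.induct)
  case base
  have "gens (trivial_complex :: ('n symb, 'n, 'k) free_complex) = symbols (set []) V"
    by (simp add: trivial_complex_def symbols_def)
  then show ?case using resolves_trivial[where 'n = 'n and 'k = 'k] by (simp add: trivial_complex_def)
next
  case (cone ms F u V' \<psi>)
  note lq = lin_quot_snocD[OF cone.prems]
  have F: "resolves (multiples (set ms)) None F" "hdeg F = symb_hdeg" "mdeg F = symb_mdeg" "gens F = symbols (set ms) V"
    using cone.IH[OF lq(1)] by auto
  have gF: "graded_free_complex F" using F(1) by (simp add: resolves_def)
  have "linear_step (set ms) u V'" using cone.hyps(2) colon_eq_iff_linear_step by blast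
  then have V': "V' = V u" using linear_step_unique lq(2) by blast
  define X where "X = koszul_cone F V' u \<psi>"
  have disj: "gens F \<inter> (\<lambda>T. Some (T, u)) ` Pow V' = {}" unfolding F(4) by (rule symbols_disjoint[OF lq(3)])
  have X: "gens X = gens F \<union> (\<lambda>T. Some (T, u)) ` Pow V'" "hdeg X = symb_hdeg" "mdeg X = symb_mdeg"
    by (simp_all add: X_def koszul_cone_def Let_def)
  have N: "None \<in> gens F" by (simp add: F(4) symbols_def)
  have "resolves (multiples (insert u (set ms))) None X"
  proof (rule resolves_cone[OF _ F(1) X(1) disj X(2,3) F(2,3)])
    show "graded_free_complex X" unfolding X_def by (rule koszul_cone_graded[OF gF F(2,3) disj cone.hyps(3)])
    show "linear_step (set ms) u V'" by fact
    show "cf X b c = cf F b c" if "b \<in> gens F" "c \<in> gens F" for b c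
      using that disj X F(3) by (auto simp: cf_def X_def koszul_cone_def Let_def)
    show "cf X b (Some (T, u)) = 0" if "b \<in> gens F" "T \<subseteq> V'" for b T
      using that disj by (auto simp: cf_def X_def koszul_cone_def Let_def)
    show "cf X (Some (T, u)) (Some (T', u)) = - simplex_bd id T T'" if "T \<subseteq> V'" "T' \<subseteq> V'" for T T'
      using that by (auto simp: cf_def X_def koszul_cone_def Let_def koszul_bd symb_mdeg_def)
    show "cf X (Some ({}, u)) None = 1"
      using cone.hyps(4) by (auto simp: cf_def X_def koszul_cone_def Let_def symb_mdeg_def sqfree_def lookup_single when_def fun_eq_iff)
  qed
  moreover have "gens X = symbols (set (ms @ [u])) V" using X(1) F(4) V' by (simp add: symbols_insert)
  ultimately show ?case using X(2,3) unfolding X_def by simp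
qed

text \<open>A comparison map exists because multiplication by u sends the variables of the colon
  ideal into the ideal of the earlier generators, where the complex built so far is exact.\<close>

lemma herzog_takayama_exists:
  assumes "lin_quot ms V"
  shows "\<exists>F :: ('n::{finite,linorder} symb, 'n, 'k::field) free_complex. herzog_takayama ms F"
  using assms
proof (induction ms rule: rev_induct)
  case Nil
  then show ?case using herzog_takayama.base by blast
next
  case (snoc u ms)
  note lq = lin_quot_snocD[OF snoc.prems]
  obtain F :: "('n symb, 'n, 'k) free_complex" where F: "herzog_takayama ms F" using snoc.IH[OF lq(1)] by blast
  let ?K = "koszul (V u) u :: ('n set, 'n, 'k) free_complex"
  have R: "resolves (multiples (set ms)) None F" "mdeg F = symb_mdeg"
    using herzog_takayama_resolves[OF F lq(1)] by auto
  have "mdeg ?K T \<in> multiples (set ms)" if T: "T \<in> gens ?K" "hdeg ?K T = 1" for T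
  proof -
    obtain j where "T = {j}" "j \<in> V u" using T by (auto simp: koszul_sel card_Suc_eq)
    then have "u \<le> sqfree T + u" "u j < (sqfree T + u) j" by (auto simp: le_fun_def sqfree_def)
    then show ?thesis using linear_step_multiples[OF lq(2)] \<open>j \<in> V u\<close> by (auto simp: koszul_sel)
  qed
  then obtain \<phi> where \<phi>: "scalar_map ?K F \<phi>" "\<And>T. T \<in> gens ?K \<Longrightarrow> hdeg ?K T = 0 \<Longrightarrow> \<phi> T None = 1"
    using comparison_map[OF koszul_graded R(1), where f = "\<lambda>_. 1"] by metis
  define \<psi> where "\<psi> T c = Poly_Mapping.single (mdeg ?K T - mdeg F c) (\<phi> T c)" for T c
  have "chain_map ?K F \<psi>"
    unfolding \<psi>_def using scalar_map_chain_map[OF koszul_graded _ \<phi>(1)] R(1) by (auto simp: resolves_def)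
  moreover have "\<psi> {} None = monom u"
    using \<phi>(2)[of "{}"] by (simp add: \<psi>_def koszul_sel R(2) symb_mdeg_def)
  moreover have "colon (ideal_gen (monom ` set ms)) u = ideal_gen ((monom ` var ` V u) :: ('n, 'k) pol set)"
    using lq(2) colon_eq_iff_linear_step by blast
  ultimately show ?case using herzog_takayama.cone[OF F] by blast
qed

section \<open>Minimal generators\<close>

text \<open>Every sequence has a monotone subsequence, and a decreasing one of naturals is constant
  from its minimum on.\<close>

lemma nat_seq_mono_subseq:
  fixes s :: "nat \<Rightarrow> nat"
  obtains r :: "nat \<Rightarrow> nat" where "strict_mono r" "\<And>i j. i \<le> j \<Longrightarrow> s (r i) \<le> s (r j)"
proof -
  obtain r where r: "strict_mono r" "monoseq (\<lambda>n. s (r n))" using seq_monosub by blast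
  show thesis
  proof (cases "\<forall>m. \<forall>n\<ge>m. s (r m) \<le> s (r n)")
    case True then show ?thesis using that r(1) by blast
  next
    case False
    then have dec: "\<And>m n. m \<le> n \<Longrightarrow> s (r n) \<le> s (r m)" using r(2) unfolding monoseq_def by blast
    obtain N where N: "\<And>n. s (r N) \<le> s (r n)" using ex_has_least_nat[of "\<lambda>_. True" 0 "\<lambda>n. s (r n)"] by auto
    show ?thesis
    proof (rule that[of "\<lambda>n. r (N + n)"])
      show "strict_mono (\<lambda>n. r (N + n))" using r(1) by (auto simp: strict_mono_def)
      show "s (r (N + i)) \<le> s (r (N + j))" for i j using N[of "N + j"] dec[of N "N + i"] by (simp add: order_trans)
    qed
  qed
qed

text \<open>The sequence is thinned out for one coordinate after the other; coordinates already
  treated stay monotone.\<close>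

lemma dickson_subseq:
  fixes f :: "nat \<Rightarrow> 'n \<Rightarrow> nat"
  assumes "finite S"
  shows "\<exists>r :: nat \<Rightarrow> nat. strict_mono r \<and> (\<forall>k\<in>S. \<forall>i j. i \<le> j \<longrightarrow> f (r i) k \<le> f (r j) k)"
  using assms
proof (induction S rule: finite_induct)
  case empty
  then show ?case using strict_mono_id by blast
next
  case (insert x S)
  then obtain r :: "nat \<Rightarrow> nat" where r: "strict_mono r" "\<And>k i j. k \<in> S \<Longrightarrow> i \<le> j \<Longrightarrow> f (r i) k \<le> f (r j) k" by blast
  obtain q :: "nat \<Rightarrow> nat" where q: "strict_mono q" "\<And>i j. i \<le> j \<Longrightarrow> f (r (q i)) x \<le> f (r (q j)) x"
    using nat_seq_mono_subseq[of "\<lambda>n. f (r n) x"] by blast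
  have "strict_mono (r \<circ> q)" using r(1) q(1) by (rule strict_mono_o)
  moreover have "f ((r \<circ> q) i) k \<le> f ((r \<circ> q) j) k" if "k \<in> insert x S" "i \<le> j" for k i j
    using that q r(2)[of k "q i" "q j"] strict_mono_less_eq[OF q(1), of i j] by auto
  ultimately show ?case by blast
qed

text \<open>Dickson's lemma: otherwise an injective sequence of members of \<open>A\<close> would
  contain two comparable terms.\<close>

lemma dickson:
  fixes A :: "('n::finite \<Rightarrow> nat) set"
  assumes anti: "\<And>a b. a \<in> A \<Longrightarrow> b \<in> A \<Longrightarrow> a \<le> b \<Longrightarrow> a = b"
  shows "finite A"
proof (rule ccontr)
  assume "infinite A"
  then obtain f :: "nat \<Rightarrow> 'n \<Rightarrow> nat" where f: "inj f" "range f \<subseteq> A" using infinite_countable_subset by blast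
  obtain r :: "nat \<Rightarrow> nat" where r: "strict_mono r" "\<And>k i j. i \<le> j \<Longrightarrow> f (r i) k \<le> f (r j) k"
    using dickson_subseq[of UNIV f] by auto
  have "f (r 0) \<le> f (r 1)" using r(2)[of 0 1] by (simp add: le_fun_def)
  then have "f (r 0) = f (r 1)" using anti[of "f (r 0)" "f (r 1)"] f(2) by blast
  then have "r 0 = r 1" using f(1) by (simp add: inj_def)
  then show False using strict_monoD[OF r(1), of 0 1] by simp
qed

lemma min_gens_antichain: "a \<in> min_gens I \<Longrightarrow> b \<in> min_gens I \<Longrightarrow> a \<le> b \<Longrightarrow> a = b"
  by (auto simp: min_gens_def)

lemma finite_min_gens: "finite (min_gens I)"
  by (rule dickson) (rule min_gens_antichain)

lemma min_gens_mons: "m \<in> min_gens I \<longleftrightarrow> m \<in> mons I \<and> (\<forall>m'\<in>mons I. m' \<le> m \<longrightarrow> m' = m)"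
  by (auto simp: min_gens_def mons_def)

lemma exists_min_gen_below:
  assumes "\<alpha> \<in> mons I" shows "\<exists>m\<in>min_gens I. m \<le> \<alpha>"
proof -
  obtain m where m: "m \<in> mons I" "m \<le> \<alpha>" and least: "\<And>m'. m' \<in> mons I \<Longrightarrow> m' \<le> \<alpha> \<Longrightarrow> sum m UNIV \<le> sum m' UNIV"
    using ex_has_least_nat[of "\<lambda>m. m \<in> mons I \<and> m \<le> \<alpha>" \<alpha> "\<lambda>m. sum m UNIV"] assms by auto
  have "m' = m" if m': "m' \<in> mons I" "m' \<le> m" for m'
  proof (rule ccontr)
    assume "m' \<noteq> m"
    then obtain i where "m' i < m i" using m'(2) unfolding le_fun_def fun_eq_iff by (meson order_le_less)
    then have "sum m' UNIV < sum m UNIV" using m'(2) by (intro sum_strict_mono_ex1) (auto simp: le_fun_def)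
    moreover have "sum m UNIV \<le> sum m' UNIV" using least[OF m'(1)] m'(2) m(2) order_trans by blast
    ultimately show False by simp
  qed
  then show ?thesis using m by (auto simp: min_gens_mons)
qed

lemma mons_eq_multiples_min_gens:
  assumes "monomial_ideal I" shows "mons I = multiples (min_gens I)"
proof (intro set_eqI iffI)
  show "x \<in> mons I \<Longrightarrow> x \<in> multiples (min_gens I)" for x
    using exists_min_gen_below unfolding multiples_def by blast
  show "x \<in> mons I" if x: "x \<in> multiples (min_gens I)" for x
  proof -
    obtain m where "m \<in> mons I" "m \<le> x" using x by (auto simp: multiples_def min_gens_mons)
    then show ?thesis by (rule mons_upward[OF assms])
  qed
qed

lemma monomial_ideal_ideal_gen: "monomial_ideal (ideal_gen ((monom ` A) :: ('n::finite, 'k::field) pol set))"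
  by (auto simp: monomial_ideal_def)

lemma ideal_gen_min_gens: "monomial_ideal I \<Longrightarrow> ideal_gen (monom ` min_gens I) = I"
  by (rule monomial_ideal_eqI)
    (simp_all add: monomial_ideal_ideal_gen mons_ideal_gen_multiples mons_eq_multiples_min_gens)

lemma min_gens_ideal_gen:
  assumes "\<And>a b. a \<in> A \<Longrightarrow> b \<in> A \<Longrightarrow> a \<le> b \<Longrightarrow> a = b"
  shows "min_gens (ideal_gen ((monom ` A) :: ('n::finite, 'k::field) pol set)) = A"
proof (intro set_eqI iffI)
  fix m assume "m \<in> min_gens (ideal_gen ((monom ` A) :: ('n, 'k) pol set))"
  then show "m \<in> A" unfolding min_gens_mons mons_ideal_gen_multiples by (auto simp: multiples_def)
next
  fix m assume m: "m \<in> A"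
  have "m' = m" if "s \<in> A" "s \<le> m'" "m' \<le> m" for s m'
    using assms[OF that(1) m] that by (metis order_antisym order_trans)
  then show "m \<in> min_gens (ideal_gen ((monom ` A) :: ('n, 'k) pol set))"
    unfolding min_gens_mons mons_ideal_gen_multiples using m by (auto simp: multiples_def)
qed

lemma one_in_monomial_ideal:
  assumes I: "monomial_ideal I" shows "I = UNIV \<longleftrightarrow> 0 \<in> mons I"
proof
  assume 0: "0 \<in> mons I"
  have "t \<in> mons I" for t by (rule mons_upward[OF I 0]) (simp add: le_fun_def)
  then show "I = UNIV" using mem_monomial_ideal[OF I] by blast
qed (simp add: mons_def)

section \<open>Stable ideals\<close>

text \<open>The lexicographic order with x_1 > x_2 > ..., regardless of degrees; larger generators
  will come first. It is chosen because g(x_j u), for j < max(u), precedes u in it.\<close>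

definition lex_gt :: "('n::linorder \<Rightarrow> nat) \<Rightarrow> ('n \<Rightarrow> nat) \<Rightarrow> bool" where
  "lex_gt p u \<longleftrightarrow> (\<exists>i. u i < p i \<and> (\<forall>k<i. p k = u k))"

lemma lex_gt_irrefl: "\<not> lex_gt u u"
  by (simp add: lex_gt_def)

lemma lex_gt_trans: "lex_gt a b \<Longrightarrow> lex_gt b c \<Longrightarrow> lex_gt a c"
proof -
  assume "lex_gt a b" "lex_gt b c"
  then obtain i j where i: "b i < a i" "\<And>k. k < i \<Longrightarrow> a k = b k" and j: "c j < b j" "\<And>k. k < j \<Longrightarrow> b k = c k"
    by (auto simp: lex_gt_def)
  show "lex_gt a c" unfolding lex_gt_def
    by (rule exI[of _ "min i j"]) (use i j in \<open>auto simp: min_def not_le dest: order_less_trans\<close>, (metis order_less_trans order_le_less)+)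
qed

lemma lex_gt_total:
  fixes a b :: "'n::{finite,linorder} \<Rightarrow> nat"
  assumes "a \<noteq> b" shows "lex_gt a b \<or> lex_gt b a"
proof -
  define i where "i = Min {i. a i \<noteq> b i}"
  have "{i. a i \<noteq> b i} \<noteq> {}" using assms by auto
  then have "a i \<noteq> b i" using Min_in[of "{i. a i \<noteq> b i}"] by (simp add: i_def)
  moreover have "a k = b k" if "k < i" for k
  proof (rule ccontr)
    assume "a k \<noteq> b k"
    then have "i \<le> k" unfolding i_def by (intro Min_le) auto
    then show False using that by simp
  qed
  ultimately show ?thesis unfolding lex_gt_def by (metis linorder_neqE_nat)
qed

lemma mmax_nonzero: "(m :: 'n::{finite,linorder} mon) \<noteq> 0 \<Longrightarrow> m (mmax m) \<noteq> 0"
  using Max_in[of "{i. m i \<noteq> 0}"] by (auto simp: mmax_def fun_eq_iff)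

lemma mmax_ge: "(m :: 'n::{finite,linorder} mon) i \<noteq> 0 \<Longrightarrow> i \<le> mmax m"
  by (simp add: mmax_def)

lemma above_mmax: "mmax (m :: 'n::{finite,linorder} mon) < i \<Longrightarrow> m i = 0"
  using mmax_ge[of m i] by force

text \<open>The Eliahou-Kervaire condition on the decomposition of w: since max(u) \<open>\<le>\<close> min(w/u), the
  exponents of u and w agree below max(u).\<close>

definition initial_part :: "'n::linorder mon \<Rightarrow> 'n mon \<Rightarrow> bool" where
  "initial_part u w \<longleftrightarrow> u \<le> w \<and> (\<forall>i<mmax u. w i = u i)"

lemma initial_part_iff:
  fixes u w :: "'n::{finite,linorder} mon"
  shows "u \<le> w \<and> (w = u \<or> mmax u \<le> mmin (w - u)) \<longleftrightarrow> initial_part u w"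
proof (cases "u \<le> w \<and> w \<noteq> u")
  case True
  then have *: "((w - u) i \<noteq> 0) = (w i \<noteq> u i)" for i by (auto simp: le_fun_def) (metis le_antisym)
  have "{i. (w - u) i \<noteq> 0} \<noteq> {}" using True * by (auto simp: fun_eq_iff)
  then have "(mmax u \<le> mmin (w - u)) = (\<forall>i. (w - u) i \<noteq> 0 \<longrightarrow> mmax u \<le> i)" by (simp add: mmin_def)
  also have "\<dots> = (\<forall>i<mmax u. w i = u i)" unfolding * by (metis linorder_not_less)
  finally show ?thesis using True by (simp add: initial_part_def)
qed (auto simp: initial_part_def)

locale stable_ideal =
  fixes I :: "('n::{finite,linorder}, 'k::field) pol set"
  assumes monomial: "monomial_ideal I" and proper: "0 \<notin> mons I" and stable: "stable I"
begin

lemma gen_nonzero: "u \<in> min_gens I \<Longrightarrow> u \<noteq> 0"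
  using proper by (auto simp: min_gens_mons)

text \<open>Below its maximal variable each of u and v agrees with w. Comparing them at max(u) as
  well shows that one divides the other, which minimal generators do only if they are equal.\<close>

lemma initial_part_unique_aux:
  assumes "u \<in> min_gens I" "v \<in> min_gens I" "initial_part u w" "initial_part v w" "mmax u \<le> mmax v"
  shows "u = v"
proof -
  have "u \<le> v \<or> v \<le> u"
  proof (cases "mmax u < mmax v \<or> u (mmax u) \<le> v (mmax u)")
    case True
    have "u i \<le> v i" for i
    proof -
      consider "i < mmax u" | "i = mmax u" | "mmax u < i" by fastforce
      then show ?thesis
      proof cases
        assume "i < mmax u"
        then have "i < mmax v" "w i = u i" using assms(3,5) by (auto simp: initial_part_def)
        then show ?thesis using assms(4) by (simp add: initial_part_def)
      next
        assume i: "i = mmax u"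
        show ?thesis
        proof (cases "mmax u < mmax v")
          case True
          then have "w i = v i" using i assms(4) by (simp add: initial_part_def)
          then show ?thesis using assms(3) by (metis initial_part_def le_funD)
        qed (use True i in auto)
      qed (simp add: above_mmax)
    qed
    then show ?thesis by (simp add: le_fun_def)
  next
    case False
    then have eq: "mmax u = mmax v" and le: "v (mmax u) \<le> u (mmax u)" using assms(5) by auto
    have "v i \<le> u i" for i
    proof -
      consider "i < mmax u" | "i = mmax u" | "mmax u < i" by fastforce
      then show ?thesis
      proof cases
        assume "i < mmax u"
        then have "w i = v i" "w i = u i" using assms(3,4) eq by (auto simp: initial_part_def)
        then show ?thesis by simp
      qed (use le eq in \<open>simp_all add: above_mmax\<close>)
    qed
    then show ?thesis by (simp add: le_fun_def)
  qed
  then show ?thesis using min_gens_antichain assms(1,2) by metis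
qed

lemma initial_part_unique:
  "u \<in> min_gens I \<Longrightarrow> v \<in> min_gens I \<Longrightarrow> initial_part u w \<Longrightarrow> initial_part v w \<Longrightarrow> u = v"
  using initial_part_unique_aux[of u v w] initial_part_unique_aux[of v u w] linear[of "mmax u" "mmax v"] by blast

text \<open>Replacing a variable by an earlier one lowers the weighted degree, so a divisor of minimal
  weighted degree is the initial part.\<close>

lemma initial_part_exists:
  assumes w: "w \<in> mons I" shows "\<exists>u\<in>min_gens I. initial_part u w"
proof -
  define r :: "'n \<Rightarrow> nat" where "r k = card {l. l \<le> k}" for k
  define wt where "wt u = (\<Sum>k\<in>UNIV. u k * r k)" for u :: "'n mon"
  have r: "r i < r j" if "i < j" for i j
    unfolding r_def
  proof (rule psubset_card_mono)
    have "j \<notin> {l. l \<le> i}" "j \<in> {l. l \<le> j}" "{l. l \<le> i} \<subseteq> {l. l \<le> j}" using that by auto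
    then show "{l. l \<le> i} \<subset> {l. l \<le> j}" by blast
  qed simp
  obtain u where u: "u \<in> min_gens I" "u \<le> w" and least: "\<And>v. v \<in> min_gens I \<Longrightarrow> v \<le> w \<Longrightarrow> wt u \<le> wt v"
    using ex_has_least_nat[of "\<lambda>u. u \<in> min_gens I \<and> u \<le> w" _ wt] exists_min_gen_below[OF w] by blast
  have "w i = u i" if i: "i < mmax u" for i
  proof (rule ccontr)
    assume "w i \<noteq> u i"
    then have wi: "u i < w i" using u(2) by (metis le_fun_def le_neq_implies_less)
    define m where "m = mmax u"
    have um: "u m \<noteq> 0" unfolding m_def by (rule mmax_nonzero[OF gen_nonzero[OF u(1)]])
    define u' where "u' = var i + (u - var m)"
    have "u' \<in> mons I" using stable u(1) i unfolding stable_def mons_def u'_def m_def by blast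
    then obtain v where v: "v \<in> min_gens I" "v \<le> u'" using exists_min_gen_below by blast
    have u'k: "u' k + (if k = m then 1 else 0) = u k + (if k = i then 1 else 0)" for k
      using um i by (auto simp: u'_def var_def m_def)
    have "u' k \<le> w k" for k
      using u'k[of k] le_funD[OF u(2), of k] wi by (auto split: if_splits)
    then have "v \<le> w" using v(2) by (meson le_funI order_trans le_funD)
    then have "wt u \<le> wt v" using least v(1) by blast
    also have "wt v \<le> wt u'" unfolding wt_def using le_funD[OF v(2)] by (intro sum_mono mult_right_mono) auto
    finally have "wt u \<le> wt u'" .
    moreover have "wt u' + r m = wt u + r i"
    proof -
      have "wt u' + r m = (\<Sum>k\<in>UNIV. (u' k + (if k = m then 1 else 0)) * r k)"
        by (simp add: wt_def distrib_right sum.distrib if_distrib[of "\<lambda>x. x * _"] cong: if_cong)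
      also have "\<dots> = (\<Sum>k\<in>UNIV. (u k + (if k = i then 1 else 0)) * r k)" by (simp only: u'k)
      also have "\<dots> = wt u + r i"
        by (simp add: wt_def distrib_right sum.distrib if_distrib[of "\<lambda>x. x * _"] cong: if_cong)
      finally show ?thesis .
    qed
    ultimately show False using r[OF i] by (simp add: m_def)
  qed
  then show ?thesis using u by (auto simp: initial_part_def)
qed

abbreviation g :: "'n mon \<Rightarrow> 'n mon" where "g \<equiv> ek_gen I"

lemma g_eqI: "u \<in> min_gens I \<Longrightarrow> initial_part u w \<Longrightarrow> g w = u"
  unfolding ek_gen_def initial_part_iff by (rule the_equality) (auto intro: initial_part_unique)

lemma g_in: "w \<in> mons I \<Longrightarrow> g w \<in> min_gens I"
  and g_initial: "w \<in> mons I \<Longrightarrow> initial_part (g w) w"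
  using initial_part_exists[of w] g_eqI[of _ w] by auto

lemma gen_mons: "u \<in> min_gens I \<Longrightarrow> u \<in> mons I"
  by (simp add: min_gens_mons)

lemma var_add_mons: "u \<in> mons I \<Longrightarrow> var j + u \<in> mons I"
  by (rule mons_upward[OF monomial]) (auto simp: le_fun_def)

lemma g_var_above: "u \<in> min_gens I \<Longrightarrow> mmax u \<le> j \<Longrightarrow> g (var j + u) = u"
  by (rule g_eqI) (auto simp: initial_part_def le_fun_def var_def)

text \<open>The identity behind the commutation of the operators that replace u by g(x_j u). The
  initial part of x_i g(w) is shown to be an initial part of x_i w as well, and initial parts are
  unique.\<close>

lemma g_var_g:
  assumes w: "w \<in> mons I" shows "g (var i + g w) = g (var i + w)"
proof -
  define a where "a = g w"
  define b where "b = g (var i + a)"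
  have a: "a \<in> min_gens I" "a \<le> w" "\<And>k. k < mmax a \<Longrightarrow> w k = a k"
    using g_in[OF w] g_initial[OF w] by (auto simp: a_def initial_part_def)
  have ia: "var i + a \<in> mons I" using var_add_mons gen_mons[OF a(1)] by blast
  have b: "b \<in> min_gens I" "b \<le> var i + a" "\<And>k. k < mmax b \<Longrightarrow> (var i + a) k = b k"
    using g_in[OF ia] g_initial[OF ia] by (auto simp: b_def initial_part_def)
  have "w k = a k" if k: "k < mmax b" for k
  proof (cases "k < mmax a")
    case False
    \<comment> \<open>The variable at max(b) does not occur in a, so it is x_i, with i beyond
      max(a); but then b = a, a contradiction.\<close>
    then have lt: "mmax a < mmax b" using k by simp
    have "b (mmax b) \<noteq> 0" using mmax_nonzero gen_nonzero[OF b(1)] by blast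
    moreover have "a (mmax b) = 0" using lt by (rule above_mmax)
    ultimately have "i = mmax b" using le_funD[OF b(2), of "mmax b"] by (auto simp: var_def split: if_splits)
    then have "b = a" using g_var_above[OF a(1), of i] lt by (simp add: b_def)
    then show ?thesis using lt by simp
  qed (use a in auto)
  then have "(var i + w) k = b k" if "k < mmax b" for k using b(3)[OF that] that by simp
  moreover have "b \<le> var i + w" using b(2) add_left_mono[OF a(2), of "var i"] by (rule order_trans)
  ultimately have "initial_part b (var i + w)" by (simp add: initial_part_def)
  from g_eqI[OF b(1) this] show ?thesis unfolding b_def a_def by (rule sym)
qed

text \<open>Both sides are the initial part of x_i x_j u.\<close>

lemma g_var_commute:
  assumes "u \<in> min_gens I" shows "g (var i + g (var j + u)) = g (var j + g (var i + u))"
  using g_var_g[OF var_add_mons[OF gen_mons[OF assms]]] by (simp add: add.left_commute)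

lemma mmax_g_var:
  assumes u: "u \<in> min_gens I" shows "mmax (g (var j + u)) \<le> max (mmax u) j"
proof -
  have ju: "var j + u \<in> mons I" using var_add_mons gen_mons[OF u] by blast
  have "g (var j + u) \<le> var j + u" using g_initial[OF ju] by (simp add: initial_part_def)
  then have "g (var j + u) (mmax (g (var j + u))) \<le> (var j + u) (mmax (g (var j + u)))" by (rule le_funD)
  then have "(var j + u) (mmax (g (var j + u))) \<noteq> 0"
    using mmax_nonzero[OF gen_nonzero[OF g_in[OF ju]]] by linarith
  then show ?thesis using mmax_ge[of u] by (auto simp: var_def le_max_iff_disj split: if_splits)
qed

text \<open>Were the exponent of g(x_j u) at j not larger than that of u, it would divide u and
  hence equal u, which is no initial part of x_j u. Its maximal variable is at least j, so it agrees
  with u below j. Thus the differential leads only to u itself and to lexicographically larger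
  generators.\<close>

lemma lex_gt_g_var:
  assumes u: "u \<in> min_gens I" and j: "j < mmax u"
  shows "lex_gt (g (var j + u)) u"
proof -
  define p where "p = g (var j + u)"
  have ju: "var j + u \<in> mons I" using var_add_mons gen_mons[OF u] by blast
  have p: "p \<in> min_gens I" "p \<le> var j + u" "\<And>k. k < mmax p \<Longrightarrow> (var j + u) k = p k"
    using g_in[OF ju] g_initial[OF ju] by (auto simp: p_def initial_part_def)
  have jp: "j \<le> mmax p"
  proof (rule ccontr)
    assume "\<not> j \<le> mmax p"
    then have pj: "mmax p < j" by simp
    have "p k \<le> u k" for k using le_funD[OF p(2), of k] above_mmax[OF pj] by (cases "k = j") (auto simp: var_def)
    then have "p = u" using min_gens_antichain[OF p(1) u] by (simp add: le_fun_def)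
    then show False using pj j by simp
  qed
  have below: "p k = u k" if "k < j" for k
    using p(3)[OF order_less_le_trans[OF that jp]] that by (auto simp: var_def split: if_splits)
  have "u j < p j"
  proof (rule ccontr)
    assume "\<not> u j < p j"
    then have pj: "p j \<le> u j" by simp
    have "p k \<le> u k" for k using le_funD[OF p(2), of k] pj by (cases "k = j") (auto simp: var_def)
    then have "p = u" using min_gens_antichain[OF p(1) u] by (simp add: le_fun_def)
    then show False using p(3)[of j] j by (auto simp: var_def)
  qed
  then show ?thesis using below unfolding lex_gt_def p_def by blast
qed

text \<open>A lexicographically larger generator first exceeds u at a variable before max(u), for
  otherwise u would divide it. Conversely g(x_j u) divides x_j u and is lexicographically
  larger.\<close>

lemma lex_linear_step:
  assumes u: "u \<in> min_gens I"
  shows "linear_step {p \<in> min_gens I. lex_gt p u} u {j. j < mmax u}"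
  unfolding linear_step_def
proof (intro conjI ballI)
  fix p assume "p \<in> {p \<in> min_gens I. lex_gt p u}"
  then obtain i where p: "p \<in> min_gens I" and i: "u i < p i" "\<And>k. k < i \<Longrightarrow> p k = u k" by (auto simp: lex_gt_def)
  have "i < mmax u"
  proof (rule ccontr)
    assume "\<not> i < mmax u"
    then have "u k \<le> p k" for k using i above_mmax[of u k] by (cases "k < i"; cases "k = i") auto
    then have "u = p" using min_gens_antichain[OF u p] by (simp add: le_fun_def)
    then show False using i by simp
  qed
  then show "\<exists>j\<in>{j. j < mmax u}. u j < p j" using i by blast
next
  fix j assume "j \<in> {j. j < mmax u}"
  then have "j < mmax u" by simp
  have ju: "var j + u \<in> mons I" using var_add_mons gen_mons[OF u] by blast
  have "g (var j + u) \<le> u + var j" using g_initial[OF ju] by (simp add: initial_part_def add.commute)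
  then show "\<exists>p\<in>{p \<in> min_gens I. lex_gt p u}. p \<le> u + var j"
    using g_in[OF ju] lex_gt_g_var[OF u \<open>j < mmax u\<close>] by blast
qed

end

section \<open>The Eliahou-Kervaire complex as an iterated cone\<close>

lemma sorted_enumeration:
  assumes "finite G" and trans: "\<And>a b c. r a b \<Longrightarrow> r b c \<Longrightarrow> r a c"
    and total: "\<And>a b. a \<in> G \<Longrightarrow> b \<in> G \<Longrightarrow> a \<noteq> b \<Longrightarrow> r a b \<or> r b a"
  shows "\<exists>xs. sorted_wrt r xs \<and> set xs = G \<and> distinct xs"
  using assms(1) total
proof (induction G rule: finite_induct)
  case empty
  then show ?case by (intro exI[of _ "[]"]) simp
next
  case (insert x G)
  then obtain xs where xs: "sorted_wrt r xs" "set xs = G" "distinct xs" by auto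
  define ys where "ys = filter (\<lambda>y. r y x) xs @ x # filter (\<lambda>y. \<not> r y x) xs"
  have "r x y" if "y \<in> G" "\<not> r y x" for y using insert.prems[of x y] insert.hyps that by auto
  then have "sorted_wrt r ys"
    unfolding ys_def sorted_wrt_append using xs trans by (auto simp: sorted_wrt_filter)
  moreover have "set ys = insert x G" "distinct ys" using xs insert.hyps by (auto simp: ys_def)
  ultimately show ?case by blast
qed

lemma sorted_wrt_prefix:
  assumes "sorted_wrt r xs" "xs = pre @ u # post" and irrefl: "\<And>a. \<not> r a a" and trans: "\<And>a b c. r a b \<Longrightarrow> r b c \<Longrightarrow> r a c"
  shows "set pre = {p \<in> set xs. r p u}"
proof -
  have "\<forall>p\<in>set pre. r p u" "\<forall>q\<in>set post. r u q"
    using assms(1) unfolding assms(2) sorted_wrt_append by auto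
  moreover have "\<not> r q u" if "r u q" for q using irrefl trans that by blast
  ultimately show ?thesis unfolding assms(2) using irrefl by auto
qed

lemma sqfree_remove_add: "j \<in> T \<Longrightarrow> sqfree T + u - (sqfree (T - {j}) + v) = var j + u - v"
  by (auto simp: fun_eq_iff sqfree_def var_def)

context stable_ideal
begin

definition lower_vars :: "'n mon \<Rightarrow> 'n set" where
  "lower_vars u = {j. j < mmax u}"

text \<open>The scalar differential on all symbols, also those violating j_t < max(u), since it is
  easier to square there. Here signs count positions from 0, in the Eliahou-Kervaire formula from 1;
  hence the minus sign in \<open>ekc\<close>.\<close>

definition el :: "'n set \<Rightarrow> 'n mon \<Rightarrow> 'n set \<Rightarrow> 'n mon \<Rightarrow> 'k" where
  "el T u T' v = (\<Sum>j\<in>T. if T' = T - {j} then simplex_sgn id T j * ((if v = u then 1 else 0) - (if v = g (var j + u) then 1 else 0)) else 0)"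

definition ekc :: "'n symb \<Rightarrow> 'n symb \<Rightarrow> 'k" where
  "ekc b c = (case b of None \<Rightarrow> 0 | Some (T, u) \<Rightarrow>
     (case c of None \<Rightarrow> if T = {} then 1 else 0 | Some (T', v) \<Rightarrow> - el T u T' v))"

lemma el_nonzeroD:
  assumes "el T u T' v \<noteq> 0"
  shows "\<exists>j\<in>T. T' = T - {j} \<and> (v = u \<or> v = g (var j + u))"
proof -
  obtain j where "j \<in> T" "(if T' = T - {j} then simplex_sgn id T j * ((if v = u then 1 else 0) - (if v = g (var j + u) then 1 else 0)) else 0) \<noteq> (0 :: 'k)"
    using assms unfolding el_def by (rule sum_nonzeroE)
  then show ?thesis by (auto split: if_splits)
qed

lemma ek_bd: "bd (eliahou_kervaire I) b c = Poly_Mapping.single (symb_mdeg b - symb_mdeg c) (ekc b c)"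
proof (cases b)
  case None
  then show ?thesis by (simp add: eliahou_kervaire_def ekc_def)
next
  case (Some p)
  obtain T u where p: "p = (T, u)" by fastforce
  show ?thesis
  proof (cases c)
    case None
    then show ?thesis using Some p by (simp add: eliahou_kervaire_def ekc_def symb_mdeg_def)
  next
    case (Some q)
    obtain T' v where q: "q = (T', v)" by fastforce
    have "(-1) ^ card {k \<in> T. k \<le> j} *
         ((if T' = T - {j} \<and> v = u then monom (var j) else 0) -
          (let g = ek_gen I (var j + u) in if T' = T - {j} \<and> v = g then monom ((var j + u) - g) else 0))
        = Poly_Mapping.single (sqfree T + u - (sqfree T' + v))
           (- (if T' = T - {j} then simplex_sgn id T j * ((if v = u then 1 else 0) - (if v = g (var j + u) then 1 else 0)) else 0 :: 'k))"
      if j: "j \<in> T" for j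
    proof (cases "T' = T - {j}")
      case True
      have "{k \<in> T. k \<le> j} = insert j {k \<in> T. id k < id j}" using j by auto
      then have "(-1) ^ card {k \<in> T. k \<le> j} = (- simplex_sgn id T j :: 'k)" 
        by (simp add: simplex_sgn_def)
      moreover have "(-1) ^ card {k \<in> T. k \<le> j} * Poly_Mapping.single D x = Poly_Mapping.single D ((-1) ^ card {k \<in> T. k \<le> j} * x)" for D :: "'n mon" and x :: 'k
        by (cases "even (card {k \<in> T. k \<le> j})") (simp_all add: single_uminus)
      moreover have "sqfree T + u - (sqfree T' + v) = var j + u - v" unfolding True by (rule sqfree_remove_add[OF j])
      moreover have "(if T' = T - {j} \<and> v = u then monom (var j) else 0) -
          (let g = ek_gen I (var j + u) in if T' = T - {j} \<and> v = g then monom ((var j + u) - g) else 0)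
         = Poly_Mapping.single (var j + u - v) ((if v = u then 1 else 0) - (if v = g (var j + u) then 1 else 0) :: 'k)"
        using True by (auto simp: single_diff Let_def)
      ultimately show ?thesis using True by simp
    qed simp
    then have "bd (eliahou_kervaire I) (Some (T, u)) (Some (T', v)) = Poly_Mapping.single (sqfree T + u - (sqfree T' + v)) (- el T u T' v)"
      unfolding el_def sum_negf[symmetric] single_sum by (simp add: eliahou_kervaire_def)
    then show ?thesis using \<open>b = Some p\<close> p Some q by (simp add: ekc_def symb_mdeg_def)
  qed
qed

lemma sum_el:
  assumes "finite B" "u \<in> B" "\<And>j. j \<in> T \<Longrightarrow> g (var j + u) \<in> B"
  shows "(\<Sum>T'\<in>UNIV. \<Sum>v\<in>B. el T u T' v * f T' v) = (\<Sum>j\<in>T. simplex_sgn id T j * (f (T - {j}) u - f (T - {j}) (g (var j + u))))"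
proof -
  have "(\<Sum>T'\<in>UNIV. \<Sum>v\<in>B. el T u T' v * f T' v)
     = (\<Sum>T'\<in>UNIV. \<Sum>v\<in>B. \<Sum>j\<in>T. if T' = T - {j} then simplex_sgn id T j * ((if v = u then f (T - {j}) v else 0) - (if v = g (var j + u) then f (T - {j}) v else 0)) else 0)"
    unfolding el_def sum_distrib_right by (intro sum.cong refl) (auto simp: algebra_simps)
  also have "\<dots> = (\<Sum>j\<in>T. \<Sum>T'\<in>UNIV. \<Sum>v\<in>B. if T' = T - {j} then simplex_sgn id T j * ((if v = u then f (T - {j}) v else 0) - (if v = g (var j + u) then f (T - {j}) v else 0)) else 0)"
    by (subst sum.swap[of _ T], subst (2) sum.swap, rule refl)
  also have "\<dots> = (\<Sum>j\<in>T. \<Sum>T'\<in>UNIV. if T' = T - {j} then simplex_sgn id T j * (f (T - {j}) u - f (T - {j}) (g (var j + u))) else 0)"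
  proof (intro sum.cong refl, goal_cases)
    case (1 j T')
    then show ?case using assms by (auto simp: sum_distrib_left[symmetric] sum_subtractf)
  qed
  also have "\<dots> = (\<Sum>j\<in>T. simplex_sgn id T j * (f (T - {j}) u - f (T - {j}) (g (var j + u))))" by simp
  finally show ?thesis .
qed

text \<open>On all symbols the differential is an alternating sum of the commuting operators that
  remove j from T and replace u by u - g(x_j u).\<close>

lemma el_el:
  assumes u: "u \<in> min_gens I"
  shows "(\<Sum>T'\<in>UNIV. \<Sum>v\<in>min_gens I. el T u T' v * el T' v S w) = 0"
proof -
  have gu: "g (var j + u) \<in> min_gens I" for j using g_in var_add_mons gen_mons[OF u] by blast
  define d where "d v = (if w = v then 1 else 0 :: 'k)" for v
  have "(\<Sum>T'\<in>UNIV. \<Sum>v\<in>min_gens I. el T u T' v * el T' v S w)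
     = (\<Sum>j\<in>T. simplex_sgn id T j * (el (T - {j}) u S w - el (T - {j}) (g (var j + u)) S w))"
    by (rule sum_el) (use finite_min_gens u gu in auto)
  also have "\<dots> = (\<Sum>j\<in>T. \<Sum>i\<in>T - {j}. if S = T - {j} - {i} then simplex_sgn id T j * simplex_sgn id (T - {j}) i *
       (d u - d (g (var i + u)) - (d (g (var j + u)) - d (g (var i + g (var j + u))))) else 0)"
    unfolding el_def sum_subtractf[symmetric] sum_distrib_left d_def
    by (intro sum.cong refl) (auto simp: algebra_simps)
  also have "\<dots> = 0"
  proof (rule sum_antisymmetric[of T id])
    fix j i assume ji: "j \<in> T" "i \<in> T" "j \<noteq> i"
    have sets: "T - {j} - {i} = T - {i} - {j}" by blast
    have "simplex_sgn id T j * simplex_sgn id (T - {j}) i = - (simplex_sgn id T i * simplex_sgn id (T - {i}) j :: 'k)"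
      using ji by (intro simplex_sgn_swap) auto
    then show "(if S = T - {j} - {i} then simplex_sgn id T j * simplex_sgn id (T - {j}) i *
       (d u - d (g (var i + u)) - (d (g (var j + u)) - d (g (var i + g (var j + u))))) else 0)
     = - (if S = T - {i} - {j} then simplex_sgn id T i * simplex_sgn id (T - {i}) j *
       (d u - d (g (var j + u)) - (d (g (var i + u)) - d (g (var j + g (var i + u))))) else 0)"
      unfolding sets g_var_commute[OF u, of j i] by (simp add: algebra_simps)
  qed auto
  finally show ?thesis .
qed

text \<open>The symbols that violate j_t < max(u) span a subcomplex.\<close>

lemma el_invalid:
  assumes v: "v \<in> min_gens I" and T: "\<not> T \<subseteq> lower_vars v" and S: "S \<subseteq> lower_vars w"
  shows "el T v S w = 0"
  unfolding el_def
proof (rule sum.neutral, intro ballI)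
  fix j assume j: "j \<in> T"
  define m where "m = Max T"
  have "T \<noteq> {}" using j by auto
  then have m: "m \<in> T" "\<And>i. i \<in> T \<Longrightarrow> i \<le> m" by (auto simp: m_def)
  have vm: "mmax v \<le> m" using T m by (force simp: lower_vars_def not_less)
  show "(if S = T - {j} then simplex_sgn id T j * ((if w = v then 1 else 0) - (if w = g (var j + v) then 1 else 0)) else 0) = (0 :: 'k)"
  proof (cases "j = m")
    case True
    then show ?thesis using g_var_above[OF v vm] by simp
  next
    case False
    have "w \<noteq> v" "w \<noteq> g (var j + v)" if "S = T - {j}"
    proof -
      have "m < mmax w" using that S m(1) False by (auto simp: lower_vars_def)
      moreover have "mmax (g (var j + v)) \<le> m" using mmax_g_var[OF v, of j] vm m(2)[OF j] by (meson max.boundedI order_trans)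
      ultimately show "w \<noteq> v" "w \<noteq> g (var j + v)" using vm by auto
    qed
    then show ?thesis by auto
  qed
qed

text \<open>Restricted to an initial segment of the lexicographic order, so that adding one
  generator becomes a mapping cone.\<close>

definition ek_part :: "'n mon set \<Rightarrow> ('n symb, 'n, 'k) free_complex" where
  "ek_part A = (eliahou_kervaire I) \<lparr> gens := symbols A lower_vars \<rparr>"

text \<open>Ensures that the differential does not leave \<open>ek_part A\<close>.\<close>

definition closed :: "'n mon set \<Rightarrow> bool" where
  "closed A \<longleftrightarrow> A \<subseteq> min_gens I \<and> (\<forall>u\<in>A. \<forall>j<mmax u. g (var j + u) \<in> A)"

lemma ek_part_sel:
  "gens (ek_part A) = symbols A lower_vars" "hdeg (ek_part A) = symb_hdeg" "mdeg (ek_part A) = symb_mdeg"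
  "bd (ek_part A) b c = Poly_Mapping.single (symb_mdeg b - symb_mdeg c) (ekc b c)"
  by (simp_all add: ek_part_def ek_bd) (simp_all add: eliahou_kervaire_def)

lemma ek_part_cf: "cf (ek_part A) b c = ekc b c"
  by (rule cf_eqI) (simp add: ek_part_sel)

lemma symbols_as_image: "symbols A V = insert None ((\<lambda>(T, u). Some (T, u)) ` {(T, u). u \<in> A \<and> T \<subseteq> V u})"
  by (auto simp: symbols_def)

text \<open>The sum over the basis may be extended to all symbols: generators outside
  \<open>A\<close> are not reached, and symbols violating the bound on T never lead back to the
  basis by \<open>el_invalid\<close>. Over all symbols the square vanishes by
  \<open>el_el\<close>.\<close>

lemma ek_part_graded:
  assumes A: "closed A" shows "graded_free_complex (ek_part A)"
proof (rule gradedI[where k = ekc], unfold ek_part_sel)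
  have AG: "A \<subseteq> min_gens I" and clos: "\<And>u j. u \<in> A \<Longrightarrow> j < mmax u \<Longrightarrow> g (var j + u) \<in> A"
    using A by (auto simp: closed_def)
  have fA: "finite A" using AG finite_min_gens finite_subset by blast
  show fin: "finite (symbols A lower_vars)" by (rule finite_symbols[OF fA])
  show "symb_hdeg b = Suc (symb_hdeg c) \<and> symb_mdeg c \<le> symb_mdeg b"
    if b: "b \<in> symbols A lower_vars" and c: "c \<in> symbols A lower_vars" and ne: "ekc b c \<noteq> 0" for b c
  proof -
    obtain T u where b': "b = Some (T, u)" "u \<in> A" using b ne by (auto simp: symbols_def ekc_def)
    show ?thesis
    proof (cases c)
      case None
      then have "T = {}" using ne b' by (auto simp: ekc_def split: if_splits)
      then show ?thesis using None b' by (simp add: symb_hdeg_def symb_mdeg_def le_fun_def)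
    next
      case (Some q)
      obtain T' v where q: "q = (T', v)" by fastforce
      then have "el T u T' v \<noteq> 0" using ne b' Some by (simp add: ekc_def)
      then obtain j where j: "j \<in> T" "T' = T - {j}" and v: "v = u \<or> v = g (var j + u)" using el_nonzeroD by blast
      have card_T: "card T = Suc (card T')" using card.remove[of T j] j by simp
      have "v \<le> var j + u"
        using v g_initial[OF var_add_mons[OF gen_mons]] b'(2) AG by (auto simp: initial_part_def le_fun_def)
      then have "sqfree T' + v \<le> sqfree T' + (var j + u)" by (rule add_left_mono)
      moreover have "sqfree T = sqfree T' + var j" using j by (auto simp: fun_eq_iff sqfree_def var_def)
      ultimately have "sqfree T' + v \<le> sqfree T + u" by (simp add: add.assoc)
      then show ?thesis using card_T b' Some q by (simp add: symb_hdeg_def symb_mdeg_def)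
    qed
  qed
  show "(\<Sum>c\<in>symbols A lower_vars. ekc b c * ekc c e) = 0"
    if b: "b \<in> symbols A lower_vars" and e: "e \<in> symbols A lower_vars" and h: "symb_hdeg b = Suc (Suc (symb_hdeg e))" for b e
  proof -
    obtain T u where b': "b = Some (T, u)" "u \<in> A" "T \<subseteq> lower_vars u" using b h by (auto simp: symbols_def symb_hdeg_def)
    have uG: "u \<in> min_gens I" using b' AG by blast
    define P where "P = {(T', v). v \<in> A \<and> T' \<subseteq> lower_vars v}"
    have fP: "finite P" by (rule finite_subset[of _ "UNIV \<times> A"]) (use fA in \<open>auto simp: P_def\<close>)
    have "(\<Sum>c\<in>symbols A lower_vars. ekc b c * ekc c e) = ekc b None * ekc None e + (\<Sum>c\<in>(\<lambda>(T, u). Some (T, u)) ` P. ekc b c * ekc c e)"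
      unfolding symbols_as_image P_def[symmetric] using fP by (subst sum.insert) auto
    also have "(\<Sum>c\<in>(\<lambda>(T, u). Some (T, u)) ` P. ekc b c * ekc c e) = (\<Sum>p\<in>P. ekc b (Some p) * ekc (Some p) e)"
      by (subst sum.reindex) (auto simp: inj_on_def)
    finally have sum: "(\<Sum>c\<in>symbols A lower_vars. ekc b c * ekc c e) = (\<Sum>p\<in>P. ekc b (Some p) * ekc (Some p) e)"
      by (simp add: ekc_def)
    show ?thesis
    proof (cases e)
      case None
      then have "card T = 1" using h b' by (simp add: symb_hdeg_def)
      then obtain j where j: "T = {j}" by (auto simp: card_Suc_eq)
      then have "j < mmax u" using b'(3) by (simp add: lower_vars_def)
      then have gA: "g (var j + u) \<in> A" using clos b'(2) by blast
      have "(\<Sum>p\<in>P. ekc b (Some p) * ekc (Some p) e) = (\<Sum>p\<in>P. if fst p = {} then - el T u {} (snd p) else 0)"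
        unfolding b'(1) None by (intro sum.cong refl) (auto simp: ekc_def split: prod.splits)
      also have "\<dots> = (\<Sum>p\<in>Pair ({} :: 'n set) ` A. if fst p = {} then - el T u {} (snd p) else 0)"
        by (rule sum.mono_neutral_right) (use fP in \<open>auto simp: P_def\<close>)
      also have "\<dots> = (\<Sum>v\<in>A. - el T u {} v)" by (subst sum.reindex) (auto simp: inj_on_def)
      \<comment> \<open>For the end at \<open>None\<close> the set T is a singleton; its terms at u
        and at g(x_j u) have opposite signs, both continue to \<open>None\<close> with coefficient
        1, and so they cancel.\<close>
      also have "\<dots> = (\<Sum>v\<in>A. (if v = g (var j + u) then 1 else 0) - (if v = u then 1 else 0))"
      proof (intro sum.cong refl)
        have "{v \<in> {j}. id v < id j} = {}" by auto
        then have "simplex_sgn id {j} j = (1 :: 'k)" unfolding simplex_sgn_def by (simp only: card.empty power_0)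
        then show "- el T u {} v = (if v = g (var j + u) then 1 else 0) - (if v = u then 1 else 0)" for v
          by (simp add: el_def j)
      qed
      also have "\<dots> = 0" using fA gA b'(2) by (simp add: sum_subtractf)
      finally show ?thesis using sum by simp
    next
      case (Some q)
      obtain S w where q: "q = (S, w)" by fastforce
      have S: "S \<subseteq> lower_vars w" using e Some q by (auto simp: symbols_def)
      have "(\<Sum>p\<in>P. ekc b (Some p) * ekc (Some p) e) = (\<Sum>(T', v)\<in>P. el T u T' v * el T' v S w)"
        unfolding b'(1) Some q by (intro sum.cong refl) (auto simp: ekc_def)
      also have "\<dots> = (\<Sum>(T', v)\<in>UNIV \<times> min_gens I. el T u T' v * el T' v S w)"
      proof (rule sum.mono_neutral_left)
        show "finite ((UNIV :: 'n set set) \<times> min_gens I)" by (intro finite_cartesian_product finite_min_gens) simp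
        show "P \<subseteq> UNIV \<times> min_gens I" using AG by (auto simp: P_def)
        show "\<forall>p\<in>UNIV \<times> min_gens I - P. (case p of (T', v) \<Rightarrow> el T u T' v * el T' v S w) = 0"
        proof (intro ballI, rule ccontr)
          fix p assume p: "p \<in> UNIV \<times> min_gens I - P" and ne: "(case p of (T', v) \<Rightarrow> el T u T' v * el T' v S w) \<noteq> 0"
          obtain T' v where p': "p = (T', v)" by fastforce
          then have ne': "el T u T' v \<noteq> 0" "el T' v S w \<noteq> 0" using ne by auto
          have "T' \<subseteq> lower_vars v" using el_invalid[of v T' S w] S p p' ne'(2) by blast
          moreover have "v \<in> A"
          proof -
            obtain j where "j \<in> T" "v = u \<or> v = g (var j + u)" using el_nonzeroD[OF ne'(1)] by blast
            then show ?thesis using b' clos by (auto simp: lower_vars_def)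
          qed
          ultimately show False using p p' by (simp add: P_def)
        qed
      qed
      also have "\<dots> = (\<Sum>T'\<in>UNIV. \<Sum>v\<in>min_gens I. el T u T' v * el T' v S w)"
        by (rule sum.cartesian_product[symmetric])
      finally show ?thesis using sum el_el[OF uG] by simp
    qed
  qed
qed auto

text \<open>For j < max(u) the generator g(x_j u) differs from u and lies in the part already built.
  So the block of u is a pure Koszul complex on the variables before max(u), which generate the
  colon ideal.\<close>

lemma ek_part_resolves:
  assumes "distinct ms" "\<And>pre u post. ms = pre @ u # post \<Longrightarrow> u \<in> min_gens I \<and> set pre = {p \<in> min_gens I. lex_gt p u}"
  shows "resolves (multiples (set ms)) None (ek_part (set ms))"
  using assms
proof (induction ms rule: rev_induct)
  case Nil
  have gr: "graded_free_complex (ek_part {})" by (rule ek_part_graded) (simp add: closed_def)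
  have gens: "gens (ek_part {}) = {None}" by (simp add: ek_part_sel symbols_def)
  have "exact_at (ek_part {}) i \<alpha>" if "0 < i" for i \<alpha>
    unfolding exact_at_def
  proof (intro allI impI)
    fix v assume v: "strand (ek_part {}) i \<alpha> v \<and> (\<forall>c\<in>gens (ek_part {}). (\<Sum>b\<in>gens (ek_part {}). v b * cf (ek_part {}) b c) = 0)"
    then have "v b = 0" for b using that by (auto simp: strand_def gens ek_part_sel(2,3) symb_hdeg_def)
    then show "\<exists>w. strand (ek_part {}) (Suc i) \<alpha> w \<and> (\<forall>c\<in>gens (ek_part {}). (\<Sum>b\<in>gens (ek_part {}). w b * cf (ek_part {}) b c) = v c)"
      by (intro exI[of _ "\<lambda>_. 0"]) (auto simp: strand_def)
  qed
  then show ?case using gr by (auto simp: resolves_def gens ek_part_sel(2,3) multiples_def symb_hdeg_def symb_mdeg_def ek_part_cf ekc_def)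
next
  case (snoc u ms)
  have u: "u \<in> min_gens I" and pre: "set ms = {p \<in> min_gens I. lex_gt p u}" using snoc.prems(2)[of ms u "[]"] by auto
  have IH: "resolves (multiples (set ms)) None (ek_part (set ms))"
    using snoc.IH snoc.prems by simp
  have dec: "g (var j + p) \<in> min_gens I \<and> lex_gt (g (var j + p)) p" if "p \<in> min_gens I" "j < mmax p" for p j
    using lex_gt_g_var[OF that] g_in var_add_mons gen_mons[OF that(1)] by blast
  have clos: "closed (insert u (set ms))"
    unfolding closed_def pre using u dec lex_gt_trans by blast
  have un: "u \<notin> set ms" using snoc.prems(1) by simp
  have gu: "g (var j + u) \<noteq> u" if "j \<in> lower_vars u" for j
    using dec[OF u, of j] that lex_gt_irrefl[of u] by (auto simp: lower_vars_def)
  have "resolves (multiples (insert u (set ms))) None (ek_part (insert u (set ms)))"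
  proof (rule resolves_cone[OF ek_part_graded[OF clos] IH])
    show "gens (ek_part (insert u (set ms))) = gens (ek_part (set ms)) \<union> (\<lambda>T. Some (T, u)) ` Pow (lower_vars u)"
      by (simp add: ek_part_sel symbols_insert)
    show "gens (ek_part (set ms)) \<inter> (\<lambda>T. Some (T, u)) ` Pow (lower_vars u) = {}"
      unfolding ek_part_sel by (rule symbols_disjoint[OF un])
    show "linear_step (set ms) u (lower_vars u)" using lex_linear_step[OF u] by (simp add: pre lower_vars_def)
    show "cf (ek_part (insert u (set ms))) (Some ({}, u)) None = 1" by (simp add: ek_part_cf ekc_def)
    show "cf (ek_part (insert u (set ms))) b (Some (T, u)) = 0" if "b \<in> gens (ek_part (set ms))" for b T
    proof (cases b)
      case (Some q)
      obtain T' v where q: "q = (T', v)" by fastforce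
      then have v: "v \<in> set ms" "T' \<subseteq> lower_vars v" using that Some by (auto simp: ek_part_sel symbols_def)
      have "el T' v T u = 0"
      proof (rule ccontr)
        assume "el T' v T u \<noteq> 0"
        then obtain j where "j \<in> T'" "u = v \<or> u = g (var j + v)" using el_nonzeroD by blast
        moreover have "g (var j + v) \<in> set ms" if "j \<in> T'" for j
          using that v dec[of v j] lex_gt_trans unfolding pre by (auto simp: lower_vars_def)
        ultimately show False using un v(1) by blast
      qed
      then show ?thesis using Some q by (simp add: ek_part_cf ekc_def)
    qed (simp add: ek_part_cf ekc_def)
    show "cf (ek_part (insert u (set ms))) (Some (T, u)) (Some (T', u)) = - simplex_bd id T T'"
      if "T \<subseteq> lower_vars u" for T T'
    proof -
      have "el T u T' u = simplex_bd id T T'"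
        unfolding el_def simplex_bd_eq
      proof (intro sum.cong refl)
        fix j assume "j \<in> T"
        then have "u \<noteq> g (var j + u)" using gu[of j] that by auto
        then show "(if T' = T - {j} then simplex_sgn id T j * ((if u = u then 1 else 0) - (if u = g (var j + u) then 1 else 0)) else 0)
            = (if T' = T - {j} then simplex_sgn id T j else 0 :: 'k)" by simp
      qed
      then show ?thesis by (simp add: ek_part_cf ekc_def)
    qed
  qed (simp_all add: ek_part_sel ek_part_cf)
  then show ?case by simp
qed

theorem eliahou_kervaire_resolves:
  obtains ms where "set ms = min_gens I" "lin_quot ms lower_vars" "resolves (mons I) None (eliahou_kervaire I)"
    "gens (eliahou_kervaire I) = symbols (min_gens I) lower_vars"
proof -
  obtain ms where ms: "sorted_wrt lex_gt ms" "set ms = min_gens I" "distinct ms"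
    using sorted_enumeration[OF finite_min_gens[of I], of lex_gt] lex_gt_trans lex_gt_total by blast
  have pre: "u \<in> min_gens I \<and> set pre = {p \<in> min_gens I. lex_gt p u}" if split: "ms = pre @ u # post" for pre u post
  proof -
    have "set pre = {p \<in> set ms. lex_gt p u}"
      using ms(1) split lex_gt_irrefl lex_gt_trans by (rule sorted_wrt_prefix)
    moreover have "u \<in> set ms" by (simp add: split)
    ultimately show ?thesis by (simp add: ms(2))
  qed
  have lq: "lin_quot ms lower_vars"
    unfolding lin_quot_def
  proof (intro conjI allI ballI impI)
    show "distinct ms" by (fact ms(3))
    show "p = u" if "p \<in> set ms" "u \<in> set ms" "p \<le> u" for p u using min_gens_antichain that ms(2) by metis
    show "linear_step (set pre) u (lower_vars u)" if "ms = pre @ u # post" for pre u post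
      using pre[OF that] lex_linear_step[of u] by (simp add: lower_vars_def)
  qed
  have gens: "gens (eliahou_kervaire I) = symbols (min_gens I) lower_vars"
    by (simp add: eliahou_kervaire_def symbols_def lower_vars_def)
  then have "ek_part (min_gens I) = eliahou_kervaire I" by (simp add: ek_part_def)
  then have "resolves (mons I) None (eliahou_kervaire I)"
    using ek_part_resolves[OF ms(3) pre] ms(2) mons_eq_multiples_min_gens[OF monomial] by simp
  then show thesis using that ms(2) lq gens by blast
qed

end

section \<open>Orders with linear quotients\<close>

text \<open>Split off one variable after the other: primeness puts one of the two factors into P,
  and 1 is not in P.\<close>

lemma prime_ideal_monomD:
  fixes P :: "('n::finite, 'k::field) pol set"
  assumes P: "prime_ideal P" and t: "monom t \<in> P"
  shows "\<exists>j. 0 < t j \<and> monom (var j) \<in> P"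
  using t
proof (induction "sum t UNIV" arbitrary: t rule: less_induct)
  case less
  show ?case
  proof (cases "t = 0")
    case True
    then have "1 \<in> P" using less.prems by simp
    then have "f * 1 \<in> P" for f using P module.subspace_scale[OF module_mult] unfolding prime_ideal_def by blast
    then show ?thesis using P by (auto simp: prime_ideal_def)
  next
    case False
    then obtain j where j: "t j \<noteq> 0" by (auto simp: fun_eq_iff)
    have split: "var j + (t - var j) = t" using j by (auto simp: fun_eq_iff var_def)
    then have "monom (var j) * monom (t - var j) \<in> P" using less.prems by (simp add: mult_single)
    then consider "monom (var j) \<in> P" | "monom (t - var j) \<in> P" using P unfolding prime_ideal_def by blast
    then show ?thesis
    proof cases
      case 2
      have "sum (t - var j) UNIV < sum t UNIV"
        by (rule sum_strict_mono_ex1) (use j in \<open>auto simp: var_def intro!: exI[of _ j]\<close>)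
      then obtain i where "0 < (t - var j) i" "monom (var i) \<in> P" using less.hyps 2 by blast
      then show ?thesis by (intro exI[of _ i]) auto
    qed (use j in auto)
  qed
qed

lemma takeWhile_neq_split: "u \<notin> set pre \<Longrightarrow> takeWhile (\<lambda>v. v \<noteq> u) (pre @ u # post) = pre"
  by (induction pre) auto

text \<open>For an earlier p, the monomial p / gcd(p, u) lies in the colon ideal, and primeness
  yields a variable of that ideal dividing it, that is, one at which p exceeds u.\<close>

lemma linear_quotients_lin_quot:
  fixes I :: "('n::finite, 'k::field) pol set"
  assumes "linear_quotients_wrt I ms"
  obtains V where "lin_quot ms V"
proof
  \<comment> \<open>All variables of the colon ideal at u. For the first generator the prefix is
    empty, and so is the set.\<close>
  define V where "V u = {j. u + var j \<in> multiples (set (takeWhile (\<lambda>v. v \<noteq> u) ms))}" for u :: "'n mon"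
  have ms: "distinct ms" "set ms = min_gens I"
    and prime: "\<And>i. 0 < i \<Longrightarrow> i < length ms \<Longrightarrow> prime_ideal (colon (ideal_gen (monom ` set (take i ms)) :: ('n, 'k) pol set) (ms ! i))"
    using assms by (auto simp: linear_quotients_wrt_def Let_def)
  show "lin_quot ms V"
    unfolding lin_quot_def
  proof (intro conjI allI ballI impI)
    show "p = u" if "p \<in> set ms" "u \<in> set ms" "p \<le> u" for p u using min_gens_antichain that ms(2) by metis
    fix pre u post assume eq: "ms = pre @ u # post"
    then have "u \<notin> set pre" using ms(1) by auto
    then have tw: "takeWhile (\<lambda>v. v \<noteq> u) ms = pre" using eq by (simp add: takeWhile_neq_split)
    show "linear_step (set pre) u (V u)"
      unfolding linear_step_def
    proof (intro conjI ballI)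
      fix p assume p: "p \<in> set pre"
      define P where "P = colon (ideal_gen (monom ` set pre) :: ('n, 'k) pol set) u"
      have "pre \<noteq> []" using p by auto
      then have "prime_ideal P" using prime[of "length pre"] eq by (auto simp: P_def)
      moreover have "monom (p - u) \<in> P"
      proof -
        have "p \<le> p - u + u" by (auto simp: le_fun_def)
        then show ?thesis using p by (auto simp: P_def mem_colon multiples_def)
      qed
      ultimately obtain j where j: "0 < (p - u) j" "monom (var j) \<in> P" using prime_ideal_monomD by blast
      then have "j \<in> V u" by (simp add: P_def mem_colon V_def tw add.commute)
      then show "\<exists>j\<in>V u. u j < p j" using j(1) by auto
    next
      fix j assume "j \<in> V u"
      then show "\<exists>p\<in>set pre. p \<le> u + var j" by (simp add: V_def tw multiples_def)
    qed
  qed (fact ms(1))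
qed

section \<open>Sorting an order with linear quotients by degree\<close>

definition mon_deg :: "'n::finite mon \<Rightarrow> nat" where
  "mon_deg m = sum m UNIV"

lemma mon_deg_eq:
  assumes "p \<le> q" "mon_deg q \<le> mon_deg p" shows "p = q"
proof (rule ccontr)
  assume "p \<noteq> q"
  then obtain i where "p i \<noteq> q i" by (auto simp: fun_eq_iff)
  then have "p i < q i" using le_funD[OF assms(1), of i] by simp
  then have "sum p UNIV < sum q UNIV" using assms(1) by (intro sum_strict_mono_ex1) (auto simp: le_fun_def)
  then show False using assms(2) by (simp add: mon_deg_def)
qed

lemma mon_deg_add: "mon_deg (p + q) = mon_deg p + mon_deg q"
  by (simp add: mon_deg_def sum.distrib)

lemma mon_deg_var [simp]: "mon_deg (var j) = 1"
  by (simp add: mon_deg_def var_def)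

lemma mon_deg_sqfree [simp]: "mon_deg (sqfree T) = card T"
  by (simp add: mon_deg_def sqfree_def sum.If_cases)

lemma lin_quot_pos:
  assumes "lin_quot ms V" "u \<in> set ms"
  shows "linear_step {p \<in> set ms. pos ms p < pos ms u} u (V u)"
proof -
  obtain pre post where eq: "ms = pre @ u # post" "u \<notin> set pre" using split_list_first[OF assms(2)] by blast
  then have "takeWhile (\<lambda>v. v \<noteq> u) ms = pre" by (simp add: takeWhile_neq_split)
  then have "set pre = {p \<in> set ms. pos ms p < pos ms u}" using mem_takeWhile_iff_pos[of _ ms u] eq by auto
  then show ?thesis using assms(1) eq unfolding lin_quot_def by metis
qed

text \<open>A generator that the sorting moves in front of u has smaller degree; the crux is that it
  still exceeds u at a variable of \<open>V u\<close>. The generators dividing x_j u that are used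
  at u are not moved behind u, because their degree is at most that of u.\<close>

lemma lin_quot_sorted:
  assumes lq: "lin_quot ms V"
  obtains ms' where "set ms' = set ms" "lin_quot ms' V" "sorted_wrt (\<lambda>p q. mon_deg p \<le> mon_deg q) ms'"
proof -
  have anti: "\<And>p u. p \<in> set ms \<Longrightarrow> u \<in> set ms \<Longrightarrow> p \<le> u \<Longrightarrow> p = u" using lq by (auto simp: lin_quot_def)
  \<comment> \<open>Ties are broken by the old position, so generators of equal degree keep their
    order.\<close>
  define r where "r p q \<longleftrightarrow> mon_deg p < mon_deg q \<or> mon_deg p = mon_deg q \<and> pos ms p < pos ms q" for p q
  have r_trans: "\<And>a b c. r a b \<Longrightarrow> r b c \<Longrightarrow> r a c" and r_irrefl: "\<And>a. \<not> r a a" by (auto simp: r_def)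
  have r_total: "r a b \<or> r b a" if "a \<in> set ms" "b \<in> set ms" "a \<noteq> b" for a b
    using inj_onD[OF inj_on_pos, of ms a b] that unfolding r_def by (metis linorder_neqE_nat)
  obtain ms' where ms': "sorted_wrt r ms'" "set ms' = set ms" "distinct ms'"
    using sorted_enumeration[of "set ms" r] r_trans r_total by blast
  \<comment> \<open>A generator of larger degree than u that divides x_j u would be x_j u itself, a
    proper multiple of u.\<close>
  have below: "mon_deg p \<le> mon_deg u" if "p \<in> set ms" "u \<in> set ms" "p \<noteq> u" "p \<le> u + var j" for p u j
  proof (rule ccontr)
    assume "\<not> mon_deg p \<le> mon_deg u"
    then have "p = u + var j" using that(4) by (intro mon_deg_eq) (auto simp: mon_deg_add)
    then have "u \<le> p" by (simp add: le_fun_def)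
    then show False using anti that by blast
  qed
  \<comment> \<open>Induction on the old position of w. At a variable l of \<open>V w\<close> in
    which u exceeds w, some p before w divides x_l w. Wherever p exceeds u, so does w: at l the
    exponent of p is at most one more than that of w, hence at most that of u. Either p precedes u
    in the old order, or it is again a later generator of smaller degree.\<close>
  have later: "\<exists>j\<in>V u. u j < w j" if u: "u \<in> set ms" and w: "w \<in> set ms" "pos ms u < pos ms w" "mon_deg w < mon_deg u" for u w
    using w
  proof (induction "pos ms w" arbitrary: w rule: less_induct)
    case less
    note sw = lin_quot_pos[OF lq less.prems(1)] and su = lin_quot_pos[OF lq u]
    obtain l where l: "l \<in> V w" "w l < u l" using sw u less.prems(2) by (auto simp: linear_step_def)
    then obtain p where p: "p \<in> set ms" "pos ms p < pos ms w" "p \<le> w + var l" using sw by (auto simp: linear_step_def)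
    have "p \<noteq> w" using p(2) by auto
    have uw: "u \<noteq> w" using less.prems(2) by auto
    have pd: "mon_deg p \<le> mon_deg w" using below[OF p(1) less.prems(1) \<open>p \<noteq> w\<close> p(3)] .
    then have "p \<noteq> u" using less.prems(3) by auto
    have trans: "u j < w j" if "u j < p j" for j
      using le_funD[OF p(3), of j] l(2) that by (auto simp: var_def split: if_splits)
    consider "pos ms p < pos ms u" | "pos ms u < pos ms p"
      using inj_onD[OF inj_on_pos, of ms p u] p(1) u \<open>p \<noteq> u\<close> by fastforce
    then show ?case
    proof cases
      case 1
      then have "\<exists>j\<in>V u. u j < p j" using su p(1) unfolding linear_step_def by blast
      then show ?thesis using trans by blast
    next
      case 2
      then show ?thesis using less.hyps[OF p(2,1) 2] pd less.prems(3) trans by (meson order_le_less_trans)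
    qed
  qed
  have lq': "lin_quot ms' V"
    unfolding lin_quot_def
  proof (intro conjI allI ballI impI)
    show "p = u" if "p \<in> set ms'" "u \<in> set ms'" "p \<le> u" for p u using anti that ms'(2) by simp
    fix pre u post assume eq: "ms' = pre @ u # post"
    have pre: "set pre = {p \<in> set ms. r p u}"
      using sorted_wrt_prefix[of r ms' pre u post] ms'(1,2) eq r_irrefl r_trans by blast
    have u: "u \<in> set ms" using eq ms'(2) by (metis in_set_conv_decomp)
    note su = lin_quot_pos[OF lq u]
    show "linear_step (set pre) u (V u)"
      unfolding linear_step_def pre
    proof (intro conjI ballI)
      fix p assume p: "p \<in> {p \<in> set ms. r p u}"
      show "\<exists>j\<in>V u. u j < p j"
      proof (cases "pos ms p < pos ms u")
        case True then show ?thesis using su p by (auto simp: linear_step_def)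
      next
        case False
        then have "mon_deg p < mon_deg u" "p \<noteq> u" using p by (auto simp: r_def)
        moreover have "pos ms u < pos ms p"
          using False inj_onD[OF inj_on_pos, of ms p u] p u \<open>p \<noteq> u\<close> by fastforce
        ultimately show ?thesis using later[OF u] p by blast
      qed
    next
      fix j assume "j \<in> V u"
      then obtain p where p: "p \<in> set ms" "pos ms p < pos ms u" "p \<le> u + var j" using su by (auto simp: linear_step_def)
      then have "mon_deg p \<le> mon_deg u" by (intro below[OF p(1) u _ p(3)]) auto
      then have "r p u" using p(2) by (auto simp: r_def)
      then show "\<exists>p\<in>{p \<in> set ms. r p u}. p \<le> u + var j" using p by blast
    qed
  qed (fact ms'(3))
  have "sorted_wrt (\<lambda>p q. mon_deg p \<le> mon_deg q) ms'"
    by (rule sorted_wrt_mono_rel[OF _ ms'(1)]) (auto simp: r_def)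
  then show thesis using that ms'(2) lq' by blast
qed

section \<open>Pruning\<close>

text \<open>Without gradient paths between critical faces of equal lcm, the entries there are empty
  sums.\<close>

lemma morse_unitfree:
  fixes ms :: "'n::finite mon list"
  assumes mm: "morse_matching ms M"
    and "\<And>\<tau> \<sigma> es. \<tau> \<in> critical (set ms) M \<Longrightarrow> \<sigma> \<in> critical (set ms) M \<Longrightarrow> gradient_path M \<tau> es \<sigma> \<Longrightarrow> mlcm \<tau> \<noteq> mlcm \<sigma>"
  shows "unitfree (morse_complex ms M :: (_, 'n, 'k::field) free_complex)"
  unfolding unitfree_def morse_matching.morse_sel[OF mm] morse_matching.morse_cf[OF mm]
proof (intro ballI impI)
  fix b c assume "b \<in> critical (set ms) M" "c \<in> critical (set ms) M" "of_int (morse_matching.W ms M b c) \<noteq> (0 :: 'k)"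
  then show "mlcm b \<noteq> mlcm c"
    using morse_matching.W_nonzeroD(2)[OF mm morse_matching.crit_subset[OF mm], of b c] assms(2) by (metis of_int_0)
qed

lemma empty_matching: "homogeneous_acyclic_matching (set ms) {}"
proof -
  have "wf ({(\<tau>, \<sigma>). \<tau> \<subseteq> set ms \<and> facet \<sigma> \<tau>}\<inverse>)"
  proof (rule wf_subset[OF wf_measure[of card]], clarify)
    fix \<tau> \<sigma> assume "\<tau> \<subseteq> set ms" "facet \<sigma> \<tau>"
    then obtain u where "u \<in> \<tau>" "\<sigma> = \<tau> - {u}" "finite \<tau>" using finite_subset by (auto simp: facet_def)
    then show "(\<sigma>, \<tau>) \<in> measure card" using card.remove[of \<tau> u] by simp
  qed
  then show ?thesis using wf_acyclic acyclic_converse by (auto simp: homogeneous_acyclic_matching_def)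
qed

lemma mlcm_insert_absorb:
  assumes "finite \<sigma>" "q \<le> mlcm \<sigma>" shows "mlcm (insert q \<sigma>) = mlcm \<sigma>"
  using assms mlcm_mono[of "insert q \<sigma>" \<sigma>] mlcm_le_iff[of "insert q \<sigma>" "mlcm \<sigma>"] mlcm_upper[of \<sigma>]
  by (intro antisym) auto

lemma pruning_empty:
  assumes "\<And>\<sigma> u. \<sigma> \<subseteq> set ms \<Longrightarrow> u \<in> set ms \<Longrightarrow> u \<notin> \<sigma> \<Longrightarrow> mlcm \<sigma> \<noteq> mlcm (insert u \<sigma>)"
  shows "pruning ms = {}"
proof -
  have "fold (prune_step (set ms)) xs {} = {}" if "set xs \<subseteq> set ms" for xs
    using that
  proof (induction xs)
    case (Cons x xs)
    then have "prune_step (set ms) x {} = {}" using assms by (auto simp: prune_step_def)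
    then show ?case using Cons by simp
  qed simp
  then show ?thesis by (simp add: pruning_def)
qed

text \<open>Each generator strictly dominates all the others in some variable, so removing it from a
  face changes the lcm: no edge can be pruned and the Taylor complex is already minimal. This serves
  for principal ideals and for ideals generated by monomials x_j u.\<close>

lemma taylor_minimal:
  fixes ms :: "'n::finite mon list"
  assumes ms: "distinct ms" "0 \<notin> set ms"
    and strict: "\<And>w. w \<in> set ms \<Longrightarrow> \<exists>j. \<forall>v\<in>set ms. v \<noteq> w \<longrightarrow> v j < w j"
  shows "minimal_pruning (ideal_gen (monom ` set ms) :: ('n, 'k::field) pol set) ms {}"
    "resolves (multiples (set ms)) {} (morse_complex ms {} :: (_, 'n, 'k) free_complex)"
    "unitfree (morse_complex ms {} :: (_, 'n, 'k) free_complex)"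
proof -
  let ?I = "ideal_gen (monom ` set ms) :: ('n, 'k) pol set"
  have lcm: "mlcm \<sigma> \<noteq> mlcm (insert w \<sigma>)" if \<sigma>: "\<sigma> \<subseteq> set ms" "w \<in> set ms" "w \<notin> \<sigma>" for \<sigma> w
  proof
    assume eq: "mlcm \<sigma> = mlcm (insert w \<sigma>)"
    have fin: "finite \<sigma>" using \<sigma> finite_subset by blast
    then have w: "w \<le> mlcm \<sigma>" using mlcm_upper[of "insert w \<sigma>" w] eq by simp
    show False
    proof (cases "\<sigma> = {}")
      case True
      then have "w = 0" using w by (auto simp: le_fun_def fun_eq_iff)
      then show False using ms(2) \<sigma>(2) by simp
    next
      case False
      obtain j where j: "\<And>v. v \<in> set ms \<Longrightarrow> v \<noteq> w \<Longrightarrow> v j < w j" using strict[OF \<sigma>(2)] by blast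
      have "mlcm \<sigma> j < w j"
        unfolding mlcm_def using fin False \<sigma> j by (subst Max_less_iff) (auto intro: le_less_trans[OF le0])
      then show False using le_funD[OF w, of j] by simp
    qed
  qed
  have mm: "morse_matching ms {}" using ms(2) empty_matching by (rule morse_matching.intro)
  show R: "resolves (multiples (set ms)) {} (morse_complex ms {} :: (_, 'n, 'k) free_complex)"
    using morse_matching.morse_resolves[OF mm] by (simp add: multiples_def)
  show U: "unitfree (morse_complex ms {} :: (_, 'n, 'k) free_complex)"
  proof (rule morse_unitfree[OF mm])
    fix \<tau> \<sigma> es assume *: "\<tau> \<in> critical (set ms) {}" "\<sigma> \<in> critical (set ms) {}" "gradient_path {} \<tau> es \<sigma>"
    then have "facet \<sigma> \<tau>" by (cases es) auto
    then obtain w where "w \<in> \<tau>" "\<sigma> = \<tau> - {w}" by (auto simp: facet_def)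
    then have "insert w \<sigma> = \<tau>" "w \<notin> \<sigma>" "\<tau> \<subseteq> set ms" using * by (auto simp: critical_def)
    then show "mlcm \<tau> \<noteq> mlcm \<sigma>" using lcm[of \<sigma> w] by auto
  qed
  have anti: "a = b" if "a \<in> set ms" "b \<in> set ms" "a \<le> b" for a b
    using strict[OF that(1)] le_funD[OF that(3)] that(2) by (metis linorder_not_less)
  have "minimal_pruning ?I ms (pruning ms)"
  proof (rule minimal_pruning.order)
    show "monomial_ideal ?I" by (rule monomial_ideal_ideal_gen)
    show "set ms = min_gens ?I" using min_gens_ideal_gen anti by blast
    have "minimal_free_resolution UNIV ?I (morse_complex ms {})"
      by (rule resolves_minimal_free_resolution[OF _ monomial_ideal_ideal_gen U]) (use R in \<open>simp add: mons_ideal_gen_multiples\<close>)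
    then show "minimal_free_resolution UNIV ?I (morse_complex ms (pruning ms))" using pruning_empty lcm by metis
  qed (fact ms)
  then show "minimal_pruning ?I ms {}" using pruning_empty lcm by metis
qed

text \<open>
  One step of the construction: u is added to the generators A, and V is the set of variables that
  generate the colon ideal. For each variable x_j in V a generator p j divides x_j u; these form Q.
  A face that contains u and at least one vertex outside Q and u is matched by toggling a vertex in Q
  that depends only on the vertices outside Q. The faces with vertices in Q and u remain.
\<close>

locale quotient_step =
  fixes A :: "'n::finite mon set" and u :: "'n mon" and V :: "'n set" and p :: "'n \<Rightarrow> 'n mon"
  assumes finA: "finite A" and uA: "u \<notin> A"
    and anti: "\<And>a b. a \<in> insert u A \<Longrightarrow> b \<in> insert u A \<Longrightarrow> a \<le> b \<Longrightarrow> a = b"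
    and step: "linear_step A u V"
    and p: "\<And>j. j \<in> V \<Longrightarrow> p j \<in> A \<and> p j \<le> u + var j"
begin

definition "Q = p ` V"
definition rest :: "'n face \<Rightarrow> 'n face" where "rest \<sigma> = \<sigma> - {u} - Q"
definition toggle :: "'n face \<Rightarrow> 'n mon" where "toggle B = (SOME q. q \<in> Q \<and> q \<le> mlcm (insert u B))"
definition new_pairs :: "'n matching" where
  "new_pairs = {(\<sigma>, insert (toggle (rest \<sigma>)) \<sigma>) | \<sigma>.
     \<sigma> \<subseteq> insert u A \<and> u \<in> \<sigma> \<and> rest \<sigma> \<noteq> {} \<and> toggle (rest \<sigma>) \<notin> \<sigma>}"

lemma new_pairsI:
  "\<sigma> \<subseteq> insert u A \<Longrightarrow> u \<in> \<sigma> \<Longrightarrow> rest \<sigma> \<noteq> {} \<Longrightarrow> toggle (rest \<sigma>) \<notin> \<sigma> \<Longrightarrow>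
     \<tau> = insert (toggle (rest \<sigma>)) \<sigma> \<Longrightarrow> (\<sigma>, \<tau>) \<in> new_pairs"
  unfolding new_pairs_def by blast

lemma QA: "Q \<subseteq> A"
  using p by (auto simp: Q_def)

lemma p_above: "j \<in> V \<Longrightarrow> u j < p j j"
proof (rule ccontr)
  assume j: "j \<in> V" "\<not> u j < p j j"
  have "p j i \<le> u i" for i using le_funD[OF conjunct2[OF p[OF j(1)]], of i] j(2) by (cases "i = j") (auto simp: var_def)
  then have "p j = u" using anti[of "p j" u] p[OF j(1)] by (simp add: le_fun_def)
  then show False using p[OF j(1)] uA by simp
qed

lemma p_other: "j \<in> V \<Longrightarrow> i \<noteq> j \<Longrightarrow> p j i \<le> u i"
  using p[of j] by (auto simp: le_fun_def var_def dest!: spec[of _ i])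

lemma inj_p: "inj_on p V"
  using p_above p_other by (intro inj_onI) (metis not_less)

lemma finite_face: "\<sigma> \<subseteq> insert u A \<Longrightarrow> finite \<sigma>"
  using finA finite_subset by blast

text \<open>A vertex b of B exceeds u at some variable x_j of \<open>V\<close>, so x_j u, and with
  it \<open>p j\<close>, divides the lcm of u and b.\<close>

lemma toggle:
  assumes "B \<subseteq> A" "B \<noteq> {}"
  shows "toggle B \<in> Q" "toggle B \<le> mlcm (insert u B)"
proof -
  have fin: "finite (insert u B)" using assms finA finite_subset by blast
  obtain b where b: "b \<in> B" using assms by blast
  then have "\<exists>j\<in>V. u j < b j" using step assms(1) unfolding linear_step_def by blast
  then obtain j where j: "j \<in> V" "u j < b j" by blast
  have "u \<le> mlcm (insert u B)" "b \<le> mlcm (insert u B)" using mlcm_upper[OF fin] b by auto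
  then have "u + var j \<le> mlcm (insert u B)"
    using j(2) by (simp add: add_var_le_iff) (metis le_funD order_less_le_trans)
  then have "\<exists>q. q \<in> Q \<and> q \<le> mlcm (insert u B)" using p[OF j(1)] j(1) order_trans unfolding Q_def by blast
  from someI_ex[OF this] show "toggle B \<in> Q" "toggle B \<le> mlcm (insert u B)" unfolding toggle_def by auto
qed

lemma rest_subset: "\<sigma> \<subseteq> insert u A \<Longrightarrow> rest \<sigma> \<subseteq> A"
  by (auto simp: rest_def)

lemma rest_insert: "q \<in> Q \<Longrightarrow> rest (insert q \<sigma>) = rest \<sigma>" and rest_remove: "q \<in> Q \<Longrightarrow> rest (\<sigma> - {q}) = rest \<sigma>"
  by (auto simp: rest_def)

lemma new_pairsD:
  assumes "(\<sigma>, \<tau>) \<in> new_pairs"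
  shows "\<sigma> \<subseteq> insert u A" "\<tau> \<subseteq> insert u A" "u \<in> \<sigma>" "u \<in> \<tau>" "rest \<sigma> \<noteq> {}" "rest \<tau> = rest \<sigma>"
    "\<tau> = insert (toggle (rest \<sigma>)) \<sigma>" "toggle (rest \<sigma>) \<notin> \<sigma>" "toggle (rest \<sigma>) \<in> Q" "mlcm \<sigma> = mlcm \<tau>"
proof -
  show 1: "\<sigma> \<subseteq> insert u A" "u \<in> \<sigma>" "rest \<sigma> \<noteq> {}" "\<tau> = insert (toggle (rest \<sigma>)) \<sigma>" "toggle (rest \<sigma>) \<notin> \<sigma>"
    using assms by (auto simp: new_pairs_def)
  note t = toggle[OF rest_subset[OF 1(1)] 1(3)]
  show "toggle (rest \<sigma>) \<in> Q" "\<tau> \<subseteq> insert u A" "u \<in> \<tau>" "rest \<tau> = rest \<sigma>"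
    using t QA 1 rest_insert by auto
  have "mlcm (insert u (rest \<sigma>)) \<le> mlcm \<sigma>" using 1 finite_face by (intro mlcm_mono) (auto simp: rest_def)
  then show "mlcm \<sigma> = mlcm \<tau>" using mlcm_insert_absorb[OF finite_face[OF 1(1)]] t(2) 1(4) order_trans by metis
qed

lemma Field_new_pairs: "Field new_pairs = {\<sigma>. \<sigma> \<subseteq> insert u A \<and> u \<in> \<sigma> \<and> rest \<sigma> \<noteq> {}}"
proof (intro equalityI subsetI)
  fix \<sigma> assume "\<sigma> \<in> Field new_pairs"
  then obtain \<tau> where "(\<sigma>, \<tau>) \<in> new_pairs \<or> (\<tau>, \<sigma>) \<in> new_pairs" by (auto simp: Field_def)
  then show "\<sigma> \<in> {\<sigma>. \<sigma> \<subseteq> insert u A \<and> u \<in> \<sigma> \<and> rest \<sigma> \<noteq> {}}"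
    using new_pairsD(1,3,5)[of \<sigma> \<tau>] new_pairsD(2,4,5,6)[of \<tau> \<sigma>] by auto
next
  fix \<sigma> assume "\<sigma> \<in> {\<sigma>. \<sigma> \<subseteq> insert u A \<and> u \<in> \<sigma> \<and> rest \<sigma> \<noteq> {}}"
  then have \<sigma>: "\<sigma> \<subseteq> insert u A" "u \<in> \<sigma>" "rest \<sigma> \<noteq> {}" by auto
  note t = toggle[OF rest_subset[OF \<sigma>(1)] \<sigma>(3)]
  show "\<sigma> \<in> Field new_pairs"
  proof (cases "toggle (rest \<sigma>) \<in> \<sigma>")
    case False
    then have "(\<sigma>, insert (toggle (rest \<sigma>)) \<sigma>) \<in> new_pairs" using \<sigma> by (auto simp: new_pairs_def)
    then show ?thesis by (auto simp: Field_def)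
  next
    case True
    define \<rho> where "\<rho> = \<sigma> - {toggle (rest \<sigma>)}"
    have r: "rest \<rho> = rest \<sigma>" using rest_remove[OF t(1)] by (simp add: \<rho>_def)
    have "u \<noteq> toggle (rest \<sigma>)" using t(1) QA uA by auto
    then have "\<rho> \<subseteq> insert u A" "u \<in> \<rho>" "toggle (rest \<rho>) \<notin> \<rho>" "\<sigma> = insert (toggle (rest \<rho>)) \<rho>"
      using \<sigma> True unfolding r by (auto simp: \<rho>_def)
    moreover have "rest \<rho> \<noteq> {}" using \<sigma>(3) r by simp
    ultimately have "(\<rho>, \<sigma>) \<in> new_pairs" by (intro new_pairsI)
    then show ?thesis by (auto simp: Field_def)
  qed
qed

text \<open>The generator \<open>p j\<close> divides x_j u but not u, so it raises the lcm with u by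
  exactly the factor x_j. The surviving faces thus have the multidegrees of the symbols (T,
  u).\<close>

lemma mlcm_remaining:
  assumes "T \<subseteq> V" shows "mlcm (insert u (p ` T)) = sqfree T + u"
proof (rule antisym)
  have fin: "finite (insert u (p ` T))" by simp
  have "p j \<le> sqfree T + u" if "j \<in> T" for j
  proof -
    have "u + var j \<le> sqfree T + u" using that by (auto simp: le_fun_def sqfree_def var_def)
    then show ?thesis using p[of j] that assms order_trans by blast
  qed
  moreover have "u \<le> sqfree T + u" by (simp add: le_fun_def)
  ultimately show "mlcm (insert u (p ` T)) \<le> sqfree T + u" by (simp add: mlcm_le_iff)
  have "u \<le> mlcm (insert u (p ` T))" by (rule mlcm_upper[OF fin]) simp
  moreover have "u j < mlcm (insert u (p ` T)) j" if "j \<in> T" for j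
    using p_above[of j] le_funD[OF mlcm_upper[OF fin], of "p j" j] that assms by auto
  ultimately show "sqfree T + u \<le> mlcm (insert u (p ` T))" by (simp add: sqfree_add_le_iff)
qed

lemma remaining_inj: "inj_on (\<lambda>T. insert u (p ` T)) (Pow V)"
proof (rule inj_onI)
  fix T T' assume T: "T \<in> Pow V" "T' \<in> Pow V" "insert u (p ` T) = insert u (p ` T')"
  have "u \<notin> p ` V" using p uA by auto
  then have "p ` T = p ` T'" using T by (metis Pow_iff image_mono insert_ident subsetD)
  then show "T = T'" using inj_on_image_eq_iff[OF inj_p] T by auto
qed

lemma card_remaining: "T \<subseteq> V \<Longrightarrow> card (insert u (p ` T)) = Suc (card T)"
proof -
  assume T: "T \<subseteq> V"
  then have "u \<notin> p ` T" using p uA by auto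
  moreover have "card (p ` T) = card T" using T inj_p by (meson card_image inj_on_subset)
  ultimately show ?thesis by simp
qed

lemma remaining:
  "{\<sigma>. \<sigma> \<subseteq> insert u A \<and> u \<in> \<sigma> \<and> \<sigma> \<notin> Field new_pairs} = (\<lambda>T. insert u (p ` T)) ` Pow V"
proof (intro equalityI subsetI)
  fix \<sigma> assume "\<sigma> \<in> {\<sigma>. \<sigma> \<subseteq> insert u A \<and> u \<in> \<sigma> \<and> \<sigma> \<notin> Field new_pairs}"
  then have \<sigma>: "u \<in> \<sigma>" "\<sigma> - {u} \<subseteq> Q" by (auto simp: Field_new_pairs rest_def)
  then obtain T where "T \<subseteq> V" "\<sigma> - {u} = p ` T" unfolding Q_def by (meson subset_imageE)
  then show "\<sigma> \<in> (\<lambda>T. insert u (p ` T)) ` Pow V" using \<sigma>(1) by (intro image_eqI[of _ _ T]) auto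
next
  fix \<sigma> assume "\<sigma> \<in> (\<lambda>T. insert u (p ` T)) ` Pow V"
  then show "\<sigma> \<in> {\<sigma>. \<sigma> \<subseteq> insert u A \<and> u \<in> \<sigma> \<and> \<sigma> \<notin> Field new_pairs}"
    using QA by (auto simp: Field_new_pairs rest_def Q_def)
qed

context
  fixes M :: "'n matching"
  assumes M: "homogeneous_acyclic_matching A M"
begin

lemma old_pairsD:
  assumes "(\<sigma>, \<tau>) \<in> M" shows "\<sigma> \<subseteq> A" "\<tau> \<subseteq> A" "facet \<sigma> \<tau>" "mlcm \<sigma> = mlcm \<tau>"
proof -
  show *: "\<tau> \<subseteq> A" "facet \<sigma> \<tau>" "mlcm \<sigma> = mlcm \<tau>"
    using M assms unfolding homogeneous_acyclic_matching_def by blast+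
  then show "\<sigma> \<subseteq> A" by (auto simp: facet_def)
qed

text \<open>Every step of the flow lowers a lexicographic rank: first membership of u; then, for
  faces without u, the position in the old flow; for faces with u, the number of vertices outside
  \<open>Q\<close> other than u and finally the weight \<open>f\<close>.\<close>

lemma acyclic_step:
  "acyclic ({(\<tau>, \<sigma>). \<tau> \<subseteq> insert u A \<and> facet \<sigma> \<tau> \<and> (\<sigma>, \<tau>) \<notin> M \<union> new_pairs} \<union> (M \<union> new_pairs))" (is "acyclic ?E")
proof -
  define E0 where "E0 = {(\<tau>, \<sigma>). \<tau> \<subseteq> A \<and> facet \<sigma> \<tau> \<and> (\<sigma>, \<tau>) \<notin> M} \<union> M"
  have "finite E0"
  proof (rule finite_subset)
    show "E0 \<subseteq> Pow A \<times> Pow A" using old_pairsD by (auto simp: E0_def facet_def) blast+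
  qed (use finA in simp)
  moreover have "acyclic E0" using M by (simp add: homogeneous_acyclic_matching_def E0_def)
  ultimately have wf0: "wf (E0\<inverse>)" by (rule finite_acyclic_wf_converse)
  \<comment> \<open>A step up inserts the toggled vertex and lowers the weight by 1; removing
    another vertex of \<open>Q\<close> lowers it by 2, hence the factor. Removing the toggled vertex
    is the reversed direction of a matched pair and does not occur. If \<open>rest x\<close> is
    empty, nothing is matched and the cardinality suffices.\<close>
  define f where "f x = (if rest x = {} then card x else 2 * card (x - {toggle (rest x)}) + (if toggle (rest x) \<in> x then 0 else 1))" for x
  define h :: "'n face \<Rightarrow> nat \<times> 'n face \<times> nat \<times> nat" where
    "h x = (if u \<in> x then (1, {}, card (rest x), f x) else (0, x, 0, 0))" for x
  define R where "R = inv_image (less_than <*lex*> E0\<inverse> <*lex*> less_than <*lex*> less_than) h"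
  have wfR: "wf R" unfolding R_def by (intro wf_inv_image wf_lex_prod wf_less_than wf0)
  have "?E\<inverse> \<subseteq> R"
  proof clarify
    fix y x assume "(x, y) \<in> ?E"
    then consider (down) "x \<subseteq> insert u A" "facet y x" "(y, x) \<notin> M" "(y, x) \<notin> new_pairs" | (old) "(x, y) \<in> M" | (new) "(x, y) \<in> new_pairs"
      by blast
    then show "(y, x) \<in> R"
    proof cases
      case old
      then have "(x, y) \<in> E0" "u \<notin> x" "u \<notin> y" using old_pairsD[OF old] uA by (auto simp: E0_def)
      then show ?thesis by (simp add: R_def h_def)
    next
      case new
      note D = new_pairsD[OF new]
      have "toggle (rest x) \<in> y" "y - {toggle (rest x)} = x" "x - {toggle (rest x)} = x" using D(7,8) by auto
      then have "f y < f x" using D(5,6,8) by (simp add: f_def)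
      then show ?thesis using D by (simp add: R_def h_def)
    next
      case down
      then obtain v where v: "v \<in> x" "y = x - {v}" by (auto simp: facet_def)
      have fx: "finite x" using finite_face down(1) by blast
      show ?thesis
      proof (cases "u \<in> x")
        case False
        then have "(x, y) \<in> E0" "u \<notin> y" using down v by (auto simp: E0_def)
        then show ?thesis using False by (simp add: R_def h_def)
      next
        case ux: True
        show ?thesis
        proof (cases "v = u")
          case True
          then show ?thesis using ux v by (simp add: R_def h_def)
        next
          case False
          then have uy: "u \<in> y" using ux v by simp
          have frx: "finite (rest x)" using fx by (simp add: rest_def)
          show ?thesis
          proof (cases "v \<in> Q")
            case False
            then have "v \<in> rest x" "rest y = rest x - {v}" using v \<open>v \<noteq> u\<close> by (auto simp: rest_def)
            then have "card (rest y) < card (rest x)" using frx card.remove[of "rest x" v] by simp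
            then show ?thesis using ux uy by (simp add: R_def h_def)
          next
            case True
            then have r: "rest y = rest x" using v rest_remove by simp
            have "f y < f x"
            proof (cases "rest x = {}")
              case True
              then show ?thesis using r v fx card.remove[of x v] by (simp add: f_def)
            next
              case False
              define e where "e = toggle (rest x)"
              have "v \<noteq> e"
              proof
                assume "v = e"
                then have *: "y \<subseteq> insert u A" "toggle (rest y) \<notin> y" "x = insert (toggle (rest y)) y"
                  unfolding r using v down(1) by (auto simp: e_def)
                have "rest y \<noteq> {}" using r False by simp
                then have "(y, x) \<in> new_pairs" using * uy by (intro new_pairsI)
                then show False using down(4) by simp
              qed
              then have "x - {e} = insert v (y - {e})" "v \<notin> y - {e}" "finite (y - {e})" "e \<in> y \<longleftrightarrow> e \<in> x" using v fx by auto
              then show ?thesis using r False by (simp add: f_def flip: e_def)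
            qed
            then show ?thesis using ux uy r by (simp add: R_def h_def)
          qed
        qed
      qed
    qed
  qed
  then have "wf (?E\<inverse>)" using wfR wf_subset by blast
  then show ?thesis using wf_acyclic acyclic_converse by blast
qed

lemma matching_step: "homogeneous_acyclic_matching (insert u A) (M \<union> new_pairs)"
proof -
  have pairs: "\<tau> \<subseteq> insert u A \<and> facet \<sigma> \<tau> \<and> mlcm \<sigma> = mlcm \<tau>" if "(\<sigma>, \<tau>) \<in> M \<union> new_pairs" for \<sigma> \<tau>
  proof (cases "(\<sigma>, \<tau>) \<in> M")
    case True
    then show ?thesis using old_pairsD[OF True] by auto
  next
    case False
    then have "(\<sigma>, \<tau>) \<in> new_pairs" using that by blast
    note D = new_pairsD[OF this]
    have "\<sigma> = \<tau> - {toggle (rest \<sigma>)}" "toggle (rest \<sigma>) \<in> \<tau>" using D(7,8) by auto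
    then show ?thesis using D(2,10) unfolding facet_def by blast
  qed
  have "\<sigma> = \<sigma>' \<and> \<tau> = \<tau>'"
    if P: "(\<sigma>, \<tau>) \<in> M \<union> new_pairs" and P': "(\<sigma>', \<tau>') \<in> M \<union> new_pairs" and meet: "{\<sigma>, \<tau>} \<inter> {\<sigma>', \<tau>'} \<noteq> {}" for \<sigma> \<tau> \<sigma>' \<tau>'
  proof (cases "u \<in> \<sigma>")
    case True
    then have N: "(\<sigma>, \<tau>) \<in> new_pairs" using P old_pairsD(1) uA by blast
    then have "u \<in> \<tau>" by (rule new_pairsD(4))
    then have N': "(\<sigma>', \<tau>') \<in> new_pairs" using P' old_pairsD(1,2)[of \<sigma>' \<tau>'] uA meet True by auto
    note D = new_pairsD[OF N] and D' = new_pairsD[OF N']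
    \<comment> \<open>Both faces of a new pair have the same vertices outside \<open>Q\<close>, so
      pairs that meet toggle the same vertex.\<close>
    have r: "rest \<sigma> = rest \<sigma>'" using meet D(6) D'(6) by auto
    define e where "e = toggle (rest \<sigma>)"
    have "\<tau> = insert e \<sigma>" "e \<notin> \<sigma>" "\<tau>' = insert e \<sigma>'" "e \<notin> \<sigma>'" using D(7,8) D'(7,8) r by (simp_all add: e_def)
    then show ?thesis using meet by (metis Int_emptyI empty_iff insertE insertI1 insert_ident)
  next
    case False
    then have O: "(\<sigma>, \<tau>) \<in> M" using P new_pairsD(3) by blast
    then have "u \<notin> \<tau>" using old_pairsD(2) uA by blast
    then have O': "(\<sigma>', \<tau>') \<in> M" using P' new_pairsD(3,4)[of \<sigma>' \<tau>'] meet False by auto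
    have "\<forall>e\<in>M. \<forall>e'\<in>M. {fst e, snd e} \<inter> {fst e', snd e'} \<noteq> {} \<longrightarrow> fst e = fst e' \<and> snd e = snd e'"
      using M unfolding homogeneous_acyclic_matching_def split_beta by (elim conjE)
    from this[rule_format, OF O O'] meet show ?thesis by simp
  qed
  then show ?thesis
    unfolding homogeneous_acyclic_matching_def using pairs acyclic_step by blast
qed

lemma critical_step:
  "critical (insert u A) (M \<union> new_pairs) = critical A M \<union> (\<lambda>T. insert u (p ` T)) ` Pow V"
proof -
  have out: "\<sigma> \<in> critical (insert u A) (M \<union> new_pairs) \<longleftrightarrow> \<sigma> \<in> critical A M" if "u \<notin> \<sigma>" for \<sigma>
  proof -
    have "\<sigma> \<notin> Field new_pairs" using that by (simp add: Field_new_pairs)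
    then show ?thesis using that by (auto simp: critical_def)
  qed
  have ins: "\<sigma> \<in> critical (insert u A) (M \<union> new_pairs) \<longleftrightarrow> \<sigma> \<in> (\<lambda>T. insert u (p ` T)) ` Pow V" if "u \<in> \<sigma>" for \<sigma>
  proof -
    have "\<sigma> \<notin> Field M" using that uA old_pairsD(1,2) by (fastforce simp: Field_def)
    then show ?thesis using that unfolding remaining[symmetric] by (auto simp: critical_def)
  qed
  show ?thesis
  proof (rule set_eqI)
    fix \<sigma>
    show "\<sigma> \<in> critical (insert u A) (M \<union> new_pairs) \<longleftrightarrow> \<sigma> \<in> critical A M \<union> (\<lambda>T. insert u (p ` T)) ` Pow V"
    proof (cases "u \<in> \<sigma>")
      case True
      then have "\<sigma> \<notin> critical A M" using uA by (auto simp: critical_def)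
      then show ?thesis using ins[OF True] by simp
    next
      case False
      then have "\<sigma> \<notin> (\<lambda>T. insert u (p ` T)) ` Pow V" by auto
      then show ?thesis using out[OF False] by simp
    qed
  qed
qed

text \<open>Both faces of a new pair contain u, and steps down or along old pairs never introduce
  it.\<close>

lemma gradient_path_old:
  "gradient_path (M \<union> new_pairs) \<tau> es \<sigma> \<Longrightarrow> \<tau> \<subseteq> A \<Longrightarrow> gradient_path M \<tau> es \<sigma> \<and> \<sigma> \<subseteq> A"
proof (induction es arbitrary: \<tau>)
  case Nil
  then show ?case by (auto simp: facet_def)
next
  case (Cons e es)
  obtain \<alpha> \<beta> where e: "e = (\<alpha>, \<beta>)" by fastforce
  have *: "facet \<alpha> \<tau>" "(\<alpha>, \<tau>) \<notin> M \<union> new_pairs" "(\<alpha>, \<beta>) \<in> M \<union> new_pairs" "gradient_path (M \<union> new_pairs) \<beta> es \<sigma>"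
    using Cons.prems(1) by (auto simp: e)
  have "u \<notin> \<alpha>" using *(1) Cons.prems(2) uA by (auto simp: facet_def)
  then have "(\<alpha>, \<beta>) \<in> M" using *(3) new_pairsD(3) by blast
  then show ?case using * Cons.IH[of \<beta>] old_pairsD(2) by (auto simp: e)
qed

end

end


section \<open>Betti splittings and the construction of the pruning\<close>

lemma zero_mem_multiples: "0 \<in> multiples B \<longleftrightarrow> 0 \<in> B"
proof -
  have "s \<le> 0 \<longleftrightarrow> s = 0" for s :: "'n mon" by (auto simp: le_fun_def fun_eq_iff)
  then show ?thesis by (auto simp: multiples_def)
qed

lemma mlcm_singleton [simp]: "mlcm {u} = u"
  by (simp add: mlcm_def)

lemma ideal_sum_ideal_gen: "ideal_sum (ideal_gen B) (ideal_gen C) = ideal_gen (B \<union> C)"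
  unfolding module.span_Un[OF module_mult] ideal_sum_def by auto

lemma betti_ideal_gen:
  fixes B :: "'n::finite mon set" and F :: "('b, 'n, 'k::field) free_complex"
  assumes "resolves (multiples B) z F" "unitfree F" "0 \<notin> B"
  shows "betti (ideal_gen (monom ` B) :: ('n, 'k) pol set) {0} i \<alpha> = card {b \<in> gens F. hdeg F b = Suc i \<and> mdeg F b = \<alpha>}"
  by (rule betti_eq_card[OF _ monomial_ideal_ideal_gen])
    (use assms in \<open>simp_all add: mons_ideal_gen_multiples zero_mem_multiples\<close>)

context quotient_step
begin

text \<open>The common index set, degree by degree, of the surviving faces containing u and, for i >
  0, of the Taylor faces of the intersection ideal.\<close>

definition degree_faces :: "nat \<Rightarrow> 'n mon \<Rightarrow> 'n set set" where
  "degree_faces i \<alpha> = {T. T \<subseteq> V \<and> card T = i \<and> sqfree T + u = \<alpha>}"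

lemma card_remaining_degree:
  "card {\<sigma> \<in> (\<lambda>T. insert u (p ` T)) ` Pow V. card \<sigma> = Suc i \<and> mlcm \<sigma> = \<alpha>} = card (degree_faces i \<alpha>)"
proof -
  have "{\<sigma> \<in> (\<lambda>T. insert u (p ` T)) ` Pow V. card \<sigma> = Suc i \<and> mlcm \<sigma> = \<alpha>} = (\<lambda>T. insert u (p ` T)) ` degree_faces i \<alpha>"
    using card_remaining mlcm_remaining by (auto simp: degree_faces_def)
  moreover have "inj_on (\<lambda>T. insert u (p ` T)) (degree_faces i \<alpha>)"
    by (rule inj_on_subset[OF remaining_inj]) (auto simp: degree_faces_def)
  ultimately show ?thesis by (simp add: card_image)
qed

lemma card_mixed:
  assumes "0 < i"
  shows "card {\<sigma> \<in> mixed_faces A {u} - Field new_pairs. card \<sigma> = Suc i \<and> mlcm \<sigma> = \<alpha>} = card (degree_faces i \<alpha>)"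
proof -
  have "\<sigma> \<in> mixed_faces A {u} - Field new_pairs \<longleftrightarrow> \<sigma> \<in> (\<lambda>T. insert u (p ` T)) ` Pow V" if "card \<sigma> = Suc i" for \<sigma>
  proof -
    have "\<sigma> \<inter> A \<noteq> {}" if "\<sigma> \<subseteq> insert u A" "u \<in> \<sigma>"
    proof
      assume "\<sigma> \<inter> A = {}"
      then have "\<sigma> = {u}" using that by auto
      then show False using \<open>card \<sigma> = Suc i\<close> assms by simp
    qed
    then show ?thesis unfolding remaining[symmetric] by (auto simp: mixed_faces_def)
  qed
  then have "{\<sigma> \<in> mixed_faces A {u} - Field new_pairs. card \<sigma> = Suc i \<and> mlcm \<sigma> = \<alpha>}
     = {\<sigma> \<in> (\<lambda>T. insert u (p ` T)) ` Pow V. card \<sigma> = Suc i \<and> mlcm \<sigma> = \<alpha>}" by blast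
  then show ?thesis using card_remaining_degree by simp
qed

text \<open>These monomials generate the intersection of the ideal of \<open>A\<close> with the
  principal ideal of u.\<close>

definition "links = (\<lambda>j. u + var j) ` V"

lemma links_inj: "inj_on (\<lambda>j. u + var j) B"
proof (rule inj_onI)
  fix i j assume "u + var i = u + var j"
  then have "var i i = var j i" by simp
  then show "i = j" by (simp add: var_def split: if_splits)
qed

lemma mlcm_links:
  assumes "T \<noteq> {}" shows "mlcm ((\<lambda>j. u + var j) ` T) = sqfree T + u"
proof (rule antisym)
  have "u + var j \<le> sqfree T + u" if "j \<in> T" for j
    using that by (auto simp: le_fun_def sqfree_def var_def)
  then show "mlcm ((\<lambda>j. u + var j) ` T) \<le> sqfree T + u" by (subst mlcm_le_iff) auto
  have le: "u + var j \<le> mlcm ((\<lambda>j. u + var j) ` T)" if "j \<in> T" for j using that by (intro mlcm_upper) auto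
  then show "sqfree T + u \<le> mlcm ((\<lambda>j. u + var j) ` T)" using assms by (auto simp: sqfree_add_le_iff add_var_le_iff)
qed

lemma card_links_degree:
  assumes "0 < i"
  shows "card {\<sigma> \<in> critical links {}. card \<sigma> = i \<and> mlcm \<sigma> = \<alpha>} = card (degree_faces i \<alpha>)"
proof -
  let ?q = "\<lambda>T. (\<lambda>j. u + var j) ` T"
  have c: "card (?q T) = card T" for T by (rule card_image[OF links_inj])
  have "{\<sigma> \<in> critical links {}. card \<sigma> = i \<and> mlcm \<sigma> = \<alpha>} = ?q ` degree_faces i \<alpha>"
  proof (intro equalityI subsetI)
    fix \<sigma> assume \<sigma>: "\<sigma> \<in> {\<sigma> \<in> critical links {}. card \<sigma> = i \<and> mlcm \<sigma> = \<alpha>}"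
    then obtain T where T: "T \<subseteq> V" "\<sigma> = ?q T" unfolding critical_def links_def by (auto elim!: subset_imageE)
    then have "T \<noteq> {}" using \<sigma> assms by auto
    then show "\<sigma> \<in> ?q ` degree_faces i \<alpha>" using T \<sigma> c mlcm_links by (auto simp: degree_faces_def)
  next
    fix \<sigma> assume "\<sigma> \<in> ?q ` degree_faces i \<alpha>"
    then obtain T where T: "\<sigma> = ?q T" "T \<subseteq> V" "card T = i" "sqfree T + u = \<alpha>" by (auto simp: degree_faces_def)
    then have "T \<noteq> {}" using assms by auto
    then show "\<sigma> \<in> {\<sigma> \<in> critical links {}. card \<sigma> = i \<and> mlcm \<sigma> = \<alpha>}"
      using T c mlcm_links by (auto simp: critical_def links_def)
  qed
  moreover have "inj_on ?q (degree_faces i \<alpha>)"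
    using inj_on_image_eq_iff[OF links_inj[of UNIV]] by (intro inj_onI) simp
  ultimately show ?thesis by (simp add: card_image)
qed

lemma multiples_links: "t \<in> multiples links \<longleftrightarrow> t \<in> multiples A \<and> u \<le> t"
proof -
  have "t \<in> multiples links \<longleftrightarrow> u \<le> t \<and> (\<exists>j\<in>V. u j < t j)"
    by (auto simp: multiples_def links_def add_var_le_iff)
  then show ?thesis using linear_step_multiples[OF step, of t] by blast
qed

lemma ideal_Int: "ideal_gen (monom ` A) \<inter> ideal_gen (monom ` {u}) = (ideal_gen (monom ` links) :: ('n, 'k::field) pol set)"
proof (rule set_eqI)
  fix f :: "('n, 'k) pol"
  show "f \<in> ideal_gen (monom ` A) \<inter> ideal_gen (monom ` {u}) \<longleftrightarrow> f \<in> ideal_gen (monom ` links)"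
    unfolding Int_iff mem_ideal_gen_monom using multiples_links by (auto simp: multiples_def)
qed

text \<open>All Betti numbers are read off from unit-free resolutions, those of the sum by means of
  \<open>U'\<close>. The surviving faces containing u are indexed by the subsets T of
  \<open>V\<close>: the empty T accounts for the principal ideal, the others for the intersection
  ideal, whose Taylor complex is minimal.\<close>

lemma minimal_pruning_step:
  fixes ms :: "'n mon list" and M :: "'n matching"
  assumes A: "set ms = A" and zero: "0 \<notin> insert u A"
    and M: "homogeneous_acyclic_matching A M" and pr: "minimal_pruning (ideal_gen (monom ` A) :: ('n, 'k::field) pol set) ms M"
    and U: "unitfree (morse_complex ms M :: (_, 'n, 'k) free_complex)"
    and U': "unitfree (morse_complex (ms @ [u]) (M \<union> new_pairs) :: (_, 'n, 'k) free_complex)"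
  shows "minimal_pruning (ideal_gen (monom ` insert u A) :: ('n, 'k) pol set) (ms @ [u]) (M \<union> new_pairs)"
proof -
  let ?J = "ideal_gen (monom ` A) :: ('n, 'k) pol set" and ?K = "ideal_gen (monom ` {u}) :: ('n, 'k) pol set"
  let ?I = "ideal_gen (monom ` insert u A) :: ('n, 'k) pol set" and ?L = "ideal_gen (monom ` links) :: ('n, 'k) pol set"
  have mm: "morse_matching ms M" using zero M A by (intro morse_matching.intro) auto
  have mm': "morse_matching (ms @ [u]) (M \<union> new_pairs)"
    using zero matching_step[OF M] A by (intro morse_matching.intro) auto
  have R: "resolves (multiples A) {} (morse_complex ms M :: (_, 'n, 'k) free_complex)"
    using morse_matching.morse_resolves[OF mm] A by (simp add: multiples_def)
  have R': "resolves (multiples (insert u A)) {} (morse_complex (ms @ [u]) (M \<union> new_pairs) :: (_, 'n, 'k) free_complex)"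
    using morse_matching.morse_resolves[OF mm'] A by (simp add: multiples_def)
  obtain ls where ls: "set ls = links" "distinct ls" using finite_distinct_list[of links] by (auto simp: links_def)
  have zl: "0 \<notin> links" by (auto simp: links_def fun_eq_iff var_def split: if_splits)
  have K: "minimal_pruning ?K [u] {}" "resolves (multiples {u}) {} (morse_complex [u] {} :: (_, 'n, 'k) free_complex)"
    "unitfree (morse_complex [u] {} :: (_, 'n, 'k) free_complex)"
    using taylor_minimal[of "[u]", where 'k = 'k] zero by auto
  \<comment> \<open>Among the monomials x_i u only x_j u exceeds u at j.\<close>
  have "\<exists>j. \<forall>v\<in>set ls. v \<noteq> w \<longrightarrow> v j < w j" if w: "w \<in> set ls" for w
  proof -
    obtain j where j: "w = u + var j" using w ls by (auto simp: links_def)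
    have "v j < w j" if v: "v \<in> set ls" "v \<noteq> w" for v
    proof -
      obtain i where "v = u + var i" using v(1) ls by (auto simp: links_def)
      then show ?thesis using v(2) j by (cases "i = j") (auto simp: var_def)
    qed
    then show ?thesis by blast
  qed
  then have L: "minimal_pruning ?L ls {}" "resolves (multiples links) {} (morse_complex ls {} :: (_, 'n, 'k) free_complex)"
    "unitfree (morse_complex ls {} :: (_, 'n, 'k) free_complex)"
    using taylor_minimal[of ls, where 'k = 'k] ls zl by simp_all
  have mmK: "morse_matching [u] {}" and mmL: "morse_matching ls {}"
    using zero zl ls empty_matching by (auto intro!: morse_matching.intro)
  have crit: "critical (insert u A) (M \<union> new_pairs) = critical A M \<union> (\<lambda>T. insert u (p ` T)) ` Pow V"
    by (rule critical_step[OF M])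
  have fcrit: "finite (critical A M)" by (rule finite_subset[of _ "Pow A"]) (use finA in \<open>auto simp: critical_def\<close>)
  have bI: "betti ?I {0} i \<alpha> = card {b \<in> critical A M. card b = Suc i \<and> mlcm b = \<alpha>} + card (degree_faces i \<alpha>)" for i \<alpha>
  proof -
    have "betti ?I {0} i \<alpha> = card {b \<in> critical (insert u A) (M \<union> new_pairs). card b = Suc i \<and> mlcm b = \<alpha>}"
      using betti_ideal_gen[OF R' U' zero] A by (simp add: morse_matching.morse_sel[OF mm'])
    also have "{b \<in> critical (insert u A) (M \<union> new_pairs). card b = Suc i \<and> mlcm b = \<alpha>}
       = {b \<in> critical A M. card b = Suc i \<and> mlcm b = \<alpha>} \<union> {\<sigma> \<in> (\<lambda>T. insert u (p ` T)) ` Pow V. card \<sigma> = Suc i \<and> mlcm \<sigma> = \<alpha>}"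
      unfolding crit by blast
    also have "card \<dots> = card {b \<in> critical A M. card b = Suc i \<and> mlcm b = \<alpha>} + card {\<sigma> \<in> (\<lambda>T. insert u (p ` T)) ` Pow V. card \<sigma> = Suc i \<and> mlcm \<sigma> = \<alpha>}"
    proof (rule card_Un_disjoint)
      show "finite {b \<in> critical A M. card b = Suc i \<and> mlcm b = \<alpha>}" by (rule finite_subset[OF _ fcrit]) auto
      show "finite {\<sigma> \<in> (\<lambda>T. insert u (p ` T)) ` Pow V. card \<sigma> = Suc i \<and> mlcm \<sigma> = \<alpha>}"
        by (rule finite_subset[of _ "(\<lambda>T. insert u (p ` T)) ` Pow V"]) auto
    qed (use uA in \<open>auto simp: critical_def\<close>)
    finally show ?thesis by (simp add: card_remaining_degree)
  qed
  have bJ: "betti ?J {0} i \<alpha> = card {b \<in> critical A M. card b = Suc i \<and> mlcm b = \<alpha>}" for i \<alpha>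
    using betti_ideal_gen[OF R U] zero A by (simp add: morse_matching.morse_sel[OF mm])
  have bK: "betti ?K {0} i \<alpha> = (if i = 0 \<and> u = \<alpha> then 1 else 0)" for i \<alpha>
  proof -
    have "betti ?K {0} i \<alpha> = card {b \<in> critical {u} {}. card b = Suc i \<and> mlcm b = \<alpha>}"
      using betti_ideal_gen[OF K(2,3)] zero by (simp add: morse_matching.morse_sel[OF mmK])
    also have "{b \<in> critical {u} {}. card b = Suc i \<and> mlcm b = \<alpha>} = (if i = 0 \<and> u = \<alpha> then {{u}} else {})"
      by (auto simp: critical_def subset_singleton_iff)
    finally show ?thesis by simp
  qed
  have bL: "betti ?L {0} (i - 1) \<alpha> = card (degree_faces i \<alpha>)" if "0 < i" for i \<alpha>
    using betti_ideal_gen[OF L(2,3) zl, of "i - 1" \<alpha>] card_links_degree[OF that] that ls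
    by (simp add: morse_matching.morse_sel[OF mmL])
  \<comment> \<open>The face {u} is not mixed; it supplies the one generator of the principal
    ideal.\<close>
  have d0: "card (degree_faces 0 \<alpha>) = (if u = \<alpha> then 1 else 0)" for \<alpha>
  proof -
    have "degree_faces 0 \<alpha> = (if u = \<alpha> then {{}} else {})" by (auto simp: degree_faces_def)
    then show ?thesis by simp
  qed
  have "betti_splitting ?I ?J ?K"
    unfolding betti_splitting_def
  proof (intro conjI allI)
    have "monom ` insert u A = (monom ` A \<union> monom ` {u} :: ('n, 'k) pol set)" by blast
    then show "?I = ideal_sum ?J ?K" unfolding ideal_sum_ideal_gen by (simp only:)
    have mg: "min_gens ?I = insert u A" "min_gens ?J = A" "min_gens ?K = {u}"
      by (rule min_gens_ideal_gen; use anti in blast)+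
    show "min_gens ?I = min_gens ?J \<union> min_gens ?K" "min_gens ?J \<inter> min_gens ?K = {}" unfolding mg using uA by auto
    fix i \<alpha>
    show "betti ?I {0} i \<alpha> = betti ?J {0} i \<alpha> + betti ?K {0} i \<alpha> + (if i = 0 then 0 else betti (?J \<inter> ?K) {0} (i - 1) \<alpha>)"
      unfolding ideal_Int bI bJ bK using bL[of i \<alpha>] d0 by (cases "i = 0") simp_all
  qed (rule monomial_ideal_ideal_gen)+
  then have "minimal_pruning ?I (ms @ [u]) (M \<union> {} \<union> new_pairs)"
  proof (rule minimal_pruning.split[OF _ pr K(1)])
    show "minimal_pruning (?J \<inter> ?K) ls {}" unfolding ideal_Int by (rule L(1))
    show "Field new_pairs \<subseteq> mixed_faces (set ms) (set [u])"
      unfolding Field_new_pairs A by (auto simp: mixed_faces_def rest_def)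
    show "homogeneous_acyclic_matching (set ms \<union> set [u]) (M \<union> {} \<union> new_pairs)" using matching_step[OF M] A by simp
    show "card {\<sigma> \<in> mixed_faces (set ms) (set [u]) - Field new_pairs. card \<sigma> = Suc i \<and> mlcm \<sigma> = \<alpha>}
        = card {\<sigma> \<in> critical (set ls) {}. card \<sigma> = i \<and> mlcm \<sigma> = \<alpha>}" if "0 < i" for i \<alpha>
      using card_mixed[OF that] card_links_degree[OF that] A ls by simp
  qed
  then show ?thesis by simp
qed

end

text \<open>The invariant of the induction over the list. The second clause is the count for the
  final comparison. The third comes from the lcm being v times a squarefree monomial of degree
  \<open>card \<sigma> - 1\<close>; it is what excludes units in the differential of the faces of
  the next generator.\<close>

definition good_matching :: "'n::finite mon list \<Rightarrow> ('n mon \<Rightarrow> 'n set) \<Rightarrow> 'n matching \<Rightarrow> bool" where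
  "good_matching ms V M \<longleftrightarrow> homogeneous_acyclic_matching (set ms) M \<and>
     card (critical (set ms) M) = Suc (\<Sum>u\<in>set ms. 2 ^ card (V u)) \<and>
     (\<forall>\<sigma>\<in>critical (set ms) M. \<sigma> \<noteq> {} \<longrightarrow> (\<exists>v\<in>set ms. mon_deg (mlcm \<sigma>) + 1 = mon_deg v + card \<sigma>)) \<and>
     (\<forall>\<tau> \<sigma> es. \<tau> \<in> critical (set ms) M \<longrightarrow> \<sigma> \<in> critical (set ms) M \<longrightarrow> gradient_path M \<tau> es \<sigma> \<longrightarrow> mlcm \<tau> \<noteq> mlcm \<sigma>)"

lemma minimal_pruning_exists:
  fixes ms :: "'n::finite mon list"
  assumes "lin_quot ms V" "0 \<notin> set ms" "sorted_wrt (\<lambda>p q. mon_deg p \<le> mon_deg q) ms"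
  shows "\<exists>M. good_matching ms V M \<and> minimal_pruning (ideal_gen (monom ` set ms) :: ('n, 'k::field) pol set) ms M"
  using assms
proof (induction ms rule: rev_induct)
  case Nil
  have "minimal_pruning (ideal_gen (monom ` set []) :: ('n, 'k) pol set) [] {}"
    by (rule taylor_minimal) auto
  moreover have "\<not> gradient_path {} {} es {}" for es :: "('n face \<times> 'n face) list" by (cases es) (auto simp: facet_def)
  moreover have "critical (set []) {} = {{}}" by (auto simp: critical_def)
  ultimately show ?case using empty_matching[of "[]"] by (intro exI[of _ "{}"]) (auto simp: good_matching_def)
next
  case (snoc u ms)
  note lq = lin_quot_snocD[OF snoc.prems(1)]
  have sorted: "sorted_wrt (\<lambda>p q. mon_deg p \<le> mon_deg q) ms" and last: "\<And>v. v \<in> set ms \<Longrightarrow> mon_deg v \<le> mon_deg u"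
    using snoc.prems(3) by (auto simp: sorted_wrt_append)
  have zero: "0 \<notin> insert u (set ms)" using snoc.prems(2) unfolding set_append list.set by blast
  then have z0: "0 \<notin> set ms" by blast
  have set_snoc: "set (ms @ [u]) = insert u (set ms)" by simp
  obtain M where good: "good_matching ms V M"
    and pr: "minimal_pruning (ideal_gen (monom ` set ms) :: ('n, 'k) pol set) ms M"
    using snoc.IH[OF lq(1) z0 sorted] by blast
  have M: "homogeneous_acyclic_matching (set ms) M"
    and cardM: "card (critical (set ms) M) = Suc (\<Sum>u\<in>set ms. 2 ^ card (V u))"
    using good by (simp_all add: good_matching_def)
  have degM: "\<exists>v\<in>set ms. mon_deg (mlcm \<sigma>) + 1 = mon_deg v + card \<sigma>" if "\<sigma> \<in> critical (set ms) M" "\<sigma> \<noteq> {}" for \<sigma>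
    using good that unfolding good_matching_def by blast
  have pathM: "mlcm \<tau> \<noteq> mlcm \<sigma>"
    if "\<tau> \<in> critical (set ms) M" "\<sigma> \<in> critical (set ms) M" "gradient_path M \<tau> es \<sigma>" for \<tau> \<sigma> es
    using good that unfolding good_matching_def by blast
  obtain p where p: "\<And>j. j \<in> V u \<Longrightarrow> p j \<in> set ms \<and> p j \<le> u + var j"
    using lq(2) unfolding linear_step_def by metis
  interpret quotient_step "set ms" u "V u" p
  proof
    show "a = b" if "a \<in> insert u (set ms)" "b \<in> insert u (set ms)" "a \<le> b" for a b
      using snoc.prems(1) that unfolding lin_quot_def set_snoc by blast
  qed (use lq p in auto)
  define M' where "M' = M \<union> new_pairs"
  have M': "homogeneous_acyclic_matching (insert u (set ms)) M'" unfolding M'_def by (rule matching_step[OF M])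
  have mm: "morse_matching ms M" and mm': "morse_matching (ms @ [u]) M'"
    using zero M M' by (auto intro!: morse_matching.intro)
  have crit: "critical (insert u (set ms)) M' = critical (set ms) M \<union> (\<lambda>T. insert u (p ` T)) ` Pow (V u)"
    unfolding M'_def by (rule critical_step[OF M])
  have path': "mlcm \<tau> \<noteq> mlcm \<sigma>"
    if \<tau>: "\<tau> \<in> critical (insert u (set ms)) M'" and \<sigma>: "\<sigma> \<in> critical (insert u (set ms)) M'" and es: "gradient_path M' \<tau> es \<sigma>" for \<tau> \<sigma> es
  proof (cases "\<tau> \<in> critical (set ms) M")
    case True
    then have "\<tau> \<subseteq> set ms" by (simp add: critical_def)
    then have "gradient_path M \<tau> es \<sigma>" "\<sigma> \<subseteq> set ms" using gradient_path_old[OF M] es unfolding M'_def by blast+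
    moreover have "u \<notin> \<sigma>" using \<open>\<sigma> \<subseteq> set ms\<close> lq(3) by blast
    then have "\<sigma> \<in> critical (set ms) M" using \<sigma> unfolding crit by auto
    ultimately show ?thesis using pathM True by blast
  next
    case False
    then obtain T where T: "\<tau> = insert u (p ` T)" "T \<subseteq> V u" using \<tau> unfolding crit by auto
    have cards: "card \<tau> = Suc (card \<sigma>)"
      using morse_matching.gradient_path_degrees[OF mm' es] \<tau> by (simp add: critical_def)
    have dT: "mlcm \<tau> = sqfree T + u" "card \<tau> = Suc (card T)" using T mlcm_remaining card_remaining by auto
    show ?thesis
    proof
      assume eq: "mlcm \<tau> = mlcm \<sigma>"
      show False
      proof (cases "\<sigma> \<in> critical (set ms) M")
        case False
        then obtain T' where T': "\<sigma> = insert u (p ` T')" "T' \<subseteq> V u" using \<sigma> unfolding crit by auto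
        \<comment> \<open>Faces of the same generator with equal lcm have equal cardinality,
          contrary to the drop by one along the path.\<close>
        then have "mon_deg (sqfree T + u) = mon_deg (sqfree T' + u)" using eq dT mlcm_remaining by simp
        then show False using cards dT(2) T' card_remaining by (simp add: mon_deg_add)
      next
        case True
        have "\<sigma> \<noteq> {}"
        proof
          assume "\<sigma> = {}"
          then have "sqfree T + u = 0" using eq dT by simp
          then have "u = 0" by (simp add: fun_eq_iff)
          then show False using zero by simp
        qed
        \<comment> \<open>Comparing degrees gives deg v = deg u + 1, against the sorting of the
          list.\<close>
        then obtain v where "v \<in> set ms" "mon_deg (mlcm \<sigma>) + 1 = mon_deg v + card \<sigma>" using degM True by blast
        moreover have "mon_deg (mlcm \<sigma>) = card T + mon_deg u" unfolding eq[symmetric] dT(1) by (simp add: mon_deg_add)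
        ultimately show False using last[of v] dT(2) cards by simp
      qed
    qed
  qed
  have U: "unitfree (morse_complex ms M :: (_, 'n, 'k) free_complex)" using pathM by (intro morse_unitfree[OF mm])
  have U': "unitfree (morse_complex (ms @ [u]) M' :: (_, 'n, 'k) free_complex)" using path' by (intro morse_unitfree[OF mm']) auto
  have pr': "minimal_pruning (ideal_gen (monom ` insert u (set ms)) :: ('n, 'k) pol set) (ms @ [u]) M'"
    using minimal_pruning_step[OF refl zero M pr U] U' unfolding M'_def by blast
  have "card (critical (insert u (set ms)) M') = card (critical (set ms) M) + card ((\<lambda>T. insert u (p ` T)) ` Pow (V u))"
    unfolding crit
  proof (rule card_Un_disjoint)
    show "finite (critical (set ms) M)" by (rule morse_matching.finite_crit[OF mm])
    show "critical (set ms) M \<inter> (\<lambda>T. insert u (p ` T)) ` Pow (V u) = {}" using lq(3) by (auto simp: critical_def)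
  qed simp
  also have "card ((\<lambda>T. insert u (p ` T)) ` Pow (V u)) = 2 ^ card (V u)"
    by (simp add: card_image[OF remaining_inj] card_Pow)
  finally have card': "card (critical (insert u (set ms)) M') = Suc (\<Sum>u\<in>insert u (set ms). 2 ^ card (V u))"
    using cardM lq(3) by simp
  have deg': "\<exists>v\<in>insert u (set ms). mon_deg (mlcm \<sigma>) + 1 = mon_deg v + card \<sigma>"
    if \<sigma>: "\<sigma> \<in> critical (insert u (set ms)) M'" "\<sigma> \<noteq> {}" for \<sigma>
  proof (cases "\<sigma> \<in> critical (set ms) M")
    case True
    then show ?thesis using degM \<sigma>(2) by blast
  next
    case False
    then obtain T where "\<sigma> = insert u (p ` T)" "T \<subseteq> V u" using \<sigma> unfolding crit by auto
    then show ?thesis using mlcm_remaining card_remaining by (simp add: mon_deg_add)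
  qed
  have "good_matching (ms @ [u]) V M'"
    unfolding good_matching_def set_snoc using M' card' deg' path' by blast
  then show ?case unfolding set_snoc using pr' by blast
qed

text \<open>The pruning is carried out on the list sorted by degree. Neither the ideal nor the sets
  \<open>V u\<close> change, so the number of generators can be stated for the given order.\<close>

lemma minimal_pruned_resolution_exists:
  fixes I :: "('n::finite, 'k::field) pol set"
  assumes I: "monomial_ideal I" "I \<noteq> UNIV" and ms: "lin_quot ms V" "set ms = min_gens I"
  obtains P where "minimal_pruned_resolution I P" "resolves (mons I) {} P" "unitfree P"
    "card (gens P) = Suc (\<Sum>u\<in>min_gens I. 2 ^ card (V u))"
proof -
  obtain ms' where ms': "set ms' = set ms" "lin_quot ms' V" "sorted_wrt (\<lambda>p q. mon_deg p \<le> mon_deg q) ms'"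
    using lin_quot_sorted[OF ms(1)] .
  have zero: "0 \<notin> set ms'" using ms'(1) ms(2) I by (auto simp: min_gens_mons one_in_monomial_ideal)
  have gen: "ideal_gen (monom ` set ms') = I" using ideal_gen_min_gens[OF I(1)] ms' ms by simp
  obtain M where good: "good_matching ms' V M" and pr: "minimal_pruning I ms' M"
    using minimal_pruning_exists[OF ms'(2) zero ms'(3), where 'k = 'k] unfolding gen by blast
  have M: "homogeneous_acyclic_matching (set ms') M" "card (critical (set ms') M) = Suc (\<Sum>u\<in>set ms'. 2 ^ card (V u))"
    using good by (simp_all add: good_matching_def)
  have path: "mlcm \<tau> \<noteq> mlcm \<sigma>"
    if "\<tau> \<in> critical (set ms') M" "\<sigma> \<in> critical (set ms') M" "gradient_path M \<tau> es \<sigma>" for \<tau> \<sigma> es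
    using good that unfolding good_matching_def by blast
  have mm: "morse_matching ms' M" using zero M(1) by (rule morse_matching.intro)
  let ?P = "morse_complex ms' M :: (_, 'n, 'k) free_complex"
  have R: "resolves (mons I) {} ?P"
    using morse_matching.morse_resolves[OF mm, where 'k = 'k] mons_eq_multiples_min_gens[OF I(1)] ms'(1) ms(2)
    by (simp add: multiples_def)
  have U: "unitfree ?P" using path by (rule morse_unitfree[OF mm])
  show thesis
  proof (rule that[OF _ R U])
    show "minimal_pruned_resolution I ?P"
      unfolding minimal_pruned_resolution_def using pr resolves_minimal_free_resolution[OF R I(1) U] by blast
    show "card (gens ?P) = Suc (\<Sum>u\<in>min_gens I. 2 ^ card (V u))"
      using M(2) ms'(1) ms(2) by (simp add: morse_matching.morse_sel[OF mm])
  qed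
qed

theorem corollary1:
  fixes I :: "('n::{finite,linorder}, 'k::field) pol set"
  assumes "monomial_ideal I" and "I \<noteq> UNIV"
  shows
    "(stable I \<longrightarrow>
       (\<exists>P. minimal_pruned_resolution I P \<and> complex_iso P (eliahou_kervaire I))) \<and>
     (\<forall>ms. linear_quotients_wrt I ms \<longrightarrow>
       (\<exists>F :: ('n symb, 'n, 'k) free_complex. herzog_takayama ms F) \<and>
       (\<exists>P. minimal_pruned_resolution I P \<and>
          (\<forall>F. herzog_takayama ms F \<longrightarrow> complex_iso P F)))"
proof (intro conjI allI impI)
  assume "stable I"
  then interpret stable_ideal I
    using assms one_in_monomial_ideal by unfold_locales auto
  obtain ms where ms: "set ms = min_gens I" "lin_quot ms lower_vars"
    and EK: "resolves (mons I) None (eliahou_kervaire I)" "gens (eliahou_kervaire I) = symbols (min_gens I) lower_vars"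
    using eliahou_kervaire_resolves .
  obtain P where P: "minimal_pruned_resolution I P" "resolves (mons I) {} P" "unitfree P"
    "card (gens P) = Suc (\<Sum>u\<in>min_gens I. 2 ^ card (lower_vars u))"
    using minimal_pruned_resolution_exists[OF assms ms(2,1)] .
  \<comment> \<open>Minimality of the Eliahou-Kervaire complex is a consequence of the comparison
    and is not checked on its differential.\<close>
  have "complex_iso P (eliahou_kervaire I)"
    by (rule resolves_complex_iso[OF P(2,3) EK(1)]) (simp add: EK(2) P(4) card_symbols finite_min_gens)
  then show "\<exists>P. minimal_pruned_resolution I P \<and> complex_iso P (eliahou_kervaire I)" using P(1) by blast
next
  fix ms assume lq: "linear_quotients_wrt I ms"
  then obtain V where V: "lin_quot ms V" by (rule linear_quotients_lin_quot)
  have ms: "set ms = min_gens I" using lq by (simp add: linear_quotients_wrt_def)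
  show "\<exists>F :: ('n symb, 'n, 'k) free_complex. herzog_takayama ms F" by (rule herzog_takayama_exists[OF V])
  obtain P where P: "minimal_pruned_resolution I P" "resolves (mons I) {} P" "unitfree P"
    "card (gens P) = Suc (\<Sum>u\<in>min_gens I. 2 ^ card (V u))"
    using minimal_pruned_resolution_exists[OF assms V ms] .
  \<comment> \<open>One P serves for all choices of comparison maps, as its construction does not
    involve F.\<close>
  have "complex_iso P F" if F: "herzog_takayama ms F" for F :: "('n symb, 'n, 'k) free_complex"
  proof (rule resolves_complex_iso[OF P(2,3)])
    note HT = herzog_takayama_resolves[OF F V]
    show "resolves (mons I) None F" using HT mons_eq_multiples_min_gens[OF assms(1)] ms by simp
    show "card (gens F) \<le> card (gens P)" using HT ms by (simp add: P(4) card_symbols finite_min_gens)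
  qed
  then show "\<exists>P. minimal_pruned_resolution I P \<and> (\<forall>F. herzog_takayama ms F \<longrightarrow> complex_iso P F)" using P(1) by blast
qed

end
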